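(* Let $B_0$ be a base hierarchy such that there is no $k\ge0$ for which both $S_{B_0}(b)\le\min(3b,\,b\cdot\min B_0)$ for every $b\in B_0$ and $S_{B_0}(b)=3b$ for $k$ many $b\in B_0$. Define $B_{i+1}=(B_i)_{+(i+1)}$ for every $i$, and let $\mathcal B=(B_i)_{i\in\mathbb N}$. Then $\mathsf{RCA}_0$ does not prove that for every $n$ there is some $i$ such that $\mathbb G^{\mathcal B}_i(n)=0$.
   Context: Let $\mathbb N=\{0,1,2,\dots\}$; $\infty$ is regarded as greater than, and divisible by, every positive integer. For $b\ge 2$ and $n>0$, the $b$-decomposition of $n$ is the unique $n=b^e a+r$ with $b^e\le n<b^{e+1}$, $0<a<b$, $r<b^e$. For nonempty $B\subseteq\mathbb N\setminus\{0,1\}$: $\mathrm{base}_B(n)=\max\{b\in B: b\le n\}$ if $n\ge\min B$, else $\min B$; $S_B(n)=\min\{b\in B:b>n\}$ if this exists, else $\infty$. A base hierarchy is a nonempty $B\subseteq\mathbb N\setminus\{0,1\}$ with $b\mid S_B(b)$ for all $b\in B$. $n$ is $B$-critical if $\mathrm{base}_B(n)\mid n$. Upgrade: for base hierarchies $B,C$ with $\min B\le\min C$, define ${\uparrow}n={\uparrow}_B^C n\in\mathbb N\cup\{\infty\}$ recursively. If $n<\min B$, ${\uparrow}n=n$. Otherwise $b=\mathrm{base}_B(n)$; for an integer $c\ge2$ define $\langle b\to c\rangle m={\uparrow}m$ if $m<b$, and $\langle b\to c\rangle m=c^{\langle b\to c\rangle e}\cdot{\uparrow}a+\langle b\to c\rangle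 r$ if $m\ge b$ has $b$-decomposition $m=b^ea+r$. Then ${\uparrow}n=\langle b\to c\rangle n$ where $c$ is the least element of $C$ with ${\uparrow}(n-1)<\langle b\to c\rangle n<S_C(c)$; ${\uparrow}n=\infty$ if none exists. Ouroboros successor: for a base hierarchy $B$ and integer $i\ge1$, $B_{+i}=\bigcup_{n}B^n_{+i}$, where recursively $B^n_{+i}=\{\min B+1\}$ for $n\le\min B$, and for $n>\min B$, with $c=\max B^{n-1}_{+i}$ and operators $\langle\cdot\to\cdot\rangle$ taken with respect to ${\uparrow}_B^{B^{n-1}_{+i}}$: (a) if $n$ is not $B$-critical, $B^n_{+i}=B^{n-1}_{+i}$; (b) if $n\in B$, let $b=\mathrm{base}_B(n-1)$ and $B^n_{+i}=B^{n-1}_{+i}\cup\{ca\}$ with $a$ least such that $\langle b\to c\rangle(n-1)<ca$; (c) if $n\notin B$ is $B$-critical, let $b=\mathrm{base}_B(n)$, $d_0=c$, $d_{j+1}=\langle b\to d_j\rangle n$, and $B^n_{+i}=B^{n-1}_{+i}\cup\{d_1,\dots,d_i\}$. Goodstein sequence for a sequence $\mathcal B=(B_i)$ of base hierarchies: $\mathbb G^{\mathcal B}_0(n)=n$, $\mathbb G^{\mathcal B}_{i+1}(n)={\uparrow}_{B_i}^{B_{i+1}}\mathbb G^{\mathcal B}_i(n)-1$ if $\mathbb G^{\mathcal B}_i(n)>0$, else $0$. *)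

theory Defs
  imports "HOL-Library.Extended_Nat"
begin

section \<open>Base hierarchies and Goodstein sequences\<close>

definition is_decomposition :: "nat \<Rightarrow> nat \<Rightarrow> nat \<Rightarrow> nat \<Rightarrow> nat \<Rightarrow> bool" where
  "is_decomposition b n e a r \<longleftrightarrow>
     b ^ e \<le> n \<and> n < b ^ (e + 1) \<and> 0 < a \<and> a < b \<and> r < b ^ e \<and> n = b ^ e * a + r"

definition decomposition :: "nat \<Rightarrow> nat \<Rightarrow> nat \<times> nat \<times> nat" where
  "decomposition b n = (THE (e, a, r). is_decomposition b n e a r)"

definition base :: "nat set \<Rightarrow> nat \<Rightarrow> nat" where
  "base B n = (if \<exists>b\<in>B. b \<le> n then Max {b \<in> B. b \<le> n} else Inf B)"

definition next_base :: "nat set \<Rightarrow> nat \<Rightarrow> enat" where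
  "next_base B n = (if \<exists>b\<in>B. n < b then enat (LEAST b. b \<in> B \<and> n < b) else \<infinity>)"

definition base_hierarchy :: "nat set \<Rightarrow> bool" where
  "base_hierarchy B \<longleftrightarrow>
     B \<noteq> {} \<and> 0 \<notin> B \<and> 1 \<notin> B \<and> (\<forall>b\<in>B. \<forall>s. next_base B b = enat s \<longrightarrow> b dvd s)"

definition critical :: "nat set \<Rightarrow> nat \<Rightarrow> bool" where
  "critical B n \<longleftrightarrow> base B n dvd n"

definition epow :: "nat \<Rightarrow> enat \<Rightarrow> enat" where
  "epow c x = (case x of enat k \<Rightarrow> enat (c ^ k) | \<infinity> \<Rightarrow> \<infinity>)"

lemma is_decomposition_exists:
  assumes "2 \<le> b" "0 < n"
  shows "\<exists>e a r. is_decomposition b n e a r"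
proof -
  have "n < b ^ n" using assms by (intro power_gt_expt) auto
  then obtain k where k: "n < b ^ k" "\<And>j. j < k \<Longrightarrow> \<not> n < b ^ j"
    using exists_least_iff[of "\<lambda>k. n < b ^ k"] by auto
  then obtain e where e: "k = Suc e" using assms by (cases k) auto
  have le: "b ^ e \<le> n" using k(2)[of e] e by simp
  have pos: "0 < b ^ e" using assms by simp
  have "n div b ^ e < b" using k(1) e pos by (simp add: less_mult_imp_div_less)
  moreover have "0 < n div b ^ e" using le pos by (simp add: div_greater_zero_iff)
  ultimately have "is_decomposition b n e (n div b ^ e) (n mod b ^ e)"
    using k(1) e le pos by (simp add: is_decomposition_def)
  then show ?thesis by blast
qed

lemma is_decomposition_unique:
  assumes "is_decomposition b n e a r" "is_decomposition b n e' a' r'"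
  shows "e = e' \<and> a = a' \<and> r = r'"
proof -
  have b: "1 < b" using assms(1) by (auto simp: is_decomposition_def)
  have "e < e' + 1"
    using assms b power_less_imp_less_exp[OF b, of e "e' + 1"]
    by (auto simp: is_decomposition_def)
  moreover have "e' < e + 1"
    using assms b power_less_imp_less_exp[OF b, of e' "e + 1"]
    by (auto simp: is_decomposition_def)
  ultimately have e: "e = e'" by simp
  have "a = n div b ^ e" "r = n mod b ^ e"
    using assms(1) by (auto simp: is_decomposition_def)
  moreover have "a' = n div b ^ e" "r' = n mod b ^ e"
    using assms(2) e by (auto simp: is_decomposition_def)
  ultimately show ?thesis using e by simp
qed

lemma decomposition_eqI: "is_decomposition b n e a r \<Longrightarrow> decomposition b n = (e, a, r)"
  unfolding decomposition_def
  by (rule the_equality) (auto dest: is_decomposition_unique)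

lemma decomposition_works:
  assumes "2 \<le> b" "0 < n" "decomposition b n = (e, a, r)"
  shows "is_decomposition b n e a r"
  using is_decomposition_exists[OF assms(1,2)] assms(3) decomposition_eqI by fastforce

lemma is_decomposition_less:
  assumes "is_decomposition b n e a r"
  shows "e < n" "r < n"
proof -
  have "1 < b" using assms by (auto simp: is_decomposition_def)
  then have "e < b ^ e" by (intro power_gt_expt) auto
  then show "e < n" "r < n" using assms by (auto simp: is_decomposition_def)
qed

text \<open>\<open>bracket U b c\<close> is the operator \<open>\<langle>b\<rightarrow>c\<rangle>\<close> taken with respect to \<open>\<up> = U\<close>; only the values of
  \<open>U\<close> below \<open>b\<close> are used.  The value for \<open>b < 2\<close> is a dummy.\<close>

function bracket :: "(nat \<Rightarrow> enat) \<Rightarrow> nat \<Rightarrow> nat \<Rightarrow> nat \<Rightarrow> enat" where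
  "bracket U b c m =
     (if m < b then U m else if b < 2 then 0
      else case decomposition b m of (e, a, r) \<Rightarrow>
        epow c (bracket U b c e) * U a + bracket U b c r)"
  by auto
termination
  by (relation "measure (\<lambda>(U, b, c, m). m)")
     (auto dest!: decomposition_works[rotated 2, OF sym] dest: is_decomposition_less)

declare bracket.simps [simp del]

lemma bracket_cong [fundef_cong]:
  assumes "b = b'" "c = c'" "m = m'" "\<And>k. k < b' \<Longrightarrow> U k = U' k"
  shows "bracket U b c m = bracket U' b' c' m'"
proof -
  have "bracket U b c m = bracket U' b c m"
  proof (induction m rule: less_induct)
    case (less m)
    show ?case
    proof (cases "m < b \<or> b < 2")
      case True
      then show ?thesis using assms(1,4) by (subst (1 2) bracket.simps) auto
    next
      case False
      then obtain e a r where ear: "decomposition b m = (e, a, r)" "is_decomposition b m e a r"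
        using is_decomposition_exists[of b m] decomposition_eqI by fastforce
      then have "a < b" by (auto simp: is_decomposition_def)
      then show ?thesis using False ear less is_decomposition_less[OF ear(2)] assms(1,4)
        by (subst (1 2) bracket.simps) auto
    qed
  qed
  then show ?thesis using assms by simp
qed

lemma base_le: "Inf B \<le> n \<Longrightarrow> base B n \<le> n"
proof -
  assume "Inf B \<le> n"
  moreover have "Max {b \<in> B. b \<le> n} \<le> n" if "\<exists>b\<in>B. b \<le> n"
  proof -
    have "Max {b \<in> B. b \<le> n} \<in> {b \<in> B. b \<le> n}" using that by (intro Max_in) auto
    then show ?thesis by simp
  qed
  ultimately show ?thesis by (auto simp: base_def)
qed

text \<open>The disjunct \<open>n = 0\<close> only matters when \<open>Inf B = 0\<close>, so never for a base hierarchy.\<close>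

function upgrade :: "nat set \<Rightarrow> nat set \<Rightarrow> nat \<Rightarrow> enat" where
  "upgrade B C n =
     (if n < Inf B \<or> n = 0 then enat n
      else let b = base B n;
               good = (\<lambda>c. c \<in> C \<and>
                 upgrade B C (n - 1) < bracket (upgrade B C) b c n \<and>
                 bracket (upgrade B C) b c n < next_base C c)
           in if \<exists>c. good c then bracket (upgrade B C) b (LEAST c. good c) n else \<infinity>)"
  by auto
termination
  by (relation "measure (\<lambda>(B, C, n). n)") (auto dest: base_le simp: not_less)

declare upgrade.simps [simp del]

text \<open>\<open>plus_stage B i n\<close> is \<open>B\<^sup>n\<^sub>+\<^sub>i\<close>; in case (c), \<open>d\<^sub>j\<close> is iterated as long as it is finite.\<close>

definition d_step :: "nat set \<Rightarrow> nat set \<Rightarrow> nat \<Rightarrow> enat \<Rightarrow> enat" where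
  "d_step B Z n x = (case x of enat d \<Rightarrow> bracket (upgrade B Z) (base B n) d n | \<infinity> \<Rightarrow> \<infinity>)"

definition new_bases :: "nat set \<Rightarrow> nat \<Rightarrow> nat set \<Rightarrow> nat \<Rightarrow> nat set" where
  "new_bases B i Z n =
     (let c = Max Z in
      if n \<in> B then
        (let w = bracket (upgrade B Z) (base B (n - 1)) c (n - 1)
         in {c * a | a. w < enat (c * a) \<and> (\<forall>a'<a. \<not> w < enat (c * a'))})
      else if critical B n then
        {x. \<exists>j\<in>{1..i}. enat x = (d_step B Z n ^^ j) (enat c)}
      else {})"

primrec plus_stage :: "nat set \<Rightarrow> nat \<Rightarrow> nat \<Rightarrow> nat set" where
  "plus_stage B i 0 = {Inf B + 1}"
| "plus_stage B i (Suc n) =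
     (if Suc n \<le> Inf B then {Inf B + 1}
      else plus_stage B i n \<union> new_bases B i (plus_stage B i n) (Suc n))"

definition ouroboros_plus :: "nat set \<Rightarrow> nat \<Rightarrow> nat set" where
  "ouroboros_plus B i = (\<Union>n. plus_stage B i n)"

primrec ouroboros_seq :: "nat set \<Rightarrow> nat \<Rightarrow> nat set" where
  "ouroboros_seq B 0 = B"
| "ouroboros_seq B (Suc i) = ouroboros_plus (ouroboros_seq B i) (i + 1)"

text \<open>The value \<open>\<infinity>\<close> is propagated.\<close>

primrec goodstein :: "(nat \<Rightarrow> nat set) \<Rightarrow> nat \<Rightarrow> nat \<Rightarrow> enat" where
  "goodstein BB n 0 = enat n"
| "goodstein BB n (Suc i) =
     (case goodstein BB n i of
        enat m \<Rightarrow> if 0 < m then upgrade (BB i) (BB (Suc i)) m - 1 else 0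
      | \<infinity> \<Rightarrow> \<infinity>)"


section \<open>Second-order arithmetic and \<open>RCA\<^sub>0\<close>\<close>

text \<open>De Bruijn indices, with separate index spaces for number and set variables.\<close>

datatype tm = Var nat | Zero | One | Plus tm tm | Times tm tm

datatype fm =
    Fls
  | Eq tm tm
  | Less tm tm
  | Mem tm nat
  | Imp fm fm
  | AllN fm
  | AllS fm

abbreviation "Neg p \<equiv> Imp p Fls"
abbreviation "Dis p q \<equiv> Imp (Neg p) q"
abbreviation "Con p q \<equiv> Neg (Imp p (Neg q))"
abbreviation "Iff p q \<equiv> Con (Imp p q) (Imp q p)"
abbreviation "ExN p \<equiv> Neg (AllN (Neg p))"
abbreviation "ExS p \<equiv> Neg (AllS (Neg p))"

primrec subT :: "(nat \<Rightarrow> tm) \<Rightarrow> tm \<Rightarrow> tm" where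
  "subT f (Var k) = f k"
| "subT f Zero = Zero"
| "subT f One = One"
| "subT f (Plus t u) = Plus (subT f t) (subT f u)"
| "subT f (Times t u) = Times (subT f t) (subT f u)"

abbreviation liftT :: "tm \<Rightarrow> tm" where
  "liftT \<equiv> subT (\<lambda>k. Var (Suc k))"

text \<open>\<open>subF f g\<close> simultaneously replaces free number variables by the terms \<open>f\<close> and renames free
  set variables by \<open>g\<close>.\<close>

primrec subF :: "(nat \<Rightarrow> tm) \<Rightarrow> (nat \<Rightarrow> nat) \<Rightarrow> fm \<Rightarrow> fm" where
  "subF f g Fls = Fls"
| "subF f g (Eq t u) = Eq (subT f t) (subT f u)"
| "subF f g (Less t u) = Less (subT f t) (subT f u)"
| "subF f g (Mem t X) = Mem (subT f t) (g X)"
| "subF f g (Imp p q) = Imp (subF f g p) (subF f g q)"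
| "subF f g (AllN p) = AllN (subF (case_nat (Var 0) (\<lambda>k. liftT (f k))) g p)"
| "subF f g (AllS p) = AllS (subF f (case_nat 0 (\<lambda>k. Suc (g k))) p)"

abbreviation liftN :: "fm \<Rightarrow> fm" where
  "liftN \<equiv> subF (\<lambda>k. Var (Suc k)) id"

abbreviation liftS :: "fm \<Rightarrow> fm" where
  "liftS \<equiv> subF Var Suc"

abbreviation instN :: "fm \<Rightarrow> tm \<Rightarrow> fm" where
  "instN p t \<equiv> subF (case_nat t Var) id p"

abbreviation instS :: "fm \<Rightarrow> nat \<Rightarrow> fm" where
  "instS p X \<equiv> subF Var (case_nat X id) p"

inductive bounded :: "fm \<Rightarrow> bool" where
  "bounded Fls"
| "bounded (Eq t u)"
| "bounded (Less t u)"
| "bounded (Mem t X)"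
| "bounded p \<Longrightarrow> bounded q \<Longrightarrow> bounded (Imp p q)"
| "bounded p \<Longrightarrow> bounded (AllN (Imp (Less (Var 0) (liftT t)) p))"

definition Sigma01 :: "fm \<Rightarrow> bool" where
  "Sigma01 p \<longleftrightarrow> (\<exists>q. bounded q \<and> p = ExN q)"

definition Pi01 :: "fm \<Rightarrow> bool" where
  "Pi01 p \<longleftrightarrow> (\<exists>q. bounded q \<and> p = AllN q)"

text \<open>A Hilbert calculus; axioms with free variables stand for their universal closures.\<close>

inductive RCA0 :: "fm \<Rightarrow> bool" (\<open>RCA\<^sub>0 \<turnstile> _\<close> [50] 50) where
  \<comment> \<open>classical predicate logic with equality\<close>
  ax_K: "RCA\<^sub>0 \<turnstile> Imp p (Imp q p)"
| ax_S: "RCA\<^sub>0 \<turnstile> Imp (Imp p (Imp q r)) (Imp (Imp p q) (Imp p r))"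
| ax_DN: "RCA\<^sub>0 \<turnstile> Imp (Neg (Neg p)) p"
| ax_instN: "RCA\<^sub>0 \<turnstile> Imp (AllN p) (instN p t)"
| ax_distN: "RCA\<^sub>0 \<turnstile> Imp (AllN (Imp p q)) (Imp (AllN p) (AllN q))"
| ax_vacN: "RCA\<^sub>0 \<turnstile> Imp p (AllN (liftN p))"
| ax_instS: "RCA\<^sub>0 \<turnstile> Imp (AllS p) (instS p X)"
| ax_distS: "RCA\<^sub>0 \<turnstile> Imp (AllS (Imp p q)) (Imp (AllS p) (AllS q))"
| ax_vacS: "RCA\<^sub>0 \<turnstile> Imp p (AllS (liftS p))"
| ax_refl: "RCA\<^sub>0 \<turnstile> Eq t t"
| ax_subst: "RCA\<^sub>0 \<turnstile> Imp (Eq t u) (Imp (instN p t) (instN p u))"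
| MP: "RCA\<^sub>0 \<turnstile> Imp p q \<Longrightarrow> RCA\<^sub>0 \<turnstile> p \<Longrightarrow> RCA\<^sub>0 \<turnstile> q"
| GenN: "RCA\<^sub>0 \<turnstile> p \<Longrightarrow> RCA\<^sub>0 \<turnstile> AllN p"
| GenS: "RCA\<^sub>0 \<turnstile> p \<Longrightarrow> RCA\<^sub>0 \<turnstile> AllS p"
  \<comment> \<open>basic axioms\<close>
| ax_Suc_nz: "RCA\<^sub>0 \<turnstile> Neg (Eq (Plus (Var 0) One) Zero)"
| ax_Suc_inj: "RCA\<^sub>0 \<turnstile> Imp (Eq (Plus (Var 0) One) (Plus (Var 1) One)) (Eq (Var 0) (Var 1))"
| ax_add_0: "RCA\<^sub>0 \<turnstile> Eq (Plus (Var 0) Zero) (Var 0)"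
| ax_add_Suc: "RCA\<^sub>0 \<turnstile> Eq (Plus (Var 0) (Plus (Var 1) One)) (Plus (Plus (Var 0) (Var 1)) One)"
| ax_mult_0: "RCA\<^sub>0 \<turnstile> Eq (Times (Var 0) Zero) Zero"
| ax_mult_Suc: "RCA\<^sub>0 \<turnstile> Eq (Times (Var 0) (Plus (Var 1) One)) (Plus (Times (Var 0) (Var 1)) (Var 0))"
| ax_less_0: "RCA\<^sub>0 \<turnstile> Neg (Less (Var 0) Zero)"
| ax_less_Suc: "RCA\<^sub>0 \<turnstile> Iff (Less (Var 0) (Plus (Var 1) One)) (Dis (Less (Var 0) (Var 1)) (Eq (Var 0) (Var 1)))"
  \<comment> \<open>induction for \<open>\<Sigma>\<^sup>0\<^sub>1\<close> formulas and comprehension for \<open>\<Delta>\<^sup>0\<^sub>1\<close> formulas\<close>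
| ax_ind: "Sigma01 p \<Longrightarrow>
    RCA\<^sub>0 \<turnstile> Imp (instN p Zero)
      (Imp (AllN (Imp p (subF (case_nat (Plus (Var 0) One) (\<lambda>k. Var (Suc k))) id p))) (AllN p))"
| ax_comp: "Sigma01 p \<Longrightarrow> Pi01 q \<Longrightarrow>
    RCA\<^sub>0 \<turnstile> Imp (AllN (Iff p q)) (ExS (AllN (Iff (Mem (Var 0) 0) (liftS p))))"

primrec evalT :: "(nat \<Rightarrow> nat) \<Rightarrow> tm \<Rightarrow> nat" where
  "evalT \<rho> (Var k) = \<rho> k"
| "evalT \<rho> Zero = 0"
| "evalT \<rho> One = 1"
| "evalT \<rho> (Plus t u) = evalT \<rho> t + evalT \<rho> u"
| "evalT \<rho> (Times t u) = evalT \<rho> t * evalT \<rho> u"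

text \<open>Truth in the full standard model.\<close>

primrec sat :: "(nat \<Rightarrow> nat) \<Rightarrow> (nat \<Rightarrow> nat set) \<Rightarrow> fm \<Rightarrow> bool" where
  "sat \<rho> \<sigma> Fls \<longleftrightarrow> False"
| "sat \<rho> \<sigma> (Eq t u) \<longleftrightarrow> evalT \<rho> t = evalT \<rho> u"
| "sat \<rho> \<sigma> (Less t u) \<longleftrightarrow> evalT \<rho> t < evalT \<rho> u"
| "sat \<rho> \<sigma> (Mem t X) \<longleftrightarrow> evalT \<rho> t \<in> \<sigma> X"
| "sat \<rho> \<sigma> (Imp p q) \<longleftrightarrow> (sat \<rho> \<sigma> p \<longrightarrow> sat \<rho> \<sigma> q)"
| "sat \<rho> \<sigma> (AllN p) \<longleftrightarrow> (\<forall>n. sat (case_nat n \<rho>) \<sigma> p)"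
| "sat \<rho> \<sigma> (AllS p) \<longleftrightarrow> (\<forall>A. sat \<rho> (case_nat A \<sigma>) p)"

text \<open>\<open>RCA0_proves_about B p\<close>: \<open>RCA\<^sub>0\<close> proves the property \<open>p\<close> (a formula whose only free variable is
  the set variable \<open>0\<close>) of the particular set \<open>B\<close>.  As \<open>B\<close> is not a symbol of the language, it has to
  be introduced by a description; any true \<open>\<Pi>\<^sup>0\<^sub>1\<close> description \<open>\<theta>\<close> is admitted.  For instance, if
  \<open>RCA\<^sub>0\<close> proves a \<open>\<Sigma>\<^sup>0\<^sub>1\<close> definition \<open>\<beta>\<close> of \<open>B\<close> equivalent to a \<open>\<Pi>\<^sup>0\<^sub>1\<close> formula \<open>\<delta>\<close>, then \<open>\<theta>\<close> can be
  \<open>\<forall>x. (x \<in> X \<longrightarrow> \<delta> x) \<and> (\<beta> x \<longrightarrow> x \<in> X)\<close>, which says \<open>X = B\<close>; but \<open>B\<close> need not be computable.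
  Descriptions of higher complexity cannot be admitted: they could carry arbitrary true \<open>\<Pi>\<^sup>0\<^sub>2\<close>
  sentences, among them the totality statements that \<open>RCA\<^sub>0\<close> fails to prove.\<close>

definition RCA0_proves_about :: "nat set \<Rightarrow> fm \<Rightarrow> bool" where
  "RCA0_proves_about B p \<longleftrightarrow>
     (\<exists>\<theta>. Pi01 \<theta> \<and> (\<forall>\<rho> \<sigma>. \<sigma> 0 = B \<longrightarrow> sat \<rho> \<sigma> \<theta>) \<and> RCA\<^sub>0 \<turnstile> AllS (Imp \<theta> p))"


section \<open>The termination statement as a formula of second-order arithmetic\<close>

text \<open>To write formulas with named bound variables, terms and formulas are parametrised by the number
  of enclosing number and set quantifiers: a variable is represented by its binding depth, which is
  converted into a de Bruijn index at the place of its occurrence.\<close>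

type_synonym ltm = "nat \<Rightarrow> tm"
type_synonym lset = "nat \<Rightarrow> nat"
type_synonym lfm = "nat \<Rightarrow> nat \<Rightarrow> fm"

definition l_zero :: ltm (\<open>\<^bold>0\<close>) where "\<^bold>0 = (\<lambda>d. Zero)"
definition l_one :: ltm (\<open>\<^bold>1\<close>) where "\<^bold>1 = (\<lambda>d. One)"
definition l_plus :: "ltm \<Rightarrow> ltm \<Rightarrow> ltm" (infixl \<open>\<^bold>+\<close> 65) where "a \<^bold>+ b = (\<lambda>d. Plus (a d) (b d))"
definition l_times :: "ltm \<Rightarrow> ltm \<Rightarrow> ltm" (infixl \<open>\<^bold>*\<close> 70) where "a \<^bold>* b = (\<lambda>d. Times (a d) (b d))"

definition l_eq :: "ltm \<Rightarrow> ltm \<Rightarrow> lfm" (infix \<open>\<^bold>=\<close> 50) where "(a \<^bold>= b) = (\<lambda>d s. Eq (a d) (b d))"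
definition l_less :: "ltm \<Rightarrow> ltm \<Rightarrow> lfm" (infix \<open>\<^bold><\<close> 50) where "(a \<^bold>< b) = (\<lambda>d s. Less (a d) (b d))"
definition l_mem :: "ltm \<Rightarrow> lset \<Rightarrow> lfm" (infix \<open>\<^bold>\<in>\<close> 50) where "(a \<^bold>\<in> X) = (\<lambda>d s. Mem (a d) (X s))"

definition l_not :: "lfm \<Rightarrow> lfm" (\<open>\<^bold>\<not> _\<close> [40] 40) where "(\<^bold>\<not> P) = (\<lambda>d s. Neg (P d s))"
definition l_and :: "lfm \<Rightarrow> lfm \<Rightarrow> lfm" (infixr \<open>\<^bold>\<and>\<close> 35) where "(P \<^bold>\<and> Q) = (\<lambda>d s. Con (P d s) (Q d s))"
definition l_or :: "lfm \<Rightarrow> lfm \<Rightarrow> lfm" (infixr \<open>\<^bold>\<or>\<close> 30) where "(P \<^bold>\<or> Q) = (\<lambda>d s. Dis (P d s) (Q d s))"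
definition l_imp :: "lfm \<Rightarrow> lfm \<Rightarrow> lfm" (infixr \<open>\<^bold>\<longrightarrow>\<close> 25) where "(P \<^bold>\<longrightarrow> Q) = (\<lambda>d s. Imp (P d s) (Q d s))"
definition l_iff :: "lfm \<Rightarrow> lfm \<Rightarrow> lfm" (infixr \<open>\<^bold>\<longleftrightarrow>\<close> 25) where "(P \<^bold>\<longleftrightarrow> Q) = (\<lambda>d s. Iff (P d s) (Q d s))"

definition l_all :: "(ltm \<Rightarrow> lfm) \<Rightarrow> lfm" (binder \<open>\<^bold>\<forall>\<close> 10) where
  "l_all F = (\<lambda>d s. AllN (F (\<lambda>d'. Var (d' - Suc d)) (Suc d) s))"
definition l_ex :: "(ltm \<Rightarrow> lfm) \<Rightarrow> lfm" (binder \<open>\<^bold>\<exists>\<close> 10) where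
  "l_ex F = (\<lambda>d s. ExN (F (\<lambda>d'. Var (d' - Suc d)) (Suc d) s))"
definition l_exS :: "(lset \<Rightarrow> lfm) \<Rightarrow> lfm" (binder \<open>\<^bold>\<exists>\<^sub>s\<close> 10) where
  "l_exS F = (\<lambda>d s. ExS (F (\<lambda>s'. s' - Suc s) d (Suc s)))"

definition l_le :: "ltm \<Rightarrow> ltm \<Rightarrow> lfm" (infix \<open>\<^bold>\<le>\<close> 50) where "(a \<^bold>\<le> b) = (a \<^bold>< b \<^bold>\<or> a \<^bold>= b)"

text \<open>The usual coding of pairs, \<open>(x + y)\<^sup>2 + x\<close>.\<close>

definition l_pair :: "ltm \<Rightarrow> ltm \<Rightarrow> ltm" (\<open>\<^bold>\<langle>_, _\<^bold>\<rangle>\<close>) where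
  "\<^bold>\<langle>a, b\<^bold>\<rangle> = (a \<^bold>+ b) \<^bold>* (a \<^bold>+ b) \<^bold>+ a"

text \<open>In the following, sets of numbers and graphs of partial functions are passed as predicates
  (\<open>B\<close>, \<open>C\<close>, \<open>Z\<close>, \<open>U\<close>), and values \<open>\<infinity>\<close> appear as undefined values.\<close>

text \<open>\<open>v\<close> is a value of the \<open>k\<close>-th iterate of the relation \<open>R\<close> starting in \<open>P\<close>.\<close>

definition f_rec :: "(ltm \<Rightarrow> lfm) \<Rightarrow> (ltm \<Rightarrow> ltm \<Rightarrow> ltm \<Rightarrow> lfm) \<Rightarrow> ltm \<Rightarrow> ltm \<Rightarrow> lfm" where
  "f_rec P R k v = (\<^bold>\<exists>\<^sub>s T.
     (\<^bold>\<forall>x. \<^bold>\<langle>\<^bold>0, x\<^bold>\<rangle> \<^bold>\<in> T \<^bold>\<longleftrightarrow> P x) \<^bold>\<and>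
     (\<^bold>\<forall>j. \<^bold>\<forall>x. j \<^bold>< k \<^bold>\<longrightarrow> (\<^bold>\<langle>j \<^bold>+ \<^bold>1, x\<^bold>\<rangle> \<^bold>\<in> T \<^bold>\<longleftrightarrow> (\<^bold>\<exists>y. \<^bold>\<langle>j, y\<^bold>\<rangle> \<^bold>\<in> T \<^bold>\<and> R j y x))) \<^bold>\<and>
     \<^bold>\<langle>k, v\<^bold>\<rangle> \<^bold>\<in> T)"

text \<open>\<open>v = c ^ e\<close>\<close>

definition f_pow :: "ltm \<Rightarrow> ltm \<Rightarrow> ltm \<Rightarrow> lfm" where
  "f_pow c e v = f_rec (\<lambda>x. x \<^bold>= \<^bold>1) (\<lambda>j y x. x \<^bold>= y \<^bold>* c) e v"

definition f_decomp :: "ltm \<Rightarrow> ltm \<Rightarrow> ltm \<Rightarrow> ltm \<Rightarrow> ltm \<Rightarrow> lfm" where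
  "f_decomp b n e a r = (\<^bold>\<exists>p. f_pow b e p \<^bold>\<and>
     p \<^bold>\<le> n \<^bold>\<and> n \<^bold>< p \<^bold>* b \<^bold>\<and> \<^bold>0 \<^bold>< a \<^bold>\<and> a \<^bold>< b \<^bold>\<and> r \<^bold>< p \<^bold>\<and> n \<^bold>= p \<^bold>* a \<^bold>+ r)"

definition f_min :: "(ltm \<Rightarrow> lfm) \<Rightarrow> ltm \<Rightarrow> lfm" where
  "f_min B m = (B m \<^bold>\<and> (\<^bold>\<forall>x. B x \<^bold>\<longrightarrow> m \<^bold>\<le> x))"

definition f_max :: "(ltm \<Rightarrow> lfm) \<Rightarrow> ltm \<Rightarrow> lfm" where
  "f_max B m = (B m \<^bold>\<and> (\<^bold>\<forall>x. B x \<^bold>\<longrightarrow> x \<^bold>\<le> m))"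

text \<open>\<open>b = base B n\<close>\<close>

definition f_base :: "(ltm \<Rightarrow> lfm) \<Rightarrow> ltm \<Rightarrow> ltm \<Rightarrow> lfm" where
  "f_base B n b =
     (f_max (\<lambda>x. B x \<^bold>\<and> x \<^bold>\<le> n) b \<^bold>\<or> (f_min B b \<^bold>\<and> n \<^bold>< b))"

definition f_critical :: "(ltm \<Rightarrow> lfm) \<Rightarrow> ltm \<Rightarrow> lfm" where
  "f_critical B n = (\<^bold>\<exists>b. \<^bold>\<exists>k. f_base B n b \<^bold>\<and> n \<^bold>= b \<^bold>* k)"

text \<open>\<open>v = bracket U b c m\<close>\<close>

definition f_bracket :: "(ltm \<Rightarrow> ltm \<Rightarrow> lfm) \<Rightarrow> ltm \<Rightarrow> ltm \<Rightarrow> ltm \<Rightarrow> ltm \<Rightarrow> lfm" where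
  "f_bracket U b c m v = (\<^bold>\<exists>\<^sub>s T.
     (\<^bold>\<forall>k. \<^bold>\<forall>x. \<^bold>\<langle>k, x\<^bold>\<rangle> \<^bold>\<in> T \<^bold>\<longleftrightarrow>
       (k \<^bold>< b \<^bold>\<and> U k x) \<^bold>\<or>
       (b \<^bold>\<le> k \<^bold>\<and> (\<^bold>\<exists>e. \<^bold>\<exists>a. \<^bold>\<exists>r. f_decomp b k e a r \<^bold>\<and>
          (\<^bold>\<exists>p. \<^bold>\<exists>q. \<^bold>\<exists>y. \<^bold>\<exists>z. \<^bold>\<langle>e, p\<^bold>\<rangle> \<^bold>\<in> T \<^bold>\<and> f_pow c p q \<^bold>\<and> U a y \<^bold>\<and> \<^bold>\<langle>r, z\<^bold>\<rangle> \<^bold>\<in> T \<^bold>\<and>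
             x \<^bold>= q \<^bold>* y \<^bold>+ z)))) \<^bold>\<and>
     \<^bold>\<langle>m, v\<^bold>\<rangle> \<^bold>\<in> T)"

text \<open>\<open>w = \<langle>b\<rightarrow>c\<rangle>n\<close> and \<open>\<up>(n - 1) < w < S\<^sub>C(c)\<close>, where \<open>\<up>\<close> has graph \<open>U\<close>\<close>

definition f_good :: "(ltm \<Rightarrow> ltm \<Rightarrow> lfm) \<Rightarrow> (ltm \<Rightarrow> lfm) \<Rightarrow> ltm \<Rightarrow> ltm \<Rightarrow> ltm \<Rightarrow> ltm \<Rightarrow> lfm" where
  "f_good U C b n c w =
     (C c \<^bold>\<and> f_bracket U b c n w \<^bold>\<and>
      (\<^bold>\<exists>k. \<^bold>\<exists>u. n \<^bold>= k \<^bold>+ \<^bold>1 \<^bold>\<and> U k u \<^bold>\<and> u \<^bold>< w) \<^bold>\<and>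
      (\<^bold>\<forall>x. C x \<^bold>\<and> c \<^bold>< x \<^bold>\<longrightarrow> w \<^bold>< x))"

text \<open>\<open>v = upgrade B C n\<close>\<close>

definition f_upgrade :: "(ltm \<Rightarrow> lfm) \<Rightarrow> (ltm \<Rightarrow> lfm) \<Rightarrow> ltm \<Rightarrow> ltm \<Rightarrow> lfm" where
  "f_upgrade B C n v = (\<^bold>\<exists>m. f_min B m \<^bold>\<and> (\<^bold>\<exists>\<^sub>s T.
     (\<^bold>\<forall>k. \<^bold>\<forall>x. k \<^bold>\<le> n \<^bold>\<longrightarrow> (\<^bold>\<langle>k, x\<^bold>\<rangle> \<^bold>\<in> T \<^bold>\<longleftrightarrow>
       (k \<^bold>< m \<^bold>\<and> x \<^bold>= k) \<^bold>\<or>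
       (m \<^bold>\<le> k \<^bold>\<and> (\<^bold>\<exists>b. \<^bold>\<exists>c. f_base B k b \<^bold>\<and> f_good (\<lambda>j y. \<^bold>\<langle>j, y\<^bold>\<rangle> \<^bold>\<in> T) C b k c x \<^bold>\<and>
          (\<^bold>\<forall>c'. \<^bold>\<forall>y. c' \<^bold>< c \<^bold>\<longrightarrow> \<^bold>\<not> f_good (\<lambda>j y. \<^bold>\<langle>j, y\<^bold>\<rangle> \<^bold>\<in> T) C b k c' y))))) \<^bold>\<and>
     \<^bold>\<langle>n, v\<^bold>\<rangle> \<^bold>\<in> T))"

text \<open>\<open>x \<in> new_bases B i Z n\<close>, where \<open>n = l + 1\<close>\<close>

definition f_new :: "(ltm \<Rightarrow> lfm) \<Rightarrow> ltm \<Rightarrow> (ltm \<Rightarrow> lfm) \<Rightarrow> ltm \<Rightarrow> ltm \<Rightarrow> lfm" where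
  "f_new B i Z l x = (\<^bold>\<exists>c. f_max Z c \<^bold>\<and>
     ((B (l \<^bold>+ \<^bold>1) \<^bold>\<and>
       (\<^bold>\<exists>b. \<^bold>\<exists>w. \<^bold>\<exists>a. f_base B l b \<^bold>\<and> f_bracket (f_upgrade B Z) b c l w \<^bold>\<and>
          w \<^bold>< c \<^bold>* a \<^bold>\<and> (\<^bold>\<forall>a'. a' \<^bold>< a \<^bold>\<longrightarrow> \<^bold>\<not> w \<^bold>< c \<^bold>* a') \<^bold>\<and> x \<^bold>= c \<^bold>* a)) \<^bold>\<or>
      (\<^bold>\<not> B (l \<^bold>+ \<^bold>1) \<^bold>\<and> f_critical B (l \<^bold>+ \<^bold>1) \<^bold>\<and>
       (\<^bold>\<exists>b. \<^bold>\<exists>j. f_base B (l \<^bold>+ \<^bold>1) b \<^bold>\<and> \<^bold>1 \<^bold>\<le> j \<^bold>\<and> j \<^bold>\<le> i \<^bold>\<and>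
          f_rec (\<lambda>y. y \<^bold>= c) (\<lambda>_ y z. f_bracket (f_upgrade B Z) b y (l \<^bold>+ \<^bold>1) z) j x))))"

text \<open>\<open>x \<in> plus_stage B i n\<close>\<close>

definition f_stage :: "(ltm \<Rightarrow> lfm) \<Rightarrow> ltm \<Rightarrow> ltm \<Rightarrow> ltm \<Rightarrow> lfm" where
  "f_stage B i n x = (\<^bold>\<exists>m. f_min B m \<^bold>\<and> (\<^bold>\<exists>\<^sub>s T.
     (\<^bold>\<forall>x. \<^bold>\<langle>\<^bold>0, x\<^bold>\<rangle> \<^bold>\<in> T \<^bold>\<longleftrightarrow> x \<^bold>= m \<^bold>+ \<^bold>1) \<^bold>\<and>
     (\<^bold>\<forall>k. \<^bold>\<forall>x. k \<^bold>< n \<^bold>\<longrightarrow> (\<^bold>\<langle>k \<^bold>+ \<^bold>1, x\<^bold>\<rangle> \<^bold>\<in> T \<^bold>\<longleftrightarrow>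
       (k \<^bold>+ \<^bold>1 \<^bold>\<le> m \<^bold>\<and> x \<^bold>= m \<^bold>+ \<^bold>1) \<^bold>\<or>
       (m \<^bold>< k \<^bold>+ \<^bold>1 \<^bold>\<and> (\<^bold>\<langle>k, x\<^bold>\<rangle> \<^bold>\<in> T \<^bold>\<or> f_new B i (\<lambda>y. \<^bold>\<langle>k, y\<^bold>\<rangle> \<^bold>\<in> T) k x)))) \<^bold>\<and>
     \<^bold>\<langle>n, x\<^bold>\<rangle> \<^bold>\<in> T))"

definition f_plus :: "(ltm \<Rightarrow> lfm) \<Rightarrow> ltm \<Rightarrow> ltm \<Rightarrow> lfm" where
  "f_plus B i x = (\<^bold>\<exists>n. f_stage B i n x)"

text \<open>The set \<open>H\<close> codes the sequence \<open>(B\<^sub>i)\<close> with \<open>B\<^sub>0 = X\<close>.\<close>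

definition f_hierarchies :: "lset \<Rightarrow> lset \<Rightarrow> lfm" where
  "f_hierarchies X H =
     ((\<^bold>\<forall>x. \<^bold>\<langle>\<^bold>0, x\<^bold>\<rangle> \<^bold>\<in> H \<^bold>\<longleftrightarrow> x \<^bold>\<in> X) \<^bold>\<and>
      (\<^bold>\<forall>i. \<^bold>\<forall>x. \<^bold>\<langle>i \<^bold>+ \<^bold>1, x\<^bold>\<rangle> \<^bold>\<in> H \<^bold>\<longleftrightarrow> f_plus (\<lambda>y. \<^bold>\<langle>i, y\<^bold>\<rangle> \<^bold>\<in> H) (i \<^bold>+ \<^bold>1) x))"

text \<open>\<open>v = goodstein (ouroboros_seq X) n i\<close>\<close>

definition f_goodstein :: "lset \<Rightarrow> ltm \<Rightarrow> ltm \<Rightarrow> ltm \<Rightarrow> lfm" where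
  "f_goodstein X n i v = (\<^bold>\<exists>\<^sub>s H. f_hierarchies X H \<^bold>\<and>
     f_rec (\<lambda>x. x \<^bold>= n)
       (\<lambda>j y x.
          (\<^bold>0 \<^bold>< y \<^bold>\<and> f_upgrade (\<lambda>z. \<^bold>\<langle>j, z\<^bold>\<rangle> \<^bold>\<in> H) (\<lambda>z. \<^bold>\<langle>j \<^bold>+ \<^bold>1, z\<^bold>\<rangle> \<^bold>\<in> H) y (x \<^bold>+ \<^bold>1)) \<^bold>\<or>
          (y \<^bold>= \<^bold>0 \<^bold>\<and> x \<^bold>= \<^bold>0))
       i v)"

text \<open>The only free variable is the set variable \<open>0\<close>, bound at set depth \<open>0\<close>.\<close>

definition goodstein_terminates :: fm where
  "goodstein_terminates =
     (let X = (\<lambda>s. s - Suc 0) in (\<^bold>\<forall>n. \<^bold>\<exists>i. f_goodstein X n i \<^bold>0) 0 (Suc 0))"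



section \<open>Soundness of the calculus\<close>

lemma eval_subT: "evalT \<rho> (subT f t) = evalT (\<lambda>k. evalT \<rho> (f k)) t"
  by (induction t) auto

lemma sat_subF: "sat \<rho> \<sigma> (subF f g p) \<longleftrightarrow> sat (\<lambda>k. evalT \<rho> (f k)) (\<lambda>X. \<sigma> (g X)) p"
proof (induction p arbitrary: \<rho> \<sigma> f g)
  case (AllN p)
  have "(\<lambda>k. evalT (case_nat n \<rho>) (case_nat (Var 0) (\<lambda>k. liftT (f k)) k)) =
      case_nat n (\<lambda>k. evalT \<rho> (f k))" for n
    by (rule ext) (simp add: eval_subT split: nat.split)
  then show ?case using AllN by simp
next
  case (AllS p)
  have "(\<lambda>X. case_nat A \<sigma> (case_nat 0 (\<lambda>k. Suc (g k)) X)) = case_nat A (\<lambda>X. \<sigma> (g X))" for A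
    by (rule ext) (simp split: nat.split)
  then show ?case using AllS by simp
qed (auto simp: eval_subT)

lemma sat_instN: "sat \<rho> \<sigma> (instN p t) \<longleftrightarrow> sat (case_nat (evalT \<rho> t) \<rho>) \<sigma> p"
proof -
  have "(\<lambda>k. evalT \<rho> (case_nat t Var k)) = case_nat (evalT \<rho> t) \<rho>"
    by (rule ext) (simp split: nat.split)
  then show ?thesis by (simp add: sat_subF)
qed

lemma sat_instS: "sat \<rho> \<sigma> (instS p X) \<longleftrightarrow> sat \<rho> (case_nat (\<sigma> X) \<sigma>) p"
proof -
  have "(\<lambda>k. \<sigma> (case_nat X id k)) = case_nat (\<sigma> X) \<sigma>"
    by (rule ext) (simp split: nat.split)
  then show ?thesis by (simp add: sat_subF)
qed

theorem RCA0_sound: "RCA\<^sub>0 \<turnstile> p \<Longrightarrow> sat \<rho> \<sigma> p"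
proof (induction arbitrary: \<rho> \<sigma> rule: RCA0.induct)
  case (ax_ind p)
  have eq: "(\<lambda>k. evalT (case_nat n \<rho>) (case_nat (Plus (Var 0) One) (\<lambda>k. Var (Suc k)) k)) = case_nat (Suc n) \<rho>" for n
    by (rule ext) (simp split: nat.split)
  have "sat (case_nat n \<rho>) \<sigma> p" if "sat (case_nat 0 \<rho>) \<sigma> p"
    "\<And>n. sat (case_nat n \<rho>) \<sigma> p \<Longrightarrow> sat (case_nat (Suc n) \<rho>) \<sigma> p" for n
    by (induction n) (use that in auto)
  then show ?case by (simp add: sat_instN) (simp add: sat_subF eq)
next
  case (ax_comp p q)
  then show ?case
    by (auto simp: sat_subF intro!: exI[of _ "{n. sat (case_nat n \<rho>) \<sigma> p}"])
next
  case (ax_subst t u p)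
  then show ?case by (simp only: sat.simps sat_instN) simp
next
  case (ax_instN p t)
  then show ?case by (simp only: sat.simps sat_instN) simp
next
  case (ax_instS p X)
  then show ?case by (simp only: sat.simps sat_instS) simp
qed (auto simp: sat_subF)


section \<open>Adequacy of the formula in the standard model\<close>

text \<open>A context consists of binding depths and assignments; \<open>tmd\<close>, \<open>setd\<close>, \<open>fmd\<close>, \<open>predd\<close>, etc.
  relate syntactic objects to their denotations, in all extensions of the context.\<close>

type_synonym ctx = "nat \<times> nat \<times> (nat \<Rightarrow> nat) \<times> (nat \<Rightarrow> nat set)"

definition ctx_le :: "ctx \<Rightarrow> ctx \<Rightarrow> bool" (infix \<open>\<sqsubseteq>\<close> 50) where
  "G \<sqsubseteq> G' \<longleftrightarrow> (case G of (d, s, \<rho>, \<sigma>) \<Rightarrow> case G' of (d', s', \<rho>', \<sigma>') \<Rightarrow>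
     d \<le> d' \<and> s \<le> s' \<and> (\<forall>k. \<rho>' (k + (d' - d)) = \<rho> k) \<and> (\<forall>k. \<sigma>' (k + (s' - s)) = \<sigma> k))"

definition holds :: "ctx \<Rightarrow> lfm \<Rightarrow> bool" where
  "holds G P = (case G of (d, s, \<rho>, \<sigma>) \<Rightarrow> sat \<rho> \<sigma> (P d s))"

definition tmd :: "ctx \<Rightarrow> ltm \<Rightarrow> nat \<Rightarrow> bool" where
  "tmd G a x \<longleftrightarrow> (\<forall>d s \<rho> \<sigma>. G \<sqsubseteq> (d, s, \<rho>, \<sigma>) \<longrightarrow> evalT \<rho> (a d) = x)"

definition setd :: "ctx \<Rightarrow> lset \<Rightarrow> nat set \<Rightarrow> bool" where
  "setd G X A \<longleftrightarrow> (\<forall>d s \<rho> \<sigma>. G \<sqsubseteq> (d, s, \<rho>, \<sigma>) \<longrightarrow> \<sigma> (X s) = A)"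

definition fmd :: "ctx \<Rightarrow> lfm \<Rightarrow> bool \<Rightarrow> bool" where
  "fmd G P p \<longleftrightarrow> (\<forall>G'. G \<sqsubseteq> G' \<longrightarrow> holds G' P = p)"

definition predd :: "ctx \<Rightarrow> (ltm \<Rightarrow> lfm) \<Rightarrow> (nat \<Rightarrow> bool) \<Rightarrow> bool" where
  "predd G P p \<longleftrightarrow> (\<forall>G' a x. G \<sqsubseteq> G' \<longrightarrow> tmd G' a x \<longrightarrow> fmd G' (P a) (p x))"

definition predd2 :: "ctx \<Rightarrow> (ltm \<Rightarrow> ltm \<Rightarrow> lfm) \<Rightarrow> (nat \<Rightarrow> nat \<Rightarrow> bool) \<Rightarrow> bool" where
  "predd2 G P p \<longleftrightarrow> (\<forall>G' a x b y. G \<sqsubseteq> G' \<longrightarrow> tmd G' a x \<longrightarrow> tmd G' b y \<longrightarrow> fmd G' (P a b) (p x y))"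

definition predd3 :: "ctx \<Rightarrow> (ltm \<Rightarrow> ltm \<Rightarrow> ltm \<Rightarrow> lfm) \<Rightarrow> (nat \<Rightarrow> nat \<Rightarrow> nat \<Rightarrow> bool) \<Rightarrow> bool" where
  "predd3 G P p \<longleftrightarrow> (\<forall>G' a x b y c z. G \<sqsubseteq> G' \<longrightarrow> tmd G' a x \<longrightarrow> tmd G' b y \<longrightarrow> tmd G' c z \<longrightarrow>
     fmd G' (P a b c) (p x y z))"

lemma ctx_refl: "G \<sqsubseteq> G" by (cases G) (simp add: ctx_le_def)

lemma ctx_trans: "G \<sqsubseteq> H \<Longrightarrow> H \<sqsubseteq> K \<Longrightarrow> G \<sqsubseteq> K"
proof -
  assume a: "G \<sqsubseteq> H" "H \<sqsubseteq> K"
  obtain d s r S where G: "G = (d,s,r,S)" by (cases G)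
  obtain d' s' r' S' where H: "H = (d',s',r',S')" by (cases H)
  obtain d'' s'' r'' S'' where K: "K = (d'',s'',r'',S'')" by (cases K)
  from a have le: "d \<le> d'" "d' \<le> d''" "s \<le> s'" "s' \<le> s''" by (auto simp: G H K ctx_le_def)
  have 1: "r'' (k + (d'' - d)) = r k" for k
  proof -
    have "k + (d'' - d) = (k + (d' - d)) + (d'' - d')" using le by simp
    then show ?thesis using a unfolding G H K ctx_le_def split by metis
  qed
  have 2: "S'' (k + (s'' - s)) = S k" for k
  proof -
    have "k + (s'' - s) = (k + (s' - s)) + (s'' - s')" using le by simp
    then show ?thesis using a unfolding G H K ctx_le_def split by metis
  qed
  show ?thesis using le 1 2 by (auto simp: G K ctx_le_def)
qed

lemma tmd_mono: "tmd G a x \<Longrightarrow> G \<sqsubseteq> H \<Longrightarrow> tmd H a x"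
  unfolding tmd_def by (blast intro: ctx_trans)
lemma setd_mono: "setd G a x \<Longrightarrow> G \<sqsubseteq> H \<Longrightarrow> setd H a x"
  unfolding setd_def by (blast intro: ctx_trans)
lemma fmd_mono: "fmd G a x \<Longrightarrow> G \<sqsubseteq> H \<Longrightarrow> fmd H a x"
  unfolding fmd_def by (blast intro: ctx_trans)
lemma predd_mono: "predd G a x \<Longrightarrow> G \<sqsubseteq> H \<Longrightarrow> predd H a x"
  unfolding predd_def by (blast intro: ctx_trans)
lemma predd2_mono: "predd2 G a x \<Longrightarrow> G \<sqsubseteq> H \<Longrightarrow> predd2 H a x"
  unfolding predd2_def by (blast intro: ctx_trans)
lemma predd3_mono: "predd3 G a x \<Longrightarrow> G \<sqsubseteq> H \<Longrightarrow> predd3 H a x"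
  unfolding predd3_def by (blast intro: ctx_trans)

lemma tmd_ops:
  "tmd G \<^bold>0 0" "tmd G \<^bold>1 1"
  "tmd G a x \<Longrightarrow> tmd G b y \<Longrightarrow> tmd G (a \<^bold>+ b) (x + y)"
  "tmd G a x \<Longrightarrow> tmd G b y \<Longrightarrow> tmd G (a \<^bold>* b) (x * y)"
  by (auto simp: tmd_def l_zero_def l_one_def l_plus_def l_times_def)

definition pair :: "nat \<Rightarrow> nat \<Rightarrow> nat" where "pair x y = (x + y) * (x + y) + x"

lemma tmd_pair: "tmd G a x \<Longrightarrow> tmd G b y \<Longrightarrow> tmd G \<^bold>\<langle>a, b\<^bold>\<rangle> (pair x y)"
  unfolding l_pair_def pair_def by (intro tmd_ops)

lemma fmd_atoms:
  "tmd G a x \<Longrightarrow> tmd G b y \<Longrightarrow> fmd G (a \<^bold>= b) (x = y)"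
  "tmd G a x \<Longrightarrow> tmd G b y \<Longrightarrow> fmd G (a \<^bold>< b) (x < y)"
  "tmd G a x \<Longrightarrow> setd G X A \<Longrightarrow> fmd G (a \<^bold>\<in> X) (x \<in> A)"
  by (auto simp: fmd_def tmd_def setd_def holds_def l_eq_def l_less_def l_mem_def)

lemma fmd_le: "tmd G a x \<Longrightarrow> tmd G b y \<Longrightarrow> fmd G (a \<^bold>\<le> b) (x \<le> y)"
  by (auto simp: fmd_def tmd_def holds_def l_eq_def l_less_def l_le_def l_or_def)

lemma fmd_conn:
  "fmd G P p \<Longrightarrow> fmd G (\<^bold>\<not> P) (\<not> p)"
  "fmd G P p \<Longrightarrow> fmd G Q q \<Longrightarrow> fmd G (P \<^bold>\<and> Q) (p \<and> q)"
  "fmd G P p \<Longrightarrow> fmd G Q q \<Longrightarrow> fmd G (P \<^bold>\<or> Q) (p \<or> q)"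
  "fmd G P p \<Longrightarrow> fmd G Q q \<Longrightarrow> fmd G (P \<^bold>\<longrightarrow> Q) (p \<longrightarrow> q)"
  "fmd G P p \<Longrightarrow> fmd G Q q \<Longrightarrow> fmd G (P \<^bold>\<longleftrightarrow> Q) (p \<longleftrightarrow> q)"
  by (auto simp: fmd_def holds_def l_not_def l_and_def l_or_def l_imp_def l_iff_def)

lemma ctx_pushN: "(d, s, \<rho>, \<sigma>) \<sqsubseteq> (Suc d, s, case_nat n \<rho>, \<sigma>)"
  by (simp add: ctx_le_def Suc_diff_le)

lemma ctx_pushS: "(d, s, \<rho>, \<sigma>) \<sqsubseteq> (d, Suc s, \<rho>, case_nat A \<sigma>)"
  by (simp add: ctx_le_def Suc_diff_le)

lemma tmd_new: "tmd (Suc d, s, case_nat n \<rho>, \<sigma>) (\<lambda>d'. Var (d' - Suc d)) n"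
  unfolding tmd_def
proof (intro allI impI)
  fix d' s' \<rho>' \<sigma>'
  assume "(Suc d, s, case_nat n \<rho>, \<sigma>) \<sqsubseteq> (d', s', \<rho>', \<sigma>')"
  then have "\<rho>' (0 + (d' - Suc d)) = case_nat n \<rho> 0" unfolding ctx_le_def split by blast
  then show "evalT \<rho>' (Var (d' - Suc d)) = n" by simp
qed

lemma setd_new: "setd (d, Suc s, \<rho>, case_nat A \<sigma>) (\<lambda>s'. s' - Suc s) A"
  unfolding setd_def
proof (intro allI impI)
  fix d' s' \<rho>' \<sigma>'
  assume "(d, Suc s, \<rho>, case_nat A \<sigma>) \<sqsubseteq> (d', s', \<rho>', \<sigma>')"
  then have "\<sigma>' (0 + (s' - Suc s)) = case_nat A \<sigma> 0" unfolding ctx_le_def split by blast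
  then show "\<sigma>' (s' - Suc s) = A" by simp
qed

lemma pushN_holds:
  assumes "predd G F f" "G \<sqsubseteq> (d, s, \<rho>, \<sigma>)"
  shows "sat (case_nat n \<rho>) \<sigma> (F (\<lambda>d'. Var (d' - Suc d)) (Suc d) s) = f n"
proof -
  let ?H = "(Suc d, s, case_nat n \<rho>, \<sigma>)"
  have "G \<sqsubseteq> ?H" using assms(2) ctx_pushN ctx_trans by blast
  then have "fmd ?H (F (\<lambda>d'. Var (d' - Suc d))) (f n)"
    using assms(1) tmd_new unfolding predd_def by blast
  then show ?thesis using ctx_refl[of ?H] by (auto simp: fmd_def holds_def)
qed

lemma fmd_all: "predd G F f \<Longrightarrow> fmd G (l_all F) (\<forall>x. f x)"
  unfolding fmd_def by (auto simp: holds_def l_all_def pushN_holds)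
lemma fmd_ex: "predd G F f \<Longrightarrow> fmd G (l_ex F) (\<exists>x. f x)"
  unfolding fmd_def by (auto simp: holds_def l_ex_def pushN_holds)

lemma fmd_exS:
  assumes "\<And>H X A. G \<sqsubseteq> H \<Longrightarrow> setd H X A \<Longrightarrow> fmd H (F X) (f A)"
  shows "fmd G (l_exS F) (\<exists>A. f A)"
proof -
  have "sat \<rho> (case_nat A \<sigma>) (F (\<lambda>s'. s' - Suc s) d (Suc s)) = f A"
    if "G \<sqsubseteq> (d, s, \<rho>, \<sigma>)" for d s \<rho> \<sigma> A
  proof -
    let ?H = "(d, Suc s, \<rho>, case_nat A \<sigma>)"
    have "G \<sqsubseteq> ?H" using that ctx_pushS ctx_trans by blast
    from assms[OF this setd_new] show ?thesis
      using ctx_refl[of ?H] by (auto simp: fmd_def holds_def)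
  qed
  then show ?thesis unfolding fmd_def by (auto simp: holds_def l_exS_def)
qed

lemma preddI: "(\<And>H a x. G \<sqsubseteq> H \<Longrightarrow> tmd H a x \<Longrightarrow> fmd H (P a) (p x)) \<Longrightarrow> predd G P p"
  by (simp add: predd_def)
lemma predd2I: "(\<And>H a x b y. G \<sqsubseteq> H \<Longrightarrow> tmd H a x \<Longrightarrow> tmd H b y \<Longrightarrow> fmd H (P a b) (p x y)) \<Longrightarrow> predd2 G P p"
  by (simp add: predd2_def)
lemma predd3I: "(\<And>H a x b y c z. G \<sqsubseteq> H \<Longrightarrow> tmd H a x \<Longrightarrow> tmd H b y \<Longrightarrow> tmd H c z \<Longrightarrow> fmd H (P a b c) (p x y z)) \<Longrightarrow> predd3 G P p"
  by (simp add: predd3_def)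
lemma preddD: "predd G P p \<Longrightarrow> G \<sqsubseteq> H \<Longrightarrow> tmd H a x \<Longrightarrow> fmd H (P a) (p x)"
  unfolding predd_def by blast
lemma predd2D: "predd2 G P p \<Longrightarrow> G \<sqsubseteq> H \<Longrightarrow> tmd H a x \<Longrightarrow> tmd H b y \<Longrightarrow> fmd H (P a b) (p x y)"
  unfolding predd2_def by blast
lemma predd3D: "predd3 G P p \<Longrightarrow> G \<sqsubseteq> H \<Longrightarrow> tmd H a x \<Longrightarrow> tmd H b y \<Longrightarrow> tmd H c z \<Longrightarrow> fmd H (P a b c) (p x y z)"
  unfolding predd3_def by blast

lemma fmd_all': "(\<And>H a x. G \<sqsubseteq> H \<Longrightarrow> tmd H a x \<Longrightarrow> fmd H (F a) (f x)) \<Longrightarrow> fmd G (l_all F) (\<forall>x. f x)"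
  by (intro fmd_all preddI)
lemma fmd_ex': "(\<And>H a x. G \<sqsubseteq> H \<Longrightarrow> tmd H a x \<Longrightarrow> fmd H (F a) (f x)) \<Longrightarrow> fmd G (l_ex F) (\<exists>x. f x)"
  by (intro fmd_ex preddI)

lemmas den_step = fmd_conn fmd_atoms fmd_le fmd_all' fmd_ex' fmd_exS tmd_ops tmd_pair

text \<open>The prefix \<open>r\<close> marks the denotations of the formulas with prefix \<open>f\<close>.\<close>

definition r_rec where
  "r_rec P R k v \<longleftrightarrow> (\<exists>T. (\<forall>x. pair 0 x \<in> T \<longleftrightarrow> P x) \<and>
     (\<forall>j x. j < k \<longrightarrow> (pair (j + 1) x \<in> T \<longleftrightarrow> (\<exists>y. pair j y \<in> T \<and> R j y x))) \<and> pair k v \<in> T)"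
definition r_decomp where
  "r_decomp b n e a r \<longleftrightarrow> (\<exists>p. r_rec (\<lambda>x. x = 1) (\<lambda>j y x. x = y * b) e p \<and>
     p \<le> n \<and> n < p * b \<and> 0 < a \<and> a < b \<and> r < p \<and> n = p * a + r)"
definition r_min where
  "r_min B (m::nat) \<longleftrightarrow> B m \<and> (\<forall>x. B x \<longrightarrow> m \<le> x)"
definition r_max where
  "r_max B (m::nat) \<longleftrightarrow> B m \<and> (\<forall>x. B x \<longrightarrow> x \<le> m)"
definition r_base where
  "r_base B n b \<longleftrightarrow> r_max (\<lambda>x. B x \<and> x \<le> n) b \<or> (r_min B b \<and> n < b)"
definition r_critical where
  "r_critical B n \<longleftrightarrow> (\<exists>b k. r_base B n b \<and> n = b * k)"
definition r_bracket where
  "r_bracket U b c m v \<longleftrightarrow> (\<exists>T. (\<forall>k x. pair k x \<in> T \<longleftrightarrow>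
       (k < b \<and> U k x) \<or>
       (b \<le> k \<and> (\<exists>e a r. r_decomp b k e a r \<and>
          (\<exists>p q y z. pair e p \<in> T \<and> r_rec (\<lambda>x. x = 1) (\<lambda>j y x. x = y * c) p q \<and> U a y \<and> pair r z \<in> T \<and>
             x = q * y + z)))) \<and>
     pair m v \<in> T)"
definition r_good where
  "r_good U C b n c w \<longleftrightarrow> (C c \<and> r_bracket U b c n w \<and>
      (\<exists>k u. n = k + 1 \<and> U k u \<and> u < w) \<and> (\<forall>x. C x \<and> c < x \<longrightarrow> w < x))"
definition r_upgrade where
  "r_upgrade B C n v \<longleftrightarrow> (\<exists>m. r_min B m \<and> (\<exists>T. 
     (\<forall>k x. k \<le> n \<longrightarrow> (pair k x \<in> T \<longleftrightarrow>
       (k < m \<and> x = k) \<or>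
       (m \<le> k \<and> (\<exists>b c. r_base B k b \<and> r_good (\<lambda>j y. pair j y \<in> T) C b k c x \<and>
          (\<forall>c' y. c' < c \<longrightarrow> \<not> r_good (\<lambda>j y. pair j y \<in> T) C b k c' y))))) \<and>
     pair n v \<in> T))"
definition r_new where
  "r_new B i Z l x \<longleftrightarrow> (\<exists>c. r_max Z c \<and>
     ((B (l + 1) \<and>
       (\<exists>b w a. r_base B l b \<and> r_bracket (r_upgrade B Z) b c l w \<and>
          w < c * a \<and> (\<forall>a'. a' < a \<longrightarrow> \<not> w < c * a') \<and> x = c * a)) \<or>
      (\<not> B (l + 1) \<and> r_critical B (l + 1) \<and>
       (\<exists>b j. r_base B (l + 1) b \<and> 1 \<le> j \<and> j \<le> i \<and>
          r_rec (\<lambda>y. y = c) (\<lambda>_ y z. r_bracket (r_upgrade B Z) b y (l + 1) z) j x))))"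
definition r_stage where
  "r_stage B i n v \<longleftrightarrow> (\<exists>m. r_min B m \<and> (\<exists>T.
     (\<forall>x. pair 0 x \<in> T \<longleftrightarrow> x = m + 1) \<and>
     (\<forall>k x. k < n \<longrightarrow> (pair (k + 1) x \<in> T \<longleftrightarrow>
       (k + 1 \<le> m \<and> x = m + 1) \<or>
       (m < k + 1 \<and> (pair k x \<in> T \<or> r_new B i (\<lambda>y. pair k y \<in> T) k x)))) \<and>
     pair n v \<in> T))"
definition r_hierarchies where
  "r_hierarchies X H \<longleftrightarrow> (\<forall>x. pair 0 x \<in> H \<longleftrightarrow> x \<in> X) \<and>
     (\<forall>i x. pair (i + 1) x \<in> H \<longleftrightarrow> (\<exists>n. r_stage (\<lambda>y. pair i y \<in> H) (i + 1) n x))"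
definition r_goodstein where
  "r_goodstein X n i v \<longleftrightarrow> (\<exists>H. r_hierarchies X H \<and>
     r_rec (\<lambda>x. x = n)
       (\<lambda>j y x. (0 < y \<and> r_upgrade (\<lambda>z. pair j z \<in> H) (\<lambda>z. pair (j + 1) z \<in> H) y (x + 1)) \<or>
          (y = 0 \<and> x = 0)) i v)"

named_theorems den_macro

lemma den_rec [den_macro]:
  assumes "predd G P p" "predd3 G R r" "tmd G k kk" "tmd G v vv"
  shows "fmd G (f_rec P R k v) (r_rec p r kk vv)"
  using assms unfolding f_rec_def r_rec_def
  apply -
  apply (rule den_step den_macro preddI predd2I predd3I | assumption
     | (rule tmd_mono, assumption) | (rule setd_mono, assumption)
     | (rule predd_mono, assumption) | (rule predd2_mono, assumption) | (rule predd3_mono, assumption)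
     | (rule preddD, assumption) | (rule predd2D, assumption) | (rule predd3D, assumption)
     | rule ctx_refl | (rule ctx_trans[rotated], assumption))+
  done

lemma den_pow [den_macro]:
  assumes "tmd G c cc" "tmd G k kk" "tmd G v vv"
  shows "fmd G (f_pow c k v) (r_rec (\<lambda>x. x = 1) (\<lambda>j y x. x = y * cc) kk vv)"
  using assms unfolding f_pow_def
  apply -
  apply (rule den_step den_macro preddI predd2I predd3I | assumption
     | (rule tmd_mono, assumption) | (rule setd_mono, assumption)
     | (rule predd_mono, assumption) | (rule predd2_mono, assumption) | (rule predd3_mono, assumption)
     | (rule preddD, assumption) | (rule predd2D, assumption) | (rule predd3D, assumption)
     | rule ctx_refl | (rule ctx_trans[rotated], assumption))+
  done

lemma den_decomp [den_macro]:
  assumes "tmd G b bb" "tmd G n nn" "tmd G e ee" "tmd G a aa" "tmd G r rr"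
  shows "fmd G (f_decomp b n e a r) (r_decomp bb nn ee aa rr)"
  using assms unfolding f_decomp_def r_decomp_def
  apply -
  apply (rule den_step den_macro preddI predd2I predd3I | assumption
     | (rule tmd_mono, assumption) | (rule setd_mono, assumption)
     | (rule predd_mono, assumption) | (rule predd2_mono, assumption) | (rule predd3_mono, assumption)
     | (rule preddD, assumption) | (rule predd2D, assumption) | (rule predd3D, assumption)
     | rule ctx_refl | (rule ctx_trans[rotated], assumption))+
  done

lemma den_min [den_macro]:
  assumes "predd G P p" "tmd G v vv"
  shows "fmd G (f_min P v) (r_min p vv)"
  using assms unfolding f_min_def r_min_def
  apply -
  apply (rule den_step den_macro preddI predd2I predd3I | assumption
     | (rule tmd_mono, assumption) | (rule setd_mono, assumption)
     | (rule predd_mono, assumption) | (rule predd2_mono, assumption) | (rule predd3_mono, assumption)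
     | (rule preddD, assumption) | (rule predd2D, assumption) | (rule predd3D, assumption)
     | rule ctx_refl | (rule ctx_trans[rotated], assumption))+
  done

lemma den_max [den_macro]:
  assumes "predd G P p" "tmd G v vv"
  shows "fmd G (f_max P v) (r_max p vv)"
  using assms unfolding f_max_def r_max_def
  apply -
  apply (rule den_step den_macro preddI predd2I predd3I | assumption
     | (rule tmd_mono, assumption) | (rule setd_mono, assumption)
     | (rule predd_mono, assumption) | (rule predd2_mono, assumption) | (rule predd3_mono, assumption)
     | (rule preddD, assumption) | (rule predd2D, assumption) | (rule predd3D, assumption)
     | rule ctx_refl | (rule ctx_trans[rotated], assumption))+
  done

lemma den_base [den_macro]:
  assumes "predd G P p" "tmd G n nn" "tmd G v vv"
  shows "fmd G (f_base P n v) (r_base p nn vv)"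
  using assms unfolding f_base_def r_base_def
  apply -
  apply (rule den_step den_macro preddI predd2I predd3I | assumption
     | (rule tmd_mono, assumption) | (rule setd_mono, assumption)
     | (rule predd_mono, assumption) | (rule predd2_mono, assumption) | (rule predd3_mono, assumption)
     | (rule preddD, assumption) | (rule predd2D, assumption) | (rule predd3D, assumption)
     | rule ctx_refl | (rule ctx_trans[rotated], assumption))+
  done

lemma den_critical [den_macro]:
  assumes "predd G P p" "tmd G v vv"
  shows "fmd G (f_critical P v) (r_critical p vv)"
  using assms unfolding f_critical_def r_critical_def
  apply -
  apply (rule den_step den_macro preddI predd2I predd3I | assumption
     | (rule tmd_mono, assumption) | (rule setd_mono, assumption)
     | (rule predd_mono, assumption) | (rule predd2_mono, assumption) | (rule predd3_mono, assumption)
     | (rule preddD, assumption) | (rule predd2D, assumption) | (rule predd3D, assumption)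
     | rule ctx_refl | (rule ctx_trans[rotated], assumption))+
  done

lemma den_bracket [den_macro]:
  assumes "predd2 G U u" "tmd G b bb" "tmd G c cc" "tmd G n nn" "tmd G v vv"
  shows "fmd G (f_bracket U b c n v) (r_bracket u bb cc nn vv)"
  using assms unfolding f_bracket_def r_bracket_def
  apply -
  apply (rule den_step den_macro preddI predd2I predd3I | assumption
     | (rule tmd_mono, assumption) | (rule setd_mono, assumption)
     | (rule predd_mono, assumption) | (rule predd2_mono, assumption) | (rule predd3_mono, assumption)
     | (rule preddD, assumption) | (rule predd2D, assumption) | (rule predd3D, assumption)
     | rule ctx_refl | (rule ctx_trans[rotated], assumption))+
  done

lemma den_good [den_macro]:
  assumes "predd2 G U u" "predd G C C'" "tmd G b bb" "tmd G n nn" "tmd G c cc" "tmd G v vv"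
  shows "fmd G (f_good U C b n c v) (r_good u C' bb nn cc vv)"
  using assms unfolding f_good_def r_good_def
  apply -
  apply (rule den_step den_macro preddI predd2I predd3I | assumption
     | (rule tmd_mono, assumption) | (rule setd_mono, assumption)
     | (rule predd_mono, assumption) | (rule predd2_mono, assumption) | (rule predd3_mono, assumption)
     | (rule preddD, assumption) | (rule predd2D, assumption) | (rule predd3D, assumption)
     | rule ctx_refl | (rule ctx_trans[rotated], assumption))+
  done

lemma den_upgrade [den_macro]:
  assumes "predd G B B'" "predd G C C'" "tmd G n nn" "tmd G v vv"
  shows "fmd G (f_upgrade B C n v) (r_upgrade B' C' nn vv)"
  using assms unfolding f_upgrade_def r_upgrade_def
  apply -
  apply (rule den_step den_macro preddI predd2I predd3I | assumption
     | (rule tmd_mono, assumption) | (rule setd_mono, assumption)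
     | (rule predd_mono, assumption) | (rule predd2_mono, assumption) | (rule predd3_mono, assumption)
     | (rule preddD, assumption) | (rule predd2D, assumption) | (rule predd3D, assumption)
     | rule ctx_refl | (rule ctx_trans[rotated], assumption))+
  done

lemma den_new [den_macro]:
  assumes "predd G B B'" "tmd G i ii" "predd G C C'" "tmd G n nn" "tmd G v vv"
  shows "fmd G (f_new B i C n v) (r_new B' ii C' nn vv)"
  using assms unfolding f_new_def r_new_def
  apply -
  apply (rule den_step den_macro preddI predd2I predd3I | assumption
     | (rule tmd_mono, assumption) | (rule setd_mono, assumption)
     | (rule predd_mono, assumption) | (rule predd2_mono, assumption) | (rule predd3_mono, assumption)
     | (rule preddD, assumption) | (rule predd2D, assumption) | (rule predd3D, assumption)
     | rule ctx_refl | (rule ctx_trans[rotated], assumption))+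
  done

lemma den_stage [den_macro]:
  assumes "predd G B B'" "tmd G i ii" "tmd G n nn" "tmd G v vv"
  shows "fmd G (f_stage B i n v) (r_stage B' ii nn vv)"
  using assms unfolding f_stage_def r_stage_def
  apply -
  apply (rule den_step den_macro preddI predd2I predd3I | assumption
     | (rule tmd_mono, assumption) | (rule setd_mono, assumption)
     | (rule predd_mono, assumption) | (rule predd2_mono, assumption) | (rule predd3_mono, assumption)
     | (rule preddD, assumption) | (rule predd2D, assumption) | (rule predd3D, assumption)
     | rule ctx_refl | (rule ctx_trans[rotated], assumption))+
  done

lemma den_hierarchies [den_macro]:
  assumes "setd G X A" "setd G H K"
  shows "fmd G (f_hierarchies X H) (r_hierarchies A K)"
  using assms unfolding f_hierarchies_def f_plus_def r_hierarchies_def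
  apply -
  apply (rule den_step den_macro preddI predd2I predd3I | assumption
     | (rule tmd_mono, assumption) | (rule setd_mono, assumption)
     | (rule predd_mono, assumption) | (rule predd2_mono, assumption) | (rule predd3_mono, assumption)
     | (rule preddD, assumption) | (rule predd2D, assumption) | (rule predd3D, assumption)
     | rule ctx_refl | (rule ctx_trans[rotated], assumption))+
  done

lemma den_goodstein [den_macro]:
  assumes "setd G X A" "tmd G n nn" "tmd G i ii" "tmd G v vv"
  shows "fmd G (f_goodstein X n i v) (r_goodstein A nn ii vv)"
  using assms unfolding f_goodstein_def r_goodstein_def
  apply -
  apply (rule den_step den_macro preddI predd2I predd3I | assumption
     | (rule tmd_mono, assumption) | (rule setd_mono, assumption)
     | (rule predd_mono, assumption) | (rule predd2_mono, assumption) | (rule predd3_mono, assumption)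
     | (rule preddD, assumption) | (rule predd2D, assumption) | (rule predd3D, assumption)
     | rule ctx_refl | (rule ctx_trans[rotated], assumption))+
  done

lemma pair_inject [simp]: "pair x y = pair x' y' \<longleftrightarrow> x = x' \<and> y = y'"
proof
  assume eq: "pair x y = pair x' y'"
  have aux: "a = b" if "a * a + x = b * b + y" "x \<le> a" "y \<le> b" for a b x y :: nat
  proof (rule ccontr)
    assume "a \<noteq> b"
    then consider "Suc a \<le> b" | "Suc b \<le> a" by linarith
    then show False
    proof cases
      case 1
      then have "Suc a * Suc a \<le> b * b" by (intro mult_mono) auto
      then show False using that by simp
    next
      case 2
      then have "Suc b * Suc b \<le> a * a" by (intro mult_mono) auto
      then show False using that by simp
    qed
  qed
  have "x + y = x' + y'" using eq aux[of "x + y" x "x' + y'" x'] by (simp add: pair_def)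
  then show "x = x' \<and> y = y'" using eq by (simp add: pair_def)
qed simp

primrec iter :: "(nat \<Rightarrow> bool) \<Rightarrow> (nat \<Rightarrow> nat \<Rightarrow> nat \<Rightarrow> bool) \<Rightarrow> nat \<Rightarrow> nat \<Rightarrow> bool" where
  "iter P R 0 x \<longleftrightarrow> P x"
| "iter P R (Suc j) x \<longleftrightarrow> (\<exists>y. iter P R j y \<and> R j y x)"

lemma r_rec_iter: "r_rec P R k v \<longleftrightarrow> iter P R k v"
proof
  assume "r_rec P R k v"
  then obtain T where T: "\<And>x. pair 0 x \<in> T \<longleftrightarrow> P x"
    "\<And>j x. j < k \<Longrightarrow> pair (j + 1) x \<in> T \<longleftrightarrow> (\<exists>y. pair j y \<in> T \<and> R j y x)" "pair k v \<in> T"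
    unfolding r_rec_def by blast
  have "j \<le> k \<Longrightarrow> pair j x \<in> T \<longleftrightarrow> iter P R j x" for j x
    by (induction j arbitrary: x) (use T(1,2) in auto)
  then show "iter P R k v" using T(3) by simp
next
  assume "iter P R k v"
  then show "r_rec P R k v" unfolding r_rec_def
    by (intro exI[of _ "{pair j x | j x. iter P R j x}"]) auto
qed

lemma iter_pow: "iter (\<lambda>x. x = 1) (\<lambda>j y x. x = y * c) e v \<longleftrightarrow> v = c ^ e"
  by (induction e arbitrary: v) (auto simp: mult.commute)

lemma r_decomp_iff: "r_decomp b n e a r \<longleftrightarrow> is_decomposition b n e a r"
  unfolding r_decomp_def is_decomposition_def r_rec_iter iter_pow by (auto simp: mult.commute)

lemma r_min_iff: "B \<noteq> {} \<Longrightarrow> r_min (\<lambda>x. x \<in> B) m \<longleftrightarrow> m = Inf B"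
  unfolding r_min_def by (metis Inf_nat_def1 cInf_lower bdd_below_bot dual_order.antisym)

lemma r_max_iff: "finite B \<Longrightarrow> B \<noteq> {} \<Longrightarrow> r_max (\<lambda>x. x \<in> B) m \<longleftrightarrow> m = Max B"
  unfolding r_max_def by (metis Max_ge Max_in dual_order.antisym)

lemma r_base_iff:
  assumes "B \<noteq> {}"
  shows "r_base (\<lambda>x. x \<in> B) n b \<longleftrightarrow> b = base B n"
proof (cases "\<exists>b\<in>B. b \<le> n")
  case True
  then have "r_max (\<lambda>x. x \<in> {b \<in> B. b \<le> n}) b \<longleftrightarrow> b = Max {b \<in> B. b \<le> n}"
    by (intro r_max_iff) auto
  moreover have "\<not> (r_min (\<lambda>x. x \<in> B) b \<and> n < b)" using True by (auto simp: r_min_def)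
  ultimately show ?thesis using True unfolding r_base_def base_def by auto
next
  case False
  moreover have "n < Inf B" using False Inf_nat_def1[OF assms] by (meson not_less)
  ultimately show ?thesis unfolding r_base_def base_def r_min_iff[OF assms]
    by (auto simp: r_max_def)
qed

lemma r_critical_iff:
  "B \<noteq> {} \<Longrightarrow> r_critical (\<lambda>x. x \<in> B) n \<longleftrightarrow> critical B n"
  unfolding r_critical_def critical_def by (auto simp: r_base_iff dvd_def)

lemma epow_simps [simp]: "epow c (enat k) = enat (c ^ k)" "epow c \<infinity> = \<infinity>"
  by (auto simp: epow_def)

lemma bracket_ge:
  assumes "2 \<le> b" "b \<le> m" "is_decomposition b m e a r"
  shows "bracket U b c m = epow c (bracket U b c e) * U a + bracket U b c r"
  using assms decomposition_eqI[OF assms(3)] by (subst bracket.simps) auto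


lemma enat_step:
  assumes "Y \<noteq> (0::enat)" "c \<noteq> 0"
  shows "epow c P * Y + Z = enat x \<longleftrightarrow> (\<exists>p y z. P = enat p \<and> Y = enat y \<and> Z = enat z \<and> x = c ^ p * y + z)"
  using assms by (cases P; cases Y; cases Z) (auto simp: zero_enat_def imult_is_infinity)

lemma bracket_step:
  assumes "2 \<le> b" "c \<noteq> 0" "b \<le> k" "\<And>a. 0 < a \<Longrightarrow> a < b \<Longrightarrow> U a \<noteq> 0"
  shows "(\<exists>e a r. is_decomposition b k e a r \<and> (\<exists>p q y z. bracket U b c e = enat p \<and> q = c ^ p \<and>
            U a = enat y \<and> bracket U b c r = enat z \<and> x = q * y + z)) \<longleftrightarrow> bracket U b c k = enat x"
proof -
  obtain e a r where d: "is_decomposition b k e a r"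
    using is_decomposition_exists[of b k] assms by auto
  then have "U a \<noteq> 0" using assms(4) by (auto simp: is_decomposition_def)
  then have "bracket U b c k = enat x \<longleftrightarrow> (\<exists>p y z. bracket U b c e = enat p \<and> U a = enat y \<and>
      bracket U b c r = enat z \<and> x = c ^ p * y + z)"
    unfolding bracket_ge[OF assms(1,3) d] by (rule enat_step) (rule assms(2))
  then show ?thesis using d is_decomposition_unique[OF d] by blast
qed

lemma r_bracket_iff:
  assumes b: "2 \<le> b" "c \<noteq> 0" and nz: "\<And>a. 0 < a \<Longrightarrow> a < b \<Longrightarrow> U a \<noteq> 0"
    and u: "\<And>k x. k < b \<Longrightarrow> u k x \<longleftrightarrow> U k = enat x"
  shows "r_bracket u b c m v \<longleftrightarrow> bracket U b c m = enat v"
proof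
  have small: "bracket U b c k = U k" if "k < b" for k using that by (subst bracket.simps) auto
  show "r_bracket u b c m v" if "bracket U b c m = enat v"
    unfolding r_bracket_def r_decomp_iff r_rec_iter iter_pow
  proof (intro exI[of _ "{pair k x | k x. bracket U b c k = enat x}"] conjI allI)
    fix k x
    have "(\<exists>e a r. is_decomposition b k e a r \<and> (\<exists>p q y z. bracket U b c e = enat p \<and> q = c ^ p \<and>
            u a y \<and> bracket U b c r = enat z \<and> x = q * y + z)) \<longleftrightarrow>
       (\<exists>e a r. is_decomposition b k e a r \<and> (\<exists>p q y z. bracket U b c e = enat p \<and> q = c ^ p \<and>
            U a = enat y \<and> bracket U b c r = enat z \<and> x = q * y + z))"
      by (intro arg_cong[where f=Ex] ext conj_cong) (auto simp: u is_decomposition_def)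
    moreover have "... \<longleftrightarrow> bracket U b c k = enat x" if "b \<le> k"
      by (rule bracket_step[OF b that nz])
    ultimately show "pair k x \<in> {pair k x | k x. bracket U b c k = enat x} \<longleftrightarrow>
       k < b \<and> u k x \<or> b \<le> k \<and> (\<exists>e a r. is_decomposition b k e a r \<and> (\<exists>p q y z.
          pair e p \<in> {pair k x | k x. bracket U b c k = enat x} \<and> q = c ^ p \<and> u a y \<and>
          pair r z \<in> {pair k x | k x. bracket U b c k = enat x} \<and> x = q * y + z))"
      by (cases "k < b") (simp_all add: u small)
  qed (use that in auto)
next
  have small: "bracket U b c k = U k" if "k < b" for k using that by (subst bracket.simps) auto
  assume "r_bracket u b c m v"
  then obtain T where T: "\<And>k x. pair k x \<in> T \<longleftrightarrow>
       k < b \<and> u k x \<or> b \<le> k \<and> (\<exists>e a r. is_decomposition b k e a r \<and> (\<exists>p q y z.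
          pair e p \<in> T \<and> q = c ^ p \<and> u a y \<and> pair r z \<in> T \<and> x = q * y + z))" "pair m v \<in> T"
    unfolding r_bracket_def r_decomp_iff r_rec_iter iter_pow by blast
  have "pair k x \<in> T \<longleftrightarrow> bracket U b c k = enat x" for k x
  proof (induction k arbitrary: x rule: less_induct)
    case (less k)
    show ?case
    proof (cases "k < b")
      case True then show ?thesis using T(1)[of k x] by (simp add: u small)
    next
      case False
      have "pair k x \<in> T \<longleftrightarrow> (\<exists>e a r. is_decomposition b k e a r \<and> (\<exists>p q y z.
          pair e p \<in> T \<and> q = c ^ p \<and> u a y \<and> pair r z \<in> T \<and> x = q * y + z))"
        using T(1)[of k x] False by simp
      also have "... \<longleftrightarrow> (\<exists>e a r. is_decomposition b k e a r \<and> (\<exists>p q y z. bracket U b c e = enat p \<and> q = c ^ p \<and>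
            U a = enat y \<and> bracket U b c r = enat z \<and> x = q * y + z))"
      proof -
        have "(pair e p \<in> T \<longleftrightarrow> bracket U b c e = enat p) \<and> (u a y \<longleftrightarrow> U a = enat y) \<and>
            (pair r z \<in> T \<longleftrightarrow> bracket U b c r = enat z)" if "is_decomposition b k e a r" for e a r p y z
          using that is_decomposition_less[OF that] less u by (auto simp: is_decomposition_def)
        then show ?thesis by (simp cong: conj_cong)
      qed
      also have "... \<longleftrightarrow> bracket U b c k = enat x"
        using False by (intro bracket_step[OF b _ nz]) auto
      finally show ?thesis .
    qed
  qed
  then show "bracket U b c m = enat v" using T(2) by simp
qed

lemma next_base_less: "enat w < next_base C c \<longleftrightarrow> (\<forall>x. x \<in> C \<and> c < x \<longrightarrow> w < x)"
proof (cases "\<exists>b\<in>C. c < b")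
  case True
  then have 1: "(LEAST b. b \<in> C \<and> c < b) \<in> C \<and> c < (LEAST b. b \<in> C \<and> c < b)"
    by (metis (mono_tags, lifting) LeastI)
  have 2: "(LEAST b. b \<in> C \<and> c < b) \<le> x" if "x \<in> C" "c < x" for x
    using that by (intro Least_le) auto
  show ?thesis using True 1 2 by (auto simp: next_base_def intro: less_le_trans)
qed (auto simp: next_base_def)

definition good where
  "good B C n c \<longleftrightarrow> c \<in> C \<and>
     upgrade B C (n - 1) < bracket (upgrade B C) (base B n) c n \<and>
     bracket (upgrade B C) (base B n) c n < next_base C c"

lemma upgrade_eq: "upgrade B C n =
     (if n < Inf B \<or> n = 0 then enat n
      else if \<exists>c. good B C n c then bracket (upgrade B C) (base B n) (LEAST c. good B C n c) n else \<infinity>)"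
  by (subst upgrade.simps) (simp only: good_def[abs_def] Let_def)

lemma upgrade_nz: "0 < n \<Longrightarrow> upgrade B C n \<noteq> 0"
proof -
  assume n: "0 < n"
  show ?thesis
  proof (cases "\<exists>c. good B C n c")
    case True
    then have "good B C n (LEAST c. good B C n c)" by (metis LeastI)
    then have "bracket (upgrade B C) (base B n) (LEAST c. good B C n c) n \<noteq> 0"
      unfolding good_def by auto
    then show ?thesis using n True by (subst upgrade_eq) (simp add: zero_enat_def)
  qed (use n in \<open>subst upgrade_eq, auto simp: zero_enat_def\<close>)
qed

lemma base_ge2: "B \<noteq> {} \<Longrightarrow> 0 \<notin> B \<Longrightarrow> 1 \<notin> B \<Longrightarrow> 2 \<le> base B n"
proof -
  assume B: "B \<noteq> {}" "0 \<notin> B" "1 \<notin> B"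
  have "base B n \<in> B"
  proof (cases "\<exists>b\<in>B. b \<le> n")
    case True
    have "Max {b \<in> B. b \<le> n} \<in> {b \<in> B. b \<le> n}" using True by (intro Max_in) auto
    then show ?thesis using True by (auto simp: base_def)
  qed (use Inf_nat_def1[OF B(1)] in \<open>auto simp: base_def\<close>)
  then show ?thesis using B by (metis One_nat_def Suc_1 less_2_cases_iff not_less)
qed

lemma r_good_iff:
  assumes "B \<noteq> {}" "0 \<notin> B" "1 \<notin> B" "0 \<notin> C" "Inf B \<le> n"
    and u: "\<And>k x. k < n \<Longrightarrow> u k x \<longleftrightarrow> upgrade B C k = enat x"
  shows "r_good u (\<lambda>x. x \<in> C) (base B n) n c w \<longleftrightarrow>
    good B C n c \<and> bracket (upgrade B C) (base B n) c n = enat w"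
proof -
  have b: "2 \<le> base B n" "base B n \<le> n" using assms base_ge2 base_le by auto
  have eq: "c \<in> C \<and> r_bracket u (base B n) c n w \<longleftrightarrow>
     c \<in> C \<and> bracket (upgrade B C) (base B n) c n = enat w"
  proof (intro conj_cong refl)
    assume "c \<in> C"
    then have "c \<noteq> 0" using assms(4) by metis
    then show "r_bracket u (base B n) c n w \<longleftrightarrow> bracket (upgrade B C) (base B n) c n = enat w"
      using b by (intro r_bracket_iff) (auto simp: upgrade_nz u)
  qed
  obtain l where l: "n = Suc l" using b by (cases n) auto
  have "(\<exists>k t. n = k + 1 \<and> u k t \<and> t < w) \<longleftrightarrow> upgrade B C (n - 1) < enat w"
    using u[of l] l by (cases "upgrade B C l") auto
  then show ?thesis using eq unfolding r_good_def good_def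
    by (auto simp: next_base_less)
qed

lemma r_upgrade_iff:
  assumes B: "B \<noteq> {}" "0 \<notin> B" "1 \<notin> B" "0 \<notin> C"
  shows "r_upgrade (\<lambda>x. x \<in> B) (\<lambda>x. x \<in> C) n v \<longleftrightarrow> upgrade B C n = enat v"
proof -
  define step where "step T k x \<longleftrightarrow> (k < Inf B \<and> x = k) \<or>
       (Inf B \<le> k \<and> (\<exists>b c. r_base (\<lambda>x. x \<in> B) k b \<and> r_good (\<lambda>j y. pair j y \<in> T) (\<lambda>x. x \<in> C) b k c x \<and>
          (\<forall>c' y. c' < c \<longrightarrow> \<not> r_good (\<lambda>j y. pair j y \<in> T) (\<lambda>x. x \<in> C) b k c' y)))" for T k x
  have "Inf B \<noteq> 0" using Inf_nat_def1[OF B(1)] B(2) by metis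
  have step: "step T k x \<longleftrightarrow> upgrade B C k = enat x"
    if T: "\<And>j y. j < k \<Longrightarrow> pair j y \<in> T \<longleftrightarrow> upgrade B C j = enat y" for T k x
  proof (cases "k < Inf B")
    case True
    then show ?thesis by (subst upgrade_eq) (auto simp: step_def)
  next
    case False
    let ?g = "good B C k"
    let ?br = "\<lambda>c. bracket (upgrade B C) (base B k) c k"
    have fin: "?g c \<Longrightarrow> \<exists>y. ?br c = enat y" for c
      by (cases "?br c") (auto simp: good_def)
    have "step T k x \<longleftrightarrow> (\<exists>c. (?g c \<and> ?br c = enat x) \<and> (\<forall>c' y. c' < c \<longrightarrow> \<not> (?g c' \<and> ?br c' = enat y)))"
      using False r_good_iff[OF B, of k "\<lambda>j y. pair j y \<in> T"] T by (simp add: step_def r_base_iff[OF B(1)])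
    also have "... \<longleftrightarrow> (\<exists>c. ?g c \<and> ?br c = enat x \<and> (\<forall>c'<c. \<not> ?g c'))" using fin by blast
    also have "... \<longleftrightarrow> (\<exists>c. ?g c) \<and> ?br (LEAST c. ?g c) = enat x"
      by (smt (verit) LeastI_ex Least_equality not_less not_less_Least)
    also have "... \<longleftrightarrow> upgrade B C k = enat x"
      using False \<open>Inf B \<noteq> 0\<close> upgrade_eq[of B C k] by auto
    finally show ?thesis .
  qed
  have eq: "r_upgrade (\<lambda>x. x \<in> B) (\<lambda>x. x \<in> C) n v \<longleftrightarrow>
      (\<exists>T. (\<forall>k x. k \<le> n \<longrightarrow> (pair k x \<in> T \<longleftrightarrow> step T k x)) \<and> pair n v \<in> T)"
    unfolding r_upgrade_def r_min_iff[OF B(1)] step_def by blast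
  show ?thesis
  proof
    assume "r_upgrade (\<lambda>x. x \<in> B) (\<lambda>x. x \<in> C) n v"
    then obtain T where T: "\<And>k x. k \<le> n \<Longrightarrow> pair k x \<in> T \<longleftrightarrow> step T k x" "pair n v \<in> T"
      using eq by blast
    have "k \<le> n \<Longrightarrow> pair k x \<in> T \<longleftrightarrow> upgrade B C k = enat x" for k x
      by (induction k arbitrary: x rule: less_induct) (use T(1) step in simp)
    then show "upgrade B C n = enat v" using T(2) by simp
  next
    assume "upgrade B C n = enat v"
    then show "r_upgrade (\<lambda>x. x \<in> B) (\<lambda>x. x \<in> C) n v" unfolding eq
      by (intro exI[of _ "{pair k x | k x. upgrade B C k = enat x}"]) (auto simp: step)
  qed
qed

lemma bracket_pos:
  assumes "2 \<le> b" "c \<noteq> 0" "\<And>a. 0 < a \<Longrightarrow> a < b \<Longrightarrow> U a \<noteq> 0" "0 < m"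
  shows "bracket U b c m \<noteq> 0"
proof (cases "m < b")
  case True
  then show ?thesis using assms by (subst bracket.simps) auto
next
  case False
  then obtain e a r where d: "is_decomposition b m e a r"
    using is_decomposition_exists[of b m] assms by auto
  then have "U a \<noteq> 0" using assms(3) by (auto simp: is_decomposition_def)
  moreover have "epow c P \<noteq> 0" for P using assms(2) by (cases P) (auto simp: zero_enat_def)
  ultimately show ?thesis using bracket_ge[OF assms(1) _ d] False by simp
qed

lemma bracket_ge_c:
  assumes "2 \<le> b" "c \<noteq> 0" "\<And>a. 0 < a \<Longrightarrow> a < b \<Longrightarrow> U a \<noteq> 0" "b \<le> m"
  shows "enat c \<le> bracket U b c m"
proof (cases "bracket U b c m")
  case (enat x)
  obtain e a r where d: "is_decomposition b m e a r"
    using is_decomposition_exists[of b m] assms by auto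
  then have Ua: "U a \<noteq> 0" using assms(3) by (auto simp: is_decomposition_def)
  have "0 < e" using d assms(4) by (cases e) (auto simp: is_decomposition_def)
  then have "bracket U b c e \<noteq> 0" using bracket_pos[of b c U e] assms by simp
  moreover obtain p y z where p: "bracket U b c e = enat p" "U a = enat y" "x = c ^ p * y + z"
    using enat enat_step[of "U a" c, OF Ua assms(2)] unfolding bracket_ge[OF assms(1,4) d] by blast
  ultimately have "0 < p" "0 < y" using Ua by (auto simp: zero_enat_def)
  then have "c * 1 \<le> c ^ p * y" using assms(2) by (intro mult_mono self_le_power) auto
  then show ?thesis using p enat by simp
qed simp

lemma iter_enat:
  "iter (\<lambda>y. y = c) (\<lambda>_ y z. f y = enat z) j x \<longleftrightarrow>
    ((\<lambda>x. case x of enat d \<Rightarrow> f d | \<infinity> \<Rightarrow> \<infinity>) ^^ j) (enat c) = enat x"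
proof (induction j arbitrary: x)
  case (Suc j)
  then show ?case by (auto split: enat.splits)
qed auto

lemma iter_cong:
  assumes "\<And>y. P y \<Longrightarrow> Q y" "\<And>j y z. Q y \<Longrightarrow> R j y z \<Longrightarrow> Q z" "\<And>j y z. Q y \<Longrightarrow> R j y z \<longleftrightarrow> R' j y z"
  shows "iter P R j x \<longleftrightarrow> iter P R' j x"
proof -
  show ?thesis
  proof (induction j arbitrary: x)
    case (Suc j)
    have Q: "iter P R j y \<Longrightarrow> Q y" for j y
      by (induction j arbitrary: y) (auto dest: assms(1,2))
    then show ?case unfolding iter.simps using Suc.IH assms(3) by meson
  qed simp
qed

context
  fixes B :: "nat set" assumes B: "B \<noteq> {}" "0 \<notin> B" "1 \<notin> B"
begin

lemma r_new_iff:
  assumes Z: "finite Z" "Z \<noteq> {}" "\<forall>z\<in>Z. 2 \<le> z" and n: "Inf B < Suc l"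
  shows "r_new (\<lambda>x. x \<in> B) i (\<lambda>x. x \<in> Z) l x \<longleftrightarrow> x \<in> new_bases B i Z (Suc l)"
    and "new_bases B i Z (Suc l) \<subseteq> {2..}"
    and "finite (new_bases B i Z (Suc l))"
proof -
  have Z0: "0 \<notin> Z" using Z(3) by force
  let ?c = "Max Z"
  have c: "2 \<le> ?c" using Z by (meson Max_in)
  have br: "r_bracket (r_upgrade (\<lambda>x. x \<in> B) (\<lambda>x. x \<in> Z)) (base B k) d m w \<longleftrightarrow>
     bracket (upgrade B Z) (base B k) d m = enat w" if "d \<noteq> 0" for k d m w
    by (intro r_bracket_iff base_ge2 B that upgrade_nz r_upgrade_iff Z0)
  have d: "r_rec (\<lambda>y. y = ?c) (\<lambda>_ y z. r_bracket (r_upgrade (\<lambda>x. x \<in> B) (\<lambda>x. x \<in> Z)) (base B (Suc l)) y (Suc l) z) j x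
     \<longleftrightarrow> (d_step B Z (Suc l) ^^ j) (enat ?c) = enat x" for j x
  proof -
    have "iter (\<lambda>y. y = ?c) (\<lambda>_ y z. r_bracket (r_upgrade (\<lambda>x. x \<in> B) (\<lambda>x. x \<in> Z)) (base B (Suc l)) y (Suc l) z) j x
      \<longleftrightarrow> iter (\<lambda>y. y = ?c) (\<lambda>_ y z. bracket (upgrade B Z) (base B (Suc l)) y (Suc l) = enat z) j x"
    proof (rule iter_cong[where Q = "\<lambda>y. 2 \<le> y"])
      fix j y z assume "2 \<le> y" "r_bracket (r_upgrade (\<lambda>x. x \<in> B) (\<lambda>x. x \<in> Z)) (base B (Suc l)) y (Suc l) z"
      then have "bracket (upgrade B Z) (base B (Suc l)) y (Suc l) = enat z" using br by auto
      moreover have "enat y \<le> bracket (upgrade B Z) (base B (Suc l)) y (Suc l)"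
        using \<open>2 \<le> y\<close> n by (intro bracket_ge_c base_ge2 base_le B upgrade_nz) auto
      ultimately show "2 \<le> z" using \<open>2 \<le> y\<close> by simp
    qed (use br c in auto)
    then show ?thesis unfolding r_rec_iter iter_enat
      by (simp add: d_step_def[abs_def])
  qed
  have d2: "enat 2 \<le> (d_step B Z (Suc l) ^^ j) (enat ?c)" for j
  proof (induction j)
    case (Suc j)
    show ?case
    proof (cases "(d_step B Z (Suc l) ^^ j) (enat ?c)")
      case (enat y)
      then have "2 \<le> y" using Suc by simp
      then have "enat y \<le> bracket (upgrade B Z) (base B (Suc l)) y (Suc l)"
        using n by (intro bracket_ge_c base_ge2 base_le B upgrade_nz) auto
      moreover have "enat 2 \<le> enat y" using \<open>2 \<le> y\<close> by simp
      ultimately have "enat 2 \<le> bracket (upgrade B Z) (base B (Suc l)) y (Suc l)" by (rule order_trans[rotated])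
      then show ?thesis using enat by (simp add: d_step_def[of _ _ _ "enat y"])
      qed (simp add: d_step_def[of _ _ _ \<infinity>])
  qed (use c in simp)
  let ?w = "bracket (upgrade B Z) (base B l) ?c l"
  show "r_new (\<lambda>x. x \<in> B) i (\<lambda>x. x \<in> Z) l x \<longleftrightarrow> x \<in> new_bases B i Z (Suc l)"
  proof -
    have w: "(\<exists>b w a. b = base B l \<and> r_bracket (r_upgrade (\<lambda>x. x \<in> B) (\<lambda>x. x \<in> Z)) b ?c l w \<and>
          w < ?c * a \<and> (\<forall>a'. a' < a \<longrightarrow> \<not> w < ?c * a') \<and> x = ?c * a) \<longleftrightarrow>
       (\<exists>a. ?w < enat (?c * a) \<and> (\<forall>a'<a. \<not> ?w < enat (?c * a')) \<and> x = ?c * a)"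
      using br[of ?c] c by (cases ?w) auto
    have e: "(\<exists>b j. b = base B (Suc l) \<and> 1 \<le> j \<and> j \<le> i \<and>
          r_rec (\<lambda>y. y = ?c) (\<lambda>_ y z. r_bracket (r_upgrade (\<lambda>x. x \<in> B) (\<lambda>x. x \<in> Z)) b y (Suc l) z) j x)
       \<longleftrightarrow> (\<exists>j\<in>{1..i}. enat x = (d_step B Z (Suc l) ^^ j) (enat ?c))"
    proof -
      have "(enat x = D) = (D = enat x)" for D by (rule eq_commute)
      then show ?thesis unfolding simp_thms ex_simps d Bex_def atLeastAtMost_iff by blast
    qed
    show ?thesis
      unfolding r_new_def r_max_iff[OF Z(1,2)] r_base_iff[OF B(1)] r_critical_iff[OF B(1)]
        Suc_eq_plus1[symmetric] simp_thms ex_simps new_bases_def Let_def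
      using w e by auto
  qed
  have "2 \<le> x" if "enat x = (d_step B Z (Suc l) ^^ j) (enat ?c)" for x j
    using d2[of j] unfolding that[symmetric] by simp
  moreover have "2 \<le> ?c * a" if "?w < enat (?c * a)" for a
    using that c by (cases a) (auto simp: zero_enat_def[symmetric])
  ultimately show "new_bases B i Z (Suc l) \<subseteq> {2..}"
    unfolding new_bases_def Let_def by (auto split: if_splits)
  have "finite {?c * a | a. ?w < enat (?c * a) \<and> (\<forall>a'<a. \<not> ?w < enat (?c * a'))}"
  proof (rule finite_subset)
    show "{?c * a | a. ?w < enat (?c * a) \<and> (\<forall>a'<a. \<not> ?w < enat (?c * a'))} \<subseteq>
        {?c * (LEAST a. ?w < enat (?c * a))}"
      by (auto intro!: arg_cong[where f="\<lambda>a. ?c * a"] Least_equality[symmetric] simp: not_less[symmetric])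
  qed simp
  moreover have "finite {x. \<exists>j\<in>{1..i}. enat x = (d_step B Z (Suc l) ^^ j) (enat ?c)}"
  proof (rule finite_subset)
    show "{x. \<exists>j\<in>{1..i}. enat x = (d_step B Z (Suc l) ^^ j) (enat ?c)} \<subseteq>
       (\<lambda>j. the_enat ((d_step B Z (Suc l) ^^ j) (enat ?c))) ` {1..i}"
    proof
      fix x assume "x \<in> {x. \<exists>j\<in>{1..i}. enat x = (d_step B Z (Suc l) ^^ j) (enat ?c)}"
      then obtain j where j: "j \<in> {1..i}" "enat x = (d_step B Z (Suc l) ^^ j) (enat ?c)" by blast
      have "x = the_enat ((d_step B Z (Suc l) ^^ j) (enat ?c))" unfolding j(2)[symmetric] by simp
      then show "x \<in> (\<lambda>j. the_enat ((d_step B Z (Suc l) ^^ j) (enat ?c))) ` {1..i}"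
        using j(1) by (rule image_eqI)
    qed
  qed simp
  ultimately show "finite (new_bases B i Z (Suc l))"
    unfolding new_bases_def Let_def by auto
qed

lemma plus_stage_props:
  "finite (plus_stage B i n) \<and> plus_stage B i n \<noteq> {} \<and> (\<forall>z\<in>plus_stage B i n. 2 \<le> z)"
proof (induction n)
  case 0
  have "Inf B \<in> B" using Inf_nat_def1 B by blast
  then have "Inf B \<noteq> 0" using B by metis
  then show ?case by simp
next
  case (Suc n)
  have "Inf B \<in> B" using Inf_nat_def1 B by blast
  then have "Inf B \<noteq> 0" using B by metis
  then show ?case using Suc r_new_iff(2,3)[of "plus_stage B i n" n i]
    by (auto simp: not_le)
qed

lemma r_stage_iff: "r_stage (\<lambda>x. x \<in> B) i n v \<longleftrightarrow> v \<in> plus_stage B i n"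
proof -
  define step where "step T k x \<longleftrightarrow> (k + 1 \<le> Inf B \<and> x = Inf B + 1) \<or>
       (Inf B < k + 1 \<and> (pair k x \<in> T \<or> r_new (\<lambda>x. x \<in> B) i (\<lambda>y. pair k y \<in> T) k x))" for T k x
  have step: "step T k x \<longleftrightarrow> x \<in> plus_stage B i (Suc k)"
    if "\<And>y. pair k y \<in> T \<longleftrightarrow> y \<in> plus_stage B i k" for T k x
    using that r_new_iff(1)[of "plus_stage B i k" k i x] plus_stage_props[of i k]
    by (auto simp: step_def)
  have eq: "r_stage (\<lambda>x. x \<in> B) i n v \<longleftrightarrow> (\<exists>T. (\<forall>x. pair 0 x \<in> T \<longleftrightarrow> x = Inf B + 1) \<and>
     (\<forall>k x. k < n \<longrightarrow> (pair (k + 1) x \<in> T \<longleftrightarrow> step T k x)) \<and> pair n v \<in> T)"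
    unfolding r_stage_def r_min_iff[OF B(1)] step_def by blast
  show ?thesis
  proof
    assume "r_stage (\<lambda>x. x \<in> B) i n v"
    then obtain T where T: "\<And>x. pair 0 x \<in> T \<longleftrightarrow> x = Inf B + 1"
      "\<And>k x. k < n \<Longrightarrow> pair (k + 1) x \<in> T \<longleftrightarrow> step T k x" "pair n v \<in> T"
      using eq by blast
    have "k \<le> n \<Longrightarrow> pair k x \<in> T \<longleftrightarrow> x \<in> plus_stage B i k" for k x
    proof (induction k arbitrary: x)
      case 0 then show ?case using T(1) by simp
    next
      case (Suc k)
      then show ?case using T(2)[of k x] step[of k T x] by simp
    qed
    then show "v \<in> plus_stage B i n" using T(3) by simp
  next
    assume "v \<in> plus_stage B i n"
    then show "r_stage (\<lambda>x. x \<in> B) i n v" unfolding eq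
      by (intro exI[of _ "{pair k x | k x. x \<in> plus_stage B i k}"])
        (auto simp: step simp del: plus_stage.simps(2))
  qed
qed

lemma ouroboros_plus_props:
  "ouroboros_plus B i \<noteq> {}" "0 \<notin> ouroboros_plus B i" "1 \<notin> ouroboros_plus B i"
  using plus_stage_props[of i] by (auto simp: ouroboros_plus_def) force+

lemma r_plus_iff: "(\<exists>n. r_stage (\<lambda>x. x \<in> B) i n x) \<longleftrightarrow> x \<in> ouroboros_plus B i"
  by (auto simp: r_stage_iff ouroboros_plus_def)

end

lemma seq_props:
  assumes "B \<noteq> {}" "0 \<notin> B" "1 \<notin> B"
  shows "ouroboros_seq B i \<noteq> {} \<and> 0 \<notin> ouroboros_seq B i \<and> 1 \<notin> ouroboros_seq B i"
  by (induction i) (simp_all add: assms ouroboros_plus_props del: One_nat_def)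

lemma r_hierarchies_iff:
  assumes B: "B \<noteq> {}" "0 \<notin> B" "1 \<notin> B"
  shows "r_hierarchies B H \<longleftrightarrow> (\<forall>i x. pair i x \<in> H \<longleftrightarrow> x \<in> ouroboros_seq B i)"
proof
  assume r: "r_hierarchies B H"
  have "\<forall>x. pair i x \<in> H \<longleftrightarrow> x \<in> ouroboros_seq B i" for i
  proof (induction i)
    case 0 then show ?case using r by (simp add: r_hierarchies_def)
  next
    case (Suc i)
    then show ?case using r seq_props[OF B, of i] by (simp add: r_hierarchies_def r_plus_iff)
  qed
  then show "\<forall>i x. pair i x \<in> H \<longleftrightarrow> x \<in> ouroboros_seq B i" by blast
next
  assume "\<forall>i x. pair i x \<in> H \<longleftrightarrow> x \<in> ouroboros_seq B i"
  then show "r_hierarchies B H"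
    using seq_props[OF B] by (simp add: r_hierarchies_def r_plus_iff)
qed

lemma r_goodstein_iff:
  assumes B: "B \<noteq> {}" "0 \<notin> B" "1 \<notin> B"
  shows "r_goodstein B n i v \<longleftrightarrow> goodstein (ouroboros_seq B) n i = enat v"
proof -
  let ?S = "ouroboros_seq B"
  have it: "iter (\<lambda>x. x = n) (\<lambda>j y x. (0 < y \<and> upgrade (?S j) (?S (j + 1)) y = enat (x + 1)) \<or> (y = 0 \<and> x = 0)) i v
     \<longleftrightarrow> goodstein ?S n i = enat v" for v
  proof (induction i arbitrary: v)
    case (Suc i)
    show ?case
    proof (cases "goodstein ?S n i")
      case (enat m)
      have "upgrade (?S i) (?S (Suc i)) m \<noteq> 0" if "0 < m" using upgrade_nz that .
      then show ?thesis using Suc enat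
        by (cases "upgrade (?S i) (?S (Suc i)) m") (auto simp: zero_enat_def one_enat_def)
    qed (use Suc in auto)
  qed auto
  have up: "r_upgrade (\<lambda>z. pair j z \<in> H) (\<lambda>z. pair (j + 1) z \<in> H) y x \<longleftrightarrow>
      upgrade (?S j) (?S (j + 1)) y = enat x"
    if H: "\<And>i x. pair i x \<in> H \<longleftrightarrow> x \<in> ?S i" for H j y x
    unfolding H using seq_props[OF B, of j] seq_props[OF B, of "j + 1"] by (intro r_upgrade_iff) blast+
  have R: "(\<lambda>j y x. (0 < y \<and> r_upgrade (\<lambda>z. pair j z \<in> H) (\<lambda>z. pair (j + 1) z \<in> H) y (x + 1)) \<or> (y = 0 \<and> x = 0))
     = (\<lambda>j y x. (0 < y \<and> upgrade (?S j) (?S (j + 1)) y = enat (x + 1)) \<or> (y = 0 \<and> x = 0))"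
    if H: "\<forall>i x. pair i x \<in> H \<longleftrightarrow> x \<in> ?S i" for H
  proof (intro ext)
    fix j y x :: nat
    have "r_upgrade (\<lambda>z. pair j z \<in> H) (\<lambda>z. pair (j + 1) z \<in> H) y (x + 1) \<longleftrightarrow>
      upgrade (?S j) (?S (j + 1)) y = enat (x + 1)" by (rule up) (use H in blast)
    then show "(0 < y \<and> r_upgrade (\<lambda>z. pair j z \<in> H) (\<lambda>z. pair (j + 1) z \<in> H) y (x + 1)) \<or> (y = 0 \<and> x = 0)
     \<longleftrightarrow> (0 < y \<and> upgrade (?S j) (?S (j + 1)) y = enat (x + 1)) \<or> (y = 0 \<and> x = 0)"
      by (simp only:)
  qed
  show ?thesis unfolding r_goodstein_def r_hierarchies_iff[OF B] r_rec_iter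
  proof
    assume "goodstein ?S n i = enat v"
    moreover obtain H where H: "\<forall>i x. pair i x \<in> H \<longleftrightarrow> x \<in> ?S i"
      by (rule that[of "{pair i x | i x. x \<in> ?S i}"]) auto
    ultimately show "\<exists>H. (\<forall>i x. pair i x \<in> H \<longleftrightarrow> x \<in> ?S i) \<and> iter (\<lambda>x. x = n)
       (\<lambda>j y x. (0 < y \<and> r_upgrade (\<lambda>z. pair j z \<in> H) (\<lambda>z. pair (j + 1) z \<in> H) y (x + 1)) \<or> (y = 0 \<and> x = 0)) i v"
      unfolding it[symmetric] by (intro exI[of _ H] conjI H) (unfold R[OF H])
  next
    assume "\<exists>H. (\<forall>i x. pair i x \<in> H \<longleftrightarrow> x \<in> ?S i) \<and> iter (\<lambda>x. x = n)
       (\<lambda>j y x. (0 < y \<and> r_upgrade (\<lambda>z. pair j z \<in> H) (\<lambda>z. pair (j + 1) z \<in> H) y (x + 1)) \<or> (y = 0 \<and> x = 0)) i v"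
    then obtain H where H: "\<forall>i x. pair i x \<in> H \<longleftrightarrow> x \<in> ?S i" and "iter (\<lambda>x. x = n)
       (\<lambda>j y x. (0 < y \<and> r_upgrade (\<lambda>z. pair j z \<in> H) (\<lambda>z. pair (j + 1) z \<in> H) y (x + 1)) \<or> (y = 0 \<and> x = 0)) i v"
      by blast
    then show "goodstein ?S n i = enat v" unfolding R[OF H] it by blast
  qed
qed

text \<open>The sentence says what it should in the standard model.\<close>

theorem goodstein_terminates_adequate:
  assumes "base_hierarchy (\<sigma> 0)"
  shows "sat \<rho> \<sigma> goodstein_terminates \<longleftrightarrow> (\<forall>n. \<exists>i. goodstein (ouroboros_seq (\<sigma> 0)) n i = 0)"
proof -
  let ?X = "\<lambda>s. s - Suc 0"
  let ?G = "(0, Suc 0, \<rho>, \<sigma>)"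
  have "case_nat (\<sigma> 0) (\<lambda>k. \<sigma> (Suc k)) = \<sigma>" by (rule ext) (simp split: nat.split)
  then have X: "setd ?G ?X (\<sigma> 0)"
    using setd_new[of 0 0 \<rho> "\<sigma> 0" "\<lambda>k. \<sigma> (Suc k)"] by (simp only:)
  have "fmd ?G (\<^bold>\<forall>n. \<^bold>\<exists>i. f_goodstein ?X n i \<^bold>0) (\<forall>n. \<exists>i. r_goodstein (\<sigma> 0) n i 0)"
  proof (rule fmd_all', rule fmd_ex')
    fix H a x K b y
    assume "?G \<sqsubseteq> H" "tmd H a x" "H \<sqsubseteq> K" "tmd K b y"
    then show "fmd K (f_goodstein ?X a b \<^bold>0) (r_goodstein (\<sigma> 0) x y 0)"
      by (intro den_goodstein setd_mono[OF X] tmd_ops) (auto intro: ctx_trans tmd_mono)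
  qed
  then have "sat \<rho> \<sigma> goodstein_terminates \<longleftrightarrow> (\<forall>n. \<exists>i. r_goodstein (\<sigma> 0) n i 0)"
    using ctx_refl[of ?G] unfolding fmd_def holds_def goodstein_terminates_def Let_def by blast
  also have "... \<longleftrightarrow> (\<forall>n. \<exists>i. goodstein (ouroboros_seq (\<sigma> 0)) n i = 0)"
    using assms by (simp add: base_hierarchy_def r_goodstein_iff zero_enat_def)
  finally show ?thesis .
qed

end

theory Submission
  imports Defs "HOL-Library.Nat_Bijection" "HOL-Library.Countable"
begin

text \<open>The proof is model-theoretic. If a ratio \<open>S\<^sub>B(b) / b\<close> exceeds \<open>3\<close> or \<open>min B\<close>, or is \<open>3\<close> infinitely
  often, then the iterated successors of the base hierarchy contain bases with more and more gaps
  (large ratios) below them.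
  A Goodstein sequence that has reached a base with \<open>k\<close> gaps below it stays positive for a time
  given by the \<open>k\<close>-th function of a hierarchy of Ackermann type; hence the length of the sequences
  dominates all primitive recursive functions.

  In an ultrapower of the natural numbers, consider a start value whose sequence is longer than
  \<open>ack \<omega> \<tau>\<close>, \<open>\<omega>\<close> infinite. By diagonalisation, a cut \<open>I\<close> with \<open>\<tau> < I < ack \<omega> \<tau>\<close> is constructed that is
  semiregular for a family of internal sets closed under the operations used to define the
  sequence; together with these sets it is a model of \<open>RCA\<^sub>0\<close>, in which true \<open>\<Pi>\<^sup>0\<^sub>1\<close> formulas remain
  true. The formulas that define the sequence are absolute between the cut and the ultrapower.
  So in the model the sequence does not terminate.\<close>

section \<open>The operator \<open>\<langle>b\<rightarrow>c\<rangle>\<close> for finite digits\<close>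

text \<open>The threshold \<open>\<tau> k\<close> from which start values survive
  \<open>ack k t\<close> steps may be noncomputable as well: the cut only has to begin above
  \<open>\<tau>\<close>. In coordinate \<open>t\<close> the start value
  \<open>\<tau> t + \<tau> t\<close> lives for \<open>ack t (\<tau> t)\<close> steps, and each of
  the \<open>t\<close> available diagonalisation steps lowers the level of \<open>ack\<close> by
  one. The formulas express recursion by the existence of a set \<open>T\<close> of pairs, and the
  model determines such a \<open>T\<close> only for arguments in \<open>I\<close>. Absoluteness
  therefore has two halves: the true graph is a set of the model and satisfies the clauses, and
  every other solution agrees with it on \<open>I\<close>, since a first disagreement would exist by
  semiregularity. A quantifier inside a clause is absolute once its witnesses have a bound in
  \<open>I\<close>; such bounds come from closure of the cut under powers, brackets and maxima of
  stages.\<close>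

definition nbr :: "(nat \<Rightarrow> nat) \<Rightarrow> nat \<Rightarrow> nat \<Rightarrow> nat \<Rightarrow> nat" where
  "nbr u b c m = the_enat (bracket (\<lambda>k. enat (u k)) b c m)"

text \<open>Only arguments below \<open>b\<close> are ever passed to \<open>U\<close>, so finiteness
  there is enough. Upgrades into different stages that agree below \<open>b\<close> thus share one
  function \<open>nbr\<close>.\<close>

lemma bracket_eq_nbr:
  assumes "2 \<le> b" "\<And>k. k < b \<Longrightarrow> U k = enat (u k)"
  shows "bracket U b c m = enat (nbr u b c m)"
proof -
  have "bracket U b c m = bracket (\<lambda>k. enat (u k)) b c m"
    using assms by (intro bracket_cong) auto
  moreover have "\<exists>x. bracket (\<lambda>k. enat (u k)) b c m = enat x"
  proof (induction m rule: less_induct)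
    case (less m)
    show ?case
    proof (cases "m < b")
      case True then show ?thesis by (subst bracket.simps) auto
    next
      case False
      then obtain e a r where d: "is_decomposition b m e a r"
        using is_decomposition_exists[of b m] assms(1) by auto
      then show ?thesis
        using less[of e] less[of r] is_decomposition_less[OF d] False
        by (auto simp: bracket_ge[OF assms(1) _ d])
    qed
  qed
  ultimately show ?thesis by (auto simp: nbr_def)
qed

lemma nbr_small: "m < b \<Longrightarrow> nbr u b c m = u m"
  by (simp add: nbr_def bracket.simps)

lemma nbr_decomposition:
  assumes "2 \<le> b" "is_decomposition b m e a r" "b \<le> m"
  shows "nbr u b c m = c ^ nbr u b c e * u a + nbr u b c r"
proof -
  have eq: "bracket (\<lambda>k. enat (u k)) b c k = enat (nbr u b c k)" for k
    using assms(1) by (intro bracket_eq_nbr) auto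
  have "enat (nbr u b c m) = enat (c ^ nbr u b c e * u a + nbr u b c r)"
    using bracket_ge[OF assms(1,3,2), of "\<lambda>k. enat (u k)" c] by (simp add: eq)
  then show ?thesis by simp
qed

lemma obtain_decomposition:
  assumes "2 \<le> b" "b \<le> m"
  obtains e a r where "is_decomposition b m e a r" "0 < e" "e < m" "r < m" "0 < a" "a < b"
    "r < b ^ e" "m = b ^ e * a + r"
proof -
  obtain e a r where d: "is_decomposition b m e a r"
    using is_decomposition_exists[of b m] assms by auto
  then have "0 < e" using assms by (cases e) (auto simp: is_decomposition_def)
  then show ?thesis using d is_decomposition_less[OF d] that by (auto simp: is_decomposition_def)
qed

lemma nbr_self: "2 \<le> b \<Longrightarrow> u 0 = 0 \<Longrightarrow> u (Suc 0) = 1 \<Longrightarrow> nbr u b c b = c"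
  using nbr_decomposition[of b b 1 1 0 u c]
  by (simp add: is_decomposition_def nbr_small)

text \<open>Here \<open>u\<close> stands for an upgrade operator, restricted to the digits less than \<open>b\<close>.\<close>

locale digits =
  fixes u :: "nat \<Rightarrow> nat" and b :: nat
  assumes b: "2 \<le> b" and u0: "u 0 = 0" and u1: "u (Suc 0) = 1"
    and mono: "\<And>j k. j < k \<Longrightarrow> k < b \<Longrightarrow> u j < u k"
begin

lemma u_pos: "0 < a \<Longrightarrow> a < b \<Longrightarrow> 0 < u a"
  using mono[of 0 a] u0 by simp

lemma nbr_0: "nbr u b c 0 = 0" using b u0 by (simp add: nbr_small)

text \<open>A number \<open>r \<ge> b\<close> below \<open>b ^ e\<close> has a leading exponent
  \<open>f < e\<close>. If \<open>f\<close> has the image \<open>f'\<close>, then the image of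
  \<open>r\<close> is below \<open>c ^ f' * (u g + 1)\<close>, which is at most
  \<open>c ^ (f' + 1)\<close>. Monotonicity up to \<open>e\<close> is a premise because the lemma
  serves inside the induction that proves monotonicity.\<close>

lemma nbr_remainder:
  assumes c: "\<And>k. k < b \<Longrightarrow> u k < c"
    and IH: "\<And>j k. j < k \<Longrightarrow> k \<le> e \<Longrightarrow> nbr u b c j < nbr u b c k" and "0 < e" "r < b ^ e"
  shows "nbr u b c r < c ^ nbr u b c e"
  using assms(2-4)
proof (induction r arbitrary: e rule: less_induct)
  case (less r)
  have "0 < c" using c[of 0] b by simp
  have e: "0 < nbr u b c e" using less.prems(1)[of 0 e] less.prems(2) by simp
  show ?case
  proof (cases "r < b")
    case True
    then have "nbr u b c r < c" using c by (simp add: nbr_small)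
    also have "c \<le> c ^ nbr u b c e" using e \<open>0 < c\<close> by (intro self_le_power) auto
    finally show ?thesis .
  next
    case False
    then obtain f g s where d: "is_decomposition b r f g s" "0 < f" "f < r" "s < r" "0 < g" "g < b"
      "s < b ^ f" "r = b ^ f * g + s" using obtain_decomposition[OF b, of r] by auto
    have "b ^ f \<le> r" using d(1) by (simp add: is_decomposition_def)
    then have "b ^ f < b ^ e" using less.prems(3) by simp
    then have "f < e" using b by simp
    then have fe: "nbr u b c f < nbr u b c e" using less.prems(1) by simp
    have "nbr u b c s < c ^ nbr u b c f"
      using less.IH[of s f] d \<open>f < e\<close> less.prems(1) by simp
    then have "nbr u b c r < c ^ nbr u b c f * u g + c ^ nbr u b c f"
      using nbr_decomposition[OF b d(1)] False by simp
    also have "... = c ^ nbr u b c f * Suc (u g)" by simp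
    also have "... \<le> c ^ nbr u b c f * c" using c[OF d(6)] by (intro mult_left_mono) auto
    also have "... = c ^ Suc (nbr u b c f)" by simp
    also have "... \<le> c ^ nbr u b c e" using fe \<open>0 < c\<close> by (intro power_increasing) auto
    finally show ?thesis .
  qed
qed

text \<open>Leading exponents are compared first, then leading digits, then remainders. The
  condition \<open>u k < c\<close> makes the image of every digit a legitimate digit in base
  \<open>c\<close>, so that the lower part cannot make up for a smaller exponent or digit.\<close>

lemma nbr_strict_mono:
  assumes c: "\<And>k. k < b \<Longrightarrow> u k < c" and "n < m"
  shows "nbr u b c n < nbr u b c m"
  using assms(2)
proof (induction m arbitrary: n rule: less_induct)
  case (less m)
  have "0 < c" using c[of 0] b by simp
  show ?case
  proof (cases "m < b")
    case True
    then show ?thesis using less.prems mono by (simp add: nbr_small)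
  next
    case False
    then obtain e a r where d: "is_decomposition b m e a r" "0 < e" "e < m" "r < m" "0 < a" "a < b"
      "r < b ^ e" "m = b ^ e * a + r" using obtain_decomposition[OF b, of m] by auto
    have eqm: "nbr u b c m = c ^ nbr u b c e * u a + nbr u b c r"
      using nbr_decomposition[OF b d(1)] False by simp
    have a: "0 < u a" using u_pos d by simp
    then have em: "c ^ nbr u b c e \<le> nbr u b c m" unfolding eqm by (simp add: trans_le_add1)
    have IH: "nbr u b c j < nbr u b c k" if "j < k" "k < m" for j k
      using less.IH that by simp
    have e: "0 < nbr u b c e" using IH[of 0 e] d by (simp add: nbr_0)
    show ?thesis
    proof (cases "n < b")
      case True
      then have "nbr u b c n < c" using c by (simp add: nbr_small)
      also have "c \<le> c ^ nbr u b c e" using e \<open>0 < c\<close> by (intro self_le_power) auto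
      finally show ?thesis using em by simp
    next
      case False
      then obtain e' a' r' where d': "is_decomposition b n e' a' r'" "0 < e'" "e' < n" "r' < n" "0 < a'" "a' < b"
        "r' < b ^ e'" "n = b ^ e' * a' + r'" using obtain_decomposition[OF b, of n] by auto
      have eqn: "nbr u b c n = c ^ nbr u b c e' * u a' + nbr u b c r'"
        using nbr_decomposition[OF b d'(1)] False by simp
      have "nbr u b c r' < c ^ nbr u b c e'"
        by (rule nbr_remainder[OF c]) (use IH d' less.prems in auto)
      then have n: "nbr u b c n < c ^ nbr u b c e' * Suc (u a')" unfolding eqn by simp
      have "b ^ e' < b ^ (e + 1)"
        using d(1) d'(1) less.prems by (auto simp: is_decomposition_def)
      then have "e' < e + 1" by (rule power_less_imp_less_exp[rotated]) (use b in simp)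
      then have "e' \<le> e" by simp
      then consider "e' < e" | "e' = e" "a' < a" | "e' = e" "a' = a" | "e' = e" "a < a'" by linarith
      then show ?thesis
      proof cases
        case 1
        have "c ^ nbr u b c e' * Suc (u a') \<le> c ^ nbr u b c e' * c"
          using c[OF d'(6)] by (intro mult_left_mono) auto
        also have "... = c ^ Suc (nbr u b c e')" by simp
        also have "... \<le> c ^ nbr u b c e" using IH[OF 1 d(3)] \<open>0 < c\<close> by (intro power_increasing) auto
        finally show ?thesis using n em by simp
      next
        case 2
        have "c ^ nbr u b c e' * Suc (u a') \<le> c ^ nbr u b c e * u a"
          using mono[OF 2(2) d(6)] 2(1) by (intro mult_mono) auto
        then show ?thesis using n unfolding eqm by simp
      next
        case 3
        then have "r' < r" using d(8) d'(8) less.prems by simp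
        then show ?thesis using IH[of r' r] d 3 unfolding eqm eqn by simp
      next
        case 4
        then have "b ^ e * Suc a \<le> b ^ e * a'" by (intro mult_left_mono) auto
        then show ?thesis using 4 d(7,8) d'(8) less.prems by simp
      qed
    qed
  qed
qed

lemma nbr_ge_c:
  assumes "0 < c" "b \<le> m"
  shows "c \<le> nbr u b c m"
proof -
  have "enat c \<le> bracket (\<lambda>k. enat (u k)) b c m"
    using assms b u_pos by (intro bracket_ge_c) (auto simp: zero_enat_def)
  then show ?thesis using bracket_eq_nbr[OF b, of "\<lambda>k. enat (u k)" u c m] by simp
qed

text \<open>Since \<open>b\<close> divides \<open>m\<close> and \<open>b ^ e\<close> with
  \<open>e > 0\<close>, it divides the remainder too, and the leading term of the image carries a
  positive power of \<open>c\<close>.\<close>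

lemma nbr_dvd:
  assumes c: "\<And>k. k < b \<Longrightarrow> u k < c" and "b dvd m"
  shows "c dvd nbr u b c m"
  using assms(2)
proof (induction m rule: less_induct)
  case (less m)
  show ?case
  proof (cases "m < b")
    case True
    then have "m = 0" using less.prems by (meson dvd_imp_le leD neq0_conv)
    then show ?thesis by (simp add: nbr_0)
  next
    case False
    then obtain e a r where d: "is_decomposition b m e a r" "0 < e" "e < m" "r < m" "m = b ^ e * a + r"
      using obtain_decomposition[OF b, of m] by (metis not_le)
    have "b dvd r"
      using less.prems d by (metis dvd_add_right_iff dvd_mult2 dvd_power)
    moreover have "0 < nbr u b c e" using nbr_strict_mono[OF c d(2)] by (simp add: nbr_0)
    ultimately show ?thesis
      using less.IH[OF d(4)] nbr_decomposition[OF b d(1)] False by (simp add: dvd_power)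
  qed
qed

text \<open>The images of the multiples of \<open>b\<close> are multiples of \<open>c\<close> in
  strictly increasing order, so each of them is at least \<open>c\<close> above the preceding one.
  The lower bounds for ratios of new bases in \<open>dseq_step\<close> and
  \<open>gap_successor\<close> come from here.\<close>

lemma nbr_mult:
  assumes c: "\<And>k. k < b \<Longrightarrow> u k < c"
  shows "a * c \<le> nbr u b c (a * b)"
proof (induction a)
  case (Suc a)
  obtain k where k: "nbr u b c (a * b) = c * k" using nbr_dvd[OF c, of "a * b"] by auto
  obtain l where l: "nbr u b c (Suc a * b) = c * l" using nbr_dvd[OF c, of "Suc a * b"] by auto
  have "c * k < c * l" using nbr_strict_mono[OF c, of "a * b" "Suc a * b"] k l b by simp
  then have "Suc k \<le> l" by simp
  then have "c * Suc k \<le> c * l" by (intro mult_left_mono) auto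
  moreover have "Suc a * c \<le> c * Suc k" using Suc k by simp
  ultimately show ?case unfolding l by (rule order_trans[rotated])
qed simp

text \<open>As \<open>b\<close> divides \<open>y\<close>, the units place of \<open>y\<close> is
  empty; it receives the digit \<open>r\<close>, which is upgraded on its own.\<close>

lemma nbr_add:
  assumes "b dvd y" "b \<le> y" "r < b"
  shows "nbr u b c (y + r) = nbr u b c y + u r"
  using assms(1,2)
proof (induction y rule: less_induct)
  case (less y)
  obtain e a s where d: "is_decomposition b y e a s" "0 < e" "e < y" "s < y" "0 < a" "a < b" "s < b ^ e"
     "y = b ^ e * a + s"
    using obtain_decomposition[OF b less.prems(2)] by auto
  have be: "b dvd b ^ e" using d by (simp add: dvd_power)
  have s: "b dvd s" using less.prems d be by (metis dvd_add_right_iff dvd_mult2)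
  \<comment> \<open>Both \<open>s\<close> and \<open>b ^ e\<close> are multiples of
    \<open>b\<close>, so the space between them has room for any digit \<open>r < b\<close>.\<close>
  have "s + b \<le> b ^ e"
  proof -
    obtain k l where kl: "s = b * k" "b ^ e = b * l" using s be by (auto elim!: dvdE)
    then have "Suc k \<le> l" using d(7) by simp
    then have "b * Suc k \<le> b * l" by (intro mult_left_mono) auto
    then show ?thesis using kl by simp
  qed
  then have sr: "s + r < b ^ e" using assms(3) by simp
  have "is_decomposition b (y + r) e a (s + r)"
  proof -
    have "b ^ e * Suc a \<le> b ^ e * b" using d(6) by (intro mult_left_mono) auto
    then have "b ^ e * a + (s + r) < b ^ e * b" using sr by simp
    then show ?thesis using d sr by (simp add: is_decomposition_def mult.commute)
  qed
  then have "nbr u b c (y + r) = c ^ nbr u b c e * u a + nbr u b c (s + r)"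
    using less.prems by (intro nbr_decomposition[OF b]) auto
  moreover have "nbr u b c (s + r) = nbr u b c s + u r"
  proof (cases "s = 0")
    case True then show ?thesis using assms(3) by (simp add: nbr_small nbr_0)
  next
    case False
    then show ?thesis using less.IH[OF d(4) s] s by (simp add: dvd_imp_le)
  qed
  ultimately have "nbr u b c (y + r) = c ^ nbr u b c e * u a + nbr u b c s + u r" by simp
  also have "c ^ nbr u b c e * u a + nbr u b c s = nbr u b c y"
    by (rule nbr_decomposition[OF b d(1) less.prems(2), symmetric])
  finally show ?case .
qed

end

section \<open>The successor of a base hierarchy\<close>

lemma hierarchy_props:
  assumes "base_hierarchy B"
  shows "B \<noteq> {}" "0 \<notin> B" "1 \<notin> B" "Inf B \<in> B" "2 \<le> Inf B" "\<And>b. b \<in> B \<Longrightarrow> 2 \<le> b" "\<And>b. b \<in> B \<Longrightarrow> Inf B \<le> b"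
proof -
  show B: "B \<noteq> {}" "0 \<notin> B" "1 \<notin> B" using assms by (auto simp: base_hierarchy_def)
  show "Inf B \<in> B" using B(1) by (rule Inf_nat_def1)
  show 2: "2 \<le> b" if "b \<in> B" for b
  proof -
    have "b \<noteq> 0" "b \<noteq> 1" using that B by metis+
    then show ?thesis by simp
  qed
  then show "2 \<le> Inf B" using \<open>Inf B \<in> B\<close> by simp
  show "Inf B \<le> b" if "b \<in> B" for b using that by (intro cInf_lower) auto
qed

lemma base_in:
  assumes "B \<noteq> {}" shows "base B n \<in> B"
proof (cases "\<exists>b\<in>B. b \<le> n")
  case True
  have "Max {b \<in> B. b \<le> n} \<in> {b \<in> B. b \<le> n}" using True by (intro Max_in) auto
  then show ?thesis using True by (auto simp: base_def)
qed (use Inf_nat_def1[OF assms] in \<open>auto simp: base_def\<close>)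

lemma base_eqI:
  assumes "b \<in> B" "b \<le> n" "\<And>x. x \<in> B \<Longrightarrow> x \<le> n \<Longrightarrow> x \<le> b"
  shows "base B n = b"
proof -
  have "Max {b \<in> B. b \<le> n} = b" using assms by (intro Max_eqI) auto
  then show ?thesis using assms by (auto simp: base_def)
qed

lemma base_greatest:
  assumes "x \<in> B" "x \<le> n" shows "x \<le> base B n"
proof -
  have "x \<le> Max {b \<in> B. b \<le> n}" using assms by (intro Max_ge) auto
  then show ?thesis using assms by (auto simp: base_def)
qed

lemma base_self: "n \<in> B \<Longrightarrow> base B n = n" by (intro base_eqI) auto

lemma base_Suc:
  assumes "Inf B \<le> l" "Suc l \<notin> B" "B \<noteq> {}" shows "base B (Suc l) = base B l"
proof (rule base_eqI)
  show "base B l \<in> B" using assms by (intro base_in)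
  show "base B l \<le> Suc l" using base_le[OF assms(1)] by simp
  show "x \<le> base B l" if "x \<in> B" "x \<le> Suc l" for x
    using base_greatest[OF that(1), of l] that assms by (cases "x = Suc l") auto
qed

lemma next_baseI:
  assumes "s \<in> B" "b < s" "\<And>x. x \<in> B \<Longrightarrow> b < x \<Longrightarrow> s \<le> x" shows "next_base B b = enat s"
proof -
  have "(LEAST x. x \<in> B \<and> b < x) = s" using assms by (intro Least_equality) auto
  then show ?thesis using assms by (auto simp: next_base_def)
qed

lemma obtain_next_base:
  assumes "x \<in> B" "b < x"
  obtains s where "s \<in> B" "b < s" "s \<le> x" "next_base B b = enat s"
proof -
  define s where "s = (LEAST y. y \<in> B \<and> b < y)"
  have 1: "s \<in> B \<and> b < s" unfolding s_def by (rule LeastI[of _ x]) (use assms in auto)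
  have 2: "s \<le> y" if "y \<in> B" "b < y" for y unfolding s_def by (rule Least_le) (use that in auto)
  show thesis using that[of s] 1 2 assms next_baseI[of s B b] by blast
qed

text \<open>The definition relates neighbouring bases only. The chain is followed downwards through
  the base \<open>c\<close> immediately below \<open>x\<close>.\<close>

lemma hierarchy_dvd:
  assumes "base_hierarchy B" "b \<in> B" "x \<in> B" "b \<le> x"
  shows "b dvd x"
  using assms(3,4)
proof (induction "x - b" arbitrary: x rule: less_induct)
  case less
  show ?case
  proof (cases "b = x")
    case False
    define c where "c = base B (x - 1)"
    have c: "c \<in> B" unfolding c_def using base_in hierarchy_props(1)[OF assms(1)] .
    have 1: "Inf B \<le> x - 1" using hierarchy_props(7)[OF assms(1,2)] False less.prems by simp
    have "c < x" using base_le[OF 1] False less.prems unfolding c_def by simp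
    have "b \<le> c" unfolding c_def using False less.prems assms(2) by (intro base_greatest) auto
    then have "b dvd c" using less.hyps[of c] c \<open>c < x\<close> less.prems by simp
    moreover have "next_base B c = enat x"
    proof (rule next_baseI)
      fix y assume "y \<in> B" "c < y"
      then show "x \<le> y" using base_greatest[of y B "x - 1"] unfolding c_def by linarith
    qed (use less.prems \<open>c < x\<close> in auto)
    then have "c dvd x" using assms(1) c unfolding base_hierarchy_def by blast
    ultimately show ?thesis by (rule dvd_trans)
  qed simp
qed

lemma chain_hierarchy:
  assumes "B \<noteq> {}" "0 \<notin> B" "1 \<notin> B" "\<And>x y. x \<in> B \<Longrightarrow> y \<in> B \<Longrightarrow> x \<le> y \<Longrightarrow> x dvd y"
  shows "base_hierarchy B"
  unfolding base_hierarchy_def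
proof (intro conjI ballI allI impI assms(1-3))
  fix b s assume b: "b \<in> B" "next_base B b = enat s"
  then obtain x where "x \<in> B" "b < x" by (auto simp: next_base_def split: if_splits)
  from obtain_next_base[OF this] b(2) have "s \<in> B \<and> b < s" by (metis enat.inject)
  then show "b dvd s" using assms(4) b(1) by simp
qed

locale successor =
  fixes B :: "nat set" and i :: nat
  assumes B: "base_hierarchy B"
begin

lemmas Bp = hierarchy_props[OF B]

abbreviation "m \<equiv> Inf B"
abbreviation "st n \<equiv> plus_stage B i n"
definition "maxb n = Max (st n)"
text \<open>Only stage \<open>n\<close> is consulted. All later bases turn out to exceed the value,
  so this is also the upgrade into the whole successor hierarchy; see
  \<open>upgrade_successor\<close>.\<close>

definition "val n = the_enat (upgrade B (st n) n)"
definition "dseq n j = ((\<lambda>x. nbr val (base B n) x n) ^^ j) (maxb (n - 1))"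
abbreviation "C \<equiv> ouroboros_plus B i"

lemma st: "finite (st n)" "st n \<noteq> {}" "z \<in> st n \<Longrightarrow> 2 \<le> z"
  using plus_stage_props[OF Bp(1-3), of i n] by auto

lemma st_fin: "finite (st n)" by (rule st(1))

lemma maxb: "maxb n \<in> st n" "z \<in> st n \<Longrightarrow> z \<le> maxb n" "2 \<le> maxb n"
proof -
  show "maxb n \<in> st n" unfolding maxb_def by (rule Max_in[OF st(1,2)])
  then show "2 \<le> maxb n" by (rule st(3))
  show "z \<le> maxb n" if "z \<in> st n" unfolding maxb_def by (rule Max_ge[OF st(1) that])
qed

lemma st_mono: "k \<le> n \<Longrightarrow> st k \<subseteq> st n"
proof (induction n)
  case (Suc n)
  show ?case
  proof (cases "k = Suc n")
    case False
    then have "st k \<subseteq> st n" using Suc by simp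
    moreover have "st n = {m + 1}" if "n \<le> m" using that by (induction n) auto
    ultimately show ?thesis by auto
  qed simp
qed simp

lemma maxb_mono: "k \<le> n \<Longrightarrow> maxb k \<le> maxb n"
  using st_mono[of k n] maxb by blast

lemma st_init: "n \<le> m \<Longrightarrow> st n = {m + 1}" by (induction n) auto
lemma maxb_init: "n \<le> m \<Longrightarrow> maxb n = m + 1" by (simp add: st_init maxb_def)

lemma st_Suc: "m < Suc n \<Longrightarrow> st (Suc n) = st n \<union> new_bases B i (st n) (Suc n)" by simp

declare plus_stage.simps(2) [simp del]

lemma val_small: "n < m \<Longrightarrow> val n = n"
  by (simp add: val_def upgrade.simps)

lemma val_01: "val 0 = 0" "val (Suc 0) = 1"
  using Bp(5) by (simp_all add: val_small)

text \<open>The clauses are proved in one strong induction because they need each other: evaluating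
  the upgrade of \<open>n\<close> requires that the upgrades below \<open>n\<close> do not depend on
  later bases, that they increase, and that the digits lie below the candidate base. The last point
  comes from the clause for \<open>n \<in> B\<close>. The first clause allows any \<open>Z\<close>
  that adds larger numbers, which covers the later stages as well as their union. The final three
  clauses record which bases are new.\<close>

definition inv where
  "inv n \<longleftrightarrow>
    (\<forall>Z. st n \<subseteq> Z \<longrightarrow> (\<forall>z\<in>Z - st n. val n < z) \<longrightarrow> upgrade B Z n = enat (val n)) \<and>
    (0 < n \<longrightarrow> val (n - 1) < val n \<and> (\<forall>z\<in>st n - st (n - 1). val (n - 1) < z)) \<and>
    (m \<le> n \<longrightarrow> val n = nbr val (base B n) (maxb n) n) \<and>
    (n \<in> B \<longrightarrow> val (n - 1) < maxb n) \<and>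
    (m < n \<longrightarrow> n \<in> B \<longrightarrow> (\<exists>a. st n = insert (maxb (n - 1) * a) (st (n - 1)))) \<and>
    (m < n \<longrightarrow> n \<notin> B \<longrightarrow> \<not> critical B n \<longrightarrow> st n = st (n - 1)) \<and>
    (m < n \<longrightarrow> n \<notin> B \<longrightarrow> critical B n \<longrightarrow> st n = st (n - 1) \<union> dseq n ` {1..i} \<and>
       (\<forall>j. 0 < dseq n j \<and> (n div base B n) * dseq n j \<le> dseq n (Suc j) \<and>
          2 \<le> n div base B n \<and> dseq n j dvd dseq n (Suc j)))"

lemma inv_upgrade:
  assumes "inv n" "st n \<subseteq> Z" "\<And>z. z \<in> Z - st n \<Longrightarrow> val n < z"
  shows "upgrade B Z n = enat (val n)"
proof -
  have "\<forall>Z. st n \<subseteq> Z \<longrightarrow> (\<forall>z\<in>Z - st n. val n < z) \<longrightarrow> upgrade B Z n = enat (val n)"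
    using assms(1) unfolding inv_def by (rule conjunct1)
  then show ?thesis using assms(2,3) by blast
qed

lemma inv_step: "inv n \<Longrightarrow> 0 < n \<Longrightarrow> val (n - 1) < val n"
  and inv_new: "inv n \<Longrightarrow> 0 < n \<Longrightarrow> z \<in> st n - st (n - 1) \<Longrightarrow> val (n - 1) < z"
  unfolding inv_def by (drule conjunct2, drule conjunct1, blast)+

lemma inv_val: "inv n \<Longrightarrow> m \<le> n \<Longrightarrow> val n = nbr val (base B n) (maxb n) n"
  unfolding inv_def by (drule conjunct2, drule conjunct2, drule conjunct1) (rule mp)

lemma inv_member: "inv n \<Longrightarrow> n \<in> B \<Longrightarrow> val (n - 1) < maxb n"
  unfolding inv_def by (drule conjunct2, drule conjunct2, drule conjunct2, drule conjunct1) (rule mp)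

lemma digits_val:
  assumes "\<And>k. k < b \<Longrightarrow> 0 < k \<Longrightarrow> val (k - 1) < val k" "2 \<le> b"
  shows "digits val b"
proof
  show "val j < val k" if "j < k" "k < b" for j k
    using that
  proof (induction k)
    case (Suc k)
    have "val k < val (Suc k)" using assms(1)[of "Suc k"] Suc.prems by simp
    then show ?case using Suc by (cases "j = k") auto
  qed simp
qed (use assms val_01 in auto)

lemma inv_below:
  assumes "\<And>k. k \<le> l \<Longrightarrow> inv k"
  shows "j < k \<Longrightarrow> k \<le> l \<Longrightarrow> val j < val k"
    and "k \<le> n \<Longrightarrow> n \<le> l \<Longrightarrow> z \<in> st n - st k \<Longrightarrow> val k < z"
proof -
  show 1: "val j < val k" if "j < k" "k \<le> l" for j k
    using that
  proof (induction k)
    case (Suc k)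
    have "val k < val (Suc k)" using inv_step[of "Suc k"] assms[of "Suc k"] Suc.prems by simp
    then show ?case using Suc by (cases "j = k") auto
  qed simp
  show "val k < z" if "k \<le> n" "n \<le> l" "z \<in> st n - st k" for z k n
    using that
  proof (induction n)
    case (Suc n)
    show ?case
    proof (cases "z \<in> st n")
      case True
      moreover have "k \<noteq> Suc n" using Suc.prems by auto
      ultimately show ?thesis using Suc by simp
    next
      case False
      have "k \<noteq> Suc n" using Suc.prems by auto
      then have "val k \<le> val n" using 1[of k n] Suc.prems by (cases "k = n") auto
      moreover have "val n < z" using inv_new[of "Suc n" z] assms[of "Suc n"] Suc.prems False by simp
      ultimately show ?thesis by simp
    qed
  qed simp
qed

text \<open>The least suitable base is the greatest one of the stage. A smaller base
  \<open>c'\<close> that passes the lower bound is followed by a base \<open>z\<close> not above its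
  own value and so violates the upper bound. Bases outside the stage exceed \<open>V\<close>, hence
  also \<open>maxb (Suc l)\<close>.\<close>

lemma upgrade_select:
  assumes inv: "\<And>k. k \<le> l \<Longrightarrow> inv k" and m: "m \<le> Suc l"
    and new: "\<And>z. z \<in> st (Suc l) - st l \<Longrightarrow> val l < z"
    and V: "V = nbr val (base B (Suc l)) (maxb (Suc l)) (Suc l)" "val l < V"
    and least: "\<And>c'. c' \<in> st (Suc l) \<Longrightarrow> c' < maxb (Suc l) \<Longrightarrow> val l < nbr val (base B (Suc l)) c' (Suc l) \<Longrightarrow>
      \<exists>z\<in>st (Suc l). c' < z \<and> z \<le> nbr val (base B (Suc l)) c' (Suc l)"
    and maxV: "maxb (Suc l) \<le> V"
  shows "val (Suc l) = V" "st (Suc l) \<subseteq> Z \<Longrightarrow> (\<And>z. z \<in> Z - st (Suc l) \<Longrightarrow> V < z) \<Longrightarrow> upgrade B Z (Suc l) = enat V"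
proof -
  let ?b = "base B (Suc l)"
  have b: "2 \<le> ?b" "?b \<le> Suc l" using base_ge2[OF Bp(1-3)] base_le[OF m] by auto
  show *: "upgrade B Z (Suc l) = enat V" if Z: "st (Suc l) \<subseteq> Z" "\<And>z. z \<in> Z - st (Suc l) \<Longrightarrow> V < z" for Z
  proof -
    have U: "upgrade B Z k = enat (val k)" if "k \<le> l" for k
    proof -
      have "val k < z" if z: "z \<in> Z - st k" for z
      proof -
        have "val k \<le> val l" using inv_below(1)[of l k l] inv \<open>k \<le> l\<close> by (cases "k = l") auto
        moreover have "z \<in> st (Suc l) \<Longrightarrow> z \<in> st l \<or> val l < z" using new[of z] by blast
        moreover have "z \<in> st (Suc l) \<or> V < z" using Z(2)[of z] that by blast
        ultimately have "z \<in> st l \<or> val k < z" using V(2) by fastforce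
        then consider "z \<in> st l - st k" | "val k < z" using z by blast
        then show ?thesis using inv_below(2)[of l k l z] inv \<open>k \<le> l\<close> by cases auto
      qed
      moreover have "st k \<subseteq> Z" using st_mono[of k "Suc l"] that Z(1) by auto
      ultimately show ?thesis using inv_upgrade[OF inv[OF that]] by blast
    qed
    have br: "bracket (upgrade B Z) ?b c (Suc l) = enat (nbr val ?b c (Suc l))" for c
      using U b by (intro bracket_eq_nbr) auto
    have good: "good B Z (Suc l) c \<longleftrightarrow> c \<in> Z \<and> val l < nbr val ?b c (Suc l) \<and>
       (\<forall>z. z \<in> Z \<and> c < z \<longrightarrow> nbr val ?b c (Suc l) < z)" for c
      unfolding good_def br by (simp add: U next_base_less)
    have gt: "good B Z (Suc l) (maxb (Suc l))"
      unfolding good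
    proof (intro conjI allI impI)
      show "maxb (Suc l) \<in> Z" using maxb(1) Z by blast
      show "nbr val ?b (maxb (Suc l)) (Suc l) < z" if "z \<in> Z \<and> maxb (Suc l) < z" for z
        using that Z(2)[of z] maxb(2)[of z "Suc l"] V(1) by fastforce
    qed (use V in simp)
    have "(LEAST c. good B Z (Suc l) c) = maxb (Suc l)"
    proof (rule Least_equality[where P = "good B Z (Suc l)", OF gt], rule ccontr)
      fix c assume c: "good B Z (Suc l) c" "\<not> maxb (Suc l) \<le> c"
      then have "c \<in> st (Suc l)" using Z(2)[of c] maxV unfolding good by fastforce
      then show False using least[of c] c Z(1) unfolding good by (meson leD not_le subsetD)
    qed
    then show ?thesis using gt m by (subst upgrade_eq) (auto simp: br V)
  qed
  show "val (Suc l) = V" using *[of "st (Suc l)"] by (simp add: val_def)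
qed

text \<open>As long as the digits stay below the current iterate, \<open>nbr_mult\<close> multiplies
  it by at least the quotient of \<open>n\<close> by its base. The iterates never fall below
  \<open>maxb (n - 1)\<close>, so the digits do stay below.\<close>

lemma dseq_step:
  assumes "digits val (base B n)" "\<And>k. k < base B n \<Longrightarrow> val k < maxb (n - 1)" "base B n dvd n" "2 * base B n \<le> n"
  shows "0 < dseq n j" "(n div base B n) * dseq n j \<le> dseq n (Suc j)" "dseq n j dvd dseq n (Suc j)"
    "maxb (n - 1) \<le> dseq n j"
proof -
  interpret digits val "base B n" by fact
  have S: "dseq n (Suc j) = nbr val (base B n) (dseq n j) n" for j by (simp add: dseq_def)
  have step: "maxb (n - 1) \<le> dseq n (Suc j) \<and> (n div base B n) * dseq n j \<le> dseq n (Suc j) \<and> dseq n j dvd dseq n (Suc j)"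
    if "maxb (n - 1) \<le> dseq n j" for j
  proof -
    have c: "val k < dseq n j" if "k < base B n" for k
      using assms(2)[OF that] \<open>maxb (n - 1) \<le> dseq n j\<close> by simp
    have 1: "(n div base B n) * dseq n j \<le> dseq n (Suc j)"
      using nbr_mult[OF c, of "n div base B n"] assms(3) by (simp add: S)
    have "base B n div base B n \<le> n div base B n" using assms(4) by (intro div_le_mono) simp
    then have "1 \<le> n div base B n" using b by simp
    then have "1 * dseq n j \<le> (n div base B n) * dseq n j" by (intro mult_right_mono) auto
    then show ?thesis using 1 nbr_dvd[OF c assms(3)] that unfolding S by linarith
  qed
  show ge: "maxb (n - 1) \<le> dseq n j" for j by (induction j) (use step in \<open>simp_all add: dseq_def\<close>)
  show "(n div base B n) * dseq n j \<le> dseq n (Suc j)" "dseq n j dvd dseq n (Suc j)" using step[OF ge] by auto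
  show "0 < dseq n j" using ge[of j] maxb(3)[of "n - 1"] by simp
qed

lemma inv: "inv n"
proof (induction n rule: less_induct)
  case (less n)
  have "m < n \<Longrightarrow> \<exists>l. n = Suc l \<and> m \<le> l" by (cases n) auto
  then consider "n < m" | "n = m" | l where "n = Suc l" "m \<le> l" by (meson linorder_neqE_nat)
  then show ?case
  proof cases
    case 1
    then show ?thesis using Bp(7)[of n] unfolding inv_def
      by (auto simp: upgrade.simps[of B _ n] val_small st_init)
  next
    \<comment> \<open>At the minimum the stage is a singleton, and the bracket sends the base itself
      to the new base. With \<open>m = Suc l\<close> the value is therefore
      \<open>m + 1\<close>.\<close>
    case 2
    define l where "l = m - 1"
    have l: "m = Suc l" using Bp(5) by (simp add: l_def)
    have inv: "inv k" if "k \<le> l" for k using less[of k] that 2 l by simp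
    have vl: "val l = l" using l by (simp add: val_small)
    have bm: "base B m = m" using Bp(4) by (rule base_self)
    have V: "nbr val m c m = c" for c using Bp(5) val_01 by (intro nbr_self)
    have st: "st (Suc l) = {Suc (Suc l)}" "st l = {Suc (Suc l)}" using l st_init[of l] st_init[of m] by auto
    have mx: "maxb (Suc l) = Suc (Suc l)" using l maxb_init[of m] by simp
    have V': "Suc (Suc l) = nbr val (base B (Suc l)) (maxb (Suc l)) (Suc l)"
      using bm V[of "Suc (Suc l)"] unfolding l[symmetric] mx[folded l] by simp
    have "val l < Suc (Suc l)" "m \<le> Suc l" using vl l by simp_all
    note sel = upgrade_select[OF inv this(2) _ V' this(1)]
    have *: "val (Suc l) = Suc (Suc l)" by (rule sel) (simp_all add: st mx)
    have **: "upgrade B Z (Suc l) = enat (Suc (Suc l))"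
      if "st (Suc l) \<subseteq> Z" "\<And>z. z \<in> Z - st (Suc l) \<Longrightarrow> Suc (Suc l) < z" for Z
      by (rule sel(2)) (use that in \<open>simp_all add: st mx\<close>)
    have "n = Suc l" "\<not> m < Suc l" "Suc l - 1 = l" using 2 l by simp_all
    then show ?thesis using * ** V'[symmetric] vl st mx unfolding inv_def by simp
  next
    case (3 l)
    note n = 3
    have inv: "inv k" if "k \<le> l" for k using less[of k] that n by simp
    have step: "val (k - 1) < val k" if "k \<le> l" "0 < k" for k using inv_step[OF inv[OF that(1)] that(2)] .
    have dig: "digits val b" if "2 \<le> b" "b \<le> Suc l" for b
      using that step by (intro digits_val) auto
    let ?bs = "base B (Suc l)" and ?b0 = "base B l"
    have b: "2 \<le> ?bs" "?bs \<le> Suc l" "2 \<le> ?b0" "?b0 \<le> l"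
      using base_ge2[OF Bp(1-3)] base_le[of B "Suc l"] base_le[of B l] 3 by auto
    interpret b0: digits val ?b0 using dig b by simp
    \<comment> \<open>The base \<open>?b0\<close> belongs to \<open>B\<close>, so the clause for
      members applies there, and maxima of stages only grow afterwards.\<close>
    have c0: "val k < maxb l" if "k < ?b0" for k
    proof -
      have "k = ?b0 - 1 \<or> k < ?b0 - 1" using that by linarith
      then have "val k \<le> val (?b0 - 1)" using inv_below(1)[of l k "?b0 - 1"] inv b(4)
        by (meson diff_le_self le_trans less_imp_le order.refl)
      also have "... < maxb ?b0" by (rule inv_member[OF inv[OF b(4)] base_in[OF Bp(1)]])
      also have "... \<le> maxb l" using b by (intro maxb_mono)
      finally show ?thesis .
    qed
    have vl: "val l = nbr val ?b0 (maxb l) l" using inv_val[OF inv[of l]] n by simp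
    have ge: "maxb l \<le> val l" unfolding vl using maxb(3)[of l] b by (intro b0.nbr_ge_c) auto
    have U: "upgrade B (st l) k = enat (val k)" if "k \<le> l" for k
    proof -
      have "\<forall>z\<in>st l - st k. val k < z" using inv_below(2)[of l k l] inv that by blast
      then show ?thesis using inv_upgrade[OF inv[OF that] st_mono[OF that]] by blast
    qed
    have br0: "bracket (upgrade B (st l)) ?b0 c k = enat (nbr val ?b0 c k)" for c k
      using U b by (intro bracket_eq_nbr) auto
    have br: "bracket (upgrade B (st l)) ?bs c k = enat (nbr val ?bs c k)" for c k
      using U b by (intro bracket_eq_nbr) auto
    have main: ?thesis
      if V: "val l < nbr val ?bs (maxb n) n"
        and new: "\<And>z. z \<in> st n - st l \<Longrightarrow> val l < z"
        and least: "\<And>c'. c' \<in> st n \<Longrightarrow> c' < maxb n \<Longrightarrow> val l < nbr val ?bs c' n \<Longrightarrow>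
          \<exists>z\<in>st n. c' < z \<and> z \<le> nbr val ?bs c' n"
        and maxV: "maxb n \<le> nbr val ?bs (maxb n) n"
        and member: "n \<in> B \<Longrightarrow> val l < maxb n"
        and sh: "n \<in> B \<Longrightarrow> \<exists>a. st n = insert (maxb l * a) (st l)"
          "n \<notin> B \<Longrightarrow> \<not> critical B n \<Longrightarrow> st n = st l"
          "n \<notin> B \<Longrightarrow> critical B n \<Longrightarrow> st n = st l \<union> dseq n ` {1..i} \<and>
           (\<forall>j. 0 < dseq n j \<and> (n div ?bs) * dseq n j \<le> dseq n (Suc j) \<and>
          2 \<le> n div ?bs \<and> dseq n j dvd dseq n (Suc j))"
    proof -
      let ?V = "nbr val ?bs (maxb n) n"
      note facts = V[unfolded n(1)] new[unfolded n(1)] least[unfolded n(1)] maxV[unfolded n(1)]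
      have m: "m \<le> Suc l" using n(2) by simp
      have "val n = ?V" unfolding n(1)
        by (rule upgrade_select(1)[of l]) (fact inv m facts refl)+
      moreover have "upgrade B Z n = enat ?V"
        if Z: "st n \<subseteq> Z" "\<And>z. z \<in> Z - st n \<Longrightarrow> ?V < z" for Z
        unfolding n(1) by (rule upgrade_select(2)[of l]) (fact inv m facts refl Z[unfolded n(1)])+
      ultimately show ?thesis using n V new member sh unfolding inv_def by simp
    qed
    \<comment> \<open>A base below \<open>maxb l\<close> violates the upper bound: its value would
      have to exceed \<open>val l\<close>, which is already at least \<open>maxb l\<close>.\<close>
    have low: "\<exists>z\<in>st n. c' < z \<and> z \<le> nbr val ?bs c' n"
      if "c' < maxb l" "val l < nbr val ?bs c' n" for c'
      using that ge maxb(1)[of l] st_mono[of l n] n by (intro bexI[of _ "maxb l"]) auto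
    consider "n \<in> B" | "n \<notin> B" "\<not> critical B n" | "n \<notin> B" "critical B n" by blast
    then show ?thesis
    proof cases
      case 1
      \<comment> \<open>For a member \<open>n\<close> the bracket at base \<open>n\<close> returns
        the candidate itself. The old bases are at most \<open>val l\<close> and fail the lower
        bound; the least multiple of \<open>?c\<close> above \<open>val l\<close> passes.\<close>
      let ?c = "maxb l"
      define a where "a = val l div ?c + 1"
      have c: "0 < ?c" using maxb(3)[of l] by simp
      have less: "val l < ?c * a' \<longleftrightarrow> a \<le> a'" for a'
        using c unfolding a_def
        by (simp add: Suc_le_eq div_less_iff_less_mult mult.commute)
      have "{?c * x | x. val l < ?c * x \<and> (\<forall>x'<x. \<not> val l < ?c * x')} = {?c * a}"
        unfolding less by (auto simp: not_le) (metis le_neq_implies_less less_irrefl)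
      then have "new_bases B i (st l) n = {?c * a}"
        using 1 n(1) br0 vl by (simp add: new_bases_def maxb_def)
      then have st: "st n = insert (?c * a) (st l)" using n st_Suc by simp
      have gt: "val l < ?c * a" using less by simp
      have mx: "maxb n = ?c * a"
      proof -
        have "y \<le> ?c * a" if "y \<in> st l" for y using maxb(2)[OF that] gt ge by linarith
        then have "Max (insert (?c * a) (st l)) = ?c * a" using st_fin[of l] by (intro Max_eqI) auto
        then show ?thesis by (simp add: maxb_def[of n] st)
      qed
      have V: "nbr val n c n = c" for c using b n base_self[OF 1] val_01 by (intro nbr_self) auto
      have bn: "?bs = n" using 1 n base_self by simp
      show ?thesis
      proof (rule main)
        fix c' assume "c' \<in> st n" "c' < maxb n" "val l < nbr val ?bs c' n"
        then show "\<exists>z\<in>st n. c' < z \<and> z \<le> nbr val ?bs c' n"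
          using maxb(2)[of c' l] ge unfolding bn V st mx by auto
      qed (use gt mx st V bn 1 in auto)
    next
      case 2
      have bb: "?bs = ?b0" using base_Suc[of B l] 2 n Bp(1) by simp
      have "new_bases B i (st l) n = {}" using 2 by (simp add: new_bases_def)
      then have st: "st n = st l" using n st_Suc by simp
      then have mx: "maxb n = maxb l" by (simp add: maxb_def)
      have V: "val l < nbr val ?bs (maxb n) n"
        unfolding bb mx using vl n b0.nbr_strict_mono[OF c0, of l n] by simp
      show ?thesis
        by (rule main) (use V mx low 2 ge st in auto)
    next
      case 3
      \<comment> \<open>The value of the candidate \<open>?d j\<close> is \<open>?d (Suc j)\<close>.
        For \<open>j < i\<close> this is again a base, so the upper bound fails; it holds first for
        \<open>j = i\<close>.\<close>
      let ?d = "dseq n"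
      have bb: "?bs = ?b0" using base_Suc[of B l] 3 n Bp(1) by simp
      interpret digits val ?bs using b0.digits_axioms bb by simp
      have bn: "base B n = ?bs" and nl: "n - 1 = l" using n by simp_all
      have dvd: "?bs dvd n" using 3 by (simp add: critical_def bn)
      \<comment> \<open>As \<open>n\<close> is not in \<open>B\<close>, it is a multiple of its base
        without being equal to it.\<close>
      have two: "2 \<le> n div ?bs"
      proof -
        obtain q where q: "n = ?bs * q" using dvd by auto
        have "?bs \<in> B" using base_in[OF Bp(1)] .
        then have "?bs \<noteq> n" using 3(1) by metis
        then have "q \<noteq> 1" using q by simp
        moreover have "q \<noteq> 0" using q n(1) by (metis mult_0_right nat.distinct(1))
        moreover have "n div ?bs = q" unfolding q using b(1) by simp
        ultimately show ?thesis by simp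
      qed
      then have "2 * ?bs \<le> n div ?bs * ?bs" by (rule mult_right_mono) simp
      then have two': "2 * ?bs \<le> n" using dvd by simp
      note d = dseq_step[of n, unfolded bn nl, OF digits_axioms c0[folded bb] dvd two']
      have S: "?d (Suc j) = nbr val ?bs (?d j) n" for j by (simp add: dseq_def bn)
      have d0: "?d 0 = maxb l" unfolding dseq_def nl by simp
      have "(d_step B (st l) n ^^ j) (enat (maxb l)) = enat (?d j)" for j
      proof (induction j)
        case (Suc j)
        have "(d_step B (st l) n ^^ Suc j) (enat (maxb l)) = d_step B (st l) n (enat (?d j))"
          by (simp only: funpow.simps o_apply Suc.IH)
        also have "... = enat (?d (Suc j))" by (simp add: d_step_def bn br S)
        finally show ?case .
      qed (simp add: d0)
      then have "new_bases B i (st l) n = ?d ` {1..i}"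
        using 3 by (auto simp: new_bases_def maxb_def)
      then have st: "st n = st l \<union> ?d ` {1..i}" using n st_Suc by simp
      have inc: "?d j < ?d (Suc j)" for j
      proof -
        have "2 * ?d j \<le> ?d (Suc j)" using d(2)[of j] two by (meson le_trans mult_le_mono1)
        then show ?thesis using d(1)[of j] by simp
      qed
      then have sm: "?d j < ?d k" if "j < k" for j k using lift_Suc_mono_less[of ?d] that by simp
      then have mo: "?d j \<le> ?d k" if "j \<le> k" for j k using that by (cases "j = k") (auto intro: less_imp_le)
      have mx: "maxb n = ?d i"
        unfolding maxb_def
      proof (rule Max_eqI)
        show "?d i \<in> st n" using d0 maxb(1)[of l] unfolding st by (cases i) auto
        show "y \<le> ?d i" if y: "y \<in> st n" for y
        proof -
          consider "y \<in> st l" | j where "j \<le> i" "y = ?d j" using y unfolding st by auto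
          then show ?thesis
          proof cases
            case 1
            then have "y \<le> ?d 0" using maxb(2)[of y l] d0 by simp
            also have "... \<le> ?d i" by (rule mo) simp
            finally show ?thesis .
          qed (simp add: mo)
        qed
      qed (rule st_fin)
      have V: "nbr val ?bs (maxb n) n = ?d (Suc i)" using mx S by simp
      have d1: "val l < ?d 1"
      proof -
        have "nbr val ?bs (maxb l) l < nbr val ?bs (maxb l) n"
          by (rule nbr_strict_mono[OF c0[folded bb]]) (use n in simp_all)
        moreover have "?d 1 = nbr val ?bs (maxb l) n" using S[of 0] d0 by simp
        ultimately show ?thesis using vl bb by simp
      qed
      show ?thesis
      proof (rule main)
        show "val l < nbr val ?bs (maxb n) n" unfolding V using d1 mo[of 1 "Suc i"] by simp
        show "maxb n \<le> nbr val ?bs (maxb n) n" using mo[of i "Suc i"] V mx by simp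
        show "val l < z" if "z \<in> st n - st l" for z
        proof -
          obtain j where "1 \<le> j" "z = ?d j" using \<open>z \<in> st n - st l\<close> unfolding st by auto
          then show ?thesis using d1 mo[of 1 j] by simp
        qed
        show "\<exists>z\<in>st n. c' < z \<and> z \<le> nbr val ?bs c' n"
          if c': "c' \<in> st n" "c' < maxb n" "val l < nbr val ?bs c' n" for c'
        proof -
          have "c' < maxb l \<or> (\<exists>j\<le>i. c' = ?d j)"
          proof (cases "c' \<in> st l")
            case True
            then show ?thesis using maxb(2)[of c' l] d0 by (metis le_neq_implies_less zero_le)
          next
            case False
            then show ?thesis using c'(1) unfolding st by auto
          qed
          then show ?thesis
          proof
            assume "\<exists>j\<le>i. c' = ?d j"
            then obtain j where j: "j \<le> i" "c' = ?d j" by blast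
            then have "j < i" using c'(2) mx by (cases "j = i") auto
            then have "?d (Suc j) \<in> st n" unfolding st by auto
            then show ?thesis using j(2) inc[of j] S[of j] by auto
          qed (use low c'(3) in blast)
        qed
        show "st n = st l \<union> ?d ` {1..i} \<and> (\<forall>j. 0 < ?d j \<and> (n div ?bs) * ?d j \<le> ?d (Suc j) \<and>
          2 \<le> n div ?bs \<and> ?d j dvd ?d (Suc j))"
          using st d two by blast
      qed (use 3 in simp_all)
    qed
  qed
qed

lemma val_strict_mono: "j < k \<Longrightarrow> val j < val k"
  using inv_below(1)[of k j k] inv by simp

lemma val_mono: "j \<le> k \<Longrightarrow> val j \<le> val k"
  using val_strict_mono[of j k] by (cases "j = k") auto

lemma val_ge: "n \<le> val n"
proof (induction n)
  case (Suc n)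
  then show ?case using val_strict_mono[of n "Suc n"] by simp
qed simp

lemma successor_new: assumes "z \<in> C" "z \<notin> st n" shows "val n < z"
proof -
  obtain k where k: "z \<in> st k" using assms(1) by (auto simp: ouroboros_plus_def)
  then have "n \<le> k" using assms(2) st_mono[of k n] by (cases "k \<le> n") auto
  then show ?thesis using inv_below(2)[of k n k z] inv k assms(2) by simp
qed

lemma st_subset: "st n \<subseteq> C" by (auto simp: ouroboros_plus_def)

lemma upgrade_successor: "upgrade B C n = enat (val n)"
  by (rule inv_upgrade[OF inv st_subset]) (use successor_new in blast)

lemma upgrade_stage: assumes "k \<le> n" shows "upgrade B (st n) k = enat (val k)"
  by (rule inv_upgrade[OF inv st_mono[OF assms]]) (use inv_below(2)[of n k n] inv assms in blast)

lemma val_eq: "m \<le> n \<Longrightarrow> val n = nbr val (base B n) (maxb n) n"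
  using inv_val[OF inv] .

lemma base_bounds: "2 \<le> base B n" "m \<le> n \<Longrightarrow> base B n \<le> n" "base B n \<in> B"
  using base_ge2[OF Bp(1-3)] base_le base_in[OF Bp(1)] by auto

lemma digits: "2 \<le> b \<Longrightarrow> digits val b"
  by (intro digits_val val_strict_mono) auto

lemma val_less_maxb:
  assumes "m \<le> n" "k < base B n" shows "val k < maxb n"
proof -
  have "val k \<le> val (base B n - 1)" using assms by (intro val_mono) simp
  also have "... < maxb (base B n)" by (rule inv_member[OF inv base_bounds(3)])
  also have "... \<le> maxb n" using base_bounds(2)[OF assms(1)] by (rule maxb_mono)
  finally show ?thesis .
qed

lemma maxb_le_val: assumes "m \<le> n" shows "maxb n \<le> val n"
proof -
  interpret digits val "base B n" by (rule digits[OF base_bounds(1)])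
  show ?thesis unfolding val_eq[OF assms]
    using maxb(3)[of n] base_bounds(2)[OF assms] by (intro nbr_ge_c) auto
qed

lemma val_member: assumes "n \<in> B" shows "val n = maxb n"
proof -
  have "m \<le> n" "2 \<le> n" using Bp(6,7)[OF assms] by auto
  then show ?thesis using val_eq[of n] base_self[OF assms] nbr_self[of n val] val_01 by simp
qed

lemma val_in_successor: "n \<in> B \<Longrightarrow> val n \<in> C"
  using val_member maxb(1) st_subset by auto

lemma inv_shape:
  assumes "m < n"
  shows "n \<in> B \<Longrightarrow> \<exists>a. st n = insert (maxb (n - 1) * a) (st (n - 1))"
    "n \<notin> B \<Longrightarrow> \<not> critical B n \<Longrightarrow> st n = st (n - 1)"
    "n \<notin> B \<Longrightarrow> critical B n \<Longrightarrow> st n = st (n - 1) \<union> dseq n ` {1..i} \<and>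
       (\<forall>j. 0 < dseq n j \<and> (n div base B n) * dseq n j \<le> dseq n (Suc j) \<and>
          2 \<le> n div base B n \<and> dseq n j dvd dseq n (Suc j))"
proof -
  note i = inv[of n, unfolded inv_def, THEN conjunct2, THEN conjunct2, THEN conjunct2, THEN conjunct2]
  show "n \<in> B \<Longrightarrow> \<exists>a. st n = insert (maxb (n - 1) * a) (st (n - 1))"
    using i[THEN conjunct1] assms by (elim impE) assumption+
  show "n \<notin> B \<Longrightarrow> \<not> critical B n \<Longrightarrow> st n = st (n - 1)"
    using i[THEN conjunct2, THEN conjunct1] assms by (elim impE) assumption+
  show "n \<notin> B \<Longrightarrow> critical B n \<Longrightarrow> st n = st (n - 1) \<union> dseq n ` {1..i} \<and>
       (\<forall>j. 0 < dseq n j \<and> (n div base B n) * dseq n j \<le> dseq n (Suc j) \<and>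
          2 \<le> n div base B n \<and> dseq n j dvd dseq n (Suc j))"
    using i[THEN conjunct2, THEN conjunct2] assms by (elim impE) assumption+
qed

lemma stage_cases:
  assumes "m < n"
  obtains (member) a where "n \<in> B" "st n = insert (maxb (n - 1) * a) (st (n - 1))"
  | (noncritical) "n \<notin> B" "\<not> critical B n" "st n = st (n - 1)"
  | (critical) "n \<notin> B" "critical B n" "st n = st (n - 1) \<union> dseq n ` {1..i}"
proof (cases "n \<in> B")
  case True
  then show thesis using inv_shape(1)[OF assms] member by auto
next
  case False
  then show thesis using inv_shape(2,3)[OF assms] noncritical critical by (cases "critical B n") simp_all
qed

lemma dseq_props:
  assumes "m < n" "n \<notin> B" "critical B n"
  shows "0 < dseq n j" "(n div base B n) * dseq n j \<le> dseq n (Suc j)" "2 \<le> n div base B n"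
    "dseq n j dvd dseq n (Suc j)" "st n = st (n - 1) \<union> dseq n ` {1..i}"
  using inv_shape(3)[OF assms] by simp_all

lemma dseq_0: "dseq n 0 = maxb (n - 1)" by (simp add: dseq_def)

lemma dseq_less:
  assumes "m < n" "n \<notin> B" "critical B n" "j < k" shows "dseq n j < dseq n k"
proof (rule lift_Suc_mono_less[OF _ assms(4)])
  fix j
  have "2 * dseq n j \<le> (n div base B n) * dseq n j"
    using dseq_props(3)[OF assms(1-3)] by (rule mult_le_mono1)
  also have "... \<le> dseq n (Suc j)" by (rule dseq_props(2)[OF assms(1-3)])
  finally show "dseq n j < dseq n (Suc j)" using dseq_props(1)[OF assms(1-3), of j] by simp
qed

lemma dseq_le:
  assumes "m < n" "n \<notin> B" "critical B n" "j \<le> k" shows "dseq n j \<le> dseq n k"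
  using dseq_less[OF assms(1-3), of j k] assms(4) by (cases "j = k") auto

lemma dseq_dvd:
  assumes "m < n" "n \<notin> B" "critical B n" "j \<le> k" shows "dseq n j dvd dseq n k"
  using assms(4)
proof (induction k)
  case (Suc k)
  show ?case
  proof (cases "j = Suc k")
    case False
    then have "dseq n j dvd dseq n k" using Suc by simp
    also have "... dvd dseq n (Suc k)" by (rule dseq_props(4)[OF assms(1-3)])
    finally show ?thesis .
  qed simp
qed simp

lemma dseq_in:
  assumes "m < n" "n \<notin> B" "critical B n" "j \<le> i" shows "dseq n j \<in> st n"
proof (cases j)
  case 0
  then show ?thesis using maxb(1)[of "n - 1"] dseq_props(5)[OF assms(1-3)] by (simp add: dseq_0)
next
  case (Suc k)
  then show ?thesis using dseq_props(5)[OF assms(1-3)] assms(4) by simp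
qed

text \<open>A new base is a multiple of the previous maximum, which inductively is a multiple of all
  old bases. In the critical case the new bases also form a divisor chain among themselves.\<close>

lemma stage_dvd: "x \<in> st n \<Longrightarrow> y \<in> st n \<Longrightarrow> x \<le> y \<Longrightarrow> x dvd y"
proof (induction n arbitrary: x y)
  case 0
  then show ?case by (auto simp: st_init)
next
  case (Suc n)
  show ?case
  proof (cases "m < Suc n")
    case False
    then show ?thesis using Suc.prems by (simp add: st_init)
  next
    case True
    have old: "x dvd maxb n" if "x \<in> st n" for x using that Suc.IH[OF that maxb(1)] maxb(2) by simp
    from True show ?thesis
    proof (cases "Suc n" rule: stage_cases)
      case (member a)
      have n: "m \<le> n" using True by simp
      have new: "y < x" if "x \<notin> st n" "y \<in> st n" "x \<in> st (Suc n)" for x y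
        using maxb(2)[OF that(2)] maxb_le_val[OF n] inv_new[OF inv, of "Suc n" x] that by simp
      have S: "z \<in> st n \<or> z = maxb n * a" if "z \<in> st (Suc n)" for z using that member(2) by auto
      show ?thesis
      proof (cases "y \<in> st n")
        case True
        then have "x \<in> st n" using new[of x y] Suc.prems by fastforce
        then show ?thesis using True Suc.IH Suc.prems(3) by blast
      next
        case False
        then have y: "y = maxb n * a" using S Suc.prems by blast
        show ?thesis using S[OF Suc.prems(1)] old[of x] by (auto simp: y)
      qed
    next
      case noncritical
      then show ?thesis using Suc by simp
    next
      case critical
      note d = dseq_less[OF True critical(1,2)] dseq_dvd[OF True critical(1,2)]
      have d0: "dseq (Suc n) 0 = maxb n" by (simp add: dseq_0)
      have S: "z \<in> st n \<or> (\<exists>j. z = dseq (Suc n) j)" if "z \<in> st (Suc n)" for z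
        using that critical(3) by auto
      consider "x \<in> st n" "y \<in> st n" | j where "x \<in> st n" "y = dseq (Suc n) j"
        | j where "x = dseq (Suc n) j" "y \<in> st n" | j k where "x = dseq (Suc n) j" "y = dseq (Suc n) k"
        using S[OF Suc.prems(1)] S[OF Suc.prems(2)] by blast
      then show ?thesis
      proof cases
        case 1
        then show ?thesis using Suc by blast
      next
        case (2 j)
        then show ?thesis using dvd_trans[OF old[of x], of y] d(2)[of 0 j] d0 by simp
      next
        case (3 j)
        then have "dseq (Suc n) j \<le> dseq (Suc n) 0" using Suc.prems maxb(2)[of y n] d0 by simp
        then have "j = 0" using d(1)[of 0 j] by (cases j) auto
        then have "x = y" using 3 d0 Suc.prems maxb(2)[of y n] by simp
        then show ?thesis by simp
      next
        case (4 j k)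
        then have "j \<le> k" using Suc.prems d(1)[of k j] by (cases "j \<le> k") auto
        then show ?thesis using 4 d(2) by simp
      qed
    qed
  qed
qed

lemma successor_hierarchy: "base_hierarchy C"
proof (rule chain_hierarchy)
  note props = ouroboros_plus_props[OF Bp(1-3), of i]
  show "C \<noteq> {}" by (rule props(1))
  show "0 \<notin> C" by (rule props(2))
  show "1 \<notin> C" by (rule props(3))
  fix x y assume xy: "x \<in> C" "y \<in> C" "x \<le> y"
  obtain k l where kl: "x \<in> st k" "y \<in> st l" using xy(1,2) by (auto simp: ouroboros_plus_def)
  have "x \<in> st (max k l)" "y \<in> st (max k l)"
    using kl st_mono[of k "max k l"] st_mono[of l "max k l"] by (simp_all add: subset_iff)
  then show "x dvd y" using xy(3) by (rule stage_dvd)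
qed

lemma Inf_successor: "Inf C = m + 1"
proof (rule cInf_eq_minimum)
  show "m + 1 \<in> C" using st_subset[of 0] by (simp add: st_init)
  show "m + 1 \<le> x" if "x \<in> C" for x
  proof (cases "x \<in> st m")
    case True then show ?thesis by (simp add: st_init)
  next
    case False
    then show ?thesis using successor_new[OF that False] val_ge[of m] by simp
  qed
qed

end

section \<open>Gaps and their survival in the successor\<close>

definition gap :: "nat \<Rightarrow> nat set \<Rightarrow> nat \<Rightarrow> bool" where
  "gap k B b \<longleftrightarrow> b \<in> B \<and> (\<forall>s\<in>B. b < s \<longrightarrow> k * b \<le> s)"

text \<open>Ratio \<open>3\<close> is the least one for which a critical number outside the
  hierarchy, namely \<open>2 * g\<close>, must lie above \<open>g\<close> and below the next base. A
  greatest base counts as a gap, since \<open>gap\<close> restricts only larger members.\<close>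

definition gaps_below :: "nat set \<Rightarrow> nat \<Rightarrow> nat" where
  "gaps_below B b = card {g \<in> B. g < b \<and> gap 3 B g}"

context successor
begin

text \<open>Bases above \<open>b\<close> are multiples of \<open>b\<close>, so \<open>b + r\<close>
  still has base \<open>b\<close>, and by \<open>nbr_add\<close> the digit \<open>r\<close> is
  upgraded separately.\<close>

lemma val_add:
  assumes "b \<in> B" "r < b" shows "val b + val r \<le> val (b + r)"
proof -
  have bp: "m \<le> b" "2 \<le> b" using Bp(6,7) assms(1) by auto
  have base: "base B (b + r) = b"
  proof (rule base_eqI)
    fix x assume x: "x \<in> B" "x \<le> b + r"
    show "x \<le> b"
    proof (rule ccontr)
      assume "\<not> x \<le> b"
      moreover obtain q where q: "x = b * q" using hierarchy_dvd[OF B assms(1) x(1)] calculation by auto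
      ultimately have "q \<noteq> 0" "q \<noteq> 1" by auto
      then have "2 \<le> q" by simp
      then have "b * 2 \<le> b * q" by (rule mult_left_mono) simp
      moreover have "b * 2 = b + b" by simp
      ultimately show False using q x(2) assms(2) by linarith
    qed
  qed (use assms in auto)
  interpret digits val b by (rule digits[OF bp(2)])
  have "val (b + r) = nbr val b (maxb (b + r)) (b + r)" using val_eq[of "b + r"] base bp by simp
  also have "... = nbr val b (maxb (b + r)) b + val r" using assms(2) by (intro nbr_add) auto
  also have "nbr val b (maxb (b + r)) b = maxb (b + r)" using val_01 bp by (intro nbr_self)
  finally show ?thesis using val_member[OF assms(1)] maxb_mono[of b "b + r"] by simp
qed

text \<open>The number \<open>(k - 1) * b\<close> lies below the next base, so it is critical
  without being a member. This is where the successor inserts the iterates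
  \<open>dseq\<close>.\<close>

lemma gap_props:
  assumes "gap k B b" "3 \<le> k"
  defines "n \<equiv> (k - 1) * b"
  shows "m < n" "n \<notin> B" "critical B n" "base B n = b" "n div base B n = k - 1" "b < n"
proof -
  have b: "b \<in> B" "2 \<le> b" "m \<le> b" using assms(1) Bp(6,7) by (auto simp: gap_def)
  have "2 * b \<le> n" unfolding n_def using assms(2) by (intro mult_right_mono) auto
  then show "b < n" "m < n" using b by auto
  have "n < k * b" unfolding n_def using assms(2) b by (intro mult_strict_right_mono) auto
  then have no: "s \<le> b" if "s \<in> B" "s \<le> n" for s
    using assms(1) that unfolding gap_def by (metis leD le_less_trans not_le)
  then show "n \<notin> B" using \<open>b < n\<close> by (meson leD order_refl)
  show bn: "base B n = b" using no b \<open>b < n\<close> by (intro base_eqI) auto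
  then show "critical B n" by (simp add: critical_def n_def)
  show "n div base B n = k - 1" using b unfolding bn unfolding n_def by simp
qed

lemma maxb_dseq:
  assumes "m < n" "n \<notin> B" "critical B n" shows "maxb n = dseq n i"
proof (rule antisym)
  show "dseq n i \<le> maxb n" using dseq_in[OF assms, of i] maxb(2) by simp
  have "maxb n \<in> st (n - 1) \<or> (\<exists>j\<le>i. maxb n = dseq n j)"
    using maxb(1)[of n] dseq_props(5)[OF assms] by auto
  then show "maxb n \<le> dseq n i"
    using maxb(2)[of "maxb n" "n - 1"] dseq_0[of n] dseq_le[OF assms, of 0 i] dseq_le[OF assms, of _ i] by auto
qed

text \<open>Bases outside stage \<open>n\<close> exceed \<open>val n\<close>, which is at least
  \<open>(k - 1) * maxb n\<close>. Being multiples of \<open>maxb n\<close>, they are at least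
  \<open>k * maxb n\<close>, so the ratio \<open>k\<close> is preserved. Between the iterates only
  the factor \<open>k - 1\<close> is guaranteed. Thus a gap of ratio \<open>4\<close> breeds gaps of
  ratio \<open>3\<close>, whereas one of ratio \<open>3\<close> merely survives.\<close>

lemma gap_successor:
  assumes "3 \<le> k" "gap k B b"
  defines "n \<equiv> (k - 1) * b"
  shows "(k - 1) * maxb n \<le> val n" "gap k C (maxb n)" "j < i \<Longrightarrow> gap (k - 1) C (dseq n j)"
    "val b \<le> dseq n 0"
proof -
  note g = gap_props[OF assms(2,1), folded n_def]
  have bp: "2 \<le> b" "b \<in> B" using assms(2) Bp(6) by (auto simp: gap_def)
  interpret digits val b by (rule digits[OF bp(1)])
  have "m \<le> n" using g(1) by simp
  then have c: "val x < maxb n" if "x < b" for x using val_less_maxb[of n x] that g(4) by simp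
  show v: "(k - 1) * maxb n \<le> val n"
    using nbr_mult[OF c, of "k - 1"] val_eq[OF \<open>m \<le> n\<close>] g(4) by (simp add: n_def)
  have above: "s \<in> st n \<or> val n < s" if "s \<in> C" for s using successor_new[OF that] by blast
  show "gap k C (maxb n)"
    unfolding gap_def
  proof (intro conjI ballI impI)
    show "maxb n \<in> C" using maxb(1) st_subset by auto
    fix s assume s: "s \<in> C" "maxb n < s"
    then have "val n < s" using above[of s] maxb(2)[of s n] by auto
    moreover obtain q where q: "s = maxb n * q"
      using hierarchy_dvd[OF successor_hierarchy \<open>maxb n \<in> C\<close> s(1)] s(2) by auto
    ultimately have "maxb n * (k - 1) < maxb n * q"
      using v by (metis le_less_trans mult.commute)
    then have "k - 1 < q" by simp
    then have "maxb n * k \<le> maxb n * q" by (intro mult_left_mono) auto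
    then show "k * maxb n \<le> s" using q by (simp add: mult.commute)
  qed
  show "val b \<le> dseq n 0"
    using val_member[OF bp(2)] maxb_mono[of b "n - 1"] g(6) by (simp add: dseq_0)
  show "gap (k - 1) C (dseq n j)" if "j < i"
    unfolding gap_def
  proof (intro conjI ballI impI)
    show "dseq n j \<in> C" using dseq_in[OF g(1-3), of j] that st_subset by auto
    fix s assume s: "s \<in> C" "dseq n j < s"
    show "(k - 1) * dseq n j \<le> s"
    proof (cases "s \<in> st n")
      case True
      have "s \<notin> st (n - 1)"
        using maxb(2)[of s "n - 1"] dseq_le[OF g(1-3), of 0 j] s(2) by (auto simp: dseq_0)
      then obtain l where l: "s = dseq n l" using True dseq_props(5)[OF g(1-3)] by auto
      then have "Suc j \<le> l" using s(2) dseq_le[OF g(1-3), of l j] by (meson leD not_less_eq_eq)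
      then show ?thesis using dseq_props(2)[OF g(1-3), of j] dseq_le[OF g(1-3), of "Suc j" l] l g(5) by simp
    next
      case False
      have "dseq n j \<le> maxb n" using maxb_dseq[OF g(1-3)] dseq_le[OF g(1-3), of j i] that by simp
      then have "(k - 1) * dseq n j \<le> (k - 1) * maxb n" by (rule mult_left_mono) simp
      also have "... \<le> val n" by (rule v)
      also have "... < s" using above[OF s(1)] False by simp
      finally show ?thesis by simp
    qed
  qed
qed

text \<open>If the minimum is \<open>2\<close>, the digit \<open>2\<close> itself is upgraded to
  \<open>3\<close>. For \<open>b > 2\<close> this turns \<open>2 * b\<close> into \<open>3\<close>
  times the new base; for \<open>b = 2\<close> the number is \<open>4 = 2 ^ 2\<close> and becomes a
  power with exponent at least \<open>3\<close>. Hence a gap of ratio \<open>3\<close> grows to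
  ratio \<open>4\<close> in one step.\<close>

lemma gap_successor_min_2:
  assumes "m = 2" "gap 3 B b"
  shows "gap 4 C (maxb (2 * b))" "3 * maxb (2 * b) \<le> val (2 * b)"
proof -
  let ?c = "maxb (2 * b)"
  have b: "2 \<le> b" "b \<in> B" using assms(2) Bp(6) by (auto simp: gap_def)
  note g = gap_props[OF assms(2), simplified]
  have cC: "?c \<in> C" using maxb(1) st_subset by auto
  then have c3: "3 \<le> ?c" using hierarchy_props(7)[OF successor_hierarchy] Inf_successor assms(1) by fastforce
  have v: "val (2 * b) = nbr val b ?c (2 * b)" using val_eq[of "2 * b"] g(1,4) by simp
  show le: "3 * ?c \<le> val (2 * b)"
  proof (cases "b = 2")
    case True
    have "is_decomposition 2 4 2 1 0" by (simp add: is_decomposition_def)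
    then have "nbr val 2 ?c 4 = ?c ^ nbr val 2 ?c 2 * val 1 + nbr val 2 ?c 0"
      by (intro nbr_decomposition) auto
    then have "val (2 * b) = ?c ^ ?c"
      using v True val_01 nbr_self[of 2 val ?c] by (simp add: nbr_small)
    moreover have "?c ^ 2 \<le> ?c ^ ?c" using c3 by (intro power_increasing) auto
    moreover have "3 * ?c \<le> ?c ^ 2" using c3 by (simp add: power2_eq_square)
    ultimately show ?thesis by simp
  next
    case False
    then have "is_decomposition b (2 * b) 1 2 0" using b by (simp add: is_decomposition_def)
    then have "nbr val b ?c (2 * b) = ?c ^ nbr val b ?c 1 * val 2 + nbr val b ?c 0"
      using b by (intro nbr_decomposition) auto
    moreover have "val 2 = 3" using val_member[of 2] Bp(4) assms(1) maxb_init[of 2] by simp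
    ultimately show ?thesis using v val_01 b by (simp add: nbr_small)
  qed
  show "gap 4 C ?c"
    unfolding gap_def
  proof (intro conjI ballI impI cC)
    fix s assume s: "s \<in> C" "?c < s"
    then have "s \<notin> st (2 * b)" using maxb(2)[of s "2 * b"] by auto
    then have "val (2 * b) < s" by (rule successor_new[OF s(1)])
    moreover obtain q where q: "s = ?c * q"
      using hierarchy_dvd[OF successor_hierarchy cC s(1)] s(2) by auto
    ultimately have "?c * 3 < ?c * q" using le by (metis le_less_trans mult.commute)
    then have "?c * 4 \<le> ?c * q" by (intro mult_left_mono) auto
    then show "4 * ?c \<le> s" using q by simp
  qed
qed

text \<open>A gap \<open>g\<close> is sent to \<open>maxb (2 * g)\<close>. For gaps
  \<open>g < h\<close> the first image lies below \<open>val h\<close> and the second does not,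
  whence injectivity; the comparison with \<open>val b\<close> shows that all images stay below
  \<open>val b\<close>.\<close>

lemma gaps_below_successor:
  assumes "b \<in> B" shows "gaps_below B b \<le> gaps_below C (val b)"
  unfolding gaps_below_def
proof (rule card_inj_on_le)
  have *: "maxb (2 * g) < val h" if "gap 3 B g" "h \<in> B" "g < h" for g h
  proof -
    have "3 * g \<le> h" using that by (auto simp: gap_def)
    moreover have "0 < g" using that Bp(2) by (auto simp: gap_def intro: ccontr)
    ultimately have "val (2 * g) < val h" by (intro val_strict_mono) simp
    moreover have "maxb (2 * g) \<le> val (2 * g)" using gap_props(1)[OF that(1)] by (intro maxb_le_val) simp
    ultimately show ?thesis by simp
  qed
  show "inj_on (\<lambda>g. maxb (2 * g)) {g \<in> B. g < b \<and> gap 3 B g}"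
  proof (rule linorder_inj_onI')
    fix g h assume gh: "g \<in> {g \<in> B. g < b \<and> gap 3 B g}" "h \<in> {g \<in> B. g < b \<and> gap 3 B g}" "g < h"
    then have "maxb (2 * g) < val h" using * by simp
    also have "val h \<le> maxb (2 * h)" using gh val_member[of h] maxb_mono[of h "2 * h"] by simp
    finally show "maxb (2 * g) \<noteq> maxb (2 * h)" by simp
  qed
  show "(\<lambda>g. maxb (2 * g)) ` {g \<in> B. g < b \<and> gap 3 B g} \<subseteq> {g \<in> C. g < val b \<and> gap 3 C g}"
  proof
    fix x assume "x \<in> (\<lambda>g. maxb (2 * g)) ` {g \<in> B. g < b \<and> gap 3 B g}"
    then obtain g where g: "x = maxb (2 * g)" "g < b" "gap 3 B g" by auto
    have "gap 3 C x" using gap_successor(2)[of 3 g] g by simp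
    moreover have "x < val b" using * assms g by simp
    ultimately show "x \<in> {g \<in> C. g < val b \<and> gap 3 C g}" by (simp add: gap_def)
  qed
qed simp

end

text \<open>The shifts fit both uses of the function. One Goodstein step leads from time
  \<open>i\<close> to \<open>i + 1\<close>, where a sum of \<open>i + 2\<close> bases is available;
  and the pigeonhole argument needs \<open>c + 1\<close> intervals, hence \<open>c + 2\<close>
  endpoints, beginning beyond \<open>c + 1\<close>.\<close>

primrec ack :: "nat \<Rightarrow> nat \<Rightarrow> nat" where
  "ack 0 x = x + 1"
| "ack (Suc k) x = (ack k ^^ (x + 2)) (x + 1)"

lemma funpow_mono_nat:
  fixes f :: "nat \<Rightarrow> nat"
  assumes "\<And>x. x < f x" "\<And>x y. x \<le> y \<Longrightarrow> f x \<le> f y" "m \<le> n" "x \<le> y"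
  shows "(f ^^ m) x \<le> (f ^^ n) y"
proof -
  have "(f ^^ m) x \<le> (f ^^ m) y" by (induction m) (use assms in auto)
  also have "(f ^^ m) y \<le> (f ^^ (m + k)) y" for k
    by (induction k) (use assms(1) in \<open>auto intro: le_trans less_imp_le\<close>)
  from this[of "n - m"] have "(f ^^ m) y \<le> (f ^^ n) y" using assms(3) by simp
  finally show ?thesis .
qed

lemma ack_mono: "x < ack k x \<and> (x \<le> y \<longrightarrow> ack k x \<le> ack k y)"
proof (induction k arbitrary: x y)
  case (Suc k)
  have f: "x < ack k x" "x \<le> y \<Longrightarrow> ack k x \<le> ack k y" for x y using Suc by blast+
  have "(ack k ^^ 0) (x + 1) \<le> (ack k ^^ (x + 2)) (x + 1)" by (intro funpow_mono_nat f) auto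
  then show ?case by (auto intro!: funpow_mono_nat f simp del: funpow.simps)
qed simp

lemma ack_gt: "x < ack k x" and ack_le: "x \<le> y \<Longrightarrow> ack k x \<le> ack k y"
  using ack_mono by blast+

lemma ack_Suc: "ack k x \<le> ack (Suc k) x"
proof -
  have "(ack k ^^ 1) x \<le> (ack k ^^ (x + 2)) (x + 1)"
    by (intro funpow_mono_nat ack_gt ack_le) auto
  then show ?thesis by simp
qed

lemma ack_le_ack: "k \<le> l \<Longrightarrow> ack k x \<le> ack l x"
  by (induction l) (auto elim!: le_SucE intro: le_trans ack_Suc simp del: ack.simps)

section \<open>Lower bounds for Goodstein sequences\<close>

locale goodstein_process =
  fixes B0 :: "nat set"
  assumes B0: "base_hierarchy B0"
begin

abbreviation "Bs \<equiv> ouroboros_seq B0"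

lemma hierarchy: "base_hierarchy (Bs i)"
proof (induction i)
  case (Suc i)
  then interpret successor "Bs i" "i + 1" by unfold_locales
  show ?case using successor_hierarchy by simp
qed (simp add: B0)

lemma successor: "successor (Bs i)" using hierarchy by unfold_locales

definition up :: "nat \<Rightarrow> nat \<Rightarrow> nat" where "up i = successor.val (Bs i) (i + 1)"

lemma upgrade_eq_up: "upgrade (Bs i) (Bs (Suc i)) n = enat (up i n)"
  using successor.upgrade_successor[OF successor, of i "i + 1" n] by (simp add: up_def)

lemma up_0: "up i 0 = 0" using successor.val_01[OF successor] by (simp add: up_def)
lemma up_less: "x < y \<Longrightarrow> up i x < up i y" using successor.val_strict_mono[OF successor] by (simp add: up_def)
lemma up_ge: "x \<le> up i x" using successor.val_ge[OF successor] by (simp add: up_def)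
lemma up_in: "b \<in> Bs i \<Longrightarrow> up i b \<in> Bs (Suc i)"
  using successor.val_in_successor[OF successor, of b i "i + 1"] by (simp add: up_def)
lemma up_add: "b \<in> Bs i \<Longrightarrow> r < b \<Longrightarrow> up i b + up i r \<le> up i (b + r)"
  using successor.val_add[OF successor] by (simp add: up_def)
lemma up_gaps: "b \<in> Bs i \<Longrightarrow> gaps_below (Bs i) b \<le> gaps_below (Bs (Suc i)) (up i b)"
  using successor.gaps_below_successor[OF successor, of b i "i + 1"] by (simp add: up_def)

lemma up_mono: "x \<le> y \<Longrightarrow> up i x \<le> up i y"
  using up_less[of x y i] by (cases "x = y") auto

lemma up_plus: "up i x + k \<le> up i (x + k)"
proof (induction k)
  case (Suc k)
  then show ?case using up_less[of "x + k" "x + Suc k" i] by simp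
qed simp

text \<open>Truncated subtraction together with \<open>up_0\<close> keeps the value at
  \<open>0\<close> once it is reached, so there is no case distinction. The first argument is the
  index of the hierarchy at the start.\<close>

primrec run :: "nat \<Rightarrow> nat \<Rightarrow> nat \<Rightarrow> nat" where
  "run i x 0 = x"
| "run i x (Suc j) = up (i + j) (run i x j) - 1"

primrec lift :: "nat \<Rightarrow> nat \<Rightarrow> nat \<Rightarrow> nat" where
  "lift i x 0 = x"
| "lift i x (Suc j) = up (i + j) (lift i x j)"

lemma goodstein_run: "goodstein Bs n j = enat (run 0 n j)"
proof (induction j)
  case (Suc j)
  then show ?case using upgrade_eq_up[of j "run 0 n j"]
    by (cases "run 0 n j") (simp_all add: up_0 zero_enat_def one_enat_def)
qed simp

lemma run_add: "run i x (j + k) = run (i + j) (run i x j) k"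
  by (induction k) (simp_all add: add.assoc)

lemma run_mono: "x \<le> y \<Longrightarrow> run i x j \<le> run i y j"
  by (induction j) (auto intro!: diff_le_mono up_mono)

text \<open>The time \<open>h\<close> is absolute, counted like \<open>i\<close> in indices of
  hierarchies; in this form successive bounds compose without shifts.\<close>

definition alive :: "nat \<Rightarrow> nat \<Rightarrow> nat \<Rightarrow> bool" where
  "alive i x h \<longleftrightarrow> (\<forall>j. i + j < h \<longrightarrow> 0 < run i x j)"

lemma alive_mono: "alive i x h \<Longrightarrow> x \<le> y \<Longrightarrow> h' \<le> h \<Longrightarrow> alive i y h'"
  unfolding alive_def using run_mono by (meson less_le_trans)

lemma alive_later:
  assumes "alive (i + j) x h" "x \<le> run i y j" "alive i y (i + j)"
  shows "alive i y h"
  unfolding alive_def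
proof (intro allI impI)
  fix k assume k: "i + k < h"
  show "0 < run i y k"
  proof (cases "k < j")
    case True then show ?thesis using assms(3) by (simp add: alive_def)
  next
    case False
    then have "run i y k = run (i + j) (run i y j) (k - j)" using run_add[of i y j "k - j"] by simp
    moreover have "0 < run (i + j) x (k - j)" using assms(1) k False by (simp add: alive_def)
    ultimately show ?thesis using run_mono[OF assms(2), of "i + j" "k - j"] by simp
  qed
qed

text \<open>While the remainder is positive it pays for all subtractions, so the base is merely
  upgraded and keeps its gaps. The remainder stays below the base by monotonicity, which keeps
  \<open>up_add\<close> applicable.\<close>

lemma base_plus_remainder:
  assumes "b \<in> Bs i" "r < b" "\<And>k. k < j \<Longrightarrow> 0 < run i r k"
  shows "lift i b j \<in> Bs (i + j) \<and> run i r j < lift i b j \<and> lift i b j + run i r j \<le> run i (b + r) j \<and>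
    gaps_below (Bs i) b \<le> gaps_below (Bs (i + j)) (lift i b j)"
  using assms(3)
proof (induction j)
  case 0 then show ?case using assms by simp
next
  case (Suc j)
  let ?b = "lift i b j" and ?r = "run i r j" and ?x = "run i (b + r) j"
  have IH: "?b \<in> Bs (i + j)" "?r < ?b" "?b + ?r \<le> ?x" "gaps_below (Bs i) b \<le> gaps_below (Bs (i + j)) ?b"
    using Suc by simp_all
  have r: "0 < up (i + j) ?r" using up_ge[of ?r "i + j"] Suc.prems[of j] by simp
  have "up (i + j) ?b + up (i + j) ?r \<le> up (i + j) ?x"
    using up_add[OF IH(1,2)] up_mono[OF IH(3)] by (rule le_trans)
  moreover have "up (i + j) ?r < up (i + j) ?b" using IH(2) by (rule up_less)
  moreover have "gaps_below (Bs i) b \<le> gaps_below (Bs (Suc (i + j))) (up (i + j) ?b)"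
    using IH(4) up_gaps[OF IH(1)] by (rule le_trans)
  ultimately have "up (i + j) ?r - 1 < up (i + j) ?b \<and> up (i + j) ?b + (up (i + j) ?r - 1) \<le> up (i + j) ?x - 1 \<and>
      gaps_below (Bs i) b \<le> gaps_below (Bs (Suc (i + j))) (up (i + j) ?b)"
    using r by linarith
  then show ?case using up_in[OF IH(1)] by (simp del: ouroboros_seq.simps)
qed

definition grows :: "nat \<Rightarrow> bool" where
  "grows k \<longleftrightarrow> (\<forall>i b. b \<in> Bs i \<longrightarrow> k \<le> gaps_below (Bs i) b \<longrightarrow> alive i b (ack k i))"

text \<open>The remainder is spent first. At time \<open>h\<close> an upgraded base with at least as
  many gaps is left, and \<open>grows k\<close> is applied at that later time.\<close>

lemma alive_base_plus:
  assumes "grows k" "b \<in> Bs i" "k \<le> gaps_below (Bs i) b" "r < b" "alive i r h" "i \<le> h"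
  shows "alive i (b + r) (ack k h)"
proof -
  define j where "j = h - i"
  have h: "h = i + j" using assms(6) by (simp add: j_def)
  have *: "lift i b j \<in> Bs h \<and> run i r j < lift i b j \<and> lift i b j + run i r j \<le> run i (b + r) j \<and>
    gaps_below (Bs i) b \<le> gaps_below (Bs h) (lift i b j)"
    unfolding h by (rule base_plus_remainder) (use assms h in \<open>auto simp: alive_def\<close>)
  then have "alive h (lift i b j) (ack k h)" using assms(1,3) by (simp add: grows_def)
  then show ?thesis
    using * alive_mono[OF assms(5), of "b + r" h] alive_later[of i j "lift i b j" "ack k h" "b + r"] h by simp
qed

text \<open>The bases are consumed from the smallest upwards, each one prolonging life from a time
  \<open>h\<close> to \<open>ack k h\<close>. By doubling, the smaller ones add up to less than the
  next base and so form an admissible remainder for it.\<close>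

lemma alive_sum:
  assumes "grows k" "\<And>j. j < p \<Longrightarrow> f j \<in> Bs i \<and> k \<le> gaps_below (Bs i) (f j)"
    "\<And>j. Suc j < p \<Longrightarrow> 2 * f j \<le> f (Suc j)" "0 < f 0"
  shows "alive i (\<Sum>j<p. f j) ((ack k ^^ p) i) \<and> (p > 0 \<longrightarrow> (\<Sum>j<p. f j) < 2 * f (p - 1))"
  using assms(2,3)
proof (induction p)
  case (Suc p)
  have IH: "alive i (\<Sum>j<p. f j) ((ack k ^^ p) i)" "p > 0 \<longrightarrow> (\<Sum>j<p. f j) < 2 * f (p - 1)"
    using Suc by simp_all
  have less: "(\<Sum>j<p. f j) < f p"
  proof (cases p)
    case (Suc q)
    then show ?thesis using IH(2) Suc.prems(2)[of q] by simp
  qed (use assms(4) in simp)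
  have "i \<le> (ack k ^^ p) i"
    using funpow_mono_nat[of "ack k" 0 p i i] ack_gt ack_le by simp
  then have "alive i (f p + (\<Sum>j<p. f j)) (ack k ((ack k ^^ p) i))"
    using Suc.prems(1)[of p] less IH(1) by (intro alive_base_plus[OF assms(1)]) auto
  then show ?case using less by (simp add: add.commute)
qed (simp add: alive_def)

lemma gaps_below_mono: "b \<le> b' \<Longrightarrow> gaps_below B b \<le> gaps_below B b'"
  unfolding gaps_below_def by (intro card_mono) auto

text \<open>Let \<open>g\<close> be the last gap below \<open>b\<close>. After one step at least
  \<open>up i (2 * g)\<close> is left, since \<open>3 * g \<le> b\<close>. This exceeds the sum of
  the iterates \<open>dseq (2 * g) j\<close> for \<open>j \<le> i + 1\<close>, because that sum is
  less than twice its last summand \<open>maxb (2 * g)\<close>. These \<open>i + 2\<close> bases of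
  the next hierarchy have \<open>k\<close> gaps below them, so \<open>alive_sum\<close> yields
  \<open>i + 2\<close> applications of \<open>ack k\<close> from time \<open>i + 1\<close>
  on.\<close>

lemma grows: "grows k"
proof (induction k)
  case 0
  have "0 < b" if "b \<in> Bs i" for b i using hierarchy_props(6)[OF hierarchy that] by simp
  then show ?case by (auto simp: grows_def alive_def)
next
  case (Suc k)
  show ?case
    unfolding grows_def
  proof (intro allI impI)
    fix i b assume b: "b \<in> Bs i" "Suc k \<le> gaps_below (Bs i) b"
    interpret successor "Bs i" "i + 1" by (rule successor)
    let ?G = "{g \<in> Bs i. g < b \<and> gap 3 (Bs i) g}"
    have fin: "finite ?G" and card: "Suc k \<le> card ?G" using b(2) by (auto simp: gaps_below_def)
    then have ne: "?G \<noteq> {}" by (metis card.empty not_less_eq_eq zero_le)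
    \<comment> \<open>With the greatest gap removed, the remaining gaps, at least \<open>k\<close>
      of them, all lie below \<open>g\<close>.\<close>
    define g where "g = Max ?G"
    have "g \<in> ?G" unfolding g_def by (rule Max_in[OF fin ne])
    then have g: "g \<in> Bs i" "g < b" "gap 3 (Bs i) g" by auto
    have "?G - {g} \<subseteq> {h \<in> Bs i. h < g \<and> gap 3 (Bs i) h}"
    proof
      fix h assume "h \<in> ?G - {g}"
      moreover then have "h \<le> g" unfolding g_def using fin by (intro Max_ge) auto
      ultimately show "h \<in> {h \<in> Bs i. h < g \<and> gap 3 (Bs i) h}" by auto
    qed
    then have "card (?G - {g}) \<le> gaps_below (Bs i) g"
      unfolding gaps_below_def by (intro card_mono) auto
    then have kg: "k \<le> gaps_below (Bs i) g" using card \<open>g \<in> ?G\<close> fin by simp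
    let ?n = "2 * g"
    note gs = gap_successor[OF _ g(3), simplified] and gp = gap_props[OF g(3), simplified]
    define f where "f = dseq ?n"
    have c: "maxb ?n = f (i + 1)" unfolding f_def by (rule maxb_dseq[OF gp(1-3)])
    have double: "2 * f j \<le> f (Suc j)" for j
      using dseq_props(2)[OF gp(1-3), of j] gp(5) by (simp add: f_def)
    have fin: "f j \<in> Bs (Suc i)" if "j < i + 2" for j
      using dseq_in[OF gp(1-3), of j] that st_subset[of ?n] by (auto simp: f_def)
    \<comment> \<open>Every iterate is at least the upgrade of \<open>g\<close>, below which the
      gaps of \<open>g\<close> survive.\<close>
    have low: "up i g \<le> f j" for j
      using gs(4) dseq_le[OF gp(1-3), of 0 j] unfolding f_def up_def by simp
    then have kf: "k \<le> gaps_below (Bs (Suc i)) (f j)" for j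
      using kg up_gaps[OF g(1)] gaps_below_mono[OF low[of j], of "Bs (Suc i)"] by linarith
    have f0: "0 < f 0" unfolding f_def by (rule dseq_props(1)[OF gp(1-3)])
    define S where "S = (\<Sum>j<i + 2. f j)"
    have sum: "alive (Suc i) S ((ack k ^^ (i + 2)) (Suc i)) \<and>
        (i + 2 > 0 \<longrightarrow> S < 2 * f (i + 2 - 1))"
      unfolding S_def using Suc fin kf double f0 by (intro alive_sum) auto
    have "3 * g \<le> b" using g(2,3) b(1) by (simp add: gap_def)
    then have "up i ?n \<le> up i b" by (intro up_mono) simp
    moreover have "2 * f (i + 1) \<le> up i ?n" using gs(1) c unfolding up_def by simp
    moreover have "S < 2 * f (i + 1)" using sum by simp
    ultimately have "S \<le> up i b - 1" by linarith
    then have "S \<le> run i b 1" by simp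
    moreover have "alive i b (i + 1)" using g(2) by (simp add: alive_def)
    ultimately have "alive i b ((ack k ^^ (i + 2)) (Suc i))"
      using alive_later[of i 1 S _ b] sum by simp
    then show "alive i b (ack (Suc k) i)" by simp
  qed
qed

lemma run_ge_lift: "lift i x j + (t - j) \<le> run i (x + t) j" if "j \<le> t"
  using that
proof (induction j)
  case (Suc j)
  have "up (i + j) (lift i x j) + (t - j) \<le> up (i + j) (run i (x + t) j)"
    using up_plus[of "i + j" "lift i x j" "t - j"] up_mono[OF Suc.IH, of "i + j"] Suc.prems by simp
  then show ?case using Suc.prems by simp
qed simp

lemma lift_base: "b \<in> Bs i \<Longrightarrow> lift i b j \<in> Bs (i + j) \<and> gaps_below (Bs i) b \<le> gaps_below (Bs (i + j)) (lift i b j)"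
proof (induction j)
  case (Suc j)
  then show ?case using up_in[of "lift i b j" "i + j"] up_gaps[of "lift i b j" "i + j"] by simp
qed simp

text \<open>The summand \<open>t\<close> pays for the first \<open>t\<close> subtractions. The base
  reaches time \<open>t\<close> merely upgraded, so the argument of \<open>ack k\<close> has become
  \<open>t\<close>.\<close>

lemma alive_with_gaps:
  assumes "b \<in> B0" "k \<le> gaps_below B0 b"
  shows "alive 0 (b + t) (ack k t)"
proof -
  have *: "lift 0 b t \<in> Bs t" "k \<le> gaps_below (Bs t) (lift 0 b t)"
    using lift_base[of b 0 t] assms by simp_all
  then have "alive t (lift 0 b t) (ack k t)" using grows by (simp add: grows_def)
  moreover have "alive 0 (b + t) t"
    unfolding alive_def
  proof (intro allI impI)
    fix j assume "0 + j < t"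
    then show "0 < run 0 (b + t) j" using run_ge_lift[of j t 0 b] by simp
  qed
  ultimately show ?thesis using run_ge_lift[of t t 0 b] alive_later[of 0 t] by simp
qed

text \<open>A gap of ratio at least \<open>4\<close> survives in all successors, and creates more and more gaps of
  ratio \<open>3\<close> below it.\<close>

lemma gap_4_iterate:
  assumes "gap 4 (Bs i) b" "3 * b + t \<le> x" "j \<le> t"
  shows "\<exists>c. gap 4 (Bs (i + j)) c \<and> 3 * c + (t - j) \<le> run i x j \<and> (0 < j \<longrightarrow> i + j \<le> gaps_below (Bs (i + j)) c)"
  using assms(3)
proof (induction j)
  case (Suc j)
  obtain c where c: "gap 4 (Bs (i + j)) c" "3 * c + (t - j) \<le> run i x j" using Suc by auto
  interpret successor "Bs (i + j)" "i + j + 1" by (rule successor)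
  \<comment> \<open>For ratio \<open>4\<close> the critical number inside the gap is
    \<open>3 * c\<close>, hence the multiple \<open>3 * c\<close> in the invariant; the reserve
    \<open>t - j\<close> pays for the subtractions still to come.\<close>
  let ?n = "3 * c"
  note gs = gap_successor[OF _ c(1), simplified] and gp = gap_props[OF c(1), simplified]
  have "up (i + j) ?n + (t - j) \<le> up (i + j) (run i x j)"
    using up_plus[of "i + j" ?n "t - j"] up_mono[OF c(2), of "i + j"] by simp
  moreover have "3 * maxb ?n \<le> up (i + j) ?n" using gs(1) by (simp add: up_def)
  ultimately have "3 * maxb ?n + (t - Suc j) \<le> run i x (Suc j)" using Suc.prems by simp
  moreover have "i + Suc j \<le> gaps_below (Bs (i + Suc j)) (maxb ?n)"
  proof -
    \<comment> \<open>The last iterate is \<open>maxb ?n\<close>, and all earlier ones are gaps of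
      ratio \<open>4 - 1\<close>.\<close>
    have "dseq ?n ` {..<i + j + 1} \<subseteq> {g \<in> Bs (i + Suc j). g < maxb ?n \<and> gap 3 (Bs (i + Suc j)) g}"
    proof
      fix g assume "g \<in> dseq ?n ` {..<i + j + 1}"
      then obtain l where l: "l < i + j + 1" "g = dseq ?n l" by auto
      then show "g \<in> {g \<in> Bs (i + Suc j). g < maxb ?n \<and> gap 3 (Bs (i + Suc j)) g}"
        using gs(3)[of l] maxb_dseq[OF gp(1-3)] dseq_less[OF gp(1-3), of l "i + j + 1"] by (simp add: gap_def)
    qed
    then have "card (dseq ?n ` {..<i + j + 1}) \<le> gaps_below (Bs (i + Suc j)) (maxb ?n)"
      unfolding gaps_below_def by (intro card_mono) auto
    moreover have "inj_on (dseq ?n) {..<i + j + 1}"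
      using dseq_less[OF gp(1-3)] by (intro linorder_inj_onI') (metis less_irrefl)
    ultimately show ?thesis by (simp add: card_image)
  qed
  moreover have "gap 4 (Bs (i + Suc j)) (maxb ?n)" using gs(2) by simp
  ultimately show ?case by blast
qed (use assms in auto)

text \<open>By time \<open>i + t\<close> a base with at least \<open>i + t\<close> gaps below it has
  emerged, so \<open>grows\<close> applies with level \<open>i + t\<close>, which dominates every
  level \<open>k \<le> t\<close>.\<close>

lemma alive_with_gap_4:
  assumes "gap 4 (Bs i) b" "3 * b + t \<le> run 0 x i" "0 < t" "k \<le> t" "alive 0 x i"
  shows "alive 0 x (ack k t)"
proof -
  have "alive i (run 0 x i) (i + t)"
    unfolding alive_def
  proof (intro allI impI)
    fix j assume "i + j < i + t"
    then have j: "j \<le> t" "0 < t - j" by simp_all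
    obtain c where "3 * c + (t - j) \<le> run i (run 0 x i) j"
      using gap_4_iterate[OF assms(1,2) j(1)] by blast
    then show "0 < run i (run 0 x i) j" using j by simp
  qed
  then have 1: "alive 0 x (i + t)" using alive_later[of 0 i _ "i + t" x] assms(5) by simp
  obtain c where c: "gap 4 (Bs (i + t)) c" "3 * c \<le> run i (run 0 x i) t" "i + t \<le> gaps_below (Bs (i + t)) c"
    using gap_4_iterate[OF assms(1,2) order_refl] assms(3) by auto
  have "alive (i + t) c (ack (i + t) (i + t))" using grows c by (simp add: grows_def gap_def)
  then have "alive 0 x (ack (i + t) (i + t))"
    using alive_later[of 0 "i + t" c _ x] 1 c(2) run_add[of 0 x i t] by simp
  moreover have "ack k t \<le> ack (i + t) t" using assms(4) by (intro ack_le_ack) simp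
  moreover have "ack (i + t) t \<le> ack (i + t) (i + t)" by (intro ack_le) simp
  ultimately show ?thesis by (elim alive_mono) auto
qed

text \<open>Either infinitely many ratios equal \<open>3\<close>, and then some base has
  \<open>k\<close> gaps below it. Or some ratio exceeds the minimum of \<open>3\<close> and
  \<open>Inf B0\<close>: if \<open>Inf B0 \<ge> 3\<close>, divisibility makes this ratio at least
  \<open>4\<close>; if \<open>Inf B0 = 2\<close>, it is at least \<open>3\<close> and becomes
  \<open>4\<close> in the first successor. The offset \<open>s\<close> absorbs the base concerned
  and, where needed, makes \<open>t\<close> at least \<open>k\<close>.\<close>

theorem goodstein_lower_bound:
  assumes "\<not> ((\<forall>b\<in>B0. next_base B0 b \<le> enat (min (3 * b) (b * Inf B0))) \<and>
            finite {b \<in> B0. next_base B0 b = enat (3 * b)})"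
  shows "\<exists>s. \<forall>t\<ge>s. \<forall>j<ack k t. goodstein Bs (s + t) j \<noteq> 0"
proof -
  note Bp = hierarchy_props[OF B0]
  have gapI: "gap l B0 b" if "b \<in> B0" "enat (l * b) \<le> next_base B0 b" for b l
    unfolding gap_def
  proof (intro conjI ballI impI that(1))
    fix s assume "s \<in> B0" "b < s"
    then obtain y where "y \<le> s" "next_base B0 b = enat y" by (rule obtain_next_base)
    then show "l * b \<le> s" using that(2) by simp
  qed
  have "\<exists>s. \<forall>t\<ge>s. alive 0 (s + t) (ack k t)"
  proof (cases "\<forall>b\<in>B0. next_base B0 b \<le> enat (min (3 * b) (b * Inf B0))")
    case True
    then have inf: "infinite {b \<in> B0. next_base B0 b = enat (3 * b)}" using assms by blast
    then obtain G where G: "G \<subseteq> {b \<in> B0. next_base B0 b = enat (3 * b)}" "finite G" "card G = k"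
      using infinite_arbitrarily_large by blast
    obtain b where b: "b \<in> B0" "\<forall>g\<in>G. g < b"
      using inf G(2) by (metis (no_types, lifting) infinite_nat_iff_unbounded mem_Collect_eq finite_nat_set_iff_bounded less_trans)
    have "G \<subseteq> {g \<in> B0. g < b \<and> gap 3 B0 g}" using G(1) b(2) gapI by auto
    then have "k \<le> gaps_below B0 b" unfolding gaps_below_def G(3)[symmetric] by (intro card_mono) auto
    then show ?thesis using alive_with_gaps[OF b(1)] by blast
  next
    case False
    then obtain b where b: "b \<in> B0" "\<not> next_base B0 b \<le> enat (min (3 * b) (b * Inf B0))" by blast
    have big: "enat (min (3 * b) (b * Inf B0)) < next_base B0 b" using b(2) by simp
    show ?thesis
    proof (cases "Inf B0 = 2")
      case True
      interpret successor B0 1 using successor[of 0] by simp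
      have "gap 3 B0 b"
      proof (rule gapI[OF b(1)])
        show "enat (3 * b) \<le> next_base B0 b"
        proof (cases "next_base B0 b")
          case (enat s)
          then have "b dvd s" "2 * b < s" using B0 b(1) big True by (auto simp: base_hierarchy_def)
          then obtain q where "s = b * q" "b * 2 < b * q" by (auto simp: mult.commute)
          then have "3 \<le> q" by simp
          then have "b * 3 \<le> b * q" by (intro mult_left_mono) auto
          then show ?thesis using enat \<open>s = b * q\<close> by simp
        qed simp
      qed
      note g = gap_successor_min_2[OF True this]
      define c where "c = maxb (2 * b)"
      \<comment> \<open>The part of \<open>s\<close> beyond \<open>2 * b\<close> covers the
        subtraction of the first step, and \<open>s \<le> t\<close> gives \<open>k \<le> t\<close>
        and \<open>0 < t\<close>.\<close>
      have "alive 0 (s + t) (ack k t)" if s: "s = 2 * b + 2 + k" "s \<le> t" for s t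
      proof (rule alive_with_gap_4[of 1 c])
        show "gap 4 (Bs 1) c" using g(1) by (simp add: c_def)
        have "3 * c + (t + s - 2 * b) \<le> up 0 (s + t)"
        proof -
          have "2 * b + (t + s - 2 * b) = s + t" using s by simp
          then have "up 0 (2 * b) + (t + s - 2 * b) \<le> up 0 (s + t)"
            using up_plus[of 0 "2 * b" "t + s - 2 * b"] by (simp only:)
          moreover have "3 * c \<le> up 0 (2 * b)" using g(2) by (simp add: up_def c_def)
          ultimately show ?thesis by linarith
        qed
        then show "3 * c + t \<le> run 0 (s + t) 1" using s by simp
        show "alive 0 (s + t) 1" using s by (simp add: alive_def)
      qed (use s in simp_all)
      then show ?thesis by blast
    next
      case False
      then have "3 \<le> Inf B0" using Bp(5) by simp
      then have "b * 3 \<le> b * Inf B0" by (rule mult_left_mono) simp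
      then have big3: "enat (3 * b) < next_base B0 b" using big by (simp add: min_absorb1 mult.commute)
      have "gap 4 (Bs 0) b"
      proof (simp, rule gapI[OF b(1)])
        show "enat (4 * b) \<le> next_base B0 b"
        proof (cases "next_base B0 b")
          case (enat s)
          then have "b dvd s" "3 * b < s" using B0 b(1) big3 by (auto simp: base_hierarchy_def)
          then obtain q where "s = b * q" "b * 3 < b * q" by (auto simp: mult.commute)
          then have "4 \<le> q" by simp
          then have "b * 4 \<le> b * q" by (intro mult_left_mono) auto
          then show ?thesis using enat \<open>s = b * q\<close> by simp
        qed simp
      qed
      then have "alive 0 (s + t) (ack k t)" if "s = 3 * b + 1 + k" "s \<le> t" for s t
        by (rule alive_with_gap_4) (use that in \<open>auto simp: alive_def\<close>)
      then show ?thesis by blast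
    qed
  qed
  then show ?thesis by (auto simp: alive_def goodstein_run zero_enat_def)
qed

end

section \<open>A nonstandard model\<close>

text \<open>Zorn's lemma is applied to families that contain all tails and have the finite
  intersection property. If a maximal family contained neither \<open>A\<close> nor its complement,
  finitely many members would have an intersection disjoint from both.\<close>

lemma free_ultrafilter_exists:
  obtains F :: "nat filter" where "F \<noteq> bot" "F \<le> sequentially"
    "\<And>P. eventually P F \<or> eventually (\<lambda>x. \<not> P x) F"
proof -
  define \<A> :: "nat set set set" where
    "\<A> = {X. range atLeast \<subseteq> X \<and> (\<forall>Y. finite Y \<longrightarrow> Y \<subseteq> X \<longrightarrow> \<Inter>Y \<noteq> {})}"
  have "\<exists>M\<in>\<A>. \<forall>X\<in>\<A>. M \<subseteq> X \<longrightarrow> X = M"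
  proof (rule subset_Zorn_nonempty)
    have "\<Inter>Y \<noteq> {}" if Y: "finite Y" "Y \<subseteq> range atLeast" for Y :: "nat set set"
    proof -
      obtain N where N: "finite N" "Y = atLeast ` N" using finite_subset_image[OF Y] by auto
      then have "Max (insert 0 N) \<in> \<Inter>Y" by auto
      then show ?thesis by blast
    qed
    then have "range atLeast \<in> \<A>" by (auto simp: \<A>_def)
    then show "\<A> \<noteq> {}" by blast
    fix C assume C: "C \<noteq> {}" "subset.chain \<A> C"
    show "\<Union>C \<in> \<A>"
      unfolding \<A>_def
    proof (intro CollectI conjI allI impI)
      obtain X where "X \<in> C" using C(1) by blast
      moreover then have "range atLeast \<subseteq> X" using C(2) unfolding subset.chain_def \<A>_def by blast
      ultimately show "range atLeast \<subseteq> \<Union>C" by blast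
      fix Y assume "finite Y" "Y \<subseteq> \<Union>C"
      then obtain X where "X \<in> C" "Y \<subseteq> X" using finite_subset_Union_chain[OF _ _ C] by metis
      moreover then have "X \<in> \<A>" using C(2) unfolding subset.chain_def by blast
      ultimately show "\<Inter>Y \<noteq> {}" using \<open>finite Y\<close> unfolding \<A>_def by blast
    qed
  qed
  then obtain M where M: "M \<in> \<A>" "\<And>X. X \<in> \<A> \<Longrightarrow> M \<subseteq> X \<Longrightarrow> X = M" by blast
  have fip: "\<Inter>Y \<noteq> {}" if "finite Y" "Y \<subseteq> M" for Y using M(1) that by (auto simp: \<A>_def)
  have dichotomy: "A \<in> M \<or> - A \<in> M" for A
  proof (rule ccontr)
    assume "\<not> (A \<in> M \<or> - A \<in> M)"
    have "\<exists>Y. finite Y \<and> Y \<subseteq> M \<and> \<Inter>Y \<inter> A = {}" if "A \<notin> M" for A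
    proof -
      have "insert A M \<notin> \<A>" using M(2)[of "insert A M"] that by blast
      then obtain Y where Y: "finite Y" "Y \<subseteq> insert A M" "\<Inter>Y = {}"
        using M(1) by (auto simp: \<A>_def)
      then have "\<Inter>(Y - {A}) \<inter> A = {}" by blast
      then show ?thesis using Y by (intro exI[of _ "Y - {A}"]) auto
    qed
    then obtain Y Z where "finite Y" "Y \<subseteq> M" "\<Inter>Y \<inter> A = {}" "finite Z" "Z \<subseteq> M" "\<Inter>Z \<inter> - A = {}"
      using \<open>\<not> (A \<in> M \<or> - A \<in> M)\<close> by metis
    then have "\<Inter>(Y \<union> Z) = {}" "finite (Y \<union> Z)" "Y \<union> Z \<subseteq> M" unfolding Inter_Un_distrib by blast+
    then show False using fip by blast
  qed
  define F where "F = (INF A\<in>M. principal A)"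
  have mem: "eventually P F" if "{x. P x} \<in> M" for P
  proof -
    have "F \<le> principal {x. P x}" unfolding F_def using that by (rule INF_lower)
    then show ?thesis by (auto simp: le_principal)
  qed
  show thesis
  proof
    show "F \<noteq> bot"
    proof
      assume "F = bot"
      then have "eventually (\<lambda>x. False) F" by simp
      then obtain Y where Y: "finite Y" "Y \<subseteq> M" "eventually (\<lambda>x. False) (INF A\<in>Y. principal A)"
        unfolding F_def eventually_INF[of _ _ M] by blast
      then have "\<Inter>Y = {}" by (auto simp: INF_principal_finite eventually_principal)
      then show False using fip Y by blast
    qed
    show "F \<le> sequentially"
      unfolding le_sequentially
    proof
      fix N :: nat
      have "{x. N \<le> x} = atLeast N" by auto
      then show "eventually (\<lambda>n. N \<le> n) F" using M(1) by (intro mem) (auto simp: \<A>_def)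
    qed
    show "eventually P F \<or> eventually (\<lambda>x. \<not> P x) F" for P
      using dichotomy[of "{x. P x}"] mem[of P] mem[of "\<lambda>x. \<not> P x"] by (auto simp: Compl_eq)
  qed
qed

text \<open>By the pigeonhole principle: among \<open>c + 1\<close> consecutive long intervals one avoids \<open>c\<close> values.\<close>

lemma avoiding_interval:
  assumes "ack (Suc k) c \<le> d"
  shows "\<exists>c' d'. ack k (c + 1) \<le> c' \<and> ack k c' \<le> d' \<and> d' \<le> d \<and> (\<forall>a<c. \<not> (c' \<le> f a \<and> f a < d'))"
proof -
  define e where "e j = (ack k ^^ j) (c + 1)" for j
  have mono: "e i \<le> e j" if "i \<le> j" for i j
    unfolding e_def by (rule funpow_mono_nat) (use that ack_gt ack_le in auto)
  have "\<exists>j\<in>{1..c + 1}. \<forall>a<c. \<not> (e j \<le> f a \<and> f a < e (Suc j))"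
  proof (rule ccontr)
    assume "\<not> ?thesis"
    then have "\<forall>j\<in>{1..c + 1}. \<exists>a. a < c \<and> e j \<le> f a \<and> f a < e (Suc j)" by blast
    then obtain a where a: "\<And>j. j \<in> {1..c + 1} \<Longrightarrow> a j < c \<and> e j \<le> f (a j) \<and> f (a j) < e (Suc j)"
      by metis
    have "inj_on a {1..c + 1}"
    proof (rule linorder_inj_onI')
      fix i j assume ij: "i \<in> {1..c + 1}" "j \<in> {1..c + 1}" "i < j"
      then have "f (a i) < e (Suc i)" "e (Suc i) \<le> e j" "e j \<le> f (a j)" using a mono by auto
      then show "a i \<noteq> a j" by auto
    qed
    then have "card {1..c + 1} \<le> card {..<c}" using a by (intro card_inj_on_le) auto
    then show False by simp
  qed
  then obtain j where j: "1 \<le> j" "j \<le> c + 1" "\<forall>a<c. \<not> (e j \<le> f a \<and> f a < e (Suc j))" by auto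
  have "e (Suc j) \<le> e (c + 2)" using j by (intro mono) simp
  also have "... \<le> d" using assms by (simp add: e_def)
  finally show ?thesis using j mono[of 1 j] by (intro exI[of _ "e j"] exI[of _ "e (Suc j)"]) (auto simp: e_def)
qed

text \<open>A code says how a set of the model is obtained from a list of number parameters by means of the
  basic operations; the first argument of \<open>Op\<close> names the operation, the other numbers select
  segments of the parameter list.\<close>

datatype code = Op nat nat "code list" | Sel nat nat code

instance code :: countable by countable_datatype

section \<open>The ultrapower and the nested intervals that define the cut\<close>

locale model =
  fixes F :: "nat filter" and opr :: "nat \<Rightarrow> nat \<Rightarrow> nat set list \<Rightarrow> nat list \<Rightarrow> nat set" and \<tau> :: "nat \<Rightarrow> nat"
  assumes proper: "F \<noteq> bot" and free: "F \<le> sequentially"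
    and ultra: "eventually P F \<or> eventually (\<lambda>x. \<not> P x) F"
begin

abbreviation ev (binder \<open>\<forall>\<^sub>F\<close> 10) where "ev P \<equiv> eventually P F"

lemma ev_not: "(\<forall>\<^sub>F t. \<not> P t) \<longleftrightarrow> \<not> (\<forall>\<^sub>F t. P t)"
proof
  assume 1: "\<forall>\<^sub>F t. \<not> P t"
  show "\<not> (\<forall>\<^sub>F t. P t)"
  proof
    assume "\<forall>\<^sub>F t. P t"
    then have "\<forall>\<^sub>F t. False" using 1 by eventually_elim simp
    then show False using proper by (simp add: eventually_False)
  qed
qed (use ultra in blast)

lemma ev_imp: "(\<forall>\<^sub>F t. P t \<longrightarrow> Q t) \<longleftrightarrow> ((\<forall>\<^sub>F t. P t) \<longrightarrow> (\<forall>\<^sub>F t. Q t))"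
proof
  assume "(\<forall>\<^sub>F t. P t) \<longrightarrow> (\<forall>\<^sub>F t. Q t)"
  then consider "\<forall>\<^sub>F t. \<not> P t" | "\<forall>\<^sub>F t. Q t" using ev_not by blast
  then show "\<forall>\<^sub>F t. P t \<longrightarrow> Q t" by cases (auto elim: eventually_mono)
qed (auto elim: eventually_elim2)

lemma ev_conj: "(\<forall>\<^sub>F t. P t \<and> Q t) \<longleftrightarrow> (\<forall>\<^sub>F t. P t) \<and> (\<forall>\<^sub>F t. Q t)" by (rule eventually_conj_iff)

lemma ev_disj: "(\<forall>\<^sub>F t. P t \<or> Q t) \<longleftrightarrow> (\<forall>\<^sub>F t. P t) \<or> (\<forall>\<^sub>F t. Q t)"
  using ev_imp[of "\<lambda>t. \<not> P t" Q] by (auto simp: ev_not imp_conv_disj)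

lemma ev_iff: "(\<forall>\<^sub>F t. P t \<longleftrightarrow> Q t) \<longleftrightarrow> ((\<forall>\<^sub>F t. P t) \<longleftrightarrow> (\<forall>\<^sub>F t. Q t))"
  by (simp add: iff_conv_conj_imp ev_conj ev_imp)

lemma ev_const: "(\<forall>\<^sub>F t. P) \<longleftrightarrow> P" using proper by (cases P) (auto simp: eventually_False)

lemma ev_ge: "\<forall>\<^sub>F t. k \<le> t" using free by (auto simp: le_sequentially)

fun eval :: "code \<Rightarrow> nat \<Rightarrow> nat list \<Rightarrow> nat set" where
  "eval (Op i p cs) d l = opr i d (map (\<lambda>c. eval c d l) cs) (take p l)"
| "eval (Sel k p c) d l = eval c d (take p (drop k l))"

definition top_bound :: "nat \<Rightarrow> nat" where "top_bound t = ack t (\<tau> t)"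

text \<open>The number \<open>a\<close> codes the argument followed by the parameters of
  \<open>c\<close>, so that a bound on \<open>a\<close> treats all of them at once. Without a
  witness, \<open>LEAST\<close> still denotes some number, which is kept out of the intervals like
  the others; applications start from an actual witness before reading membership off the
  value.\<close>

definition least_witness :: "code \<Rightarrow> nat \<Rightarrow> nat \<Rightarrow> nat" where
  "least_witness c t a = (LEAST y. pair (hd (list_decode a)) y \<in> eval c (top_bound t) (tl (list_decode a)))"

definition sched :: "nat \<Rightarrow> code" where "sched k = from_nat (fst (prod_decode k))"

text \<open>The cut will lie between the left and the right ends of these nested intervals.  Every code is
  scheduled infinitely often, and the least witnesses for the arguments below the old left end are
  kept out of the new interval: they are either below the cut, with a common bound, or above it.\<close>

primrec ival :: "nat \<Rightarrow> nat \<Rightarrow> nat \<times> nat" where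
  "ival t 0 = (\<tau> t, ack t (\<tau> t))"
| "ival t (Suc k) = (SOME (c', d'). ack (t - Suc k) (fst (ival t k) + 1) \<le> c' \<and> ack (t - Suc k) c' \<le> d' \<and>
     d' \<le> snd (ival t k) \<and> (\<forall>a<fst (ival t k). \<not> (c' \<le> least_witness (sched k) t a \<and> least_witness (sched k) t a < d')))"

definition lo :: "nat \<Rightarrow> nat \<Rightarrow> nat" where "lo k t = fst (ival t k)"
definition hi :: "nat \<Rightarrow> nat \<Rightarrow> nat" where "hi k t = snd (ival t k)"

text \<open>In coordinate \<open>t\<close> only the first \<open>t\<close> steps are meaningful.
  Step \<open>k\<close> leaves an interval of level \<open>t - k\<close>, and for fixed
  \<open>k\<close> this level is as large as desired at almost all \<open>t\<close>.\<close>

lemma ival_inv: "k \<le> t \<Longrightarrow> ack (t - k) (lo k t) \<le> hi k t"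
  and ival_step: "k < t \<Longrightarrow> ack (t - Suc k) (lo k t + 1) \<le> lo (Suc k) t \<and> ack (t - Suc k) (lo (Suc k) t) \<le> hi (Suc k) t \<and>
     hi (Suc k) t \<le> hi k t \<and> (\<forall>a<lo k t. \<not> (lo (Suc k) t \<le> least_witness (sched k) t a \<and> least_witness (sched k) t a < hi (Suc k) t))"
proof -
  have step: "ack (t - Suc k) (lo k t + 1) \<le> lo (Suc k) t \<and> ack (t - Suc k) (lo (Suc k) t) \<le> hi (Suc k) t \<and>
     hi (Suc k) t \<le> hi k t \<and> (\<forall>a<lo k t. \<not> (lo (Suc k) t \<le> least_witness (sched k) t a \<and> least_witness (sched k) t a < hi (Suc k) t))"
    if "ack (t - k) (lo k t) \<le> hi k t" "k < t" for k
  proof -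
    let ?P = "\<lambda>(c', d'). ack (t - Suc k) (lo k t + 1) \<le> c' \<and> ack (t - Suc k) c' \<le> d' \<and> d' \<le> hi k t \<and>
        (\<forall>a<lo k t. \<not> (c' \<le> least_witness (sched k) t a \<and> least_witness (sched k) t a < d'))"
    have "\<exists>c' d'. ?P (c', d')"
      unfolding prod.case using that by (intro avoiding_interval) (simp add: Suc_diff_Suc)
    then have "\<exists>p. ?P p" by blast
    then have "?P (SOME p. ?P p)" by (rule someI_ex)
    moreover have "ival t (Suc k) = (SOME p. ?P p)" unfolding lo_def hi_def by (rule ival.simps(2))
    ultimately have "?P (ival t (Suc k))" by (simp only:)
    then have "?P (lo (Suc k) t, hi (Suc k) t)" by (simp only: lo_def hi_def prod.collapse)
    then show ?thesis unfolding prod.case .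
  qed
  have inv: "ack (t - k) (lo k t) \<le> hi k t" if "k \<le> t" for k
    using that
  proof (induction k)
    case (Suc k)
    then show ?case using step[of k] by simp
  qed (simp add: lo_def hi_def)
  show "ack (t - k) (lo k t) \<le> hi k t" if "k \<le> t" using inv[OF that] .
  show "ack (t - Suc k) (lo k t + 1) \<le> lo (Suc k) t \<and> ack (t - Suc k) (lo (Suc k) t) \<le> hi (Suc k) t \<and>
     hi (Suc k) t \<le> hi k t \<and> (\<forall>a<lo k t. \<not> (lo (Suc k) t \<le> least_witness (sched k) t a \<and> least_witness (sched k) t a < hi (Suc k) t))"
    if "k < t" using step[OF inv that] that by simp
qed

lemma ack_2: "(x + 1) * (x + 1) < ack 2 (x + 1)"
proof -
  have one: "ack (Suc 0) y = 2 * y + 3" for y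
  proof -
    have "(ack 0 ^^ n) y = y + n" for n y by (induction n) auto
    then show ?thesis by (simp del: funpow.simps)
  qed
  have "2 ^ n * y \<le> (ack (Suc 0) ^^ n) y" for n y
    by (induction n) (simp_all add: one del: ack.simps)
  from this[of "x + 3" "x + 2"] have "2 ^ (x + 3) * (x + 2) \<le> ack 2 (x + 1)"
    by (simp add: numeral_2_eq_2 numeral_3_eq_3 del: funpow.simps power_Suc)
  moreover have "x + 1 \<le> 2 ^ (x + 3)" by (rule less_imp_le, rule less_trans[OF _ less_exp]) simp
  then have "(x + 1) * (x + 1) < 2 ^ (x + 3) * (x + 2)" by (intro mult_le_less_imp_less) auto
  ultimately show ?thesis by (rule less_le_trans[rotated])
qed

text \<open>Level \<open>2\<close> of \<open>ack\<close> already outgrows squaring, and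
  \<open>t - Suc k\<close> is at least \<open>2\<close> for almost all \<open>t\<close>.\<close>

lemma lo_Suc: "\<forall>\<^sub>F t. (lo k t + 1) * (lo k t + 1) < lo (Suc k) t"
  using ev_ge[of "k + 3"]
proof eventually_elim
  case (elim t)
  have "(lo k t + 1) * (lo k t + 1) < ack 2 (lo k t + 1)" by (rule ack_2)
  also have "... \<le> ack (t - Suc k) (lo k t + 1)" using elim by (intro ack_le_ack) simp
  also have "... \<le> lo (Suc k) t" using ival_step[of k t] elim by simp
  finally show ?case .
qed

lemma lo_less: "k < l \<Longrightarrow> \<forall>\<^sub>F t. lo k t < lo l t"
proof (induction l)
  case (Suc l)
  have step: "\<forall>\<^sub>F t. lo l t < lo (Suc l) t" using lo_Suc[of l] by eventually_elim simp
  show ?case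
  proof (cases "k = l")
    case False
    then have "\<forall>\<^sub>F t. lo k t < lo l t" using Suc by simp
    then show ?thesis using step by eventually_elim simp
  qed (use step in simp)
qed simp

lemma lo_le: "k \<le> l \<Longrightarrow> \<forall>\<^sub>F t. lo k t \<le> lo l t"
  using lo_less[of k l] by (cases "k = l") (auto elim: eventually_mono)

lemma lo_hi: "\<forall>\<^sub>F t. lo k t < hi l t"
proof -
  have hi: "\<forall>\<^sub>F t. hi (l + j) t \<le> hi l t" for j
  proof (induction j)
    case (Suc j)
    then show ?case using ev_ge[of "l + j + 1"]
    proof eventually_elim
      case (elim t)
      then show ?case using ival_step[of "l + j" t] by simp
    qed
  qed simp
  have "\<forall>\<^sub>F t. lo k t \<le> lo (l + k) t" by (rule lo_le) simp
  then show ?thesis using hi[of k] ev_ge[of "l + k"]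
  proof eventually_elim
    case (elim t)
    have "lo (l + k) t < ack (t - (l + k)) (lo (l + k) t)" by (rule ack_gt)
    then show ?case using elim ival_inv[of "l + k" t] by simp
  qed
qed

section \<open>The cut and its closure properties\<close>

definition I :: "(nat \<Rightarrow> nat) set" where "I = {f. \<exists>k. \<forall>\<^sub>F t. f t < lo k t}"

lemma I_mono: assumes "g \<in> I" "\<forall>\<^sub>F t. f t \<le> g t" shows "f \<in> I"
proof -
  obtain k where "\<forall>\<^sub>F t. g t < lo k t" using assms(1) by (auto simp: I_def)
  then have "\<forall>\<^sub>F t. f t < lo k t" using assms(2) by eventually_elim simp
  then show ?thesis by (auto simp: I_def)
qed

lemma I_common: assumes "f \<in> I" "g \<in> I" obtains k where "\<forall>\<^sub>F t. f t < lo k t" "\<forall>\<^sub>F t. g t < lo k t"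
proof -
  obtain k l where kl: "\<forall>\<^sub>F t. f t < lo k t" "\<forall>\<^sub>F t. g t < lo l t" using assms by (auto simp: I_def)
  have le: "\<forall>\<^sub>F t. lo k t \<le> lo (max k l) t" "\<forall>\<^sub>F t. lo l t \<le> lo (max k l) t" by (auto intro: lo_le)
  have "\<forall>\<^sub>F t. f t < lo (max k l) t" using kl(1) le(1) by eventually_elim simp
  moreover have "\<forall>\<^sub>F t. g t < lo (max k l) t" using kl(2) le(2) by eventually_elim simp
  ultimately show thesis by (rule that)
qed

lemma I_square: assumes "f \<in> I" "g \<in> I" shows "(\<lambda>t. (f t + g t) * (f t + g t)) \<in> I"
proof -
  obtain k where k: "\<forall>\<^sub>F t. f t < lo k t" "\<forall>\<^sub>F t. g t < lo k t" using assms by (rule I_common)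
  have "\<forall>\<^sub>F t. (f t + g t) * (f t + g t) < lo (Suc (Suc k)) t"
    using k lo_Suc[of k] lo_Suc[of "Suc k"]
  proof eventually_elim
    case (elim t)
    have "f t + g t \<le> (lo k t + 1) * (lo k t + 1)" using elim(1,2) by simp
    then have "f t + g t \<le> lo (Suc k) t + 1" using elim(3) by simp
    then have "(f t + g t) * (f t + g t) \<le> (lo (Suc k) t + 1) * (lo (Suc k) t + 1)" by (intro mult_mono) auto
    then show ?case using elim(4) by simp
  qed
  then show ?thesis by (auto simp: I_def)
qed

lemma I_const: "(\<lambda>t. n) \<in> I"
proof -
  have "\<forall>\<^sub>F t. k \<le> lo k t" for k
  proof (induction k)
    case (Suc k)
    then show ?case using lo_less[OF lessI, of k] by eventually_elim simp
  qed simp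
  from this[of "Suc n"] have "\<forall>\<^sub>F t. n < lo (Suc n) t" by eventually_elim simp
  then show ?thesis by (auto simp: I_def)
qed

lemma I_add: assumes "f \<in> I" "g \<in> I" shows "(\<lambda>t. f t + g t) \<in> I"
  by (rule I_mono[OF I_square[OF assms]]) simp

lemma I_mult: assumes "f \<in> I" "g \<in> I" shows "(\<lambda>t. f t * g t) \<in> I"
proof (rule I_mono[OF I_square[OF assms]])
  have "f t * g t \<le> (f t + g t) * (f t + g t)" for t by (intro mult_mono) auto
  then show "\<forall>\<^sub>F t. f t * g t \<le> (f t + g t) * (f t + g t)" by simp
qed

lemma I_Suc: "f \<in> I \<Longrightarrow> (\<lambda>t. Suc (f t)) \<in> I" using I_add[OF _ I_const[of 1]] by simp

lemma I_pair: assumes "f \<in> I" "g \<in> I" shows "(\<lambda>t. pair (f t) (g t)) \<in> I"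
  unfolding pair_def by (intro I_add I_mult assms)

lemma I_tau: "\<tau> \<in> I"
proof -
  have "\<forall>\<^sub>F t. \<tau> t < lo 1 t" using lo_less[of 0 1] by (simp add: lo_def)
  then show ?thesis unfolding I_def by blast
qed

lemma I_top_bound: assumes "f \<in> I" shows "\<forall>\<^sub>F t. f t < top_bound t"
proof -
  obtain k where "\<forall>\<^sub>F t. f t < lo k t" using assms by (auto simp: I_def)
  then show ?thesis using lo_hi[of k 0] by eventually_elim (simp add: hi_def top_bound_def)
qed

text \<open>The list \<open>fs\<close> has standard length, so finitely many applications of closure
  under pairs suffice.\<close>

lemma I_list:
  assumes "set fs \<subseteq> I" shows "(\<lambda>t. list_encode (map (\<lambda>f. f t) fs)) \<in> I"
  using assms
proof (induction fs)
  case (Cons f fs)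
  let ?g = "\<lambda>t. list_encode (map (\<lambda>f. f t) fs)"
  have "prod_encode (x, y) \<le> pair x y" for x y
  proof -
    have "2 * triangle n \<le> n * n + n" for n by (induction n) auto
    moreover have "n \<le> n * n" for n :: nat by (cases n) auto
    ultimately have "triangle n \<le> n * n" for n by (smt (verit) add_le_mono le_trans mult_2 nat_add_left_cancel_le mult_le_cancel1 zero_less_numeral)
    then show ?thesis by (simp add: prod_encode_def pair_def)
  qed
  then have "\<forall>\<^sub>F t. list_encode (map (\<lambda>f. f t) (f # fs)) \<le> Suc (pair (f t) (?g t))" by simp
  moreover have "(\<lambda>t. Suc (pair (f t) (?g t))) \<in> I" using Cons by (intro I_Suc I_pair) auto
  ultimately show ?case by (rule I_mono[rotated])
qed (simp add: I_const)

section \<open>The sets of the model and semiregularity\<close>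

definition S :: "(nat \<Rightarrow> nat set) set" where
  "S = {A. \<exists>c fs. set fs \<subseteq> I \<and> A = (\<lambda>t. eval c (top_bound t) (map (\<lambda>f. f t) fs))}"

text \<open>The parameter lists of the given sets are concatenated behind \<open>fs\<close>, and
  \<open>Sel\<close> makes each code read its own segment. The prefix \<open>fs\<close> stays first
  because \<open>Op\<close> takes its own number arguments from there.\<close>

lemma S_list:
  assumes "set As \<subseteq> S"
  shows "\<exists>cs gs. set gs \<subseteq> I \<and>
    (\<forall>t. map (\<lambda>c. eval c (top_bound t) (map (\<lambda>f. f t) (fs @ gs))) cs = map (\<lambda>A. A t) As)"
  using assms
proof (induction As arbitrary: fs)
  case (Cons A As)
  obtain c hs where A: "set hs \<subseteq> I" "A = (\<lambda>t. eval c (top_bound t) (map (\<lambda>f. f t) hs))"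
    using Cons.prems by (auto simp: S_def)
  obtain cs gs where "set gs \<subseteq> I" "\<And>t. map (\<lambda>c. eval c (top_bound t) (map (\<lambda>f. f t) ((fs @ hs) @ gs))) cs = map (\<lambda>A. A t) As"
    using Cons.IH[of "fs @ hs"] Cons.prems by auto
  then show ?case using A
    by (intro exI[of _ "Sel (length fs) (length hs) c # cs"] exI[of _ "hs @ gs"]) auto
qed (auto intro: exI[of _ "[]"])

lemma S_op:
  assumes "set As \<subseteq> S" "set fs \<subseteq> I"
  shows "(\<lambda>t. opr i (top_bound t) (map (\<lambda>A. A t) As) (map (\<lambda>f. f t) fs)) \<in> S"
proof -
  obtain cs gs where *: "set gs \<subseteq> I" "\<And>t. map (\<lambda>c. eval c (top_bound t) (map (\<lambda>f. f t) (fs @ gs))) cs = map (\<lambda>A. A t) As"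
    using S_list[OF assms(1), of fs] by blast
  have "(\<lambda>t. opr i (top_bound t) (map (\<lambda>A. A t) As) (map (\<lambda>f. f t) fs)) =
      (\<lambda>t. eval (Op i (length fs) cs) (top_bound t) (map (\<lambda>f. f t) (fs @ gs)))"
    using *(2) by (auto simp: fun_eq_iff)
  then show ?thesis unfolding S_def using * assms(2)
    by (intro CollectI exI[of _ "Op i (length fs) cs"] exI[of _ "fs @ gs"]) auto
qed

lemma sched: "\<exists>l\<ge>k. sched l = c"
  by (rule exI[of _ "prod_encode (to_nat c, k)"]) (simp add: sched_def le_prod_encode_2)

text \<open>In the terminology of Kirby and Paris, the cut \<open>I\<close> is semiregular.\<close>

lemma semiregular:
  assumes "A \<in> S" "m \<in> I"
  shows "\<exists>e\<in>I. \<forall>x. (\<forall>\<^sub>F t. x t \<le> m t) \<longrightarrow>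
     (\<forall>\<^sub>F t. (LEAST y. pair (x t) y \<in> A t) < e t) \<or> (\<forall>g\<in>I. \<forall>\<^sub>F t. g t < (LEAST y. pair (x t) y \<in> A t))"
proof -
  obtain c fs where A: "set fs \<subseteq> I" "A = (\<lambda>t. eval c (top_bound t) (map (\<lambda>f. f t) fs))"
    using assms by (auto simp: S_def)
  have "set (m # fs) \<subseteq> I" using assms A by simp
  from I_list[OF this] obtain k where k: "\<forall>\<^sub>F t. list_encode (m t # map (\<lambda>f. f t) fs) < lo k t"
    by (auto simp: I_def)
  \<comment> \<open>A step so late that all coded arguments up to \<open>m\<close> are below
    \<open>lo l\<close>, and at which the code of \<open>A\<close> is scheduled.\<close>
  obtain l where l: "k \<le> l" "sched l = c" using sched by blast
  show ?thesis
  proof (intro bexI[of _ "lo (Suc l)"] allI impI)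
    show "lo (Suc l) \<in> I" using lo_less[of "Suc l" "Suc (Suc l)"] unfolding I_def by blast
    fix x assume "\<forall>\<^sub>F t. x t \<le> m t"
    then have dich: "\<forall>\<^sub>F t. (LEAST y. pair (x t) y \<in> A t) < lo (Suc l) t \<or> hi (Suc l) t \<le> (LEAST y. pair (x t) y \<in> A t)"
      using k lo_le[OF l(1)] ev_ge[of "Suc l"]
    proof eventually_elim
      case (elim t)
      let ?a = "list_encode (x t # map (\<lambda>f. f t) fs)"
      \<comment> \<open>The pairing function increases in its first argument, so the code for
        \<open>m\<close> bounds the codes for all \<open>x \<le> m\<close> with the same
        parameters.\<close>
      have mono: "triangle n \<le> triangle n'" if "n \<le> n'" for n n' using that by (induction n') (auto elim: le_SucE)
      have "?a \<le> list_encode (m t # map (\<lambda>f. f t) fs)"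
        using elim(1) by (auto simp: prod_encode_def intro!: add_mono mono)
      then have "?a < lo l t" using elim by simp
      moreover have "least_witness c t ?a = (LEAST y. pair (x t) y \<in> A t)" by (simp add: least_witness_def A)
      moreover have "\<forall>a<lo l t. \<not> (lo (Suc l) t \<le> least_witness c t a \<and> least_witness c t a < hi (Suc l) t)"
        using ival_step[of l t] elim(4) l(2) by simp
      ultimately have "\<not> (lo (Suc l) t \<le> (LEAST y. pair (x t) y \<in> A t) \<and> (LEAST y. pair (x t) y \<in> A t) < hi (Suc l) t)"
        by metis
      then show ?case by linarith
    qed
    show "(\<forall>\<^sub>F t. (LEAST y. pair (x t) y \<in> A t) < lo (Suc l) t) \<or> (\<forall>g\<in>I. \<forall>\<^sub>F t. g t < (LEAST y. pair (x t) y \<in> A t))"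
    \<comment> \<open>Each member of the cut is below \<open>hi (Suc l)\<close>. A least witness
      that is not above the whole cut is therefore on the left side of the interval.\<close>
    proof (rule disjCI)
      assume "\<not> (\<forall>g\<in>I. \<forall>\<^sub>F t. g t < (LEAST y. pair (x t) y \<in> A t))"
      then obtain g where g: "g \<in> I" "\<not> (\<forall>\<^sub>F t. g t < (LEAST y. pair (x t) y \<in> A t))" by blast
      obtain j where "\<forall>\<^sub>F t. g t < lo j t" using g(1) by (auto simp: I_def)
      then have "\<forall>\<^sub>F t. g t < hi (Suc l) t" using lo_hi[of j "Suc l"] by eventually_elim simp
      then show "\<forall>\<^sub>F t. (LEAST y. pair (x t) y \<in> A t) < lo (Suc l) t"
        using dich g(2)[folded ev_not] by eventually_elim simp
    qed
  qed
qed

text \<open>Semiregularity gives one bound \<open>e\<close> for the least witnesses of all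
  \<open>k \<le> k0\<close> that have a witness in the cut at all. The least \<open>k\<close> with a
  witness below \<open>e\<close> can then be taken in each coordinate separately.\<close>

lemma least_number:
  assumes A: "A \<in> S" and k0: "k0 \<in> I" "x0 \<in> I" "\<forall>\<^sub>F t. pair (k0 t) (x0 t) \<in> A t"
  obtains k x where "k \<in> I" "x \<in> I" "\<forall>\<^sub>F t. pair (k t) (x t) \<in> A t" "\<forall>\<^sub>F t. k t \<le> k0 t"
    "\<And>k' x'. k' \<in> I \<Longrightarrow> x' \<in> I \<Longrightarrow> \<forall>\<^sub>F t. k' t < k t \<Longrightarrow> \<forall>\<^sub>F t. pair (k' t) (x' t) \<notin> A t"
proof -
  obtain e where e: "e \<in> I" "\<And>x. \<forall>\<^sub>F t. x t \<le> k0 t \<Longrightarrow>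
     (\<forall>\<^sub>F t. (LEAST y. pair (x t) y \<in> A t) < e t) \<or> (\<forall>g\<in>I. \<forall>\<^sub>F t. g t < (LEAST y. pair (x t) y \<in> A t))"
    using semiregular[OF A k0(1)] by blast
  have small: "\<forall>\<^sub>F t. (\<exists>y<e t. pair (k t) y \<in> A t)"
    if "\<forall>\<^sub>F t. k t \<le> k0 t" "x \<in> I" "\<forall>\<^sub>F t. pair (k t) (x t) \<in> A t" for k x
  proof -
    have "\<forall>\<^sub>F t. \<not> x t < (LEAST y. pair (k t) y \<in> A t)"
      using that(3) by eventually_elim (auto simp: not_less intro: Least_le)
    then have "\<not> (\<forall>\<^sub>F t. x t < (LEAST y. pair (k t) y \<in> A t))" unfolding ev_not .
    then have "\<forall>\<^sub>F t. (LEAST y. pair (k t) y \<in> A t) < e t" using e(2)[OF that(1)] that(2) by blast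
    then show ?thesis using that(3)
    proof eventually_elim
      case (elim t)
      then show ?case using LeastI[of "\<lambda>y. pair (k t) y \<in> A t" "x t"] by blast
    qed
  qed
  define k where "k t = (LEAST k. \<exists>y<e t. pair k y \<in> A t)" for t
  define x where "x t = (SOME y. y < e t \<and> pair (k t) y \<in> A t)" for t
  have ex: "\<forall>\<^sub>F t. \<exists>y<e t. pair (k0 t) y \<in> A t" using k0 by (intro small) auto
  then have k: "\<forall>\<^sub>F t. k t \<le> k0 t \<and> (\<exists>y<e t. pair (k t) y \<in> A t)"
  proof eventually_elim
    case (elim t)
    then show ?case unfolding k_def
      using LeastI[of "\<lambda>k. \<exists>y<e t. pair k y \<in> A t" "k0 t"] Least_le[of "\<lambda>k. \<exists>y<e t. pair k y \<in> A t" "k0 t"] by blast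
  qed
  then have x: "\<forall>\<^sub>F t. x t < e t \<and> pair (k t) (x t) \<in> A t"
    by eventually_elim (unfold x_def, rule someI_ex, blast)
  show thesis
  proof (rule that[of k x])
    show "\<forall>\<^sub>F t. k t \<le> k0 t" using k by eventually_elim simp
    then show "k \<in> I" by (rule I_mono[OF k0(1)])
    show "x \<in> I" by (rule I_mono[OF e(1)]) (use x in eventually_elim, simp)
    show "\<forall>\<^sub>F t. pair (k t) (x t) \<in> A t" using x by eventually_elim simp
    fix k' x' assume k': "k' \<in> I" "x' \<in> I" "\<forall>\<^sub>F t. k' t < k t"
    show "\<forall>\<^sub>F t. pair (k' t) (x' t) \<notin> A t"
    proof (rule ccontr)
      assume "\<not> ?thesis"
      then have "\<forall>\<^sub>F t. pair (k' t) (x' t) \<in> A t" by (simp only: ev_not not_not)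
      moreover have "\<forall>\<^sub>F t. k' t \<le> k0 t" using k'(3) k by eventually_elim simp
      ultimately have "\<forall>\<^sub>F t. \<exists>y<e t. pair (k' t) y \<in> A t" using k'(2) small by blast
      then have "\<forall>\<^sub>F t. False" using k'(3) by eventually_elim (use not_less_Least in \<open>auto simp: k_def\<close>)
      then show False using ev_const by blast
    qed
  qed
qed

text \<open>Suppose that the value at \<open>k0\<close> is outside the cut. Semiregularity yields an
  \<open>e\<close> in the cut such that each value up to \<open>k0\<close> is below \<open>e\<close>
  or above the whole cut. The first argument whose value reaches \<open>e\<close> has its value in
  the cut by \<open>step\<close>, a contradiction. The lemma thus replaces an induction over the cut
  when a recursion of nonstandard length is estimated.\<close>

lemma values_bounded:
  assumes A: "A \<in> S" "\<And>t k v. pair k v \<in> A t \<longleftrightarrow> v = g k t"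
    and step: "\<And>k e. k \<in> I \<Longrightarrow> e \<in> I \<Longrightarrow> \<forall>\<^sub>F t. \<forall>j<k t. g j t < e t \<Longrightarrow> (\<lambda>t. g (k t) t) \<in> I"
    and k0: "k0 \<in> I"
  shows "(\<lambda>t. g (k0 t) t) \<in> I"
proof (rule ccontr)
  assume notin: "(\<lambda>t. g (k0 t) t) \<notin> I"
  have L: "(LEAST y. pair k y \<in> A t) = g k t" for k t unfolding A(2) by (rule Least_equality) auto
  obtain e where e: "e \<in> I" "\<And>x. \<forall>\<^sub>F t. x t \<le> k0 t \<Longrightarrow>
     (\<forall>\<^sub>F t. g (x t) t < e t) \<or> (\<forall>h\<in>I. \<forall>\<^sub>F t. h t < g (x t) t)"
    using semiregular[OF A(1) k0] unfolding L by blast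
  have big: "\<forall>\<^sub>F t. e t \<le> g (k0 t) t"
  proof -
    have "\<not> (\<forall>\<^sub>F t. g (k0 t) t < e t)"
    proof
      assume "\<forall>\<^sub>F t. g (k0 t) t < e t"
      then have "\<forall>\<^sub>F t. g (k0 t) t \<le> e t" by eventually_elim simp
      with e(1) have "(\<lambda>t. g (k0 t) t) \<in> I" by (rule I_mono)
      then show False using notin by simp
    qed
    then show ?thesis by (simp add: ev_not[symmetric] not_less)
  qed
  define k where "k t = (LEAST k. e t \<le> g k t)" for t
  have k: "\<forall>\<^sub>F t. k t \<le> k0 t \<and> e t \<le> g (k t) t \<and> (\<forall>j<k t. g j t < e t)"
    using big
  proof eventually_elim
    case (elim t)
    then show ?case unfolding k_def
      using LeastI[of "\<lambda>k. e t \<le> g k t" "k0 t"] Least_le[of "\<lambda>k. e t \<le> g k t" "k0 t"]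
        not_less_Least[of _ "\<lambda>k. e t \<le> g k t"] by (metis not_le)
  qed
  then have kk0: "\<forall>\<^sub>F t. k t \<le> k0 t" by eventually_elim simp
  then have "k \<in> I" by (rule I_mono[OF k0])
  then have gk: "(\<lambda>t. g (k t) t) \<in> I" using k by (intro step[OF _ e(1)]) (auto elim: eventually_mono)
  have "\<not> (\<forall>\<^sub>F t. g (k t) t < e t)"
    unfolding ev_not[symmetric] using k by eventually_elim simp
  then have "\<forall>h\<in>I. \<forall>\<^sub>F t. h t < g (k t) t" using e(2)[OF kk0] by blast
  from bspec[OF this gk] have "\<forall>\<^sub>F t. g (k t) t < g (k t) t" .
  then show False using ev_const by simp
qed

end

text \<open>Codes carry finitely many parameters while assignments are infinite sequences; this
  lemma allows the assignments to be truncated.\<close>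

lemma sat_finite_dependence:
  "\<exists>N. \<forall>\<rho> \<rho>' \<sigma> \<sigma>'. (\<forall>k<N. \<rho> k = \<rho>' k) \<longrightarrow> (\<forall>X<N. \<sigma> X = \<sigma>' X) \<longrightarrow> sat \<rho> \<sigma> p = sat \<rho>' \<sigma>' p"
proof -
  have tm2: "\<exists>N. \<forall>\<rho> \<rho>'. (\<forall>k<N. \<rho> k = \<rho>' k) \<longrightarrow> evalT \<rho> t = evalT \<rho>' t \<and> evalT \<rho> u = evalT \<rho>' u"
    if "\<exists>N. \<forall>\<rho> \<rho>'. (\<forall>k<N. \<rho> k = \<rho>' k) \<longrightarrow> evalT \<rho> t = evalT \<rho>' t"
      "\<exists>N. \<forall>\<rho> \<rho>'. (\<forall>k<N. \<rho> k = \<rho>' k) \<longrightarrow> evalT \<rho> u = evalT \<rho>' u" for t u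
  proof -
    from that(1) obtain M where M: "\<forall>\<rho> \<rho>'. (\<forall>k<M. \<rho> k = \<rho>' k) \<longrightarrow> evalT \<rho> t = evalT \<rho>' t" ..
    from that(2) obtain N where N: "\<forall>\<rho> \<rho>'. (\<forall>k<N. \<rho> k = \<rho>' k) \<longrightarrow> evalT \<rho> u = evalT \<rho>' u" ..
    show ?thesis
    proof (intro exI[of _ "max M N"] allI impI)
      fix \<rho> \<rho>' :: "nat \<Rightarrow> nat" assume "\<forall>k<max M N. \<rho> k = \<rho>' k"
      then have "\<forall>k<M. \<rho> k = \<rho>' k" "\<forall>k<N. \<rho> k = \<rho>' k" by simp_all
      then show "evalT \<rho> t = evalT \<rho>' t \<and> evalT \<rho> u = evalT \<rho>' u" using M N by blast
    qed
  qed
  have tm: "\<exists>N. \<forall>\<rho> \<rho>'. (\<forall>k<N. \<rho> k = \<rho>' k) \<longrightarrow> evalT \<rho> t = evalT \<rho>' t" for t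
  proof (induction t)
    case (Plus t u)
    from tm2[OF this] show ?case unfolding evalT.simps by metis
  next
    case (Times t u)
    from tm2[OF this] show ?case unfolding evalT.simps by metis
  qed auto
  show ?thesis
  proof (induction p)
    case (Eq t u)
    from tm2[OF tm tm, of t u] show ?case unfolding sat.simps by metis
  next
    case (Less t u)
    from tm2[OF tm tm, of t u] show ?case unfolding sat.simps by metis
  next
    case (Mem t X)
    from tm[of t] obtain M where M: "\<forall>\<rho> \<rho>'. (\<forall>k<M. \<rho> k = \<rho>' k) \<longrightarrow> evalT \<rho> t = evalT \<rho>' t" ..
    show ?case
    proof (intro exI[of _ "max M (Suc X)"] allI impI)
      fix \<rho> \<rho>' :: "nat \<Rightarrow> nat" and \<sigma> \<sigma>' :: "nat \<Rightarrow> nat set"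
      assume h: "\<forall>k<max M (Suc X). \<rho> k = \<rho>' k" "\<forall>Y<max M (Suc X). \<sigma> Y = \<sigma>' Y"
      then have "\<forall>k<M. \<rho> k = \<rho>' k" "\<sigma> X = \<sigma>' X" by simp_all
      then show "sat \<rho> \<sigma> (Mem t X) = sat \<rho>' \<sigma>' (Mem t X)" using M by (metis sat.simps(4))
    qed
  next
    case (Imp p q)
    from Imp.IH obtain M N where
      M: "\<forall>\<rho> \<rho>' \<sigma> \<sigma>'. (\<forall>k<M. \<rho> k = \<rho>' k) \<longrightarrow> (\<forall>X<M. \<sigma> X = \<sigma>' X) \<longrightarrow> sat \<rho> \<sigma> p = sat \<rho>' \<sigma>' p" and
      N: "\<forall>\<rho> \<rho>' \<sigma> \<sigma>'. (\<forall>k<N. \<rho> k = \<rho>' k) \<longrightarrow> (\<forall>X<N. \<sigma> X = \<sigma>' X) \<longrightarrow> sat \<rho> \<sigma> q = sat \<rho>' \<sigma>' q" by (elim exE)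
    show ?case
    proof (intro exI[of _ "max M N"] allI impI)
      fix \<rho> \<rho>' :: "nat \<Rightarrow> nat" and \<sigma> \<sigma>' :: "nat \<Rightarrow> nat set"
      assume "\<forall>k<max M N. \<rho> k = \<rho>' k" "\<forall>Y<max M N. \<sigma> Y = \<sigma>' Y"
      then have "\<forall>k<M. \<rho> k = \<rho>' k" "\<forall>k<N. \<rho> k = \<rho>' k" "\<forall>k<M. \<sigma> k = \<sigma>' k" "\<forall>k<N. \<sigma> k = \<sigma>' k" by simp_all
      then show "sat \<rho> \<sigma> (Imp p q) = sat \<rho>' \<sigma>' (Imp p q)"
        using M[rule_format, of \<rho> \<rho>' \<sigma> \<sigma>'] N[rule_format, of \<rho> \<rho>' \<sigma> \<sigma>'] by simp
    qed
  next
    case (AllN p)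
    then obtain N where
      "\<forall>\<rho> \<rho>' \<sigma> \<sigma>'. (\<forall>k<N. \<rho> k = \<rho>' k) \<longrightarrow> (\<forall>X<N. \<sigma> X = \<sigma>' X) \<longrightarrow> sat \<rho> \<sigma> p = sat \<rho>' \<sigma>' p" ..
    note N = this[rule_format]
    have "sat \<rho> \<sigma> (AllN p) = sat \<rho>' \<sigma>' (AllN p)"
      if "\<forall>k<N. \<rho> k = \<rho>' k" "\<forall>X<N. \<sigma> X = \<sigma>' X" for \<rho> \<rho>' :: "nat \<Rightarrow> nat" and \<sigma> \<sigma>' :: "nat \<Rightarrow> nat set"
    proof -
      have "\<forall>k<N. case_nat n \<rho> k = case_nat n \<rho>' k" for n using that(1) by (auto split: nat.split)
      then show ?thesis using N[of "case_nat n \<rho>" "case_nat n \<rho>'" \<sigma> \<sigma>' for n] that(2) by simp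
    qed
    then show ?case by blast
  next
    case (AllS p)
    then obtain N where
      "\<forall>\<rho> \<rho>' \<sigma> \<sigma>'. (\<forall>k<N. \<rho> k = \<rho>' k) \<longrightarrow> (\<forall>X<N. \<sigma> X = \<sigma>' X) \<longrightarrow> sat \<rho> \<sigma> p = sat \<rho>' \<sigma>' p" ..
    note N = this[rule_format]
    have "sat \<rho> \<sigma> (AllS p) = sat \<rho>' \<sigma>' (AllS p)"
      if "\<forall>k<N. \<rho> k = \<rho>' k" "\<forall>X<N. \<sigma> X = \<sigma>' X" for \<rho> \<rho>' :: "nat \<Rightarrow> nat" and \<sigma> \<sigma>' :: "nat \<Rightarrow> nat set"
    proof -
      have "\<forall>X<N. case_nat A \<sigma> X = case_nat A \<sigma>' X" for A using that(2) by (auto split: nat.split)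
      then show ?thesis using N[of \<rho> \<rho>' "case_nat A \<sigma>" "case_nat A \<sigma>'" for A] that(1) by simp
    qed
    then show ?case by blast
  qed auto
qed

text \<open>The operations under which the sets of the model are closed.  In \<open>O_comp\<close>, the number \<open>d\<close> is a
  fixed bound above the cut.\<close>

datatype opsym = O_rel fm | O_comp fm fm | O_diff | O_base | O_seq | O_seq_row | O_goodstein | O_pow
  | O_upgrade | O_bracket | O_bracket_val | O_iter | O_iter_val | O_stage | O_stage_row | O_stage_max

instance tm :: countable by countable_datatype
instance fm :: countable by countable_datatype
instance opsym :: countable by countable_datatype

definition lassign :: "nat list \<Rightarrow> nat \<Rightarrow> nat" where "lassign l k = (if k < length l then l ! k else 0)"
definition sassign :: "nat set list \<Rightarrow> nat \<Rightarrow> nat set" where "sassign l k = (if k < length l then l ! k else {})"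

text \<open>The variants ending in \<open>_val\<close>, as well as \<open>O_stage_max\<close>, are
  graphs of total functions, as \<open>values_bounded\<close> requires; the corresponding relations
  without \<open>the_enat\<close> are undefined at the value \<open>\<infinity>\<close>, as in the
  formulas. Operations ending in \<open>_row\<close> return a single row as a set, so that it can be
  an argument of further operations.\<close>

fun opint :: "nat set \<Rightarrow> opsym \<Rightarrow> nat \<Rightarrow> nat set list \<Rightarrow> nat list \<Rightarrow> nat set" where
  "opint B0 (O_rel q) d Ss l = {pair x y | x y. sat (case_nat y (case_nat x (lassign l))) (sassign Ss) q}"
| "opint B0 (O_comp p q) d Ss l = {x. \<exists>y<d. sat (case_nat y (case_nat x (lassign l))) (sassign Ss) p \<and>
     (\<forall>z\<le>y. sat (case_nat z (case_nat x (lassign l))) (sassign Ss) q)}"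
| "opint B0 O_diff d Ss l = {z. (z \<in> Ss ! 0) \<noteq> (z \<in> Ss ! 1)}"
| "opint B0 O_base d Ss l = B0"
| "opint B0 O_seq d Ss l = {pair i x | i x. x \<in> ouroboros_seq B0 i}"
| "opint B0 O_seq_row d Ss l = ouroboros_seq B0 (l ! 0)"
| "opint B0 O_goodstein d Ss l = {pair j x | j x. goodstein (ouroboros_seq B0) (l ! 0) j = enat x}"
| "opint B0 O_pow d Ss l = {pair k x | k x. x = (l ! 0) ^ k}"
| "opint B0 O_upgrade d Ss l = {pair k x | k x. upgrade (Ss ! 0) (Ss ! 1) k = enat x}"
| "opint B0 O_bracket d Ss l = {pair k x | k x. bracket (upgrade (Ss ! 0) (Ss ! 1)) (l ! 0) (l ! 1) k = enat x}"
| "opint B0 O_bracket_val d Ss l = {pair k x | k x. x = the_enat (bracket (upgrade (Ss ! 0) (Ss ! 1)) (l ! 0) (l ! 1) k)}"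
| "opint B0 O_iter d Ss l = {pair k x | k x. (d_step (Ss ! 0) (Ss ! 1) (l ! 0) ^^ k) (enat (l ! 1)) = enat x}"
| "opint B0 O_iter_val d Ss l = {pair k x | k x. x = the_enat ((d_step (Ss ! 0) (Ss ! 1) (l ! 0) ^^ k) (enat (l ! 1)))}"
| "opint B0 O_stage d Ss l = {pair k x | k x. x \<in> plus_stage (Ss ! 0) (l ! 0) k}"
| "opint B0 O_stage_row d Ss l = plus_stage (Ss ! 0) (l ! 0) (l ! 1)"
| "opint B0 O_stage_max d Ss l = {pair k x | k x. x = Max (plus_stage (Ss ! 0) (l ! 0) k)}"

locale rca0_model = model F "\<lambda>i. opint B0 (from_nat i)" \<tau> for F B0 \<tau>
begin

lemma S_opint:
  assumes "set As \<subseteq> S" "set fs \<subseteq> I"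
  shows "(\<lambda>t. opint B0 s (top_bound t) (map (\<lambda>A. A t) As) (map (\<lambda>f. f t) fs)) \<in> S"
  using S_op[OF assms, of "to_nat s"] by simp

section \<open>Truth in the model and soundness of the calculus\<close>

primrec msat :: "(nat \<Rightarrow> nat \<Rightarrow> nat) \<Rightarrow> (nat \<Rightarrow> nat \<Rightarrow> nat set) \<Rightarrow> fm \<Rightarrow> bool" where
  "msat \<rho> \<sigma> Fls \<longleftrightarrow> False"
| "msat \<rho> \<sigma> (Eq a b) \<longleftrightarrow> (\<forall>\<^sub>F t. evalT (\<lambda>k. \<rho> k t) a = evalT (\<lambda>k. \<rho> k t) b)"
| "msat \<rho> \<sigma> (Less a b) \<longleftrightarrow> (\<forall>\<^sub>F t. evalT (\<lambda>k. \<rho> k t) a < evalT (\<lambda>k. \<rho> k t) b)"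
| "msat \<rho> \<sigma> (Mem a X) \<longleftrightarrow> (\<forall>\<^sub>F t. evalT (\<lambda>k. \<rho> k t) a \<in> \<sigma> X t)"
| "msat \<rho> \<sigma> (Imp p q) \<longleftrightarrow> (msat \<rho> \<sigma> p \<longrightarrow> msat \<rho> \<sigma> q)"
| "msat \<rho> \<sigma> (AllN p) \<longleftrightarrow> (\<forall>f\<in>I. msat (case_nat f \<rho>) \<sigma> p)"
| "msat \<rho> \<sigma> (AllS p) \<longleftrightarrow> (\<forall>A\<in>S. msat \<rho> (case_nat A \<sigma>) p)"

abbreviation evalN :: "(nat \<Rightarrow> nat \<Rightarrow> nat) \<Rightarrow> tm \<Rightarrow> nat \<Rightarrow> nat" where
  "evalN \<rho> a \<equiv> (\<lambda>t. evalT (\<lambda>k. \<rho> k t) a)"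

lemma evalN_I: "range \<rho> \<subseteq> I \<Longrightarrow> evalN \<rho> a \<in> I"
  by (induction a) (auto intro: I_const I_add I_mult)

lemma case_nat_apply: "(\<lambda>k. (case_nat f \<rho> k) t) = case_nat (f t) (\<lambda>k. \<rho> k t)"
  by (rule ext) (simp split: nat.split)

lemma case_nat_range: "x \<in> A \<Longrightarrow> range \<rho> \<subseteq> A \<Longrightarrow> range (case_nat x \<rho>) \<subseteq> A"
  by (auto simp: image_subset_iff split: nat.split)

lemma msat_subF: "msat \<rho> \<sigma> (subF f g p) \<longleftrightarrow> msat (\<lambda>k. evalN \<rho> (f k)) (\<lambda>X. \<sigma> (g X)) p"
proof (induction p arbitrary: \<rho> \<sigma> f g)
  case (AllN p)
  have "(\<lambda>k. evalN (case_nat h \<rho>) (case_nat (Var 0) (\<lambda>k. liftT (f k)) k)) =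
      case_nat h (\<lambda>k. evalN \<rho> (f k))" for h
    by (rule ext) (simp add: eval_subT split: nat.split)
  then show ?case using AllN by simp
next
  case (AllS p)
  have "(\<lambda>X. case_nat A \<sigma> (case_nat 0 (\<lambda>k. Suc (g k)) X)) = case_nat A (\<lambda>X. \<sigma> (g X))" for A
    by (rule ext) (simp split: nat.split)
  then show ?case using AllS by simp
qed (simp_all add: eval_subT)

lemma evalT_cong_ev:
  assumes "\<And>k. \<forall>\<^sub>F t. \<rho> k t = \<rho>' k t" shows "\<forall>\<^sub>F t. evalN \<rho> a t = evalN \<rho>' a t"
proof (induction a)
  case (Plus a b) then show ?case by eventually_elim simp
next
  case (Times a b) then show ?case by eventually_elim simp
qed (use assms in auto)

text \<open>Elements of the model are functions and not classes modulo \<open>F\<close>, so the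
  equality axioms need this invariance.\<close>

lemma msat_cong_ev:
  "(\<And>k. \<forall>\<^sub>F t. \<rho> k t = \<rho>' k t) \<Longrightarrow> msat \<rho> \<sigma> p = msat \<rho>' \<sigma> p"
proof (induction p arbitrary: \<rho> \<rho>' \<sigma>)
  case (Eq a b)
  have "\<forall>\<^sub>F t. (evalN \<rho> a t = evalN \<rho> b t) \<longleftrightarrow> (evalN \<rho>' a t = evalN \<rho>' b t)"
    using evalT_cong_ev[of \<rho> \<rho>' a, OF Eq] evalT_cong_ev[of \<rho> \<rho>' b, OF Eq] by eventually_elim simp
  then show ?case by (simp add: ev_iff)
next
  case (Less a b)
  have "\<forall>\<^sub>F t. (evalN \<rho> a t < evalN \<rho> b t) \<longleftrightarrow> (evalN \<rho>' a t < evalN \<rho>' b t)"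
    using evalT_cong_ev[of \<rho> \<rho>' a, OF Less] evalT_cong_ev[of \<rho> \<rho>' b, OF Less] by eventually_elim simp
  then show ?case by (simp add: ev_iff)
next
  case (Mem a X)
  have "\<forall>\<^sub>F t. (evalN \<rho> a t \<in> \<sigma> X t) \<longleftrightarrow> (evalN \<rho>' a t \<in> \<sigma> X t)"
    using evalT_cong_ev[of \<rho> \<rho>' a, OF Mem] by eventually_elim simp
  then show ?case by (simp add: ev_iff)
next
  case (Imp p q)
  have "msat \<rho> \<sigma> p = msat \<rho>' \<sigma> p" by (rule Imp.IH(1)) (rule Imp.prems)
  moreover have "msat \<rho> \<sigma> q = msat \<rho>' \<sigma> q" by (rule Imp.IH(2)) (rule Imp.prems)
  ultimately show ?case by simp
next
  case (AllN p)
  have "\<forall>\<^sub>F t. case_nat f \<rho> k t = case_nat f \<rho>' k t" for f k using AllN.prems by (simp split: nat.split)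
  then have "msat (case_nat f \<rho>) \<sigma> p = msat (case_nat f \<rho>') \<sigma> p" for f by (rule AllN.IH)
  then show ?case by simp
next
  case (AllS p)
  have "msat \<rho> (case_nat A \<sigma>) p = msat \<rho>' (case_nat A \<sigma>) p" for A by (rule AllS.IH) (rule AllS.prems)
  then show ?case by simp
qed auto

lemma msat_instN: "msat \<rho> \<sigma> (instN p a) \<longleftrightarrow> msat (case_nat (evalN \<rho> a) \<rho>) \<sigma> p"
proof -
  have "(\<lambda>k. evalN \<rho> (case_nat a Var k)) = case_nat (evalN \<rho> a) \<rho>" by (rule ext) (simp split: nat.split)
  then show ?thesis by (simp add: msat_subF)
qed

lemma msat_instS: "msat \<rho> \<sigma> (instS p X) \<longleftrightarrow> msat \<rho> (case_nat (\<sigma> X) \<sigma>) p"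
proof -
  have "(\<lambda>k. \<sigma> (case_nat X id k)) = case_nat (\<sigma> X) \<sigma>" by (rule ext) (simp split: nat.split)
  then show ?thesis by (simp add: msat_subF)
qed

text \<open>This is the theorem of Los for bounded formulas. It survives the restriction to the cut
  because a counterexample chosen coordinatewise lies below the value of a term and hence in
  \<open>I\<close>.\<close>

lemma msat_bounded:
  assumes "bounded p" "range \<rho> \<subseteq> I"
  shows "msat \<rho> \<sigma> p \<longleftrightarrow> (\<forall>\<^sub>F t. sat (\<lambda>k. \<rho> k t) (\<lambda>X. \<sigma> X t) p)"
  using assms
proof (induction arbitrary: \<rho> rule: bounded.induct)
  case 1 then show ?case by (simp add: ev_const)
next
  case (5 p q) then show ?case by (simp add: ev_imp)
next
  case (6 p a)
  have lift: "evalN (case_nat f \<rho>) (liftT a) = evalN \<rho> a" for f by (simp add: eval_subT)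
  have "(\<forall>f\<in>I. (\<forall>\<^sub>F t. f t < evalN \<rho> a t) \<longrightarrow> (\<forall>\<^sub>F t. sat (case_nat (f t) (\<lambda>k. \<rho> k t)) (\<lambda>X. \<sigma> X t) p)) \<longleftrightarrow>
     (\<forall>\<^sub>F t. \<forall>x<evalN \<rho> a t. sat (case_nat x (\<lambda>k. \<rho> k t)) (\<lambda>X. \<sigma> X t) p)" (is "?L \<longleftrightarrow> ?R")
  proof
    assume ?R
    then show ?L by (auto elim: eventually_elim2)
  next
    assume L: ?L
    show ?R
    proof (rule ccontr)
      assume "\<not> ?R"
      then have n: "\<forall>\<^sub>F t. \<not> (\<forall>x<evalN \<rho> a t. sat (case_nat x (\<lambda>k. \<rho> k t)) (\<lambda>X. \<sigma> X t) p)" unfolding ev_not .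
      define f where "f t = (SOME x. x < evalN \<rho> a t \<and> \<not> sat (case_nat x (\<lambda>k. \<rho> k t)) (\<lambda>X. \<sigma> X t) p)" for t
      have f: "\<forall>\<^sub>F t. f t < evalN \<rho> a t \<and> \<not> sat (case_nat (f t) (\<lambda>k. \<rho> k t)) (\<lambda>X. \<sigma> X t) p"
        using n by eventually_elim (unfold f_def, rule someI_ex, blast)
      then have f1: "\<forall>\<^sub>F t. f t < evalN \<rho> a t" by eventually_elim simp
      then have "\<forall>\<^sub>F t. f t \<le> evalN \<rho> a t" by eventually_elim simp
      then have "f \<in> I" by (rule I_mono[OF evalN_I[OF 6(3)]])
      then have "\<forall>\<^sub>F t. sat (case_nat (f t) (\<lambda>k. \<rho> k t)) (\<lambda>X. \<sigma> X t) p" using L f1 by blast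
      then have "\<forall>\<^sub>F t. False" using f by eventually_elim simp
      then show False by (simp add: ev_const)
    qed
  qed
  then show ?case using 6(2)[OF case_nat_range[OF _ 6(3)]] lift
    by (simp add: case_nat_apply eval_subT)
qed auto

lemma S_rel:
  assumes "range \<rho> \<subseteq> I" "range \<sigma> \<subseteq> S"
  obtains A where "A \<in> S"
    "\<And>t x y. pair x y \<in> A t \<longleftrightarrow> sat (case_nat y (case_nat x (\<lambda>k. \<rho> k t))) (\<lambda>X. \<sigma> X t) q"
proof -
  from sat_finite_dependence[of q] obtain N where
    "\<forall>\<rho> \<rho>' \<sigma> \<sigma>'. (\<forall>k<N. \<rho> k = \<rho>' k) \<longrightarrow> (\<forall>X<N. \<sigma> X = \<sigma>' X) \<longrightarrow> sat \<rho> \<sigma> q = sat \<rho>' \<sigma>' q" ..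
  note N = this[rule_format]
  let ?l = "\<lambda>t. map (\<lambda>f. f t) (map \<rho> [0..<N])" and ?s = "\<lambda>t. map (\<lambda>A. A t) (map \<sigma> [0..<N])"
  have "(\<lambda>t. opint B0 (O_rel q) (top_bound t) (?s t) (?l t)) \<in> S"
    using assms by (intro S_opint) auto
  then show thesis
  proof (rule that)
    fix t x y
    have "sat (case_nat y (case_nat x (lassign (?l t)))) (sassign (?s t)) q =
      sat (case_nat y (case_nat x (\<lambda>k. \<rho> k t))) (\<lambda>X. \<sigma> X t) q"
      by (rule N; auto simp: lassign_def sassign_def split: nat.split)
    then show "pair x y \<in> opint B0 (O_rel q) (top_bound t) (?s t) (?l t) \<longleftrightarrow>
      sat (case_nat y (case_nat x (\<lambda>k. \<rho> k t))) (\<lambda>X. \<sigma> X t) q"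
      by simp
  qed
qed

lemma S_comp:
  assumes "range \<rho> \<subseteq> I" "range \<sigma> \<subseteq> S"
  obtains A where "A \<in> S"
    "\<And>t x. x \<in> A t \<longleftrightarrow> (\<exists>y<top_bound t. sat (case_nat y (case_nat x (\<lambda>k. \<rho> k t))) (\<lambda>X. \<sigma> X t) p \<and>
       (\<forall>z\<le>y. sat (case_nat z (case_nat x (\<lambda>k. \<rho> k t))) (\<lambda>X. \<sigma> X t) q))"
proof -
  from sat_finite_dependence[of p] obtain M where
    "\<forall>\<rho> \<rho>' \<sigma> \<sigma>'. (\<forall>k<M. \<rho> k = \<rho>' k) \<longrightarrow> (\<forall>X<M. \<sigma> X = \<sigma>' X) \<longrightarrow> sat \<rho> \<sigma> p = sat \<rho>' \<sigma>' p" ..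
  note M = this[rule_format]
  from sat_finite_dependence[of q] obtain N where
    "\<forall>\<rho> \<rho>' \<sigma> \<sigma>'. (\<forall>k<N. \<rho> k = \<rho>' k) \<longrightarrow> (\<forall>X<N. \<sigma> X = \<sigma>' X) \<longrightarrow> sat \<rho> \<sigma> q = sat \<rho>' \<sigma>' q" ..
  note N = this[rule_format]
  let ?l = "\<lambda>t. map (\<lambda>f. f t) (map \<rho> [0..<max M N])" and ?s = "\<lambda>t. map (\<lambda>A. A t) (map \<sigma> [0..<max M N])"
  have "(\<lambda>t. opint B0 (O_comp p q) (top_bound t) (?s t) (?l t)) \<in> S"
    using assms by (intro S_opint) auto
  then show thesis
  proof (rule that)
    fix t x
    have "sat (case_nat y (case_nat x (lassign (?l t)))) (sassign (?s t)) p =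
      sat (case_nat y (case_nat x (\<lambda>k. \<rho> k t))) (\<lambda>X. \<sigma> X t) p" for y
      by (rule M; auto simp: lassign_def sassign_def split: nat.split)
    moreover have "sat (case_nat y (case_nat x (lassign (?l t)))) (sassign (?s t)) q =
      sat (case_nat y (case_nat x (\<lambda>k. \<rho> k t))) (\<lambda>X. \<sigma> X t) q" for y
      by (rule N; auto simp: lassign_def sassign_def split: nat.split)
    ultimately show "x \<in> opint B0 (O_comp p q) (top_bound t) (?s t) (?l t) \<longleftrightarrow>
      (\<exists>y<top_bound t. sat (case_nat y (case_nat x (\<lambda>k. \<rho> k t))) (\<lambda>X. \<sigma> X t) p \<and>
       (\<forall>z\<le>y. sat (case_nat z (case_nat x (\<lambda>k. \<rho> k t))) (\<lambda>X. \<sigma> X t) q))"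
      by simp
  qed
qed

text \<open>One bound \<open>e\<close> serves all arguments up to \<open>m\<close>, which replaces
  an existential quantifier over the cut by an internal one.\<close>

lemma bounded_witness:
  assumes "A \<in> S" "m \<in> I"
  obtains e where "e \<in> I" "\<And>x. \<forall>\<^sub>F t. x t \<le> m t \<Longrightarrow>
     (\<exists>y\<in>I. \<forall>\<^sub>F t. pair (x t) (y t) \<in> A t) \<longleftrightarrow> (\<forall>\<^sub>F t. \<exists>y<e t. pair (x t) y \<in> A t)"
proof -
  obtain e where e: "e \<in> I" "\<And>x. \<forall>\<^sub>F t. x t \<le> m t \<Longrightarrow>
     (\<forall>\<^sub>F t. (LEAST y. pair (x t) y \<in> A t) < e t) \<or> (\<forall>g\<in>I. \<forall>\<^sub>F t. g t < (LEAST y. pair (x t) y \<in> A t))"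
    using semiregular[OF assms] by blast
  show thesis
  proof (rule that[OF e(1)], rule iffI)
    fix x
    assume x: "\<forall>\<^sub>F t. x t \<le> m t"
    show "\<forall>\<^sub>F t. \<exists>y<e t. pair (x t) y \<in> A t" if wit: "\<exists>y\<in>I. \<forall>\<^sub>F t. pair (x t) (y t) \<in> A t"
    proof -
      obtain y where y: "y \<in> I" "\<forall>\<^sub>F t. pair (x t) (y t) \<in> A t" using wit by blast
      have "\<forall>\<^sub>F t. \<not> y t < (LEAST y. pair (x t) y \<in> A t)"
        using y(2) by eventually_elim (auto simp: not_less intro: Least_le)
      then have "\<not> (\<forall>\<^sub>F t. y t < (LEAST y. pair (x t) y \<in> A t))" unfolding ev_not .
      then have "\<forall>\<^sub>F t. (LEAST y. pair (x t) y \<in> A t) < e t" using e(2)[OF x] y(1) by blast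
      then show ?thesis using y(2)
      proof eventually_elim
        case (elim t)
        then show ?case using LeastI[of "\<lambda>y. pair (x t) y \<in> A t" "y t"] by blast
      qed
    qed
    assume ex: "\<forall>\<^sub>F t. \<exists>y<e t. pair (x t) y \<in> A t"
    define y where "y t = (SOME y. y < e t \<and> pair (x t) y \<in> A t)" for t
    have y: "\<forall>\<^sub>F t. y t < e t \<and> pair (x t) (y t) \<in> A t"
      using ex by eventually_elim (unfold y_def, rule someI_ex, blast)
    then have "\<forall>\<^sub>F t. y t \<le> e t" by eventually_elim simp
    then have "y \<in> I" by (rule I_mono[OF e(1)])
    moreover have "\<forall>\<^sub>F t. pair (x t) (y t) \<in> A t" using y by eventually_elim simp
    ultimately show "\<exists>y\<in>I. \<forall>\<^sub>F t. pair (x t) (y t) \<in> A t" by blast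
  qed
qed

lemma msat_Sigma01:
  assumes "bounded q" "range \<rho> \<subseteq> I" "x \<in> I"
  shows "msat (case_nat x \<rho>) \<sigma> (ExN q) \<longleftrightarrow>
    (\<exists>y\<in>I. \<forall>\<^sub>F t. sat (case_nat (y t) (case_nat (x t) (\<lambda>k. \<rho> k t))) (\<lambda>X. \<sigma> X t) q)"
proof -
  have "msat (case_nat y (case_nat x \<rho>)) \<sigma> q \<longleftrightarrow>
     (\<forall>\<^sub>F t. sat (case_nat (y t) (case_nat (x t) (\<lambda>k. \<rho> k t))) (\<lambda>X. \<sigma> X t) q)" if "y \<in> I" for y
    using msat_bounded[OF assms(1) case_nat_range[OF that case_nat_range[OF assms(3,2)]]]
    by (simp add: case_nat_apply)
  then show ?thesis by auto
qed

text \<open>Up to \<open>x0\<close> the formula is equivalent to an internal predicate with a single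
  witness bound \<open>e\<close>. If the latter fails at \<open>x0\<close>, it has a least failure
  \<open>w\<close> in almost every coordinate, and the step from the predecessor of \<open>w\<close>
  gives a contradiction.\<close>

lemma Sigma01_induction:
  assumes q: "bounded q" and \<rho>: "range \<rho> \<subseteq> I" "range \<sigma> \<subseteq> S"
    and zero: "msat (case_nat (\<lambda>t. 0) \<rho>) \<sigma> (ExN q)"
    and step: "\<And>x. x \<in> I \<Longrightarrow> msat (case_nat x \<rho>) \<sigma> (ExN q) \<Longrightarrow> msat (case_nat (\<lambda>t. x t + 1) \<rho>) \<sigma> (ExN q)"
    and x0: "x0 \<in> I"
  shows "msat (case_nat x0 \<rho>) \<sigma> (ExN q)"
proof (rule ccontr)
  assume not: "\<not> ?thesis"
  obtain A where A: "A \<in> S" "\<And>t x y. pair x y \<in> A t \<longleftrightarrow> sat (case_nat y (case_nat x (\<lambda>k. \<rho> k t))) (\<lambda>X. \<sigma> X t) q"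
    using S_rel[OF \<rho>] by blast
  obtain e where e: "e \<in> I" "\<And>x. \<forall>\<^sub>F t. x t \<le> x0 t \<Longrightarrow>
     (\<exists>y\<in>I. \<forall>\<^sub>F t. pair (x t) (y t) \<in> A t) \<longleftrightarrow> (\<forall>\<^sub>F t. \<exists>y<e t. pair (x t) y \<in> A t)"
    using bounded_witness[OF A(1) x0] by blast
  have sat: "msat (case_nat x \<rho>) \<sigma> (ExN q) \<longleftrightarrow> (\<forall>\<^sub>F t. \<exists>y<e t. pair (x t) y \<in> A t)"
    if "\<forall>\<^sub>F t. x t \<le> x0 t" for x
    using e(2)[OF that] msat_Sigma01[OF q \<rho>(1) I_mono[OF x0 that]] by (simp add: A(2))
  define w where "w t = (LEAST x. \<not> (\<exists>y<e t. pair x y \<in> A t))" for t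
  have "\<not> (\<forall>\<^sub>F t. \<exists>y<e t. pair (x0 t) y \<in> A t)" using not sat[of x0] by simp
  then have "\<forall>\<^sub>F t. \<not> (\<exists>y<e t. pair (x0 t) y \<in> A t)" unfolding ev_not .
  then have w: "\<forall>\<^sub>F t. w t \<le> x0 t \<and> \<not> (\<exists>y<e t. pair (w t) y \<in> A t)"
  proof eventually_elim
    case (elim t)
    then show ?case unfolding w_def
      using LeastI[of "\<lambda>x. \<not> (\<exists>y<e t. pair x y \<in> A t)" "x0 t"] Least_le[of "\<lambda>x. \<not> (\<exists>y<e t. pair x y \<in> A t)" "x0 t"]
      by blast
  qed
  then have wx: "\<forall>\<^sub>F t. w t \<le> x0 t" by eventually_elim simp
  have "\<forall>\<^sub>F t. \<not> (\<exists>y<e t. pair (w t) y \<in> A t)" using w by eventually_elim simp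
  then have notw: "\<not> msat (case_nat w \<rho>) \<sigma> (ExN q)" unfolding sat[OF wx] unfolding ev_not not_not .
  define x where "x t = w t - 1" for t
  have "\<forall>\<^sub>F t. \<exists>y<e t. pair 0 y \<in> A t" using sat[of "\<lambda>t. 0"] zero by simp
  then have pos: "\<forall>\<^sub>F t. 0 < w t" using w by eventually_elim (metis gr0I)
  have xx: "\<forall>\<^sub>F t. x t \<le> x0 t" using wx by eventually_elim (simp add: x_def)
  have "\<forall>\<^sub>F t. \<exists>y<e t. pair (x t) y \<in> A t"
    using pos
  proof eventually_elim
    case (elim t)
    then have "x t < w t" by (simp add: x_def)
    then show ?case using not_less_Least[of "x t" "\<lambda>x. \<not> (\<exists>y<e t. pair x y \<in> A t)"] unfolding w_def by blast
  qed
  then have "msat (case_nat (\<lambda>t. x t + 1) \<rho>) \<sigma> (ExN q)"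
    using step[OF I_mono[OF x0 xx]] sat[OF xx] by blast
  moreover have "\<forall>\<^sub>F t. case_nat (\<lambda>t. x t + 1) \<rho> k t = case_nat w \<rho> k t" for k
    using pos by (cases k) (auto simp: x_def elim: eventually_mono)
  ultimately show False using notw msat_cong_ev by blast
qed

text \<open>The set consists of those \<open>x\<close> for which a search below
  \<open>top_bound\<close> meets a witness of \<open>p\<close> before any counterexample to
  \<open>q\<close>. By \<open>iff\<close>, a witness in the cut excludes counterexamples in the cut,
  and a counterexample in the cut stops the search before it leaves the cut.\<close>

lemma Delta01_comprehension:
  assumes p: "bounded p" "bounded q" and \<rho>: "range \<rho> \<subseteq> I" "range \<sigma> \<subseteq> S"
    and iff: "\<And>x. x \<in> I \<Longrightarrow> msat (case_nat x \<rho>) \<sigma> (ExN p) \<longleftrightarrow> msat (case_nat x \<rho>) \<sigma> (AllN q)"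
  shows "\<exists>A\<in>S. \<forall>x\<in>I. (\<forall>\<^sub>F t. x t \<in> A t) \<longleftrightarrow> msat (case_nat x \<rho>) \<sigma> (ExN p)"
proof -
  let ?s = "\<lambda>r x y t. sat (case_nat y (case_nat x (\<lambda>k. \<rho> k t))) (\<lambda>X. \<sigma> X t) r"
  obtain A where A: "A \<in> S" "\<And>t x. x \<in> A t \<longleftrightarrow> (\<exists>y<top_bound t. ?s p x y t \<and> (\<forall>z\<le>y. ?s q x z t))"
    using S_comp[OF \<rho>, where p = p and q = q] by blast
  have mp: "msat (case_nat x \<rho>) \<sigma> (ExN p) \<longleftrightarrow> (\<exists>y\<in>I. \<forall>\<^sub>F t. ?s p (x t) (y t) t)" if "x \<in> I" for x
    by (rule msat_Sigma01[OF p(1) \<rho>(1) that])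
  have mq: "msat (case_nat x \<rho>) \<sigma> (AllN q) \<longleftrightarrow> (\<forall>y\<in>I. \<forall>\<^sub>F t. ?s q (x t) (y t) t)" if "x \<in> I" for x
    using msat_bounded[OF p(2) case_nat_range[OF _ case_nat_range[OF that \<rho>(1)]]] by (simp add: case_nat_apply)
  show ?thesis
  proof (intro bexI[OF _ A(1)] ballI iffI)
    fix x assume x: "x \<in> I"
    assume "msat (case_nat x \<rho>) \<sigma> (ExN p)"
    then obtain y where y: "y \<in> I" "\<forall>\<^sub>F t. ?s p (x t) (y t) t" and q: "\<And>z. z \<in> I \<Longrightarrow> \<forall>\<^sub>F t. ?s q (x t) (z t) t"
      using mp[OF x] mq[OF x] iff[OF x] by blast
    have "\<forall>\<^sub>F t. \<forall>z\<le>y t. ?s q (x t) z t"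
    proof (rule ccontr)
      assume "\<not> ?thesis"
      then have n: "\<forall>\<^sub>F t. \<not> (\<forall>z\<le>y t. ?s q (x t) z t)" unfolding ev_not .
      define z where "z t = (SOME z. z \<le> y t \<and> \<not> ?s q (x t) z t)" for t
      have z: "\<forall>\<^sub>F t. z t \<le> y t \<and> \<not> ?s q (x t) (z t) t"
        using n by eventually_elim (unfold z_def, rule someI_ex, blast)
      then have "\<forall>\<^sub>F t. z t \<le> y t" by eventually_elim simp
      then have "\<forall>\<^sub>F t. ?s q (x t) (z t) t" by (intro q I_mono[OF y(1)])
      then have "\<forall>\<^sub>F t. False" using z by eventually_elim simp
      then show False by (simp add: ev_const)
    qed
    then show "\<forall>\<^sub>F t. x t \<in> A t"
      using y(2) I_top_bound[OF y(1)] by eventually_elim (auto simp: A(2))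
  next
    fix x assume x: "x \<in> I"
    assume "\<forall>\<^sub>F t. x t \<in> A t"
    then have ex: "\<forall>\<^sub>F t. \<exists>y<top_bound t. ?s p (x t) y t \<and> (\<forall>z\<le>y. ?s q (x t) z t)" by (simp add: A(2))
    define y where "y t = (SOME y. ?s p (x t) y t \<and> (\<forall>z\<le>y. ?s q (x t) z t))" for t
    have y: "\<forall>\<^sub>F t. ?s p (x t) (y t) t \<and> (\<forall>z\<le>y t. ?s q (x t) z t)"
      using ex by eventually_elim (unfold y_def, rule someI_ex, blast)
    show "msat (case_nat x \<rho>) \<sigma> (ExN p)"
    proof (rule ccontr)
      assume n: "\<not> ?thesis"
      \<comment> \<open>If \<open>p\<close> has no witness in the cut, then \<open>q\<close> fails
        at some \<open>z\<close> of the cut. Since \<open>q\<close> holds up to the accepted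
        \<open>y\<close>, this \<open>y\<close> is at most \<open>z\<close>, so it is a witness in
        the cut after all.\<close>
      then obtain z where z: "z \<in> I" "\<not> (\<forall>\<^sub>F t. ?s q (x t) (z t) t)" using iff[OF x] mq[OF x] by blast
      have "\<forall>\<^sub>F t. y t \<le> z t"
        using z(2)[folded ev_not] y by eventually_elim (metis nat_le_linear)
      then have "y \<in> I" by (rule I_mono[OF z(1)])
      moreover have "\<forall>\<^sub>F t. ?s p (x t) (y t) t" using y by eventually_elim simp
      ultimately show False using n mp[OF x] by blast
    qed
  qed
qed

theorem RCA0_sound_model:
  "RCA\<^sub>0 \<turnstile> p \<Longrightarrow> range \<rho> \<subseteq> I \<Longrightarrow> range \<sigma> \<subseteq> S \<Longrightarrow> msat \<rho> \<sigma> p"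
proof (induction arbitrary: \<rho> \<sigma> rule: RCA0.induct)
  case (ax_instN p a)
  then show ?case using evalN_I[of \<rho> a] by (simp add: msat_instN)
next
  case (ax_instS p X)
  then show ?case by (auto simp: msat_instS)
next
  case (ax_subst a b p)
  have "\<forall>\<^sub>F t. case_nat (evalN \<rho> a) \<rho> k t = case_nat (evalN \<rho> b) \<rho> k t"
    if "\<forall>\<^sub>F t. evalN \<rho> a t = evalN \<rho> b t" for k
    using that by (simp split: nat.split)
  then show ?case using msat_cong_ev[of "case_nat (evalN \<rho> a) \<rho>" "case_nat (evalN \<rho> b) \<rho>"]
    by (simp only: msat.simps msat_instN) blast
next
  case (GenN p)
  show ?case unfolding msat.simps by (intro ballI GenN.IH case_nat_range GenN.prems)
next
  case (GenS p)
  show ?case unfolding msat.simps by (intro ballI GenS.IH case_nat_range GenS.prems)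
next
  case (ax_ind p)
  then obtain q where q: "bounded q" "p = ExN q" by (auto simp: Sigma01_def)
  have eq: "(\<lambda>k. evalN (case_nat x \<rho>) (case_nat (Plus (Var 0) One) (\<lambda>k. Var (Suc k)) k)) = case_nat (\<lambda>t. x t + 1) \<rho>" for x
    by (rule ext) (simp split: nat.split)
  show ?case
    using Sigma01_induction[OF q(1) ax_ind.prems] unfolding q(2)[symmetric]
    by (simp add: msat_instN) (simp add: msat_subF eq)
next
  case (ax_comp p q)
  then obtain p' q' where pq: "bounded p'" "p = ExN p'" "bounded q'" "q = AllN q'"
    by (auto simp: Sigma01_def Pi01_def)
  have iff: "msat \<rho> \<sigma> (Iff a b) \<longleftrightarrow> (msat \<rho> \<sigma> a \<longleftrightarrow> msat \<rho> \<sigma> b)" for \<rho> \<sigma> a b by auto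
  have ex: "msat \<rho> \<sigma> (ExS a) \<longleftrightarrow> (\<exists>A\<in>S. msat \<rho> (case_nat A \<sigma>) a)" for a by auto
  have lift: "msat (case_nat x \<rho>) (case_nat A \<sigma>) (liftS p) \<longleftrightarrow> msat (case_nat x \<rho>) \<sigma> p" for x A
    by (simp add: msat_subF)
  have mem: "msat (case_nat x \<rho>) (case_nat A \<sigma>) (Mem (Var 0) 0) \<longleftrightarrow> (\<forall>\<^sub>F t. x t \<in> A t)" for x A by simp
  show ?case
    unfolding msat.simps(5)[of _ _ "AllN (Iff p q)"] msat.simps(6)[of _ _ "Iff p q"] ex msat.simps(6)[of _ _ "Iff (Mem (Var 0) 0) (liftS p)"] iff lift mem
  proof
    assume h: "\<forall>x\<in>I. msat (case_nat x \<rho>) \<sigma> p = msat (case_nat x \<rho>) \<sigma> q"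
    then show "\<exists>A\<in>S. \<forall>x\<in>I. (\<forall>\<^sub>F t. x t \<in> A t) = msat (case_nat x \<rho>) \<sigma> p"
      unfolding pq(2,4) by (intro Delta01_comprehension[OF pq(1,3) ax_comp.prems]) blast
  qed
next
  case ax_less_Suc
  show ?case by (auto simp: less_Suc_eq ev_disj)
qed (auto simp: msat_subF ev_const intro: I_const)

end

section \<open>Absoluteness of the defining formulas\<close>

type_synonym mctx = "nat \<times> nat \<times> (nat \<Rightarrow> nat \<Rightarrow> nat) \<times> (nat \<Rightarrow> nat \<Rightarrow> nat set)"

context rca0_model
begin

text \<open>A context consists of the binding depths and the values of the variables in the model; it is
  extended by pushing new values.\<close>

definition mle :: "mctx \<Rightarrow> mctx \<Rightarrow> bool" (infix \<open>\<preceq>\<close> 50) where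
  "G \<preceq> G' \<longleftrightarrow> (case G of (d, s, \<rho>, \<sigma>) \<Rightarrow> case G' of (d', s', \<rho>', \<sigma>') \<Rightarrow>
     d \<le> d' \<and> s \<le> s' \<and> (\<forall>k. \<rho>' (k + (d' - d)) = \<rho> k) \<and> (\<forall>k. \<sigma>' (k + (s' - s)) = \<sigma> k) \<and>
     range \<rho>' \<subseteq> I \<and> range \<sigma>' \<subseteq> S)"

definition hold :: "mctx \<Rightarrow> lfm \<Rightarrow> bool" where
  "hold G P = (case G of (d, s, \<rho>, \<sigma>) \<Rightarrow> msat \<rho> \<sigma> (P d s))"

definition mterm :: "mctx \<Rightarrow> ltm \<Rightarrow> (nat \<Rightarrow> nat) \<Rightarrow> bool" where
  "mterm G a x \<longleftrightarrow> x \<in> I \<and> (\<forall>d s \<rho> \<sigma>. G \<preceq> (d, s, \<rho>, \<sigma>) \<longrightarrow> (\<forall>\<^sub>F t. evalT (\<lambda>k. \<rho> k t) (a d) = x t))"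

definition mset :: "mctx \<Rightarrow> lset \<Rightarrow> (nat \<Rightarrow> nat set) \<Rightarrow> bool" where
  "mset G X A \<longleftrightarrow> A \<in> S \<and> (\<forall>d s \<rho> \<sigma>. G \<preceq> (d, s, \<rho>, \<sigma>) \<longrightarrow> \<sigma> (X s) = A)"

text \<open>The truth value must be the same in all extensions of \<open>G\<close>. An arbitrary
  Boolean is allowed, for statements with quantifiers over the cut; \<open>iden\<close> is the case
  of an internal predicate.\<close>

definition den :: "mctx \<Rightarrow> lfm \<Rightarrow> bool \<Rightarrow> bool" where
  "den G P b \<longleftrightarrow> (\<forall>H. G \<preceq> H \<longrightarrow> hold H P = b)"

abbreviation iden :: "mctx \<Rightarrow> lfm \<Rightarrow> (nat \<Rightarrow> bool) \<Rightarrow> bool" where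
  "iden G P p \<equiv> den G P (\<forall>\<^sub>F t. p t)"

definition mpred :: "mctx \<Rightarrow> (ltm \<Rightarrow> lfm) \<Rightarrow> (nat \<Rightarrow> nat set) \<Rightarrow> bool" where
  "mpred G P A \<longleftrightarrow> (\<forall>H a x. G \<preceq> H \<longrightarrow> mterm H a x \<longrightarrow> iden H (P a) (\<lambda>t. x t \<in> A t))"

text \<open>The bound \<open>n\<close> on the first argument is what recursion needs: when a clause
  is evaluated at \<open>n\<close>, the set in question is known to be correct only below
  \<open>n\<close>.\<close>

definition mrel :: "mctx \<Rightarrow> (nat \<Rightarrow> nat) \<Rightarrow> (ltm \<Rightarrow> ltm \<Rightarrow> lfm) \<Rightarrow> (nat \<Rightarrow> nat set) \<Rightarrow> bool" where
  "mrel G n U A \<longleftrightarrow> (\<forall>H a x b y. G \<preceq> H \<longrightarrow> mterm H a x \<longrightarrow> mterm H b y \<longrightarrow> (\<forall>\<^sub>F t. x t < n t) \<longrightarrow>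
     iden H (U a b) (\<lambda>t. pair (x t) (y t) \<in> A t))"

lemma mle_trans: "G \<preceq> H \<Longrightarrow> H \<preceq> K \<Longrightarrow> G \<preceq> K"
proof -
  assume a: "G \<preceq> H" "H \<preceq> K"
  obtain d s r q where G: "G = (d,s,r,q)" by (cases G)
  obtain d' s' r' q' where H: "H = (d',s',r',q')" by (cases H)
  obtain d'' s'' r'' q'' where K: "K = (d'',s'',r'',q'')" by (cases K)
  from a have le: "d \<le> d'" "d' \<le> d''" "s \<le> s'" "s' \<le> s''" by (auto simp: G H K mle_def)
  have "r'' (k + (d'' - d)) = r k" for k
  proof -
    have "k + (d'' - d) = (k + (d' - d)) + (d'' - d')" using le by simp
    then show ?thesis using a unfolding G H K mle_def split by metis
  qed
  moreover have "q'' (k + (s'' - s)) = q k" for k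
  proof -
    have "k + (s'' - s) = (k + (s' - s)) + (s'' - s')" using le by simp
    then show ?thesis using a unfolding G H K mle_def split by metis
  qed
  ultimately show ?thesis using le a(2) by (auto simp: G K H mle_def)
qed

text \<open>Reflexivity is not automatic: \<open>H \<preceq> H\<close> says that all values of
  \<open>H\<close> belong to \<open>I\<close> and \<open>S\<close>, which every extension of a
  context inherits from \<open>mle\<close>.\<close>

lemma mle_refl: "G \<preceq> H \<Longrightarrow> H \<preceq> H"
  by (auto simp: mle_def split: prod.splits)

lemma mterm_mono: "mterm G a x \<Longrightarrow> G \<preceq> H \<Longrightarrow> mterm H a x"
  unfolding mterm_def using mle_trans by blast
lemma mset_mono: "mset G X A \<Longrightarrow> G \<preceq> H \<Longrightarrow> mset H X A"
  unfolding mset_def using mle_trans by blast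
lemma mpred_mono: "mpred G P A \<Longrightarrow> G \<preceq> H \<Longrightarrow> mpred H P A"
  unfolding mpred_def using mle_trans by blast
lemma mrel_mono: "mrel G n U A \<Longrightarrow> G \<preceq> H \<Longrightarrow> mrel H n U A"
  unfolding mrel_def using mle_trans by blast

lemma mterm_I: "mterm G a x \<Longrightarrow> x \<in> I" by (simp add: mterm_def)
lemma mset_S: "mset G X A \<Longrightarrow> A \<in> S" by (simp add: mset_def)

lemma mpredD: "mpred G P A \<Longrightarrow> G \<preceq> H \<Longrightarrow> mterm H a x \<Longrightarrow> iden H (P a) (\<lambda>t. x t \<in> A t)"
  unfolding mpred_def by blast
lemma mrelD: "mrel G n U A \<Longrightarrow> G \<preceq> H \<Longrightarrow> mterm H a x \<Longrightarrow> mterm H b y \<Longrightarrow> \<forall>\<^sub>F t. x t < n t \<Longrightarrow>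
     iden H (U a b) (\<lambda>t. pair (x t) (y t) \<in> A t)"
  unfolding mrel_def by blast

lemma mterm_ops:
  "mterm G \<^bold>0 (\<lambda>t. 0)" "mterm G \<^bold>1 (\<lambda>t. 1)"
  "mterm G a x \<Longrightarrow> mterm G b y \<Longrightarrow> mterm G (a \<^bold>+ b) (\<lambda>t. x t + y t)"
  "mterm G a x \<Longrightarrow> mterm G b y \<Longrightarrow> mterm G (a \<^bold>* b) (\<lambda>t. x t * y t)"
proof -
  show "mterm G \<^bold>0 (\<lambda>t. 0)" "mterm G \<^bold>1 (\<lambda>t. 1)" by (auto simp: mterm_def l_zero_def l_one_def I_const)
  assume a: "mterm G a x" "mterm G b y"
  show "mterm G (a \<^bold>+ b) (\<lambda>t. x t + y t)"
    unfolding mterm_def l_plus_def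
  proof (intro conjI allI impI)
    fix d s \<rho> \<sigma> assume "G \<preceq> (d, s, \<rho>, \<sigma>)"
    then have "\<forall>\<^sub>F t. evalT (\<lambda>k. \<rho> k t) (a d) = x t" "\<forall>\<^sub>F t. evalT (\<lambda>k. \<rho> k t) (b d) = y t"
      using a unfolding mterm_def by blast+
    then show "\<forall>\<^sub>F t. evalT (\<lambda>k. \<rho> k t) (Plus (a d) (b d)) = x t + y t" by eventually_elim simp
  qed (use a in \<open>auto intro: I_add mterm_I\<close>)
  show "mterm G (a \<^bold>* b) (\<lambda>t. x t * y t)"
    unfolding mterm_def l_times_def
  proof (intro conjI allI impI)
    fix d s \<rho> \<sigma> assume "G \<preceq> (d, s, \<rho>, \<sigma>)"
    then have "\<forall>\<^sub>F t. evalT (\<lambda>k. \<rho> k t) (a d) = x t" "\<forall>\<^sub>F t. evalT (\<lambda>k. \<rho> k t) (b d) = y t"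
      using a unfolding mterm_def by blast+
    then show "\<forall>\<^sub>F t. evalT (\<lambda>k. \<rho> k t) (Times (a d) (b d)) = x t * y t" by eventually_elim simp
  qed (use a in \<open>auto intro: I_mult mterm_I\<close>)
qed

lemma mterm_pair: "mterm G a x \<Longrightarrow> mterm G b y \<Longrightarrow> mterm G \<^bold>\<langle>a, b\<^bold>\<rangle> (\<lambda>t. pair (x t) (y t))"
  unfolding l_pair_def pair_def by (intro mterm_ops)

lemma iden_atoms:
  "mterm G a x \<Longrightarrow> mterm G b y \<Longrightarrow> iden G (a \<^bold>= b) (\<lambda>t. x t = y t)"
  "mterm G a x \<Longrightarrow> mterm G b y \<Longrightarrow> iden G (a \<^bold>< b) (\<lambda>t. x t < y t)"
  "mterm G a x \<Longrightarrow> mset G X A \<Longrightarrow> iden G (a \<^bold>\<in> X) (\<lambda>t. x t \<in> A t)"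
proof -
  have *: "iden G (\<lambda>d s. Q (a d) (b d)) (\<lambda>t. q (x t) (y t))"
    if "mterm G a x" "mterm G b y" "\<And>\<rho> \<sigma> u v. msat \<rho> \<sigma> (Q u v) \<longleftrightarrow> (\<forall>\<^sub>F t. q (evalT (\<lambda>k. \<rho> k t) u) (evalT (\<lambda>k. \<rho> k t) v))"
    for Q q a b x y
    unfolding den_def
  proof (intro allI impI)
    fix H assume "G \<preceq> H"
    obtain d s \<rho> \<sigma> where H: "H = (d, s, \<rho>, \<sigma>)" by (cases H)
    have "\<forall>\<^sub>F t. evalT (\<lambda>k. \<rho> k t) (a d) = x t" "\<forall>\<^sub>F t. evalT (\<lambda>k. \<rho> k t) (b d) = y t"
      using that(1,2) \<open>G \<preceq> H\<close> unfolding mterm_def H by blast+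
    then have "\<forall>\<^sub>F t. q (evalT (\<lambda>k. \<rho> k t) (a d)) (evalT (\<lambda>k. \<rho> k t) (b d)) \<longleftrightarrow> q (x t) (y t)" by eventually_elim simp
    then show "hold H (\<lambda>d s. Q (a d) (b d)) = (\<forall>\<^sub>F t. q (x t) (y t))"
      by (simp add: hold_def H that(3) ev_iff)
  qed
  show "mterm G a x \<Longrightarrow> mterm G b y \<Longrightarrow> iden G (a \<^bold>= b) (\<lambda>t. x t = y t)" unfolding l_eq_def by (rule *) simp_all
  show "mterm G a x \<Longrightarrow> mterm G b y \<Longrightarrow> iden G (a \<^bold>< b) (\<lambda>t. x t < y t)" unfolding l_less_def by (rule *) simp_all
  assume a: "mterm G a x" "mset G X A"
  show "iden G (a \<^bold>\<in> X) (\<lambda>t. x t \<in> A t)"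
    unfolding den_def
  proof (intro allI impI)
    fix H assume "G \<preceq> H"
    obtain d s \<rho> \<sigma> where H: "H = (d, s, \<rho>, \<sigma>)" by (cases H)
    have "\<forall>\<^sub>F t. evalT (\<lambda>k. \<rho> k t) (a d) = x t" "\<sigma> (X s) = A"
      using a \<open>G \<preceq> H\<close> unfolding mterm_def mset_def H by blast+
    then have "\<forall>\<^sub>F t. evalT (\<lambda>k. \<rho> k t) (a d) \<in> A t \<longleftrightarrow> x t \<in> A t" by (auto elim: eventually_mono)
    then show "hold H (a \<^bold>\<in> X) = (\<forall>\<^sub>F t. x t \<in> A t)"
      using \<open>\<sigma> (X s) = A\<close> by (simp add: hold_def H l_mem_def ev_iff)
  qed
qed

lemma hold_simps:
  "hold G (\<^bold>\<not> P) = (\<not> hold G P)" "hold G (P \<^bold>\<and> Q) = (hold G P \<and> hold G Q)"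
  "hold G (P \<^bold>\<or> Q) = (hold G P \<or> hold G Q)" "hold G (P \<^bold>\<longrightarrow> Q) = (hold G P \<longrightarrow> hold G Q)"
  "hold G (P \<^bold>\<longleftrightarrow> Q) = (hold G P \<longleftrightarrow> hold G Q)"
  by (auto simp: hold_def l_not_def l_and_def l_or_def l_imp_def l_iff_def split: prod.splits)

lemma iden_conn:
  "iden G P p \<Longrightarrow> iden G (\<^bold>\<not> P) (\<lambda>t. \<not> p t)"
  "iden G P p \<Longrightarrow> iden G Q q \<Longrightarrow> iden G (P \<^bold>\<or> Q) (\<lambda>t. p t \<or> q t)"
  "iden G P p \<Longrightarrow> iden G Q q \<Longrightarrow> iden G (P \<^bold>\<longleftrightarrow> Q) (\<lambda>t. p t \<longleftrightarrow> q t)"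
  by (auto simp: den_def hold_simps ev_not ev_disj ev_iff)

text \<open>Conjunction and implication are lazy: the second formula need only be understood where the
  first one is true.\<close>

lemma iden_lazy:
  "iden G P p \<Longrightarrow> (\<forall>\<^sub>F t. p t \<Longrightarrow> iden G Q q) \<Longrightarrow> iden G (P \<^bold>\<and> Q) (\<lambda>t. p t \<and> q t)"
  "iden G P p \<Longrightarrow> (\<forall>\<^sub>F t. p t \<Longrightarrow> iden G Q q) \<Longrightarrow> iden G (P \<^bold>\<longrightarrow> Q) (\<lambda>t. p t \<longrightarrow> q t)"
  by (auto simp: den_def hold_simps ev_imp ev_conj)

lemma iden_le: "mterm G a x \<Longrightarrow> mterm G b y \<Longrightarrow> iden G (a \<^bold>\<le> b) (\<lambda>t. x t \<le> y t)"
  unfolding l_le_def le_less by (intro iden_conn iden_atoms)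

definition pushN :: "(nat \<Rightarrow> nat) \<Rightarrow> mctx \<Rightarrow> mctx" where
  "pushN f G = (case G of (d, s, \<rho>, \<sigma>) \<Rightarrow> (Suc d, s, case_nat f \<rho>, \<sigma>))"
definition newN :: "mctx \<Rightarrow> ltm" where "newN G = (\<lambda>d'. Var (d' - Suc (fst G)))"
definition pushS :: "(nat \<Rightarrow> nat set) \<Rightarrow> mctx \<Rightarrow> mctx" where
  "pushS A G = (case G of (d, s, \<rho>, \<sigma>) \<Rightarrow> (d, Suc s, \<rho>, case_nat A \<sigma>))"
definition newS :: "mctx \<Rightarrow> lset" where "newS G = (\<lambda>s'. s' - Suc (fst (snd G)))"

lemma hold_quantifiers:
  "hold G (l_all Q) \<longleftrightarrow> (\<forall>f\<in>I. hold (pushN f G) (Q (newN G)))"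
  "hold G (l_ex Q) \<longleftrightarrow> (\<exists>f\<in>I. hold (pushN f G) (Q (newN G)))"
  "hold G (l_exS R) \<longleftrightarrow> (\<exists>A\<in>S. hold (pushS A G) (R (newS G)))"
  by (auto simp: hold_def l_all_def l_ex_def l_exS_def pushN_def newN_def pushS_def newS_def split: prod.splits)

lemma mle_push:
  assumes "G \<preceq> H"
  shows "f \<in> I \<Longrightarrow> H \<preceq> pushN f H" "A \<in> S \<Longrightarrow> H \<preceq> pushS A H"
proof -
  obtain d s \<rho> \<sigma> where H: "H = (d, s, \<rho>, \<sigma>)" by (cases H)
  have r: "range \<rho> \<subseteq> I" "range \<sigma> \<subseteq> S" using assms by (auto simp: mle_def H split: prod.splits)
  show "f \<in> I \<Longrightarrow> H \<preceq> pushN f H"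
    using r case_nat_range[of f I \<rho>] by (auto simp: H pushN_def mle_def Suc_diff_le)
  show "A \<in> S \<Longrightarrow> H \<preceq> pushS A H"
    using r case_nat_range[of A S \<sigma>] by (auto simp: H pushS_def mle_def Suc_diff_le)
qed

lemma mterm_newN: "f \<in> I \<Longrightarrow> mterm (pushN f G) (newN G) f"
  unfolding mterm_def
proof (intro conjI allI impI)
  fix d' s' \<rho>' \<sigma>'
  assume "pushN f G \<preceq> (d', s', \<rho>', \<sigma>')"
  then have "\<rho>' (0 + (d' - Suc (fst G))) = f"
    unfolding pushN_def mle_def by (cases G) (simp, metis add_0 nat.case(1))
  then show "\<forall>\<^sub>F t. evalT (\<lambda>k. \<rho>' k t) (newN G d') = f t" by (simp add: newN_def)
qed

lemma mset_newS: "A \<in> S \<Longrightarrow> mset (pushS A G) (newS G) A"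
  unfolding mset_def
proof (intro conjI allI impI)
  fix d' s' \<rho>' \<sigma>'
  assume "pushS A G \<preceq> (d', s', \<rho>', \<sigma>')"
  then have "\<sigma>' (0 + (s' - Suc (fst (snd G)))) = A"
    unfolding pushS_def mle_def by (cases G) (simp, metis add_0 nat.case(1))
  then show "\<sigma>' (newS G s') = A" by (simp add: newS_def)
qed

lemma den_all:
  assumes "\<And>H a x. G \<preceq> H \<Longrightarrow> mterm H a x \<Longrightarrow> den H (Q a) (q x)"
  shows "den G (l_all Q) (\<forall>x\<in>I. q x)"
  unfolding den_def
proof (intro allI impI)
  fix H assume H: "G \<preceq> H"
  have "hold (pushN f H) (Q (newN H)) = q f" if "f \<in> I" for f
    using assms[OF mle_trans[OF H mle_push(1)[OF H that]] mterm_newN[OF that]]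
      mle_refl[OF mle_push(1)[OF H that]] unfolding den_def by blast
  then show "hold H (l_all Q) = (\<forall>x\<in>I. q x)" unfolding hold_quantifiers by blast
qed

lemma den_ex:
  assumes "\<And>H a x. G \<preceq> H \<Longrightarrow> mterm H a x \<Longrightarrow> den H (Q a) (q x)"
  shows "den G (l_ex Q) (\<exists>x\<in>I. q x)"
  unfolding den_def
proof (intro allI impI)
  fix H assume H: "G \<preceq> H"
  have "hold (pushN f H) (Q (newN H)) = q f" if "f \<in> I" for f
    using assms[OF mle_trans[OF H mle_push(1)[OF H that]] mterm_newN[OF that]]
      mle_refl[OF mle_push(1)[OF H that]] unfolding den_def by blast
  then show "hold H (l_ex Q) = (\<exists>x\<in>I. q x)" unfolding hold_quantifiers by blast
qed

text \<open>An internal witness may leave the cut. With a bound \<open>g\<close> in \<open>I\<close>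
  this cannot happen, and the quantifier over the cut and the internal one coincide.\<close>

lemma ev_ex:
  assumes "g \<in> I" "\<forall>\<^sub>F t. \<forall>x. p t x \<longrightarrow> x \<le> g t"
  shows "(\<exists>x\<in>I. \<forall>\<^sub>F t. p t (x t)) \<longleftrightarrow> (\<forall>\<^sub>F t. \<exists>x. p t x)"
proof
  assume "\<exists>x\<in>I. \<forall>\<^sub>F t. p t (x t)"
  then show "\<forall>\<^sub>F t. \<exists>x. p t x" by (auto elim: eventually_mono)
next
  assume ex: "\<forall>\<^sub>F t. \<exists>x. p t x"
  define x where "x t = (SOME x. p t x)" for t
  have x: "\<forall>\<^sub>F t. p t (x t)" using ex by eventually_elim (unfold x_def, rule someI_ex)
  then have "\<forall>\<^sub>F t. x t \<le> g t" using assms(2) by eventually_elim blast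
  then have "x \<in> I" by (rule I_mono[OF assms(1)])
  then show "\<exists>x\<in>I. \<forall>\<^sub>F t. p t (x t)" using x by blast
qed

lemma ev_all:
  assumes "g \<in> I" "\<forall>\<^sub>F t. \<forall>x. \<not> p t x \<longrightarrow> x \<le> g t"
  shows "(\<forall>x\<in>I. \<forall>\<^sub>F t. p t (x t)) \<longleftrightarrow> (\<forall>\<^sub>F t. \<forall>x. p t x)"
proof -
  have "(\<exists>x\<in>I. \<forall>\<^sub>F t. \<not> p t (x t)) \<longleftrightarrow> (\<forall>\<^sub>F t. \<exists>x. \<not> p t x)" by (rule ev_ex[OF assms])
  moreover have "(\<forall>\<^sub>F t. \<exists>x. \<not> p t x) \<longleftrightarrow> \<not> (\<forall>\<^sub>F t. \<forall>x. p t x)" using ev_not[of "\<lambda>t. \<forall>x. p t x"] by simp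
  ultimately show ?thesis by (auto simp: ev_not)
qed

lemma iden_ex:
  assumes "\<And>H a x. G \<preceq> H \<Longrightarrow> mterm H a x \<Longrightarrow> iden H (Q a) (\<lambda>t. q t (x t))"
    and "g \<in> I" "\<forall>\<^sub>F t. \<forall>x. q t x \<longrightarrow> x \<le> g t"
  shows "iden G (l_ex Q) (\<lambda>t. \<exists>x. q t x)"
  using den_ex[of G Q "\<lambda>x. \<forall>\<^sub>F t. q t (x t)"] assms(1) ev_ex[OF assms(2,3)] by simp

lemma iden_all:
  assumes "\<And>H a x. G \<preceq> H \<Longrightarrow> mterm H a x \<Longrightarrow> iden H (Q a) (\<lambda>t. q t (x t))"
    and "g \<in> I" "\<forall>\<^sub>F t. \<forall>x. \<not> q t x \<longrightarrow> x \<le> g t"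
  shows "iden G (l_all Q) (\<lambda>t. \<forall>x. q t x)"
  using den_all[of G Q "\<lambda>x. \<forall>\<^sub>F t. q t (x t)"] assms(1) ev_all[OF assms(2,3)] by simp

lemma iden_cong: "iden G P p \<Longrightarrow> \<forall>\<^sub>F t. p t \<longleftrightarrow> q t \<Longrightarrow> iden G P q"
  by (simp add: ev_iff)

section \<open>Uniqueness, on the cut, of sets given by recursion\<close>

lemma agree_induct:
  assumes S: "T \<in> S" "A \<in> S" and n: "n \<in> I" "x \<in> I"
    and step: "\<And>j x. j \<in> I \<Longrightarrow> x \<in> I \<Longrightarrow> \<forall>\<^sub>F t. j t \<le> n t \<Longrightarrow>
      (\<And>j' x'. j' \<in> I \<Longrightarrow> x' \<in> I \<Longrightarrow> \<forall>\<^sub>F t. j' t < j t \<Longrightarrow>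
        (\<forall>\<^sub>F t. pair (j' t) (x' t) \<in> T t) \<longleftrightarrow> (\<forall>\<^sub>F t. pair (j' t) (x' t) \<in> A t)) \<Longrightarrow>
      (\<forall>\<^sub>F t. pair (j t) (x t) \<in> T t) \<longleftrightarrow> (\<forall>\<^sub>F t. pair (j t) (x t) \<in> A t)"
  shows "(\<forall>\<^sub>F t. pair (n t) (x t) \<in> T t) \<longleftrightarrow> (\<forall>\<^sub>F t. pair (n t) (x t) \<in> A t)"
proof (rule ccontr)
  \<comment> \<open>The points of disagreement form a set of the model, so by
    \<open>least_number\<close> there is a first one in the cut.\<close>
  define D where "D = (\<lambda>t. opint B0 O_diff (top_bound t) (map (\<lambda>A. A t) [T, A]) (map (\<lambda>f. f t) []))"
  have D: "D \<in> S" unfolding D_def using S by (intro S_opint) auto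
  have mem: "z \<in> D t \<longleftrightarrow> \<not> (z \<in> T t \<longleftrightarrow> z \<in> A t)" for z t by (simp add: D_def)
  have evD: "(\<forall>\<^sub>F t. pair (j t) (x t) \<in> D t) \<longleftrightarrow> \<not> ((\<forall>\<^sub>F t. pair (j t) (x t) \<in> T t) \<longleftrightarrow> (\<forall>\<^sub>F t. pair (j t) (x t) \<in> A t))" for j x
    unfolding mem ev_not ev_iff by (rule refl)
  assume "\<not> ?thesis"
  then have "\<forall>\<^sub>F t. pair (n t) (x t) \<in> D t" by (simp only: evD not_False_eq_True)
  then obtain k y where k: "k \<in> I" "y \<in> I" "\<forall>\<^sub>F t. pair (k t) (y t) \<in> D t" "\<forall>\<^sub>F t. k t \<le> n t"
    and min: "\<And>k' x'. k' \<in> I \<Longrightarrow> x' \<in> I \<Longrightarrow> \<forall>\<^sub>F t. k' t < k t \<Longrightarrow> \<forall>\<^sub>F t. pair (k' t) (x' t) \<notin> D t"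
    using least_number[OF D n] by blast
  have "(\<forall>\<^sub>F t. pair (k t) (y t) \<in> T t) \<longleftrightarrow> (\<forall>\<^sub>F t. pair (k t) (y t) \<in> A t)"
  proof (rule step[OF k(1,2,4)])
    fix j' x' assume "j' \<in> I" "x' \<in> I" "\<forall>\<^sub>F t. j' t < k t"
    then have "\<not> (\<forall>\<^sub>F t. pair (j' t) (x' t) \<in> D t)" using min by (simp add: ev_not)
    then show "(\<forall>\<^sub>F t. pair (j' t) (x' t) \<in> T t) \<longleftrightarrow> (\<forall>\<^sub>F t. pair (j' t) (x' t) \<in> A t)" unfolding evD by blast
  qed
  then show False using k(3) unfolding evD by blast
qed

lemma mrel_agree:
  assumes "mset G X T" "\<And>j' x'. j' \<in> I \<Longrightarrow> x' \<in> I \<Longrightarrow> \<forall>\<^sub>F t. j' t < n t \<Longrightarrow>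
        (\<forall>\<^sub>F t. pair (j' t) (x' t) \<in> T t) \<longleftrightarrow> (\<forall>\<^sub>F t. pair (j' t) (x' t) \<in> A t)"
  shows "mrel G n (\<lambda>a b. \<^bold>\<langle>a, b\<^bold>\<rangle> \<^bold>\<in> X) A"
  unfolding mrel_def
proof (intro allI impI)
  fix H a x b y assume H: "G \<preceq> H" "mterm H a x" "mterm H b y" "\<forall>\<^sub>F t. x t < n t"
  have "iden H (\<^bold>\<langle>a, b\<^bold>\<rangle> \<^bold>\<in> X) (\<lambda>t. pair (x t) (y t) \<in> T t)"
    by (intro iden_atoms mterm_pair H mset_mono[OF assms(1)])
  then show "iden H (\<^bold>\<langle>a, b\<^bold>\<rangle> \<^bold>\<in> X) (\<lambda>t. pair (x t) (y t) \<in> A t)"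
    using assms(2)[of x y] H mterm_I by simp
qed

text \<open>The true graph \<open>A\<close> is in \<open>S\<close> and satisfies the clauses, and
  any other solution agrees with it up to \<open>kk\<close> by \<open>agree_induct\<close>. The
  premise \<open>bound\<close> says that a value hardly decreases from one iteration to the next; it
  makes the quantifier over the preceding value a bounded one. The relation \<open>R\<close> need
  only be understood at pairs that the iteration really reaches.\<close>

lemma iden_rec:
  assumes k: "mterm G k kk" "mterm G v vv"
    and P: "\<And>H a x. G \<preceq> H \<Longrightarrow> mterm H a x \<Longrightarrow> iden H (P a) (\<lambda>t. p t (x t))"
    and R: "\<And>H a j b y c x. G \<preceq> H \<Longrightarrow> mterm H a j \<Longrightarrow> mterm H b y \<Longrightarrow> mterm H c x \<Longrightarrow>
      \<forall>\<^sub>F t. j t < kk t \<Longrightarrow> \<forall>\<^sub>F t. iter (p t) (r t) (j t) (y t) \<Longrightarrow> iden H (R a b c) (\<lambda>t. r t (j t) (y t) (x t))"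
    and bound: "\<forall>\<^sub>F t. \<forall>j y x. iter (p t) (r t) j y \<and> r t j y x \<longrightarrow> y \<le> x + 1"
    and A: "A \<in> S" "\<And>t j x. pair j x \<in> A t \<longleftrightarrow> iter (p t) (r t) j x"
  shows "iden G (f_rec P R k v) (\<lambda>t. iter (p t) (r t) (kk t) (vv t))"
  unfolding den_def
proof (intro allI impI)
  fix G' assume G': "G \<preceq> G'"
  define zero where "zero T \<longleftrightarrow> (\<forall>x\<in>I. (\<forall>\<^sub>F t. pair 0 (x t) \<in> T t) \<longleftrightarrow> (\<forall>\<^sub>F t. p t (x t)))" for T
  have eq1: "hold (pushS T G') (\<^bold>\<forall>x. \<^bold>\<langle>\<^bold>0, x\<^bold>\<rangle> \<^bold>\<in> newS G' \<^bold>\<longleftrightarrow> P x) \<longleftrightarrow> zero T" if T: "T \<in> S" for T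
  proof -
    let ?K = "pushS T G'"
    have K: "G' \<preceq> ?K" "?K \<preceq> ?K" using mle_push(2)[OF G' T] mle_refl by blast+
    have X: "mset ?K (newS G') T" by (rule mset_newS[OF T])
    have "den ?K (\<^bold>\<forall>x. \<^bold>\<langle>\<^bold>0, x\<^bold>\<rangle> \<^bold>\<in> newS G' \<^bold>\<longleftrightarrow> P x) (\<forall>x\<in>I. (\<forall>\<^sub>F t. pair 0 (x t) \<in> T t \<longleftrightarrow> p t (x t)))"
    proof (rule den_all)
      fix H a x assume H: "?K \<preceq> H" "mterm H a x"
      then have "G \<preceq> H" using G' K mle_trans by blast
      then show "iden H (\<^bold>\<langle>\<^bold>0, a\<^bold>\<rangle> \<^bold>\<in> newS G' \<^bold>\<longleftrightarrow> P a) (\<lambda>t. pair 0 (x t) \<in> T t \<longleftrightarrow> p t (x t))"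
        by (intro iden_conn iden_atoms mterm_pair mterm_ops H mset_mono[OF X] P)
    qed
    then show ?thesis using K(2) unfolding den_def zero_def ev_iff by blast
  qed
  define rstep where "rstep T \<longleftrightarrow> hold (pushS T G') (\<^bold>\<forall>j. \<^bold>\<forall>x. j \<^bold>< k \<^bold>\<longrightarrow> (\<^bold>\<langle>j \<^bold>+ \<^bold>1, x\<^bold>\<rangle> \<^bold>\<in> newS G' \<^bold>\<longleftrightarrow> (\<^bold>\<exists>y. \<^bold>\<langle>j, y\<^bold>\<rangle> \<^bold>\<in> newS G' \<^bold>\<and> R j y x)))" for T
  have inner: "rstep T \<longleftrightarrow> (\<forall>j\<in>I. \<forall>x\<in>I. (\<forall>\<^sub>F t. j t < kk t) \<longrightarrow>
       ((\<forall>\<^sub>F t. pair (j t + 1) (x t) \<in> T t) \<longleftrightarrow> E T j x))"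
    and E: "\<And>j x. T \<in> S \<Longrightarrow> j \<in> I \<Longrightarrow> x \<in> I \<Longrightarrow> \<forall>\<^sub>F t. j t < kk t \<Longrightarrow>
      (\<And>y. y \<in> I \<Longrightarrow> (\<forall>\<^sub>F t. pair (j t) (y t) \<in> T t) \<longleftrightarrow> (\<forall>\<^sub>F t. pair (j t) (y t) \<in> A t)) \<Longrightarrow>
      E T j x \<longleftrightarrow> (\<forall>\<^sub>F t. pair (j t + 1) (x t) \<in> A t)"
    if T: "T \<in> S" and Edef: "\<And>j x. E T j x = hold (pushN x (pushN j (pushS T G')))
       (\<^bold>\<exists>y. \<^bold>\<langle>newN (pushS T G'), y\<^bold>\<rangle> \<^bold>\<in> newS G' \<^bold>\<and> R (newN (pushS T G')) y (newN (pushN j (pushS T G'))))" for T E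
  proof -
    let ?K = "pushS T G'"
    have K: "G' \<preceq> ?K" using mle_push(2)[OF G' T] .
    have X: "mset ?K (newS G') T" by (rule mset_newS[OF T])
    let ?J = "\<lambda>j. pushN j ?K" and ?H = "\<lambda>j x. pushN x (pushN j ?K)"
    let ?a = "newN ?K" and ?b = "\<lambda>j. newN (pushN j ?K)"
    have J: "?K \<preceq> ?J j" if "j \<in> I" for j using mle_push(1)[OF K that] .
    have H: "?J j \<preceq> ?H j x" if "j \<in> I" "x \<in> I" for j x using mle_push(1)[OF J[OF that(1)] that(2)] .
    have KH: "?K \<preceq> ?H j x" if "j \<in> I" "x \<in> I" for j x using J H that mle_trans by blast
    have GH: "G \<preceq> ?H j x" if "j \<in> I" "x \<in> I" for j x using G' K KH[OF that] mle_trans by blast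
    have a: "mterm (?H j x) ?a j" if "j \<in> I" "x \<in> I" for j x
      using mterm_mono[OF mterm_newN[OF that(1)] H[OF that]] .
    have b: "mterm (?H j x) (?b j) x" if "x \<in> I" for j x using mterm_newN[OF that] .
    have hh: "?H j x \<preceq> ?H j x" if "j \<in> I" "x \<in> I" for j x using mle_refl[OF GH[OF that]] .
    have h1: "hold (?H j x) (?a \<^bold>< k) \<longleftrightarrow> (\<forall>\<^sub>F t. j t < kk t)"
      "hold (?H j x) (\<^bold>\<langle>?a \<^bold>+ \<^bold>1, ?b j\<^bold>\<rangle> \<^bold>\<in> newS G') \<longleftrightarrow> (\<forall>\<^sub>F t. pair (j t + 1) (x t) \<in> T t)" if "j \<in> I" "x \<in> I" for j x
    proof -
      have "iden (?H j x) (?a \<^bold>< k) (\<lambda>t. j t < kk t)"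
        by (intro iden_atoms a that mterm_mono[OF k(1) GH])
      then show "hold (?H j x) (?a \<^bold>< k) \<longleftrightarrow> (\<forall>\<^sub>F t. j t < kk t)" using hh[OF that] unfolding den_def by blast
      have "iden (?H j x) (\<^bold>\<langle>?a \<^bold>+ \<^bold>1, ?b j\<^bold>\<rangle> \<^bold>\<in> newS G') (\<lambda>t. pair (j t + 1) (x t) \<in> T t)"
        by (intro iden_atoms mterm_pair mterm_ops a b that mset_mono[OF X KH])
      then show "hold (?H j x) (\<^bold>\<langle>?a \<^bold>+ \<^bold>1, ?b j\<^bold>\<rangle> \<^bold>\<in> newS G') \<longleftrightarrow> (\<forall>\<^sub>F t. pair (j t + 1) (x t) \<in> T t)"
        using hh[OF that] unfolding den_def by blast
    qed
    show "rstep T \<longleftrightarrow> (\<forall>j\<in>I. \<forall>x\<in>I. (\<forall>\<^sub>F t. j t < kk t) \<longrightarrow>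
       ((\<forall>\<^sub>F t. pair (j t + 1) (x t) \<in> T t) \<longleftrightarrow> E T j x))"
      unfolding rstep_def hold_quantifiers(1) hold_simps Edef using h1 by blast
    fix j x assume jx: "j \<in> I" "x \<in> I" "\<forall>\<^sub>F t. j t < kk t"
      and agree: "\<And>y. y \<in> I \<Longrightarrow> (\<forall>\<^sub>F t. pair (j t) (y t) \<in> T t) \<longleftrightarrow> (\<forall>\<^sub>F t. pair (j t) (y t) \<in> A t)"
    \<comment> \<open>Row \<open>j\<close> of \<open>T\<close> is known to agree with
      \<open>A\<close> on the cut, and only predecessors \<open>y \<le> x + 1\<close> matter, so the
      existential quantifier is internal.\<close>
    have "iden (?H j x) (\<^bold>\<exists>y. \<^bold>\<langle>?a, y\<^bold>\<rangle> \<^bold>\<in> newS G' \<^bold>\<and> R ?a y (?b j))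
       (\<lambda>t. \<exists>y. iter (p t) (r t) (j t) y \<and> r t (j t) y (x t))"
    proof (rule iden_ex)
      fix L c y assume L: "?H j x \<preceq> L" "mterm L c y"
      have y: "y \<in> I" using L mterm_I by blast
      have a': "mterm L ?a j" "mterm L (?b j) x" using a[OF jx(1,2)] b[OF jx(2)] L mterm_mono by blast+
      have GL: "G \<preceq> L" using GH[OF jx(1,2)] L(1) mle_trans by blast
      show "iden L (\<^bold>\<langle>?a, c\<^bold>\<rangle> \<^bold>\<in> newS G' \<^bold>\<and> R ?a c (?b j)) (\<lambda>t. iter (p t) (r t) (j t) (y t) \<and> r t (j t) (y t) (x t))"
      proof (rule iden_lazy(1))
        have "iden L (\<^bold>\<langle>?a, c\<^bold>\<rangle> \<^bold>\<in> newS G') (\<lambda>t. pair (j t) (y t) \<in> T t)"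
          by (intro iden_atoms mterm_pair a' L mset_mono[OF mset_mono[OF X KH[OF jx(1,2)]]])
        then show "iden L (\<^bold>\<langle>?a, c\<^bold>\<rangle> \<^bold>\<in> newS G') (\<lambda>t. iter (p t) (r t) (j t) (y t))"
          unfolding agree[OF y] A(2) .
        show "iden L (R ?a c (?b j)) (\<lambda>t. r t (j t) (y t) (x t))" if "\<forall>\<^sub>F t. iter (p t) (r t) (j t) (y t)"
          by (rule R[OF GL a'(1) L(2) a'(2) jx(3) that])
      qed
    next
      show "(\<lambda>t. x t + 1) \<in> I" using I_add[OF jx(2) I_const] .
      show "\<forall>\<^sub>F t. \<forall>y. iter (p t) (r t) (j t) y \<and> r t (j t) y (x t) \<longrightarrow> y \<le> x t + 1"
        using bound by eventually_elim blast
    qed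
    then have "E T j x \<longleftrightarrow> (\<forall>\<^sub>F t. \<exists>y. iter (p t) (r t) (j t) y \<and> r t (j t) y (x t))"
      unfolding Edef den_def using hh[OF jx(1,2)] by blast
    then show "E T j x \<longleftrightarrow> (\<forall>\<^sub>F t. pair (j t + 1) (x t) \<in> A t)" unfolding A(2) by simp
  qed
  have last: "hold (pushS T G') (\<^bold>\<langle>k, v\<^bold>\<rangle> \<^bold>\<in> newS G') \<longleftrightarrow> (\<forall>\<^sub>F t. pair (kk t) (vv t) \<in> T t)" if T: "T \<in> S" for T
  proof -
    have K: "G' \<preceq> pushS T G'" using mle_push(2)[OF G' T] .
    have GK: "G \<preceq> pushS T G'" using mle_trans[OF G' K] .
    have "iden (pushS T G') (\<^bold>\<langle>k, v\<^bold>\<rangle> \<^bold>\<in> newS G') (\<lambda>t. pair (kk t) (vv t) \<in> T t)"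
      by (intro iden_atoms mterm_pair mset_newS T mterm_mono[OF k(1) GK] mterm_mono[OF k(2) GK])
    then show ?thesis using mle_refl[OF K] unfolding den_def by blast
  qed
  define E where "E T j x = hold (pushN x (pushN j (pushS T G')))
       (\<^bold>\<exists>y. \<^bold>\<langle>newN (pushS T G'), y\<^bold>\<rangle> \<^bold>\<in> newS G' \<^bold>\<and> R (newN (pushS T G')) y (newN (pushN j (pushS T G'))))" for T j x
  note inner = inner[of _ E, OF _ E_def] and E = E[of _ E, OF _ E_def]
  have zeroA: "zero A" unfolding zero_def A(2) by simp
  have "hold G' (f_rec P R k v) \<longleftrightarrow> (\<exists>T\<in>S. zero T \<and> rstep T \<and> (\<forall>\<^sub>F t. pair (kk t) (vv t) \<in> T t))"
    unfolding f_rec_def hold_quantifiers(3) hold_simps(2) rstep_def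
    by (rule bex_cong[OF refl]) (simp only: eq1 last)
  also have "... \<longleftrightarrow> (\<forall>\<^sub>F t. pair (kk t) (vv t) \<in> A t)"
  proof
    assume "\<forall>\<^sub>F t. pair (kk t) (vv t) \<in> A t"
    moreover have "rstep A" unfolding inner[OF A(1)] using E[OF A(1) A(1)] by blast
    ultimately show "\<exists>T\<in>S. zero T \<and> rstep T \<and> (\<forall>\<^sub>F t. pair (kk t) (vv t) \<in> T t)" using A(1) zeroA by blast
  next
    assume "\<exists>T\<in>S. zero T \<and> rstep T \<and> (\<forall>\<^sub>F t. pair (kk t) (vv t) \<in> T t)"
    then obtain T where T: "T \<in> S" "zero T" "rstep T" "\<forall>\<^sub>F t. pair (kk t) (vv t) \<in> T t" by blast
    have "(\<forall>\<^sub>F t. pair (kk t) (vv t) \<in> T t) \<longleftrightarrow> (\<forall>\<^sub>F t. pair (kk t) (vv t) \<in> A t)"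
    proof (rule agree_induct[OF T(1) A(1) mterm_I[OF k(1)] mterm_I[OF k(2)]])
      fix j x assume j: "j \<in> I" "x \<in> I" "\<forall>\<^sub>F t. j t \<le> kk t"
        and below: "\<And>j' x'. j' \<in> I \<Longrightarrow> x' \<in> I \<Longrightarrow> \<forall>\<^sub>F t. j' t < j t \<Longrightarrow>
        (\<forall>\<^sub>F t. pair (j' t) (x' t) \<in> T t) \<longleftrightarrow> (\<forall>\<^sub>F t. pair (j' t) (x' t) \<in> A t)"
      show "(\<forall>\<^sub>F t. pair (j t) (x t) \<in> T t) \<longleftrightarrow> (\<forall>\<^sub>F t. pair (j t) (x t) \<in> A t)"
      proof (cases "\<forall>\<^sub>F t. j t = 0")
        case True
        then have "\<forall>\<^sub>F t. pair (j t) (x t) \<in> T t \<longleftrightarrow> pair 0 (x t) \<in> T t"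
          "\<forall>\<^sub>F t. pair (j t) (x t) \<in> A t \<longleftrightarrow> pair 0 (x t) \<in> A t" by (eventually_elim, simp)+
        then show ?thesis using T(2) zeroA j(2) unfolding zero_def ev_iff by blast
      next
        case False
        then have pos: "\<forall>\<^sub>F t. j t \<noteq> 0" by (simp only: ev_not not_False_eq_True)
        define i where "i t = j t - 1" for t
        have i: "i \<in> I" by (rule I_mono[OF j(1)]) (simp add: i_def)
        have ij: "\<forall>\<^sub>F t. i t < j t" "\<forall>\<^sub>F t. i t + 1 = j t" using pos by (eventually_elim, simp add: i_def)+
        then have ik: "\<forall>\<^sub>F t. i t < kk t" using j(3) by eventually_elim simp
        have "(\<forall>\<^sub>F t. pair (i t + 1) (x t) \<in> T t) \<longleftrightarrow> (\<forall>\<^sub>F t. pair (i t + 1) (x t) \<in> A t)"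
          using T(3) E[OF T(1) T(1) i j(2) ik below[OF i _ ij(1)]] i j(2) ik unfolding inner[OF T(1)] by blast
        moreover have "\<forall>\<^sub>F t. pair (j t) (x t) \<in> T t \<longleftrightarrow> pair (i t + 1) (x t) \<in> T t"
          "\<forall>\<^sub>F t. pair (j t) (x t) \<in> A t \<longleftrightarrow> pair (i t + 1) (x t) \<in> A t" using ij(2) by (eventually_elim, simp)+
        ultimately show ?thesis unfolding ev_iff by blast
      qed
    qed
    then show "\<forall>\<^sub>F t. pair (kk t) (vv t) \<in> A t" using T(4) by blast
  qed
  finally show "hold G' (f_rec P R k v) = (\<forall>\<^sub>F t. iter (p t) (r t) (kk t) (vv t))" unfolding A(2) .
qed

lemma iden_set_recursion:
  assumes A: "A \<in> S" and m: "mterm G m mm" "mterm G v vv"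
    and good: "\<And>H X. G \<preceq> H \<Longrightarrow> mset H X A \<Longrightarrow> den H (\<Phi> X) True"
    and unique: "\<And>H X T. G \<preceq> H \<Longrightarrow> H \<preceq> H \<Longrightarrow> mset H X T \<Longrightarrow> hold H (\<Phi> X) \<Longrightarrow>
      (\<forall>\<^sub>F t. pair (mm t) (vv t) \<in> T t) \<longleftrightarrow> (\<forall>\<^sub>F t. pair (mm t) (vv t) \<in> A t)"
  shows "iden G (\<^bold>\<exists>\<^sub>s X. \<Phi> X \<^bold>\<and> \<^bold>\<langle>m, v\<^bold>\<rangle> \<^bold>\<in> X) (\<lambda>t. pair (mm t) (vv t) \<in> A t)"
  unfolding den_def
proof (intro allI impI)
  fix G' assume G': "G \<preceq> G'"
  have P: "G \<preceq> pushS T G'" "pushS T G' \<preceq> pushS T G'" "mset (pushS T G') (newS G') T" if "T \<in> S" for T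
    using mle_trans[OF G' mle_push(2)[OF G' that]] mle_refl[OF mle_push(2)[OF G' that]] mset_newS[OF that] by blast+
  have last: "hold (pushS T G') (\<^bold>\<langle>m, v\<^bold>\<rangle> \<^bold>\<in> newS G') \<longleftrightarrow> (\<forall>\<^sub>F t. pair (mm t) (vv t) \<in> T t)" if T: "T \<in> S" for T
  proof -
    have "iden (pushS T G') (\<^bold>\<langle>m, v\<^bold>\<rangle> \<^bold>\<in> newS G') (\<lambda>t. pair (mm t) (vv t) \<in> T t)"
      by (intro iden_atoms mterm_pair mset_newS T mterm_mono[OF m(1) P(1)[OF T]] mterm_mono[OF m(2) P(1)[OF T]])
    then show ?thesis using P(2)[OF T] unfolding den_def by blast
  qed
  have "hold (pushS A G') (\<Phi> (newS G'))" using good[OF P(1,3)[OF A]] P(2)[OF A] unfolding den_def by blast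
  then show "hold G' (\<^bold>\<exists>\<^sub>s X. \<Phi> X \<^bold>\<and> \<^bold>\<langle>m, v\<^bold>\<rangle> \<^bold>\<in> X) = (\<forall>\<^sub>F t. pair (mm t) (vv t) \<in> A t)"
    unfolding hold_quantifiers(3) hold_simps(2) using last unique[OF P] A by blast
qed

lemma hold_all2:
  assumes "hold G (\<^bold>\<forall>k. \<^bold>\<forall>x. \<Psi> k x)" "G \<preceq> G" "j \<in> I" "x \<in> I"
  obtains H a b where "G \<preceq> H" "H \<preceq> H" "mterm H a j" "mterm H b x" "hold H (\<Psi> a b)"
proof -
  let ?J = "pushN j G" and ?H = "pushN x (pushN j G)"
  have J: "G \<preceq> ?J" "?J \<preceq> ?H" using mle_push(1)[OF assms(2,3)] mle_push(1)[OF _ assms(4)] by blast+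
  show thesis
  proof (rule that)
    show "G \<preceq> ?H" using J mle_trans by blast
    then show "?H \<preceq> ?H" by (rule mle_refl)
    show "mterm ?H (newN G) j" using mterm_mono[OF mterm_newN[OF assms(3)] J(2)] .
    show "mterm ?H (newN ?J) x" using mterm_newN[OF assms(4)] .
    show "hold ?H (\<Psi> (newN G) (newN ?J))" using assms unfolding hold_quantifiers(1) by blast
  qed
qed

text \<open>The predicate \<open>rng\<close> marks the arguments for which the clause makes an
  assertion: all of them for brackets, those up to \<open>n\<close> for upgrades. There the clause
  must amount to agreement with \<open>A\<close>, given agreement at smaller arguments; elsewhere it
  holds trivially.\<close>

lemma iden_course_of_values:
  assumes A: "A \<in> S" and m: "mterm G m mm" "mterm G v vv"
    and rng: "\<And>j. \<forall>\<^sub>F t. j t \<le> mm t \<Longrightarrow> rng j"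
    and step: "\<And>H X T a j b x. G \<preceq> H \<Longrightarrow> mset H X T \<Longrightarrow> mterm H a j \<Longrightarrow> mterm H b x \<Longrightarrow> rng j \<Longrightarrow>
      (\<And>j' x'. j' \<in> I \<Longrightarrow> x' \<in> I \<Longrightarrow> \<forall>\<^sub>F t. j' t < j t \<Longrightarrow>
        (\<forall>\<^sub>F t. pair (j' t) (x' t) \<in> T t) \<longleftrightarrow> (\<forall>\<^sub>F t. pair (j' t) (x' t) \<in> A t)) \<Longrightarrow>
      den H (\<Psi> X a b) ((\<forall>\<^sub>F t. pair (j t) (x t) \<in> T t) \<longleftrightarrow> (\<forall>\<^sub>F t. pair (j t) (x t) \<in> A t))"
    and out: "\<And>H X T a j b x. G \<preceq> H \<Longrightarrow> mset H X T \<Longrightarrow> mterm H a j \<Longrightarrow> mterm H b x \<Longrightarrow> \<not> rng j \<Longrightarrow>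
      den H (\<Psi> X a b) True"
  shows "iden G (\<^bold>\<exists>\<^sub>s X. (\<^bold>\<forall>k. \<^bold>\<forall>x. \<Psi> X k x) \<^bold>\<and> \<^bold>\<langle>m, v\<^bold>\<rangle> \<^bold>\<in> X) (\<lambda>t. pair (mm t) (vv t) \<in> A t)"
proof (rule iden_set_recursion[OF A m])
  fix H X assume H: "G \<preceq> H" "mset H X A"
  have "den H (\<^bold>\<forall>k. \<^bold>\<forall>x. \<Psi> X k x) (\<forall>j\<in>I. \<forall>x\<in>I. True)"
  proof (intro den_all)
    fix K a j L b x assume *: "H \<preceq> K" "mterm K a j" "K \<preceq> L" "mterm L b x"
    have "G \<preceq> L" "mset L X A" "mterm L a j" using * H mle_trans mset_mono mterm_mono by meson+
    then show "den L (\<Psi> X a b) True" using step[of L X A a j b x] out[of L X A a j b x] *(4) by (cases "rng j") simp_all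
  qed
  then show "den H (\<^bold>\<forall>k. \<^bold>\<forall>x. \<Psi> X k x) True" by simp
next
  fix H X T assume H: "G \<preceq> H" "H \<preceq> H" "mset H X T" "hold H (\<^bold>\<forall>k. \<^bold>\<forall>x. \<Psi> X k x)"
  show "(\<forall>\<^sub>F t. pair (mm t) (vv t) \<in> T t) \<longleftrightarrow> (\<forall>\<^sub>F t. pair (mm t) (vv t) \<in> A t)"
  proof (rule agree_induct[OF mset_S[OF H(3)] A mterm_I[OF m(1)] mterm_I[OF m(2)]])
    fix j x assume j: "j \<in> I" "x \<in> I" "\<forall>\<^sub>F t. j t \<le> mm t" and
      below: "\<And>j' x'. j' \<in> I \<Longrightarrow> x' \<in> I \<Longrightarrow> \<forall>\<^sub>F t. j' t < j t \<Longrightarrow>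
        (\<forall>\<^sub>F t. pair (j' t) (x' t) \<in> T t) \<longleftrightarrow> (\<forall>\<^sub>F t. pair (j' t) (x' t) \<in> A t)"
    obtain K a b where K: "H \<preceq> K" "K \<preceq> K" "mterm K a j" "mterm K b x" "hold K (\<Psi> X a b)"
      using hold_all2[OF H(4,2) j(1,2)] .
    have "den K (\<Psi> X a b) ((\<forall>\<^sub>F t. pair (j t) (x t) \<in> T t) \<longleftrightarrow> (\<forall>\<^sub>F t. pair (j t) (x t) \<in> A t))"
      by (rule step[OF mle_trans[OF H(1) K(1)] mset_mono[OF H(3) K(1)] K(3,4) rng[OF j(3)] below])
    then show "(\<forall>\<^sub>F t. pair (j t) (x t) \<in> T t) \<longleftrightarrow> (\<forall>\<^sub>F t. pair (j t) (x t) \<in> A t)"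
      using K(2,5) unfolding den_def by blast
  qed
qed

lemma iden_ex_le:
  assumes "\<And>H a x. G \<preceq> H \<Longrightarrow> mterm H a x \<Longrightarrow> iden H (Q a) (\<lambda>t. q t (x t))"
    and "mterm G b g" "\<forall>\<^sub>F t. \<forall>x. q t x \<longrightarrow> x \<le> g t"
  shows "iden G (l_ex Q) (\<lambda>t. \<exists>x. q t x)"
  using iden_ex[OF assms(1) mterm_I[OF assms(2)] assms(3)] .

lemma iden_all_le:
  assumes "\<And>H a x. G \<preceq> H \<Longrightarrow> mterm H a x \<Longrightarrow> iden H (Q a) (\<lambda>t. q t (x t))"
    and "mterm G b g" "\<forall>\<^sub>F t. \<forall>x. \<not> q t x \<longrightarrow> x \<le> g t"
  shows "iden G (l_all Q) (\<lambda>t. \<forall>x. q t x)"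
  using iden_all[OF assms(1) mterm_I[OF assms(2)] assms(3)] .

text \<open>The minimum is required to lie in the cut because the formulas begin with an existential
  quantifier over it.\<close>

definition hierS :: "(nat \<Rightarrow> nat set) \<Rightarrow> bool" where
  "hierS B \<longleftrightarrow> B \<in> S \<and> (\<forall>t. base_hierarchy (B t)) \<and> (\<lambda>t. Inf (B t)) \<in> I"

definition setS :: "(nat \<Rightarrow> nat set) \<Rightarrow> bool" where
  "setS C \<longleftrightarrow> C \<in> S \<and> (\<forall>t. \<forall>c\<in>C t. 2 \<le> c)"

lemma den_conn:
  "den G P p \<Longrightarrow> den G Q q \<Longrightarrow> den G (P \<^bold>\<longleftrightarrow> Q) (p \<longleftrightarrow> q)"
  "den G P p \<Longrightarrow> (p \<Longrightarrow> den G Q q) \<Longrightarrow> den G (P \<^bold>\<longrightarrow> Q) (p \<longrightarrow> q)"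
  "den G P p \<Longrightarrow> (p \<Longrightarrow> den G Q q) \<Longrightarrow> den G (P \<^bold>\<and> Q) (p \<and> q)"
  by (auto simp: den_def hold_simps)

lemma den_refl: "(\<And>H. G \<preceq> H \<Longrightarrow> den H P b) \<Longrightarrow> den G P b"
  unfolding den_def using mle_refl by metis

lemma mpred_here: "mpred G P A \<Longrightarrow> mterm G a x \<Longrightarrow> iden G (P a) (\<lambda>t. x t \<in> A t)"
  by (rule den_refl, rule mpredD, assumption, assumption, rule mterm_mono, assumption, assumption)

lemma mrel_here: "mrel G n U A \<Longrightarrow> mterm G a x \<Longrightarrow> mterm G b y \<Longrightarrow> \<forall>\<^sub>F t. x t < n t \<Longrightarrow>
    iden G (U a b) (\<lambda>t. pair (x t) (y t) \<in> A t)"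
  by (rule den_refl, rule mrelD, assumption, assumption, (rule mterm_mono, assumption, assumption)+, assumption)

lemma mrel_weaken: "mrel G n U A \<Longrightarrow> \<forall>\<^sub>F t. n' t \<le> n t \<Longrightarrow> mrel G n' U A"
  unfolding mrel_def
proof (intro allI impI)
  fix H a x b y
  assume *: "\<forall>H a x b y. G \<preceq> H \<longrightarrow> mterm H a x \<longrightarrow> mterm H b y \<longrightarrow> (\<forall>\<^sub>F t. x t < n t) \<longrightarrow>
     iden H (U a b) (\<lambda>t. pair (x t) (y t) \<in> A t)" "\<forall>\<^sub>F t. n' t \<le> n t"
    "G \<preceq> H" "mterm H a x" "mterm H b y" "\<forall>\<^sub>F t. x t < n' t"
  have "\<forall>\<^sub>F t. x t < n t" using *(2,6) by eventually_elim simp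
  then show "iden H (U a b) (\<lambda>t. pair (x t) (y t) \<in> A t)" using *(1,3-5) by blast
qed

lemma is_decomposition_le:
  assumes "is_decomposition b n e a r" shows "e \<le> n \<and> a \<le> n \<and> r \<le> n"
proof -
  have "0 < b ^ e" using assms by (auto simp: is_decomposition_def)
  then have "1 * a \<le> b ^ e * a" by (intro mult_right_mono) auto
  moreover have "n = b ^ e * a + r" using assms by (simp add: is_decomposition_def)
  ultimately have "a \<le> n" by linarith
  then show ?thesis using is_decomposition_less[OF assms] by simp
qed

section \<open>Absoluteness of bases, powers, brackets and upgrades\<close>

lemma iden_min:
  assumes "mpred G P B" "hierS B" "mterm G m mm"
  shows "iden G (f_min P m) (\<lambda>t. mm t = Inf (B t))"
proof (rule iden_cong)
  show "iden G (f_min P m) (\<lambda>t. mm t \<in> B t \<and> (\<forall>x. x \<in> B t \<longrightarrow> mm t \<le> x))"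
    using assms(1,3) unfolding f_min_def
    apply -
    apply (rule iden_lazy iden_all_le mpred_here iden_le | assumption
      | (rule mterm_mono, assumption) | (rule mpred_mono, assumption))+
    apply (auto simp: ev_const)
    done
  have "B t \<noteq> {}" for t using assms(2) hierarchy_props(1) unfolding hierS_def by blast
  then show "\<forall>\<^sub>F t. (mm t \<in> B t \<and> (\<forall>x. x \<in> B t \<longrightarrow> mm t \<le> x)) \<longleftrightarrow> mm t = Inf (B t)"
    using r_min_iff unfolding r_min_def by simp
qed

lemma iden_base:
  assumes "mpred G P B" "hierS B" "mterm G n nn" "mterm G b bb"
  shows "iden G (f_base P n b) (\<lambda>t. bb t = base (B t) (nn t))"
proof (rule iden_cong)
  have *: "iden G (f_max (\<lambda>x. P x \<^bold>\<and> x \<^bold>\<le> n) b) (\<lambda>t. (bb t \<in> B t \<and> bb t \<le> nn t) \<and> (\<forall>x. x \<in> B t \<and> x \<le> nn t \<longrightarrow> x \<le> bb t))"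
    using assms(1,3,4) unfolding f_max_def
    apply -
    apply (rule iden_lazy mpred_here iden_le | assumption)+
    apply (rule iden_all_le[where b = n and g = nn])
    apply (rule iden_lazy mpred_here iden_le | assumption
      | (rule mterm_mono, assumption) | (rule mpred_mono, assumption))+
    apply (auto simp: ev_const)
    done
  show "iden G (f_base P n b) (\<lambda>t. ((bb t \<in> B t \<and> bb t \<le> nn t) \<and> (\<forall>x. x \<in> B t \<and> x \<le> nn t \<longrightarrow> x \<le> bb t)) \<or> (bb t = Inf (B t) \<and> nn t < bb t))"
    unfolding f_base_def by (intro iden_conn iden_lazy * iden_min iden_atoms assms)
  have B: "B t \<noteq> {}" for t using assms(2) hierarchy_props(1) unfolding hierS_def by blast
  show "\<forall>\<^sub>F t. (((bb t \<in> B t \<and> bb t \<le> nn t) \<and> (\<forall>x. x \<in> B t \<and> x \<le> nn t \<longrightarrow> x \<le> bb t)) \<or> (bb t = Inf (B t) \<and> nn t < bb t)) \<longleftrightarrow> bb t = base (B t) (nn t)"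
    unfolding r_base_iff[OF B, symmetric] r_base_def r_min_iff[OF B] r_max_def by simp
qed

lemma iden_pow:
  assumes "mterm G c cc" "mterm G e ee" "mterm G v vv" "\<forall>\<^sub>F t. 1 \<le> cc t"
  shows "iden G (f_pow c e v) (\<lambda>t. vv t = cc t ^ ee t)"
proof -
  define A where "A = (\<lambda>t. opint B0 O_pow (top_bound t) (map (\<lambda>A. A t) []) (map (\<lambda>f. f t) [cc]))"
  have "A \<in> S" unfolding A_def using mterm_I[OF assms(1)] by (intro S_opint) auto
  have "iden G (f_pow c e v) (\<lambda>t. iter (\<lambda>x. x = 1) (\<lambda>j y x. x = y * cc t) (ee t) (vv t))"
    unfolding f_pow_def
  proof (rule iden_rec[OF assms(2,3) _ _ _ \<open>A \<in> S\<close>])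
    show "\<forall>\<^sub>F t. \<forall>j y x. iter (\<lambda>x. x = 1) (\<lambda>j y x. x = y * cc t) j y \<and> x = y * cc t \<longrightarrow> y \<le> x + 1"
      using assms(4)
    proof eventually_elim
      case (elim t)
      have "y \<le> y * cc t" for y using elim by (cases "cc t") auto
      then show ?case by (simp add: le_SucI)
    qed
    show "pair j x \<in> A t \<longleftrightarrow> iter (\<lambda>x. x = 1) (\<lambda>j y x. x = y * cc t) j x" for t j x
      unfolding iter_pow by (auto simp: A_def)
  qed (intro iden_atoms mterm_ops mterm_mono[OF assms(1)]; assumption)+
  then show ?thesis unfolding iter_pow .
qed

lemma iden_decomp:
  assumes "mterm G b bb" "mterm G n nn" "mterm G e ee" "mterm G a aa" "mterm G r rr" "\<forall>\<^sub>F t. 1 \<le> bb t"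
  shows "iden G (f_decomp b n e a r) (\<lambda>t. is_decomposition (bb t) (nn t) (ee t) (aa t) (rr t))"
proof (rule iden_cong)
  show "iden G (f_decomp b n e a r) (\<lambda>t. \<exists>p. p = bb t ^ ee t \<and> p \<le> nn t \<and> nn t < p * bb t \<and> 0 < aa t \<and> aa t < bb t \<and> rr t < p \<and>
       nn t = p * aa t + rr t)"
    using assms unfolding f_decomp_def
    apply -
    apply (rule iden_ex_le[where b = n and g = nn])
    apply (rule iden_lazy iden_pow iden_le iden_atoms mterm_ops | assumption | (rule mterm_mono, assumption))+
    apply (auto simp: ev_const)
    done
  show "\<forall>\<^sub>F t. (\<exists>p. p = bb t ^ ee t \<and> p \<le> nn t \<and> nn t < p * bb t \<and> 0 < aa t \<and> aa t < bb t \<and> rr t < p \<and>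
       nn t = p * aa t + rr t) \<longleftrightarrow> is_decomposition (bb t) (nn t) (ee t) (aa t) (rr t)"
    by (auto simp: is_decomposition_def mult.commute intro!: always_eventually)
qed

text \<open>Only digits are looked up in \<open>U\<close>, so it need only be understood below
  \<open>b\<close>. This permits the use inside the recursion for upgrades, where the values at
  larger arguments are not yet known.\<close>

lemma iden_bracket:
  assumes U: "mrel G bb U Ug" "\<And>t k x. pair k x \<in> Ug t \<longleftrightarrow> upgrade (B t) (C t) k = enat x" "B \<in> S" "C \<in> S"
    and tm: "mterm G b bb" "mterm G c cc" "mterm G m mm" "mterm G v vv" and bc: "\<forall>\<^sub>F t. 2 \<le> bb t" "\<forall>\<^sub>F t. 2 \<le> cc t"
  shows "iden G (f_bracket U b c m v) (\<lambda>t. bracket (upgrade (B t) (C t)) (bb t) (cc t) (mm t) = enat (vv t))"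
proof -
  define A where "A = (\<lambda>t. opint B0 O_bracket (top_bound t) (map (\<lambda>A. A t) [B, C]) (map (\<lambda>f. f t) [bb, cc]))"
  have AS: "A \<in> S" unfolding A_def using U tm mterm_I by (intro S_opint) auto
  have A: "pair k x \<in> A t \<longleftrightarrow> bracket (upgrade (B t) (C t)) (bb t) (cc t) k = enat x" for t k x
    by (auto simp: A_def)
  have bc1: "\<forall>\<^sub>F t. 1 \<le> bb t" "\<forall>\<^sub>F t. 1 \<le> cc t" using bc by (auto elim: eventually_mono)
  have "iden G (f_bracket U b c m v) (\<lambda>t. pair (mm t) (vv t) \<in> A t)"
    unfolding f_bracket_def
  proof (rule iden_course_of_values[OF AS tm(3,4), where rng = "\<lambda>_. True"])
    fix H X T k x j y
    assume H: "G \<preceq> H" "mset H X T" "mterm H k j" "mterm H x y"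
      and below: "\<And>j' x'. j' \<in> I \<Longrightarrow> x' \<in> I \<Longrightarrow> \<forall>\<^sub>F t. j' t < j t \<Longrightarrow>
        (\<forall>\<^sub>F t. pair (j' t) (x' t) \<in> T t) \<longleftrightarrow> (\<forall>\<^sub>F t. pair (j' t) (x' t) \<in> A t)"
    have TA: "mrel H j (\<lambda>a b. \<^bold>\<langle>a, b\<^bold>\<rangle> \<^bold>\<in> X) A" by (rule mrel_agree[OF H(2) below])
    note facts = H(3,4) TA mrel_mono[OF U(1) H(1)] mterm_mono[OF tm(1) H(1)] mterm_mono[OF tm(2) H(1)] bc1
    let ?R = "(k \<^bold>< b \<^bold>\<and> U k x) \<^bold>\<or>
       (b \<^bold>\<le> k \<^bold>\<and> (\<^bold>\<exists>e. \<^bold>\<exists>a. \<^bold>\<exists>r. f_decomp b k e a r \<^bold>\<and>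
          (\<^bold>\<exists>p. \<^bold>\<exists>q. \<^bold>\<exists>y. \<^bold>\<exists>z. \<^bold>\<langle>e, p\<^bold>\<rangle> \<^bold>\<in> X \<^bold>\<and> f_pow c p q \<^bold>\<and> U a y \<^bold>\<and> \<^bold>\<langle>r, z\<^bold>\<rangle> \<^bold>\<in> X \<^bold>\<and>
             x \<^bold>= q \<^bold>* y \<^bold>+ z)))"
    have "iden H ((k \<^bold>< b \<^bold>\<and> U k x) \<^bold>\<or>
       (b \<^bold>\<le> k \<^bold>\<and> (\<^bold>\<exists>e. \<^bold>\<exists>a. \<^bold>\<exists>r. f_decomp b k e a r \<^bold>\<and>
          (\<^bold>\<exists>p. \<^bold>\<exists>q. \<^bold>\<exists>y. \<^bold>\<exists>z. \<^bold>\<langle>e, p\<^bold>\<rangle> \<^bold>\<in> X \<^bold>\<and> f_pow c p q \<^bold>\<and> U a y \<^bold>\<and> \<^bold>\<langle>r, z\<^bold>\<rangle> \<^bold>\<in> X \<^bold>\<and>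
             x \<^bold>= q \<^bold>* y \<^bold>+ z))))
      (\<lambda>t. (j t < bb t \<and> pair (j t) (y t) \<in> Ug t) \<or>
       (bb t \<le> j t \<and> (\<exists>e a r. is_decomposition (bb t) (j t) e a r \<and>
          (\<exists>p q u z. pair e p \<in> A t \<and> q = cc t ^ p \<and> pair a u \<in> Ug t \<and> pair r z \<in> A t \<and> y t = q * u + z))))"
    proof (intro iden_conn(2) iden_lazy(1))
      show "iden H (k \<^bold>< b) (\<lambda>t. j t < bb t)" "iden H (b \<^bold>\<le> k) (\<lambda>t. bb t \<le> j t)"
        by (intro iden_atoms iden_le facts)+
      show "iden H (U k x) (\<lambda>t. pair (j t) (y t) \<in> Ug t)" if "\<forall>\<^sub>F t. j t < bb t"
        by (rule mrel_here[OF facts(4) facts(1,2) that])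
      show "iden H (\<^bold>\<exists>e. \<^bold>\<exists>a. \<^bold>\<exists>r. f_decomp b k e a r \<^bold>\<and>
          (\<^bold>\<exists>p. \<^bold>\<exists>q. \<^bold>\<exists>y. \<^bold>\<exists>z. \<^bold>\<langle>e, p\<^bold>\<rangle> \<^bold>\<in> X \<^bold>\<and> f_pow c p q \<^bold>\<and> U a y \<^bold>\<and> \<^bold>\<langle>r, z\<^bold>\<rangle> \<^bold>\<in> X \<^bold>\<and> x \<^bold>= q \<^bold>* y \<^bold>+ z))
        (\<lambda>t. \<exists>e a r. is_decomposition (bb t) (j t) e a r \<and>
          (\<exists>p q u z. pair e p \<in> A t \<and> q = cc t ^ p \<and> pair a u \<in> Ug t \<and> pair r z \<in> A t \<and> y t = q * u + z))"
      proof (rule iden_ex_le[where b = k and g = j], rule iden_ex_le[where b = k and g = j], rule iden_ex_le[where b = k and g = j])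
        fix H1 e ee H2 a aa H3 r rr
        assume h: "H \<preceq> H1" "mterm H1 e ee" "H1 \<preceq> H2" "mterm H2 a aa" "H2 \<preceq> H3" "mterm H3 r rr"
        have HH3: "H \<preceq> H3" by (rule mle_trans[OF mle_trans[OF h(1,3)] h(5)])
        have tms: "mterm H3 e ee" "mterm H3 a aa" "mterm H3 r rr" "mterm H3 k j" "mterm H3 x y" "mterm H3 b bb" "mterm H3 c cc"
          by (rule mterm_mono[OF mterm_mono[OF h(2,3)] h(5)] mterm_mono[OF h(4,5)] h(6)
            mterm_mono[OF facts(1) HH3] mterm_mono[OF facts(2) HH3] mterm_mono[OF facts(5) HH3] mterm_mono[OF facts(6) HH3])+
        have rels: "mrel H3 j (\<lambda>a b. \<^bold>\<langle>a, b\<^bold>\<rangle> \<^bold>\<in> X) A" "mrel H3 bb U Ug" by (rule mrel_mono[OF facts(3) HH3] mrel_mono[OF facts(4) HH3])+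
        show "iden H3 (f_decomp b k e a r \<^bold>\<and>
          (\<^bold>\<exists>p. \<^bold>\<exists>q. \<^bold>\<exists>y. \<^bold>\<exists>z. \<^bold>\<langle>e, p\<^bold>\<rangle> \<^bold>\<in> X \<^bold>\<and> f_pow c p q \<^bold>\<and> U a y \<^bold>\<and> \<^bold>\<langle>r, z\<^bold>\<rangle> \<^bold>\<in> X \<^bold>\<and> x \<^bold>= q \<^bold>* y \<^bold>+ z))
          (\<lambda>t. is_decomposition (bb t) (j t) (ee t) (aa t) (rr t) \<and>
          (\<exists>p q u z. pair (ee t) p \<in> A t \<and> q = cc t ^ p \<and> pair (aa t) u \<in> Ug t \<and> pair (rr t) z \<in> A t \<and> y t = q * u + z))"
        proof (rule iden_lazy(1))
          show "iden H3 (f_decomp b k e a r) (\<lambda>t. is_decomposition (bb t) (j t) (ee t) (aa t) (rr t))"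
            by (intro iden_decomp tms bc1)
          assume d: "\<forall>\<^sub>F t. is_decomposition (bb t) (j t) (ee t) (aa t) (rr t)"
          then have "\<forall>\<^sub>F t. ee t < j t \<and> rr t < j t \<and> aa t < bb t \<and> 0 < aa t"
          proof eventually_elim
            case (elim t)
            then show ?case using is_decomposition_less[OF elim] unfolding is_decomposition_def by blast
          qed
          then have small: "\<forall>\<^sub>F t. ee t < j t" "\<forall>\<^sub>F t. rr t < j t" "\<forall>\<^sub>F t. aa t < bb t" "\<forall>\<^sub>F t. 0 < aa t"
            by (eventually_elim, simp)+
          \<comment> \<open>From \<open>q = c ^ p\<close> with \<open>c \<ge> 2\<close> follows
            \<open>p < q\<close>, and the upgraded digit \<open>u\<close> is nonzero. Therefore the
            value \<open>q * u + z\<close> bounds all four witnesses.\<close>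
          have bounds: "\<forall>\<^sub>F t. \<forall>p q u z. q = cc t ^ p \<and> pair (aa t) u \<in> Ug t \<and> y t = q * u + z \<longrightarrow>
              p \<le> y t \<and> q \<le> y t \<and> u \<le> y t \<and> z \<le> y t"
            using bc(2) small(4)
          proof eventually_elim
            case (elim t)
            show ?case
            proof (intro allI impI)
              fix p q u z assume *: "q = cc t ^ p \<and> pair (aa t) u \<in> Ug t \<and> y t = q * u + z"
              have "u \<noteq> 0" using * upgrade_nz[OF elim(2), of "B t" "C t"] by (auto simp: U(2) zero_enat_def)
              then have "q \<le> q * u" by simp
              moreover have "p < q" using * elim(1) power_gt_expt[of "cc t" p] by simp
              moreover have "1 * u \<le> q * u" using \<open>p < q\<close> by (intro mult_right_mono) auto
              ultimately show "p \<le> y t \<and> q \<le> y t \<and> u \<le> y t \<and> z \<le> y t" using * by linarith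
            qed
          qed
          show "iden H3 (\<^bold>\<exists>p. \<^bold>\<exists>q. \<^bold>\<exists>y. \<^bold>\<exists>z. \<^bold>\<langle>e, p\<^bold>\<rangle> \<^bold>\<in> X \<^bold>\<and> f_pow c p q \<^bold>\<and> U a y \<^bold>\<and> \<^bold>\<langle>r, z\<^bold>\<rangle> \<^bold>\<in> X \<^bold>\<and> x \<^bold>= q \<^bold>* y \<^bold>+ z)
            (\<lambda>t. \<exists>p q u z. pair (ee t) p \<in> A t \<and> q = cc t ^ p \<and> pair (aa t) u \<in> Ug t \<and> pair (rr t) z \<in> A t \<and> y t = q * u + z)"
          proof (rule iden_ex_le[where b = x and g = y], rule iden_ex_le[where b = x and g = y],
              rule iden_ex_le[where b = x and g = y], rule iden_ex_le[where b = x and g = y])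
            fix K1 p pp K2 q qq K3 w ww K4 z zz
            assume k: "H3 \<preceq> K1" "mterm K1 p pp" "K1 \<preceq> K2" "mterm K2 q qq" "K2 \<preceq> K3" "mterm K3 w ww" "K3 \<preceq> K4" "mterm K4 z zz"
            have K14: "K3 \<preceq> K4" "K2 \<preceq> K4" "K1 \<preceq> K4" "H3 \<preceq> K4" by (rule k(7), rule mle_trans[OF k(5,7)], rule mle_trans[OF k(3) mle_trans[OF k(5,7)]],
                rule mle_trans[OF k(1) mle_trans[OF k(3) mle_trans[OF k(5,7)]]])
            note K = K14(4)
            have pqw: "mterm K4 p pp" "mterm K4 q qq" "mterm K4 w ww"
              by (rule mterm_mono[OF k(2) K14(3)] mterm_mono[OF k(4) K14(2)] mterm_mono[OF k(6) K14(1)])+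
            show "iden K4 (\<^bold>\<langle>e, p\<^bold>\<rangle> \<^bold>\<in> X \<^bold>\<and> f_pow c p q \<^bold>\<and> U a w \<^bold>\<and> \<^bold>\<langle>r, z\<^bold>\<rangle> \<^bold>\<in> X \<^bold>\<and> x \<^bold>= q \<^bold>* w \<^bold>+ z)
              (\<lambda>t. pair (ee t) (pp t) \<in> A t \<and> qq t = cc t ^ pp t \<and> pair (aa t) (ww t) \<in> Ug t \<and> pair (rr t) (zz t) \<in> A t \<and> y t = qq t * ww t + zz t)"
              by (intro iden_lazy iden_atoms mterm_ops iden_pow mrel_here[OF mrel_mono[OF rels(1) K]]
                  mrel_here[OF mrel_mono[OF rels(2) K]] tms[THEN mterm_mono, OF K] small bc1 pqw k(8))
          next
            show "mterm H3 x y" by (rule tms(5))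
            show "mterm K1 x y" if "H3 \<preceq> K1" for K1 by (rule mterm_mono[OF tms(5) that])
            show "mterm K2 x y" if "H3 \<preceq> K1" "K1 \<preceq> K2" for K1 K2 by (rule mterm_mono[OF tms(5) mle_trans[OF that]])
            show "mterm K3 x y" if "H3 \<preceq> K1" "K1 \<preceq> K2" "K2 \<preceq> K3" for K1 K2 K3
              by (rule mterm_mono[OF tms(5) mle_trans[OF mle_trans[OF that(1,2)] that(3)]])
          qed (rule eventually_mono[OF bounds], blast)+
        qed
      next
        show "mterm H k j" by (rule facts(1))
        show "mterm H1 k j" if "H \<preceq> H1" for H1 by (rule mterm_mono[OF facts(1) that])
        show "mterm H2 k j" if "H \<preceq> H1" "H1 \<preceq> H2" for H1 H2 by (rule mterm_mono[OF facts(1) mle_trans[OF that]])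
      qed (rule always_eventually, blast dest: is_decomposition_le)+
    qed
    then have R: "iden H ?R (\<lambda>t. pair (j t) (y t) \<in> A t)"
    proof (rule iden_cong)
      show "\<forall>\<^sub>F t. ((j t < bb t \<and> pair (j t) (y t) \<in> Ug t) \<or>
       (bb t \<le> j t \<and> (\<exists>e a r. is_decomposition (bb t) (j t) e a r \<and>
          (\<exists>p q u z. pair e p \<in> A t \<and> q = cc t ^ p \<and> pair a u \<in> Ug t \<and> pair r z \<in> A t \<and> y t = q * u + z)))) \<longleftrightarrow>
        pair (j t) (y t) \<in> A t"
        using bc
      proof eventually_elim
        case (elim t)
        show ?case
        proof (cases "j t < bb t")
          case True
          then show ?thesis by (simp add: A U(2) bracket.simps[of _ _ _ "j t"])
        next
          case False
          have "(\<exists>e a r. is_decomposition (bb t) (j t) e a r \<and>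
          (\<exists>p q u z. pair e p \<in> A t \<and> q = cc t ^ p \<and> pair a u \<in> Ug t \<and> pair r z \<in> A t \<and> y t = q * u + z)) \<longleftrightarrow>
            pair (j t) (y t) \<in> A t"
            unfolding A U(2) using elim False upgrade_nz by (intro bracket_step) auto
          then show ?thesis using False by simp
        qed
      qed
    qed
    show "den H (\<^bold>\<langle>k, x\<^bold>\<rangle> \<^bold>\<in> X \<^bold>\<longleftrightarrow> ?R) ((\<forall>\<^sub>F t. pair (j t) (y t) \<in> T t) \<longleftrightarrow> (\<forall>\<^sub>F t. pair (j t) (y t) \<in> A t))"
      by (intro den_conn(1) R iden_atoms mterm_pair H)
  qed simp_all
  then show ?thesis unfolding A .
qed

lemma ev_always: "(\<And>t. p t) \<Longrightarrow> \<forall>\<^sub>F t. p t" by simp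

lemma hierS_base:
  assumes "hierS B" shows "2 \<le> base (B t) n" "Inf (B t) \<le> n \<Longrightarrow> base (B t) n \<le> n"
proof -
  have B: "base_hierarchy (B t)" using assms by (simp add: hierS_def)
  show "2 \<le> base (B t) n" using base_ge2 hierarchy_props(1-3)[OF B] by blast
  show "Inf (B t) \<le> n \<Longrightarrow> base (B t) n \<le> n" by (rule base_le)
qed

lemma iden_good:
  assumes U: "mrel G nn U Ug" "\<And>t k x. pair k x \<in> Ug t \<longleftrightarrow> upgrade (B t) (C t) k = enat x"
    and B: "hierS B" and C: "setS C" "mpred G P C"
    and tm: "mterm G b bb" "mterm G n nn" "mterm G c cc" "mterm G w ww"
    and bb: "\<forall>\<^sub>F t. bb t = base (B t) (nn t)" "\<forall>\<^sub>F t. Inf (B t) \<le> nn t"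
  shows "iden G (f_good U P b n c w) (\<lambda>t. good (B t) (C t) (nn t) (cc t) \<and>
    bracket (upgrade (B t) (C t)) (base (B t) (nn t)) (cc t) (nn t) = enat (ww t))"
proof (rule iden_cong)
  have bn: "\<forall>\<^sub>F t. 2 \<le> bb t" "\<forall>\<^sub>F t. bb t \<le> nn t"
    using bb by (eventually_elim, use hierS_base[OF B] in simp)+
  have U': "mrel G bb U Ug" by (rule mrel_weaken[OF U(1) bn(2)])
  show "iden G (f_good U P b n c w) (\<lambda>t. cc t \<in> C t \<and> bracket (upgrade (B t) (C t)) (bb t) (cc t) (nn t) = enat (ww t) \<and>
      (\<exists>k u. nn t = k + 1 \<and> pair k u \<in> Ug t \<and> u < ww t) \<and> (\<forall>x. x \<in> C t \<and> cc t < x \<longrightarrow> ww t < x))"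
    unfolding f_good_def
  proof (intro iden_lazy(1))
    show "iden G (P c) (\<lambda>t. cc t \<in> C t)" by (rule mpred_here[OF C(2) tm(3)])
    show "iden G (f_bracket U b c n w) (\<lambda>t. bracket (upgrade (B t) (C t)) (bb t) (cc t) (nn t) = enat (ww t))"
      if "\<forall>\<^sub>F t. cc t \<in> C t"
      using that C(1) B unfolding setS_def hierS_def
      by (intro iden_bracket[OF U' U(2)] tm bn) (auto elim: eventually_mono)
    show "iden G (\<^bold>\<exists>k. \<^bold>\<exists>u. n \<^bold>= k \<^bold>+ \<^bold>1 \<^bold>\<and> U k u \<^bold>\<and> u \<^bold>< w) (\<lambda>t. \<exists>k u. nn t = k + 1 \<and> pair k u \<in> Ug t \<and> u < ww t)"
    proof (rule iden_ex_le[where b = n and g = nn], rule iden_ex_le[where b = w and g = ww])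
      fix H k kk K u uu assume h: "G \<preceq> H" "mterm H k kk" "H \<preceq> K" "mterm K u uu"
      have GK: "G \<preceq> K" by (rule mle_trans[OF h(1,3)])
      show "iden K (n \<^bold>= k \<^bold>+ \<^bold>1 \<^bold>\<and> U k u \<^bold>\<and> u \<^bold>< w) (\<lambda>t. nn t = kk t + 1 \<and> pair (kk t) (uu t) \<in> Ug t \<and> uu t < ww t)"
        by (intro iden_lazy(1) iden_atoms mterm_ops tm[THEN mterm_mono, OF GK] mterm_mono[OF h(2,3)] h(4)
            mrel_here[OF mrel_mono[OF U(1) GK]]) (erule eventually_mono, simp)
    next
      show "mterm H w ww" if "G \<preceq> H" for H by (rule mterm_mono[OF tm(4) that])
    qed (auto intro!: ev_always tm)
    show "iden G (\<^bold>\<forall>x. P x \<^bold>\<and> c \<^bold>< x \<^bold>\<longrightarrow> w \<^bold>< x) (\<lambda>t. \<forall>x. x \<in> C t \<and> cc t < x \<longrightarrow> ww t < x)"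
    proof (rule iden_all_le[where b = w and g = ww])
      fix H x xx assume h: "G \<preceq> H" "mterm H x xx"
      show "iden H (P x \<^bold>\<and> c \<^bold>< x \<^bold>\<longrightarrow> w \<^bold>< x) (\<lambda>t. xx t \<in> C t \<and> cc t < xx t \<longrightarrow> ww t < xx t)"
        by (intro iden_lazy iden_atoms mpredD[OF C(2)] h tm[THEN mterm_mono, OF h(1)])
    qed (auto intro!: ev_always tm)
  qed
  show "\<forall>\<^sub>F t. (cc t \<in> C t \<and> bracket (upgrade (B t) (C t)) (bb t) (cc t) (nn t) = enat (ww t) \<and>
      (\<exists>k u. nn t = k + 1 \<and> pair k u \<in> Ug t \<and> u < ww t) \<and> (\<forall>x. x \<in> C t \<and> cc t < x \<longrightarrow> ww t < x)) \<longleftrightarrow>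
      (good (B t) (C t) (nn t) (cc t) \<and> bracket (upgrade (B t) (C t)) (base (B t) (nn t)) (cc t) (nn t) = enat (ww t))"
    using bb bn
  proof eventually_elim
    case (elim t)
    then obtain l where l: "nn t = Suc l" by (cases "nn t") auto
    have "(\<exists>k u. nn t = k + 1 \<and> pair k u \<in> Ug t \<and> u < ww t) \<longleftrightarrow> upgrade (B t) (C t) (nn t - 1) < enat (ww t)"
      unfolding U(2) by (cases "upgrade (B t) (C t) l") (auto simp: l)
    then show ?case using elim(1) unfolding good_def by (auto simp: next_base_less)
  qed
qed

lemma upgrade_graph:
  assumes "B \<in> S" "C \<in> S"
  shows "\<exists>A\<in>S. \<forall>t k x. pair k x \<in> A t \<longleftrightarrow> upgrade (B t) (C t) k = enat x"
proof -
  have "(\<lambda>t. opint B0 O_upgrade (top_bound t) (map (\<lambda>A. A t) [B, C]) (map (\<lambda>f. f t) [])) \<in> S"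
    using assms by (intro S_opint) auto
  then show ?thesis by (elim bexI[rotated]) auto
qed

text \<open>A good base has a finite value, as the value is strictly below \<open>next_base\<close>.
  Excluding all values \<open>y\<close> for \<open>c'\<close> therefore excludes \<open>c'\<close>
  itself.\<close>

lemma upgrade_step:
  assumes "base_hierarchy B"
  shows "(k < Inf B \<and> x = k) \<or> (Inf B \<le> k \<and> (\<exists>b c. b = base B k \<and>
      (good B C k c \<and> bracket (upgrade B C) (base B k) c k = enat x) \<and>
      (\<forall>c' y. c' < c \<longrightarrow> \<not> (good B C k c' \<and> bracket (upgrade B C) (base B k) c' k = enat y)))) \<longleftrightarrow>
    upgrade B C k = enat x"
proof (cases "k < Inf B")
  case True
  then show ?thesis by (subst upgrade_eq) auto
next
  case False
  let ?g = "good B C k" and ?br = "\<lambda>c. bracket (upgrade B C) (base B k) c k"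
  have fin: "?g c \<Longrightarrow> \<exists>y. ?br c = enat y" for c by (cases "?br c") (auto simp: good_def)
  have "Inf B \<noteq> 0" using hierarchy_props(5)[OF assms] by simp
  have "(\<exists>b c. b = base B k \<and> (?g c \<and> ?br c = enat x) \<and> (\<forall>c' y. c' < c \<longrightarrow> \<not> (?g c' \<and> ?br c' = enat y)))
    \<longleftrightarrow> (\<exists>c. ?g c \<and> ?br c = enat x \<and> (\<forall>c'<c. \<not> ?g c'))" using fin by blast
  also have "... \<longleftrightarrow> (\<exists>c. ?g c) \<and> ?br (LEAST c. ?g c) = enat x"
    by (smt (verit) LeastI_ex Least_equality not_less not_less_Least)
  also have "... \<longleftrightarrow> upgrade B C k = enat x"
    using False \<open>Inf B \<noteq> 0\<close> upgrade_eq[of B C k] by auto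
  finally show ?thesis using False by simp
qed

lemma iden_upgrade:
  assumes B: "hierS B" "mpred G P B" and C: "setS C" "mpred G Q C"
    and tm: "mterm G n nn" "mterm G v vv"
  shows "iden G (f_upgrade P Q n v) (\<lambda>t. upgrade (B t) (C t) (nn t) = enat (vv t))"
proof -
  obtain A where A: "A \<in> S" "\<And>t k x. pair k x \<in> A t \<longleftrightarrow> upgrade (B t) (C t) k = enat x"
    using upgrade_graph[of B C] B C unfolding hierS_def setS_def by blast
  let ?R = "\<lambda>X m k x. (k \<^bold>< m \<^bold>\<and> x \<^bold>= k) \<^bold>\<or>
       (m \<^bold>\<le> k \<^bold>\<and> (\<^bold>\<exists>b. \<^bold>\<exists>c. f_base P k b \<^bold>\<and> f_good (\<lambda>j y. \<^bold>\<langle>j, y\<^bold>\<rangle> \<^bold>\<in> X) Q b k c x \<^bold>\<and>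
          (\<^bold>\<forall>c'. \<^bold>\<forall>y. c' \<^bold>< c \<^bold>\<longrightarrow> \<^bold>\<not> f_good (\<lambda>j y. \<^bold>\<langle>j, y\<^bold>\<rangle> \<^bold>\<in> X) Q b k c' y)))"
  have body: "iden H (\<^bold>\<exists>\<^sub>s X. (\<^bold>\<forall>k. \<^bold>\<forall>x. k \<^bold>\<le> n \<^bold>\<longrightarrow> (\<^bold>\<langle>k, x\<^bold>\<rangle> \<^bold>\<in> X \<^bold>\<longleftrightarrow> ?R X m k x)) \<^bold>\<and> \<^bold>\<langle>n, v\<^bold>\<rangle> \<^bold>\<in> X)
      (\<lambda>t. pair (nn t) (vv t) \<in> A t)"
    if H: "G \<preceq> H" "mterm H m mm" and mm: "\<forall>\<^sub>F t. mm t = Inf (B t)" for H m mm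
  proof (rule iden_course_of_values[OF A(1) mterm_mono[OF tm(1) H(1)] mterm_mono[OF tm(2) H(1)],
        where rng = "\<lambda>j. \<forall>\<^sub>F t. j t \<le> nn t"])
    fix K X T k j x y
    assume K: "H \<preceq> K" "mset K X T" "mterm K k j" "mterm K x y" "\<forall>\<^sub>F t. j t \<le> nn t"
      and below: "\<And>j' x'. j' \<in> I \<Longrightarrow> x' \<in> I \<Longrightarrow> \<forall>\<^sub>F t. j' t < j t \<Longrightarrow>
        (\<forall>\<^sub>F t. pair (j' t) (x' t) \<in> T t) \<longleftrightarrow> (\<forall>\<^sub>F t. pair (j' t) (x' t) \<in> A t)"
    have GK: "G \<preceq> K" by (rule mle_trans[OF H(1) K(1)])
    have TA: "mrel K j (\<lambda>a b. \<^bold>\<langle>a, b\<^bold>\<rangle> \<^bold>\<in> X) A" by (rule mrel_agree[OF K(2) below])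
    have m: "mterm K m mm" by (rule mterm_mono[OF H(2) K(1)])
    let ?good = "\<lambda>t c y. good (B t) (C t) (j t) c \<and> bracket (upgrade (B t) (C t)) (base (B t) (j t)) c (j t) = enat y"
    have "iden K (?R X m k x) (\<lambda>t. (j t < mm t \<and> y t = j t) \<or> (mm t \<le> j t \<and> (\<exists>b c. b = base (B t) (j t) \<and>
      ?good t c (y t) \<and> (\<forall>c' y. c' < c \<longrightarrow> \<not> ?good t c' y))))"
    proof (intro iden_conn(2) iden_lazy(1))
      show "iden K (k \<^bold>< m) (\<lambda>t. j t < mm t)" "iden K (x \<^bold>= k) (\<lambda>t. y t = j t)" "iden K (m \<^bold>\<le> k) (\<lambda>t. mm t \<le> j t)"
        by (intro iden_atoms iden_le K m)+
      assume le: "\<forall>\<^sub>F t. mm t \<le> j t"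
      then have le': "\<forall>\<^sub>F t. Inf (B t) \<le> j t" using mm by eventually_elim simp
      show "iden K (\<^bold>\<exists>b. \<^bold>\<exists>c. f_base P k b \<^bold>\<and> f_good (\<lambda>j y. \<^bold>\<langle>j, y\<^bold>\<rangle> \<^bold>\<in> X) Q b k c x \<^bold>\<and>
          (\<^bold>\<forall>c'. \<^bold>\<forall>y. c' \<^bold>< c \<^bold>\<longrightarrow> \<^bold>\<not> f_good (\<lambda>j y. \<^bold>\<langle>j, y\<^bold>\<rangle> \<^bold>\<in> X) Q b k c' y))
        (\<lambda>t. \<exists>b c. b = base (B t) (j t) \<and> ?good t c (y t) \<and> (\<forall>c' y. c' < c \<longrightarrow> \<not> ?good t c' y))"
      proof (rule iden_ex_le[where b = k and g = j], rule iden_ex_le[where b = x and g = y])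
        fix L1 b bb L c cc assume L: "K \<preceq> L1" "mterm L1 b bb" "L1 \<preceq> L" "mterm L c cc"
        have KL: "K \<preceq> L" by (rule mle_trans[OF L(1,3)])
        have GL: "G \<preceq> L" by (rule mle_trans[OF GK KL])
        note b = mterm_mono[OF L(2,3)] and k = mterm_mono[OF K(3) KL] and x = mterm_mono[OF K(4) KL]
        show "iden L (f_base P k b \<^bold>\<and> f_good (\<lambda>j y. \<^bold>\<langle>j, y\<^bold>\<rangle> \<^bold>\<in> X) Q b k c x \<^bold>\<and>
          (\<^bold>\<forall>c'. \<^bold>\<forall>y. c' \<^bold>< c \<^bold>\<longrightarrow> \<^bold>\<not> f_good (\<lambda>j y. \<^bold>\<langle>j, y\<^bold>\<rangle> \<^bold>\<in> X) Q b k c' y))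
          (\<lambda>t. bb t = base (B t) (j t) \<and> ?good t (cc t) (y t) \<and> (\<forall>c' y. c' < cc t \<longrightarrow> \<not> ?good t c' y))"
        proof (intro iden_lazy(1))
          show "iden L (f_base P k b) (\<lambda>t. bb t = base (B t) (j t))"
            by (intro iden_base mpred_mono[OF B(2) GL] B(1) k b)
          assume bb: "\<forall>\<^sub>F t. bb t = base (B t) (j t)"
          show "iden L (f_good (\<lambda>j y. \<^bold>\<langle>j, y\<^bold>\<rangle> \<^bold>\<in> X) Q b k c x) (\<lambda>t. ?good t (cc t) (y t))"
            by (rule iden_good[OF mrel_mono[OF TA KL] A(2) B(1) C(1) mpred_mono[OF C(2) GL] b k L(4) x bb le'])
          assume g: "\<forall>\<^sub>F t. ?good t (cc t) (y t)"
          show "iden L (\<^bold>\<forall>c'. \<^bold>\<forall>y. c' \<^bold>< c \<^bold>\<longrightarrow> \<^bold>\<not> f_good (\<lambda>j y. \<^bold>\<langle>j, y\<^bold>\<rangle> \<^bold>\<in> X) Q b k c' y)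
            (\<lambda>t. \<forall>c' y. c' < cc t \<longrightarrow> \<not> ?good t c' y)"
          proof (rule iden_all_le[where b = c and g = cc], rule iden_all_le[where b = c and g = cc])
            fix M1 c' cc' M z zz assume M: "L \<preceq> M1" "mterm M1 c' cc'" "M1 \<preceq> M" "mterm M z zz"
            have LM: "L \<preceq> M" by (rule mle_trans[OF M(1,3)])
            show "iden M (c' \<^bold>< c \<^bold>\<longrightarrow> \<^bold>\<not> f_good (\<lambda>j y. \<^bold>\<langle>j, y\<^bold>\<rangle> \<^bold>\<in> X) Q b k c' z) (\<lambda>t. cc' t < cc t \<longrightarrow> \<not> ?good t (cc' t) (zz t))"
              by (intro iden_lazy(2) iden_conn(1) iden_atoms mterm_mono[OF M(2,3)] mterm_mono[OF L(4) LM]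
                iden_good[OF mrel_mono[OF TA mle_trans[OF KL LM]] A(2) B(1) C(1) mpred_mono[OF C(2) mle_trans[OF GL LM]]
                  mterm_mono[OF b LM] mterm_mono[OF k LM] mterm_mono[OF M(2,3)] M(4) bb le'])
          next
            show "mterm L c cc" by (rule L(4))
            show "mterm M1 c cc" if "L \<preceq> M1" for M1 by (rule mterm_mono[OF L(4) that])
            \<comment> \<open>The value of a good base \<open>c'\<close> is below the next base,
              hence below \<open>c\<close>. This bounds the quantifier over
              \<open>y\<close>.\<close>
            have below_c: "z \<le> c" if "good B C j c" "c' < c" "good B C j c' \<and> bracket (upgrade B C) (base B j) c' j = enat z" for B C j c c' z
              using that next_base_less[of z C c'] unfolding good_def by auto
            show "\<forall>\<^sub>F t. \<forall>y. \<not> (cc' t < cc t \<longrightarrow> \<not> ?good t (cc' t) y) \<longrightarrow> y \<le> cc t" for cc' :: "nat \<Rightarrow> nat"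
              using g by eventually_elim (use below_c in blast)
          qed (auto intro: ev_always)
        qed
      next
        show "mterm K k j" by (rule K(3))
        show "mterm L x y" if "K \<preceq> L" for L by (rule mterm_mono[OF K(4) that])
        \<comment> \<open>By \<open>bracket_ge_c\<close> a candidate never exceeds its value, which
          bounds the quantifier over candidates.\<close>
        have 1: "c \<le> y" if "good (B t) (C t) (j t) c \<and> bracket (upgrade (B t) (C t)) (base (B t) (j t)) c (j t) = enat y" "Inf (B t) \<le> j t" for t c y
        proof -
          have "c \<in> C t" using that by (simp add: good_def)
          then have "2 \<le> c" using C(1) unfolding setS_def by blast
          then have "enat c \<le> bracket (upgrade (B t) (C t)) (base (B t) (j t)) c (j t)"
            using hierS_base[OF B(1)] that(2) by (intro bracket_ge_c upgrade_nz) auto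
          then show ?thesis using that(1) by simp
        qed
        show "\<forall>\<^sub>F t. \<forall>c. bb t = base (B t) (j t) \<and> ?good t c (y t) \<and> (\<forall>c' y. c' < c \<longrightarrow> \<not> ?good t c' y) \<longrightarrow> c \<le> y t" for bb
          using le' by eventually_elim (use 1 in blast)
        show "\<forall>\<^sub>F t. \<forall>b. (\<exists>c. b = base (B t) (j t) \<and> ?good t c (y t) \<and> (\<forall>c' y. c' < c \<longrightarrow> \<not> ?good t c' y)) \<longrightarrow> b \<le> j t"
          using le' by eventually_elim (use hierS_base[OF B(1)] in blast)
      qed
    qed
    then have "iden K (?R X m k x) (\<lambda>t. pair (j t) (y t) \<in> A t)"
    proof (rule iden_cong)
      have Bh: "base_hierarchy (B t)" for t using B(1) by (simp add: hierS_def)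
      show "\<forall>\<^sub>F t. ((j t < mm t \<and> y t = j t) \<or> (mm t \<le> j t \<and> (\<exists>b c. b = base (B t) (j t) \<and>
        ?good t c (y t) \<and> (\<forall>c' y. c' < c \<longrightarrow> \<not> ?good t c' y)))) \<longleftrightarrow> pair (j t) (y t) \<in> A t"
        unfolding A(2) using mm by eventually_elim (simp only: upgrade_step[OF Bh])
    qed
    then have "den K (k \<^bold>\<le> n \<^bold>\<longrightarrow> (\<^bold>\<langle>k, x\<^bold>\<rangle> \<^bold>\<in> X \<^bold>\<longleftrightarrow> ?R X m k x))
        ((\<forall>\<^sub>F t. j t \<le> nn t) \<longrightarrow> ((\<forall>\<^sub>F t. pair (j t) (y t) \<in> T t) \<longleftrightarrow> (\<forall>\<^sub>F t. pair (j t) (y t) \<in> A t)))"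
      by (intro den_conn iden_le iden_atoms mterm_pair K mterm_mono[OF tm(1) GK])
    then show "den K (k \<^bold>\<le> n \<^bold>\<longrightarrow> (\<^bold>\<langle>k, x\<^bold>\<rangle> \<^bold>\<in> X \<^bold>\<longleftrightarrow> ?R X m k x))
        ((\<forall>\<^sub>F t. pair (j t) (y t) \<in> T t) \<longleftrightarrow> (\<forall>\<^sub>F t. pair (j t) (y t) \<in> A t))"
      using K(5) by simp
  next
    fix K X T k j x y
    assume K: "H \<preceq> K" "mset K X T" "mterm K k j" "mterm K x y" "\<not> (\<forall>\<^sub>F t. j t \<le> nn t)"
    have "den K (k \<^bold>\<le> n \<^bold>\<longrightarrow> (\<^bold>\<langle>k, x\<^bold>\<rangle> \<^bold>\<in> X \<^bold>\<longleftrightarrow> ?R X m k x)) ((\<forall>\<^sub>F t. j t \<le> nn t) \<longrightarrow> False)"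
      using K(5) by (intro den_conn(2) iden_le K mterm_mono[OF tm(1) mle_trans[OF H(1) K(1)]]) simp
    then show "den K (k \<^bold>\<le> n \<^bold>\<longrightarrow> (\<^bold>\<langle>k, x\<^bold>\<rangle> \<^bold>\<in> X \<^bold>\<longleftrightarrow> ?R X m k x)) True" using K(5) by simp
  qed simp
  have InfI: "(\<lambda>t. Inf (B t)) \<in> I" using B(1) by (simp add: hierS_def)
  have "iden G (f_upgrade P Q n v) (\<lambda>t. \<exists>m. m = Inf (B t) \<and> pair (nn t) (vv t) \<in> A t)"
    unfolding f_upgrade_def
  proof (rule iden_ex[OF _ InfI])
    fix H m mm assume H: "G \<preceq> H" "mterm H m mm"
    show "iden H (f_min P m \<^bold>\<and> (\<^bold>\<exists>\<^sub>s X. (\<^bold>\<forall>k. \<^bold>\<forall>x. k \<^bold>\<le> n \<^bold>\<longrightarrow> (\<^bold>\<langle>k, x\<^bold>\<rangle> \<^bold>\<in> X \<^bold>\<longleftrightarrow> ?R X m k x)) \<^bold>\<and> \<^bold>\<langle>n, v\<^bold>\<rangle> \<^bold>\<in> X))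
      (\<lambda>t. mm t = Inf (B t) \<and> pair (nn t) (vv t) \<in> A t)"
      by (intro iden_lazy(1) iden_min mpred_mono[OF B(2) H(1)] B(1) H(2) body[OF H])
  qed (auto intro: ev_always)
  then show ?thesis unfolding A(2) by simp
qed

lemma mrel_upgrade:
  assumes "hierS B" "mpred G P B" "setS C" "mpred G Q C"
    and A: "\<And>t k x. pair k x \<in> A t \<longleftrightarrow> upgrade (B t) (C t) k = enat x"
  shows "mrel G g (f_upgrade P Q) A"
  unfolding mrel_def A by (intro allI impI iden_upgrade assms mpred_mono[OF assms(2)] mpred_mono[OF assms(4)])

end

section \<open>Values, iterates and maxima of stages remain in the cut\<close>

context successor
begin

lemma bracket_stage:
  assumes "b \<le> Suc l" "2 \<le> b"
  shows "bracket (upgrade B (st l)) b c k = enat (nbr val b c k)"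
  using assms by (intro bracket_eq_nbr upgrade_stage) auto

text \<open>The new base is the least multiple of \<open>maxb l\<close> above \<open>val l\<close>,
  so it exceeds \<open>val l\<close> by at most \<open>maxb l\<close>.\<close>

lemma maxb_member_le:
  assumes "Suc l \<in> B" "m \<le> l" shows "maxb (Suc l) \<le> val l + maxb l"
proof (cases "maxb (Suc l) \<in> st l")
  case True then show ?thesis using maxb(2) trans_le_add2 by blast
next
  case False
  let ?c = "maxb l"
  have w: "bracket (upgrade B (st l)) (base B l) ?c l = enat (val l)"
    using bracket_stage[of "base B l" l] base_bounds(1,2)[of l] assms(2) val_eq[OF assms(2)] by simp
  have "maxb (Suc l) \<in> new_bases B i (st l) (Suc l)"
    using maxb(1)[of "Suc l"] False assms(2) st_Suc[of l] by auto
  then obtain a where a: "maxb (Suc l) = ?c * a" "val l < ?c * a" "\<forall>a'<a. \<not> val l < ?c * a'"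
    using assms(1) w by (auto simp: new_bases_def Let_def simp flip: maxb_def)
  then obtain a' where a': "a = Suc a'" by (cases a) auto
  then have "?c * a' \<le> val l" using a(3) by auto
  then show ?thesis using a(1) a' by simp
qed

lemma d_step_dseq:
  assumes "m < Suc l"
  shows "(d_step B (st l) (Suc l) ^^ j) (enat (maxb l)) = enat (dseq (Suc l) j)"
proof (induction j)
  case (Suc j)
  have "(d_step B (st l) (Suc l) ^^ Suc j) (enat (maxb l)) = d_step B (st l) (Suc l) (enat (dseq (Suc l) j))"
    by (simp only: funpow.simps o_apply Suc.IH)
  also have "... = enat (dseq (Suc l) (Suc j))"
    using bracket_stage[of "base B (Suc l)" l] base_bounds(1,2)[of "Suc l"] assms by (simp add: d_step_def dseq_def)
  finally show ?case .
qed (simp add: dseq_0)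

lemma dseq_ge:
  assumes "m < n" "n \<notin> B" "critical B n" shows "maxb (n - 1) \<le> dseq n j"
  using dseq_le[OF assms, of 0 j] by (simp add: dseq_0)

text \<open>Bases added after stage \<open>x\<close> exceed \<open>val x\<close>, which is at least
  \<open>x\<close>. The union of all stages can thus be decided at a stage in the cut.\<close>

lemma in_own_stage: "x \<in> C \<Longrightarrow> x \<in> st x"
  using successor_new[of x x] val_ge[of x] by fastforce

end

lemma successorI: "base_hierarchy B \<Longrightarrow> successor B" by unfold_locales

context rca0_model
begin

lemma ev_cases3:
  assumes "\<forall>\<^sub>F t. P t \<or> Q t \<or> R t"
  obtains "\<forall>\<^sub>F t. P t" | "\<forall>\<^sub>F t. Q t" | "\<forall>\<^sub>F t. R t"
  using assms by (auto simp: ev_disj)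

lemma I_pow:
  assumes "c \<in> I" "k \<in> I" shows "(\<lambda>t. c t ^ k t) \<in> I"
proof (rule values_bounded[where g = "\<lambda>k t. c t ^ k"])
  show "(\<lambda>t. opint B0 O_pow (top_bound t) (map (\<lambda>A. A t) []) (map (\<lambda>f. f t) [c])) \<in> S"
    using assms by (intro S_opint) auto
  show "k \<in> I" by fact
  fix k e assume k: "k \<in> I" "e \<in> I" "\<forall>\<^sub>F t. \<forall>j<k t. c t ^ j < e t"
  have "\<forall>\<^sub>F t. c t ^ k t \<le> c t * e t + 1"
    using k(3)
  proof eventually_elim
    case (elim t)
    show ?case
    proof (cases "k t")
      case (Suc j)
      then have "c t ^ j \<le> e t" using elim by auto
      then have "c t * c t ^ j \<le> c t * e t" by (rule mult_left_mono) simp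
      then show ?thesis unfolding Suc power_Suc by linarith
    qed simp
  qed
  then show "(\<lambda>t. c t ^ k t) \<in> I" by (rule I_mono[rotated]) (intro I_add I_mult I_const assms k)
qed auto

text \<open>By \<open>values_bounded\<close> a single recursion step suffices: if all earlier values
  are below \<open>e\<close>, then a decomposition contributes at most \<open>c ^ e * c + e\<close>,
  and a digit is below \<open>c\<close>.\<close>

lemma I_bracket:
  assumes "B \<in> S" "Z \<in> S" "b \<in> I" "c \<in> I" "m \<in> I" "\<forall>\<^sub>F t. 2 \<le> b t"
    and u: "\<forall>\<^sub>F t. \<forall>k<b t. upgrade (B t) (Z t) k = enat (u t k) \<and> u t k < c t"
  shows "(\<lambda>t. the_enat (bracket (upgrade (B t) (Z t)) (b t) (c t) (m t))) \<in> I"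
proof (rule values_bounded[where g = "\<lambda>k t. the_enat (bracket (upgrade (B t) (Z t)) (b t) (c t) k)"])
  show "(\<lambda>t. opint B0 O_bracket_val (top_bound t) (map (\<lambda>A. A t) [B, Z]) (map (\<lambda>f. f t) [b, c])) \<in> S"
    using assms by (intro S_opint) auto
  show "m \<in> I" by fact
  let ?g = "\<lambda>t k. the_enat (bracket (upgrade (B t) (Z t)) (b t) (c t) k)"
  fix k e assume k: "k \<in> I" "e \<in> I" "\<forall>\<^sub>F t. \<forall>j<k t. ?g t j < e t"
  have "\<forall>\<^sub>F t. ?g t (k t) \<le> c t + (c t ^ e t * c t + e t)"
    using k(3) assms(6) u
  proof eventually_elim
    case (elim t)
    have eq: "bracket (upgrade (B t) (Z t)) (b t) (c t) j = enat (nbr (u t) (b t) (c t) j)" for j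
      using elim(2,3) by (intro bracket_eq_nbr) auto
    have IH: "nbr (u t) (b t) (c t) j < e t" if "j < k t" for j using elim(1) that by (simp add: eq)
    have "0 < c t" using elim(2,3) by (auto dest: spec[of _ 0])
    have "nbr (u t) (b t) (c t) (k t) \<le> c t + (c t ^ e t * c t + e t)"
    proof (cases "k t < b t")
      case True
      then have "u t (k t) < c t" using elim(3) by blast
      then show ?thesis using True by (simp add: nbr_small)
    next
      case False
      then obtain x a r where d: "is_decomposition (b t) (k t) x a r" "x < k t" "r < k t" "a < b t"
        using obtain_decomposition[OF elim(2), of "k t"] by (metis not_le)
      have "c t ^ nbr (u t) (b t) (c t) x \<le> c t ^ e t"
        using IH[OF d(2)] \<open>0 < c t\<close> by (intro power_increasing) auto
      moreover have "u t a \<le> c t" using elim(3) d(4) by (auto intro: less_imp_le)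
      ultimately have "c t ^ nbr (u t) (b t) (c t) x * u t a \<le> c t ^ e t * c t" by (rule mult_mono) auto
      then show ?thesis using nbr_decomposition[OF elim(2) d(1), of "u t" "c t"] IH[OF d(3)] False by simp
    qed
    then show ?case by (simp add: eq)
  qed
  then show "(\<lambda>t. ?g t (k t)) \<in> I" by (rule I_mono[rotated]) (intro I_add I_mult I_pow assms k)
qed auto

text \<open>The number \<open>j\<close> of iterations may be nonstandard, so closure under one
  bracket does not suffice by itself; \<open>values_bounded\<close> turns it into closure under
  iteration. The iterates never fall below \<open>maxb\<close>, which keeps the digits below the
  current base.\<close>

lemma I_dseq:
  assumes B: "hierS B" and ij: "i \<in> I" "l \<in> I" "j \<in> I" and mx: "(\<lambda>t. successor.maxb (B t) (i t) (l t)) \<in> I"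
    and crit: "\<forall>\<^sub>F t. Inf (B t) < Suc (l t) \<and> Suc (l t) \<notin> B t \<and> critical (B t) (Suc (l t))"
  shows "(\<lambda>t. successor.dseq (B t) (i t) (Suc (l t)) (j t)) \<in> I"
proof -
  let ?Z = "\<lambda>t. plus_stage (B t) (i t) (l t)" and ?c = "\<lambda>t. successor.maxb (B t) (i t) (l t)"
  let ?d = "\<lambda>k t. the_enat ((d_step (B t) (?Z t) (Suc (l t)) ^^ k) (enat (?c t)))"
  have BS: "B \<in> S" and suc: "successor (B t)" for t using B by (auto simp: hierS_def intro: successorI)
  have "(\<lambda>t. opint B0 O_stage_row (top_bound t) (map (\<lambda>A. A t) [B]) (map (\<lambda>f. f t) [i, l])) \<in> S"
    using BS ij by (intro S_opint) auto
  then have ZS: "?Z \<in> S" by simp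
  have deq: "?d k t = successor.dseq (B t) (i t) (Suc (l t)) k" if "Inf (B t) < Suc (l t)" for k t
    using successor.d_step_dseq[OF suc that] by simp
  have "(\<lambda>t. ?d (j t) t) \<in> I"
  proof (rule values_bounded[where g = ?d, OF _ _ _ ij(3)])
    show "(\<lambda>t. opint B0 O_iter_val (top_bound t) (map (\<lambda>A. A t) [B, ?Z]) (map (\<lambda>f. f t) [\<lambda>t. Suc (l t), ?c])) \<in> S"
      using BS ZS I_Suc[OF ij(2)] mx by (intro S_opint) auto
    fix k e assume k: "k \<in> I" "e \<in> I" "\<forall>\<^sub>F t. \<forall>j<k t. ?d j t < e t"
    show "(\<lambda>t. ?d (k t) t) \<in> I"
    proof (cases "\<forall>\<^sub>F t. k t = 0")
      case True
      then have "\<forall>\<^sub>F t. ?d (k t) t \<le> ?c t" by eventually_elim simp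
      then show ?thesis by (rule I_mono[OF mx])
    next
      case False
      then have pos: "\<forall>\<^sub>F t. k t \<noteq> 0" unfolding ev_not[symmetric] .
      define y where "y t = ?d (k t - 1) t" for t
      have "\<forall>\<^sub>F t. y t \<le> e t" using k(3) pos by eventually_elim (auto simp: y_def intro: less_imp_le)
      then have y: "y \<in> I" by (rule I_mono[OF k(2)])
      define b where "b t = base (B t) (Suc (l t))" for t
      have bl: "\<forall>\<^sub>F t. b t \<le> Suc (l t)" using crit by eventually_elim (simp add: b_def base_le)
      have b: "b \<in> I" by (rule I_mono[OF I_Suc[OF ij(2)] bl])
      have "(\<lambda>t. the_enat (bracket (upgrade (B t) (?Z t)) (b t) (y t) (Suc (l t)))) \<in> I"
      proof (rule I_bracket[OF BS ZS b y I_Suc[OF ij(2)], where u = "\<lambda>t. successor.val (B t) (i t)"])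
        show "\<forall>\<^sub>F t. 2 \<le> b t" using hierS_base[OF B] by (simp add: b_def)
        show "\<forall>\<^sub>F t. \<forall>k<b t. upgrade (B t) (?Z t) k = enat (successor.val (B t) (i t) k) \<and> successor.val (B t) (i t) k < y t"
          using crit bl
        proof eventually_elim
          case (elim t)
          interpret successor "B t" "i t" by (rule suc)
          have le: "Inf (B t) \<le> l t" and crit: "Inf (B t) < Suc (l t)" "Suc (l t) \<notin> B t" "critical (B t) (Suc (l t))"
            using elim by auto
          have "b t = base (B t) (l t)" using base_Suc[OF le crit(2) Bp(1)] by (simp add: b_def)
          moreover have "maxb (l t) \<le> y t" using dseq_ge[OF crit, of "k t - 1"] by (simp add: y_def deq[OF crit(1)])
          ultimately show ?case using val_less_maxb[OF le] upgrade_stage[of _ "l t"] elim(2) by fastforce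
        qed
      qed
      moreover have "\<forall>\<^sub>F t. ?d (k t) t \<le> the_enat (bracket (upgrade (B t) (?Z t)) (b t) (y t) (Suc (l t)))"
        using pos crit
      proof eventually_elim
        case (elim t)
        then obtain k' where k': "k t = Suc k'" by (cases "k t") auto
        have "(d_step (B t) (?Z t) (Suc (l t)) ^^ k') (enat (?c t)) = enat (y t)"
          using successor.d_step_dseq[OF suc, of t "l t"] elim(2) k' by (simp add: y_def)
        then show ?case by (simp add: k' d_step_def b_def)
      qed
      ultimately show ?thesis by (rule I_mono)
    qed
  qed auto
  moreover have "\<forall>\<^sub>F t. successor.dseq (B t) (i t) (Suc (l t)) (j t) \<le> ?d (j t) t"
    using crit by eventually_elim (simp add: deq)
  ultimately show ?thesis by (rule I_mono)
qed

lemma I_val: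
  assumes B: "hierS B" and il: "i \<in> I" "l \<in> I" and mx: "(\<lambda>t. successor.maxb (B t) (i t) (l t)) \<in> I"
    and le: "\<forall>\<^sub>F t. Inf (B t) \<le> l t"
  shows "(\<lambda>t. successor.val (B t) (i t) (l t)) \<in> I"
proof -
  let ?Z = "\<lambda>t. plus_stage (B t) (i t) (l t)" and ?c = "\<lambda>t. successor.maxb (B t) (i t) (l t)"
  have BS: "B \<in> S" and suc: "successor (B t)" for t using B by (auto simp: hierS_def intro: successorI)
  have "(\<lambda>t. opint B0 O_stage_row (top_bound t) (map (\<lambda>A. A t) [B]) (map (\<lambda>f. f t) [i, l])) \<in> S"
    using BS il by (intro S_opint) auto
  then have ZS: "?Z \<in> S" by simp
  define b where "b t = base (B t) (l t)" for t
  have bl: "\<forall>\<^sub>F t. b t \<le> l t" using le by eventually_elim (simp add: b_def base_le)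
  have b: "b \<in> I" by (rule I_mono[OF il(2) bl])
  have "(\<lambda>t. the_enat (bracket (upgrade (B t) (?Z t)) (b t) (?c t) (l t))) \<in> I"
  proof (rule I_bracket[OF BS ZS b mx il(2), where u = "\<lambda>t. successor.val (B t) (i t)"])
    show "\<forall>\<^sub>F t. 2 \<le> b t" using hierS_base[OF B] by (simp add: b_def)
    show "\<forall>\<^sub>F t. \<forall>k<b t. upgrade (B t) (?Z t) k = enat (successor.val (B t) (i t) k) \<and> successor.val (B t) (i t) k < ?c t"
      using le bl
    proof eventually_elim
      case (elim t)
      interpret successor "B t" "i t" by (rule suc)
      show ?case using val_less_maxb[OF elim(1)] upgrade_stage[of _ "l t"] elim(2) by (auto simp: b_def)
    qed
  qed
  moreover have "\<forall>\<^sub>F t. successor.val (B t) (i t) (l t) \<le> the_enat (bracket (upgrade (B t) (?Z t)) (b t) (?c t) (l t))"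
    using le bl
  proof eventually_elim
    case (elim t)
    interpret successor "B t" "i t" by (rule suc)
    show ?case using bracket_stage[of "b t" "l t"] elim(2) base_bounds(1)[of "l t"] val_eq[OF elim(1)] by (simp add: b_def)
  qed
  ultimately show ?thesis by (rule I_mono)
qed

text \<open>The maximum at \<open>k\<close> is estimated from the one at \<open>k - 1\<close>, after
  which \<open>values_bounded\<close> handles the nonstandard number of stages. The ultrafilter
  decides which of the three kinds of \<open>k\<close> occurs at almost all coordinates, so each
  kind can be treated on its own.\<close>

lemma I_maxb:
  assumes B: "hierS B" and i: "i \<in> I" and n: "n \<in> I"
  shows "(\<lambda>t. successor.maxb (B t) (i t) (n t)) \<in> I"
proof (rule values_bounded[where g = "\<lambda>k t. successor.maxb (B t) (i t) k"])
  have BS: "B \<in> S" and suc: "successor (B t)" for t using B by (auto simp: hierS_def intro: successorI)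
  have InfI: "(\<lambda>t. Inf (B t)) \<in> I" using B by (simp add: hierS_def)
  show "(\<lambda>t. opint B0 O_stage_max (top_bound t) (map (\<lambda>A. A t) [B]) (map (\<lambda>f. f t) [i])) \<in> S"
    using BS i by (intro S_opint) auto
  show "pair k v \<in> opint B0 O_stage_max (top_bound t) (map (\<lambda>A. A t) [B]) (map (\<lambda>f. f t) [i]) \<longleftrightarrow>
      v = successor.maxb (B t) (i t) k" for t k v
    using successor.maxb_def[OF suc] by auto
  show "n \<in> I" by fact
  fix k e assume k: "k \<in> I" "e \<in> I" "\<forall>\<^sub>F t. \<forall>j<k t. successor.maxb (B t) (i t) j < e t"
  show "(\<lambda>t. successor.maxb (B t) (i t) (k t)) \<in> I"
  proof (cases "\<forall>\<^sub>F t. k t \<le> Inf (B t)")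
    case True
    then have "\<forall>\<^sub>F t. successor.maxb (B t) (i t) (k t) \<le> Inf (B t) + 1"
      by eventually_elim (simp add: successor.maxb_init[OF suc])
    then show ?thesis by (rule I_mono[OF I_add[OF InfI I_const]])
  next
    case False
    then have big: "\<forall>\<^sub>F t. Inf (B t) < k t" by (simp add: ev_not[symmetric] not_le)
    define l where "l t = k t - 1" for t
    have kl: "\<forall>\<^sub>F t. k t = Suc (l t) \<and> Inf (B t) \<le> l t"
      using big by eventually_elim (auto simp: l_def)
    have lI: "l \<in> I" by (rule I_mono[OF k(1)]) (simp add: l_def)
    have "\<forall>\<^sub>F t. successor.maxb (B t) (i t) (l t) \<le> e t" using k(3) kl by eventually_elim (auto intro: less_imp_le)
    then have mx: "(\<lambda>t. successor.maxb (B t) (i t) (l t)) \<in> I" by (rule I_mono[OF k(2)])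
    have v: "(\<lambda>t. successor.val (B t) (i t) (l t)) \<in> I"
      using kl by (intro I_val[OF B i lI mx]) (erule eventually_mono, simp)
    have "\<forall>\<^sub>F t. k t \<in> B t \<or> (k t \<notin> B t \<and> \<not> critical (B t) (k t)) \<or> (k t \<notin> B t \<and> critical (B t) (k t))" by (intro ev_always) blast
    then show ?thesis
    proof (cases rule: ev_cases3)
      case 1
      then have "\<forall>\<^sub>F t. successor.maxb (B t) (i t) (k t) \<le> successor.val (B t) (i t) (l t) + successor.maxb (B t) (i t) (l t)"
        using kl by eventually_elim (use successor.maxb_member_le[OF suc] in auto)
      then show ?thesis by (rule I_mono[OF I_add[OF v mx]])
    next
      case 2
      then have "\<forall>\<^sub>F t. successor.maxb (B t) (i t) (k t) \<le> successor.maxb (B t) (i t) (l t)"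
        using kl
      proof eventually_elim
        case (elim t)
        interpret successor "B t" "i t" by (rule suc)
        show ?case using inv_shape(2)[of "k t"] elim by (simp add: maxb_def)
      qed
      then show ?thesis by (rule I_mono[OF mx])
    next
      case 3
      have "(\<lambda>t. successor.dseq (B t) (i t) (Suc (l t)) (i t)) \<in> I"
        by (rule I_dseq[OF B i lI i mx]) (use 3 kl in eventually_elim, auto)
      moreover have "\<forall>\<^sub>F t. successor.maxb (B t) (i t) (k t) \<le> successor.dseq (B t) (i t) (Suc (l t)) (i t)"
        using 3 kl
      proof eventually_elim
        case (elim t)
        interpret successor "B t" "i t" by (rule suc)
        show ?case using maxb_dseq[of "k t"] elim by simp
      qed
      ultimately show ?thesis by (rule I_mono)
    qed
  qed
qed

section \<open>Absoluteness of the stages and of the successor\<close>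

lemma iden_Max:
  assumes "mpred G P Z" "mterm G m mm" "(\<lambda>t. Max (Z t)) \<in> I" "\<And>t. finite (Z t)" "\<And>t. Z t \<noteq> {}"
  shows "iden G (f_max P m) (\<lambda>t. mm t = Max (Z t))"
proof (rule iden_cong)
  show "iden G (f_max P m) (\<lambda>t. mm t \<in> Z t \<and> (\<forall>x. x \<in> Z t \<longrightarrow> x \<le> mm t))"
    unfolding f_max_def
  proof (rule iden_lazy(1)[OF mpred_here[OF assms(1,2)]])
    show "iden G (\<^bold>\<forall>x. P x \<^bold>\<longrightarrow> x \<^bold>\<le> m) (\<lambda>t. \<forall>x. x \<in> Z t \<longrightarrow> x \<le> mm t)"
    proof (rule iden_all[OF _ assms(3)])
      fix H a x assume h: "G \<preceq> H" "mterm H a x"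
      show "iden H (P a \<^bold>\<longrightarrow> a \<^bold>\<le> m) (\<lambda>t. x t \<in> Z t \<longrightarrow> x t \<le> mm t)"
        by (intro iden_lazy iden_le mpredD[OF assms(1)] h mterm_mono[OF assms(2) h(1)])
    qed (use assms(4) in \<open>auto intro: ev_always\<close>)
  qed
  show "\<forall>\<^sub>F t. (mm t \<in> Z t \<and> (\<forall>x. x \<in> Z t \<longrightarrow> x \<le> mm t)) \<longleftrightarrow> mm t = Max (Z t)"
    using r_max_iff[OF assms(4,5)] unfolding r_max_def by simp
qed

lemma iden_critical:
  assumes "mpred G P B" "hierS B" "mterm G n nn" "\<forall>\<^sub>F t. Inf (B t) \<le> nn t"
  shows "iden G (f_critical P n) (\<lambda>t. critical (B t) (nn t))"
proof -
  have "iden G (f_critical P n) (\<lambda>t. \<exists>b k. b = base (B t) (nn t) \<and> nn t = b * k)"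
    unfolding f_critical_def
  proof (rule iden_ex_le[where b = n and g = nn], rule iden_ex_le[where b = n and g = nn])
    fix H b bb K k kk assume h: "G \<preceq> H" "mterm H b bb" "H \<preceq> K" "mterm K k kk"
    have GK: "G \<preceq> K" by (rule mle_trans[OF h(1,3)])
    show "iden K (f_base P n b \<^bold>\<and> n \<^bold>= b \<^bold>* k) (\<lambda>t. bb t = base (B t) (nn t) \<and> nn t = bb t * kk t)"
      by (intro iden_lazy(1) iden_base iden_atoms mterm_ops mpred_mono[OF assms(1) GK] assms(2)
          mterm_mono[OF assms(3) GK] mterm_mono[OF h(2,3)] h(4))
  next
    show "mterm H n nn" if "G \<preceq> H" for H by (rule mterm_mono[OF assms(3) that])
    have "k \<le> b * k" if "2 \<le> b" for b k :: nat using that by (cases b) auto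
    then show "\<forall>\<^sub>F t. \<forall>k. bb t = base (B t) (nn t) \<and> nn t = bb t * k \<longrightarrow> k \<le> nn t" for bb
      using hierS_base(1)[OF assms(2)] by (intro ev_always) metis
    show "\<forall>\<^sub>F t. \<forall>b. (\<exists>k. b = base (B t) (nn t) \<and> nn t = b * k) \<longrightarrow> b \<le> nn t"
      using assms(4) by eventually_elim (use hierS_base(2)[OF assms(2)] in blast)
  qed (rule assms(3))
  moreover have "(\<exists>b k. b = base B n \<and> n = b * k) \<longleftrightarrow> critical B n" for B n by (auto simp: critical_def dvd_def)
  ultimately show ?thesis by simp
qed

end

text \<open>This puts \<open>new_bases\<close> into the shape of the formula \<open>f_new\<close>,
  with \<open>iter\<close> in place of the partial iteration of \<open>d_step\<close>.\<close>

lemma new_bases_iff: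
  "x \<in> new_bases B i Z (l + 1) \<longleftrightarrow> (\<exists>c. c = Max Z \<and>
     ((l + 1 \<in> B \<and> (\<exists>b w a. b = base B l \<and> bracket (upgrade B Z) b c l = enat w \<and>
         w < c * a \<and> (\<forall>a'. a' < a \<longrightarrow> \<not> w < c * a') \<and> x = c * a)) \<or>
      (l + 1 \<notin> B \<and> critical B (l + 1) \<and> (\<exists>b j. b = base B (l + 1) \<and> 1 \<le> j \<and> j \<le> i \<and>
         iter (\<lambda>y. y = c) (\<lambda>_ y z. bracket (upgrade B Z) (base B (l + 1)) y (l + 1) = enat z) j x))))"
proof -
  let ?c = "Max Z" and ?w = "bracket (upgrade B Z) (base B l) (Max Z) l"
  have "iter (\<lambda>y. y = ?c) (\<lambda>_ y z. bracket (upgrade B Z) (base B (l + 1)) y (l + 1) = enat z) j x \<longleftrightarrow>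
      enat x = (d_step B Z (l + 1) ^^ j) (enat ?c)" for j
    unfolding iter_enat by (auto simp: d_step_def[abs_def])
  moreover have "(\<exists>w a. ?w = enat w \<and> w < ?c * a \<and> (\<forall>a'. a' < a \<longrightarrow> \<not> w < ?c * a') \<and> x = ?c * a) \<longleftrightarrow>
      (\<exists>a. x = ?c * a \<and> ?w < enat (?c * a) \<and> (\<forall>a'<a. \<not> ?w < enat (?c * a')))"
    by (cases ?w) auto
  ultimately show ?thesis unfolding new_bases_def Let_def by auto
qed

context rca0_model
begin

lemma bracket_base_ge:
  assumes "hierS B" "2 \<le> c" "Inf (B t) \<le> n"
  shows "enat c \<le> bracket (upgrade (B t) C) (base (B t) n) c n"
  using assms hierS_base[OF assms(1)] by (intro bracket_ge_c upgrade_nz) auto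

text \<open>The quantifiers have these bounds: the maximum of the stage for \<open>c\<close>, the
  new base \<open>x\<close> for \<open>w\<close> and \<open>a\<close>, the current argument for
  bases, and \<open>i\<close> for the number of iterations.\<close>

lemma iden_new:
  assumes B: "hierS B" "mpred G P B" and Z: "setS Z" "mpred G Q Z" "(\<lambda>t. Max (Z t)) \<in> I"
      "\<And>t. finite (Z t)" "\<And>t. Z t \<noteq> {}"
    and tm: "mterm G i ii" "mterm G l ll" "mterm G x xx" and le: "\<forall>\<^sub>F t. Inf (B t) < ll t + 1"
  shows "iden G (f_new P i Q l x) (\<lambda>t. xx t \<in> new_bases (B t) (ii t) (Z t) (ll t + 1))"
  unfolding new_bases_iff f_new_def
proof (rule iden_ex[OF _ Z(3)])
  have le0: "\<forall>\<^sub>F t. Inf (B t) \<le> ll t" and le1: "\<forall>\<^sub>F t. Inf (B t) \<le> ll t + 1"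
    using le by (auto elim: eventually_mono)
  have BZ: "B \<in> S" "Z \<in> S" using B(1) Z(1) by (auto simp: hierS_def setS_def)
  obtain Ug where Ug: "Ug \<in> S" "\<And>t k x. pair k x \<in> Ug t \<longleftrightarrow> upgrade (B t) (Z t) k = enat x"
    using upgrade_graph[OF BZ] by blast
  fix H c cc assume H: "G \<preceq> H" "mterm H c cc"
  note tmH = tm[THEN mterm_mono, OF H(1)] and BH = mpred_mono[OF B(2) H(1)] and ZH = mpred_mono[OF Z(2) H(1)]
  have lH: "mterm H (l \<^bold>+ \<^bold>1) (\<lambda>t. ll t + 1)" by (intro mterm_ops tmH)
  let ?br = "\<lambda>t b y n w. bracket (upgrade (B t) (Z t)) b y n = enat w"
  have br: "iden K (f_bracket (f_upgrade P Q) b y n w) (\<lambda>t. ?br t (bb t) (yy t) (nn t) (ww t))"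
    if "H \<preceq> K" "mterm K b bb" "mterm K y yy" "mterm K n nn" "mterm K w ww"
      "\<forall>\<^sub>F t. bb t = base (B t) (kk t)" "\<forall>\<^sub>F t. 2 \<le> yy t" for K b bb y yy n nn w ww kk
  proof (rule iden_bracket[OF _ Ug(2) BZ that(2-5) _ that(7)])
    show "mrel K bb (f_upgrade P Q) Ug"
      by (rule mrel_upgrade[OF B(1) mpred_mono[OF BH that(1)] Z(1) mpred_mono[OF ZH that(1)] Ug(2)])
    show "\<forall>\<^sub>F t. 2 \<le> bb t" using that(6) by eventually_elim (simp add: hierS_base[OF B(1)])
  qed
  show "iden H (f_max Q c \<^bold>\<and>
     ((P (l \<^bold>+ \<^bold>1) \<^bold>\<and>
       (\<^bold>\<exists>b. \<^bold>\<exists>w. \<^bold>\<exists>a. f_base P l b \<^bold>\<and> f_bracket (f_upgrade P Q) b c l w \<^bold>\<and>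
          w \<^bold>< c \<^bold>* a \<^bold>\<and> (\<^bold>\<forall>a'. a' \<^bold>< a \<^bold>\<longrightarrow> \<^bold>\<not> w \<^bold>< c \<^bold>* a') \<^bold>\<and> x \<^bold>= c \<^bold>* a)) \<^bold>\<or>
      (\<^bold>\<not> P (l \<^bold>+ \<^bold>1) \<^bold>\<and> f_critical P (l \<^bold>+ \<^bold>1) \<^bold>\<and>
       (\<^bold>\<exists>b. \<^bold>\<exists>j. f_base P (l \<^bold>+ \<^bold>1) b \<^bold>\<and> \<^bold>1 \<^bold>\<le> j \<^bold>\<and> j \<^bold>\<le> i \<^bold>\<and>
          f_rec (\<lambda>y. y \<^bold>= c) (\<lambda>_ y z. f_bracket (f_upgrade P Q) b y (l \<^bold>+ \<^bold>1) z) j x))))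
    (\<lambda>t. cc t = Max (Z t) \<and>
     ((ll t + 1 \<in> B t \<and> (\<exists>b w a. b = base (B t) (ll t) \<and> ?br t b (cc t) (ll t) w \<and>
         w < cc t * a \<and> (\<forall>a'. a' < a \<longrightarrow> \<not> w < cc t * a') \<and> xx t = cc t * a)) \<or>
      (ll t + 1 \<notin> B t \<and> critical (B t) (ll t + 1) \<and> (\<exists>b j. b = base (B t) (ll t + 1) \<and> 1 \<le> j \<and> j \<le> ii t \<and>
         iter (\<lambda>y. y = cc t) (\<lambda>_ y z. ?br t (base (B t) (ll t + 1)) y (ll t + 1) z) j (xx t)))))"
  proof (rule iden_lazy(1)[OF iden_Max[OF ZH H(2) Z(3-5)] iden_conn(2)[OF iden_lazy(1) iden_lazy(1)]])
    assume c: "\<forall>\<^sub>F t. cc t = Max (Z t)"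
    have c2: "\<forall>\<^sub>F t. 2 \<le> cc t"
      using c by eventually_elim (metis Max_in[OF Z(4,5)] Z(1) setS_def)
    show "iden H (P (l \<^bold>+ \<^bold>1)) (\<lambda>t. ll t + 1 \<in> B t)" by (rule mpred_here[OF BH lH])
    then show "iden H (\<^bold>\<not> P (l \<^bold>+ \<^bold>1)) (\<lambda>t. ll t + 1 \<notin> B t)" by (rule iden_conn)
    show "iden H (\<^bold>\<exists>b. \<^bold>\<exists>w. \<^bold>\<exists>a. f_base P l b \<^bold>\<and> f_bracket (f_upgrade P Q) b c l w \<^bold>\<and>
          w \<^bold>< c \<^bold>* a \<^bold>\<and> (\<^bold>\<forall>a'. a' \<^bold>< a \<^bold>\<longrightarrow> \<^bold>\<not> w \<^bold>< c \<^bold>* a') \<^bold>\<and> x \<^bold>= c \<^bold>* a)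
      (\<lambda>t. \<exists>b w a. b = base (B t) (ll t) \<and> ?br t b (cc t) (ll t) w \<and>
         w < cc t * a \<and> (\<forall>a'. a' < a \<longrightarrow> \<not> w < cc t * a') \<and> xx t = cc t * a)"
    proof (rule iden_ex_le[where b = l and g = ll], rule iden_ex_le[where b = x and g = xx], rule iden_ex_le[where b = x and g = xx])
      fix K1 b bb K2 w ww K a aa
      assume h: "H \<preceq> K1" "mterm K1 b bb" "K1 \<preceq> K2" "mterm K2 w ww" "K2 \<preceq> K" "mterm K a aa"
      have HK: "H \<preceq> K" by (rule mle_trans[OF mle_trans[OF h(1,3)] h(5)])
      have b: "mterm K b bb" and w: "mterm K w ww"
        by (rule mterm_mono[OF mterm_mono[OF h(2,3)] h(5)]) (rule mterm_mono[OF h(4,5)])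
      note tmK = tmH[THEN mterm_mono, OF HK] and cK = mterm_mono[OF H(2) HK]
      show "iden K (f_base P l b \<^bold>\<and> f_bracket (f_upgrade P Q) b c l w \<^bold>\<and>
          w \<^bold>< c \<^bold>* a \<^bold>\<and> (\<^bold>\<forall>a'. a' \<^bold>< a \<^bold>\<longrightarrow> \<^bold>\<not> w \<^bold>< c \<^bold>* a') \<^bold>\<and> x \<^bold>= c \<^bold>* a)
        (\<lambda>t. bb t = base (B t) (ll t) \<and> ?br t (bb t) (cc t) (ll t) (ww t) \<and>
         ww t < cc t * aa t \<and> (\<forall>a'. a' < aa t \<longrightarrow> \<not> ww t < cc t * a') \<and> xx t = cc t * aa t)"
      proof (intro iden_lazy(1))
        show "iden K (f_base P l b) (\<lambda>t. bb t = base (B t) (ll t))"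
          by (intro iden_base mpred_mono[OF BH HK] B(1) tmK b)
        show "iden K (f_bracket (f_upgrade P Q) b c l w) (\<lambda>t. ?br t (bb t) (cc t) (ll t) (ww t))"
          if "\<forall>\<^sub>F t. bb t = base (B t) (ll t)" by (rule br[OF HK b cK tmK(2) w that c2])
        show "iden K (w \<^bold>< c \<^bold>* a) (\<lambda>t. ww t < cc t * aa t)" "iden K (x \<^bold>= c \<^bold>* a) (\<lambda>t. xx t = cc t * aa t)"
          by (intro iden_atoms mterm_ops w cK h(6) tmK)+
        show "iden K (\<^bold>\<forall>a'. a' \<^bold>< a \<^bold>\<longrightarrow> \<^bold>\<not> w \<^bold>< c \<^bold>* a') (\<lambda>t. \<forall>a'. a' < aa t \<longrightarrow> \<not> ww t < cc t * a')"
        proof (rule iden_all_le[where b = a and g = aa])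
          fix L a' x' assume L: "K \<preceq> L" "mterm L a' x'"
          show "iden L (a' \<^bold>< a \<^bold>\<longrightarrow> \<^bold>\<not> w \<^bold>< c \<^bold>* a') (\<lambda>t. x' t < aa t \<longrightarrow> \<not> ww t < cc t * x' t)"
            by (intro iden_lazy(2) iden_conn(1) iden_atoms mterm_ops L(2) mterm_mono[OF w L(1)]
                mterm_mono[OF cK L(1)] mterm_mono[OF h(6) L(1)])
        qed (auto intro!: ev_always h)
      qed
    next
      show "mterm H l ll" by (rule tmH)
      show xK: "mterm K x xx" if "H \<preceq> K" for K by (rule mterm_mono[OF tmH(3) that])
      then show "mterm K x xx" if "H \<preceq> L" "L \<preceq> K" for K L using mle_trans[OF that] by blast
      have a_le: "a \<le> c * a" if "2 \<le> c" for a c :: nat using that by (cases c) auto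
      show "\<forall>\<^sub>F t. \<forall>a. bb t = base (B t) (ll t) \<and> ?br t (bb t) (cc t) (ll t) (ww t) \<and>
         ww t < cc t * a \<and> (\<forall>a'. a' < a \<longrightarrow> \<not> ww t < cc t * a') \<and> xx t = cc t * a \<longrightarrow> a \<le> xx t" for bb ww
        using c2 by eventually_elim (use a_le in metis)
      show "\<forall>\<^sub>F t. \<forall>w. (\<exists>a. bb t = base (B t) (ll t) \<and> ?br t (bb t) (cc t) (ll t) w \<and>
         w < cc t * a \<and> (\<forall>a'. a' < a \<longrightarrow> \<not> w < cc t * a') \<and> xx t = cc t * a) \<longrightarrow> w \<le> xx t" for bb
        by (intro ev_always) auto
      show "\<forall>\<^sub>F t. \<forall>b. (\<exists>w a. b = base (B t) (ll t) \<and> ?br t b (cc t) (ll t) w \<and>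
         w < cc t * a \<and> (\<forall>a'. a' < a \<longrightarrow> \<not> w < cc t * a') \<and> xx t = cc t * a) \<longrightarrow> b \<le> ll t"
        using le0 by eventually_elim (use hierS_base(2)[OF B(1)] in blast)
    qed
    show "iden H (f_critical P (l \<^bold>+ \<^bold>1) \<^bold>\<and>
       (\<^bold>\<exists>b. \<^bold>\<exists>j. f_base P (l \<^bold>+ \<^bold>1) b \<^bold>\<and> \<^bold>1 \<^bold>\<le> j \<^bold>\<and> j \<^bold>\<le> i \<^bold>\<and>
          f_rec (\<lambda>y. y \<^bold>= c) (\<lambda>_ y z. f_bracket (f_upgrade P Q) b y (l \<^bold>+ \<^bold>1) z) j x))
      (\<lambda>t. critical (B t) (ll t + 1) \<and> (\<exists>b j. b = base (B t) (ll t + 1) \<and> 1 \<le> j \<and> j \<le> ii t \<and>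
         iter (\<lambda>y. y = cc t) (\<lambda>_ y z. ?br t (base (B t) (ll t + 1)) y (ll t + 1) z) j (xx t)))"
    proof (rule iden_lazy(1)[OF iden_critical[OF BH B(1) lH le1]],
        rule iden_ex_le[where b = "l \<^bold>+ \<^bold>1"], rule iden_ex_le[where b = i and g = ii])
      fix K1 b bb K j jj
      assume h: "H \<preceq> K1" "mterm K1 b bb" "K1 \<preceq> K" "mterm K j jj"
      have HK: "H \<preceq> K" by (rule mle_trans[OF h(1,3)])
      note b = mterm_mono[OF h(2,3)] and tmK = tmH[THEN mterm_mono, OF HK] and cK = mterm_mono[OF H(2) HK]
        and lK = mterm_mono[OF lH HK]
      let ?r = "\<lambda>t (_::nat) y z. ?br t (base (B t) (ll t + 1)) y (ll t + 1) z"
      have ge: "2 \<le> z \<and> y \<le> z" if "?r t j y z" "2 \<le> y" "Inf (B t) \<le> ll t + 1" for t y z and j :: nat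
        using bracket_base_ge[OF B(1) that(2,3), of "Z t"] that(1,2) by simp
      \<comment> \<open>For \<open>iden_bracket\<close> the target base must be at least
        \<open>2\<close>. A bracket is never below its target base, so the iterates inherit this
        from the starting point.\<close>
      have it2: "2 \<le> y" if "iter (\<lambda>y. y = c) (?r t) j y" "2 \<le> c" "Inf (B t) \<le> ll t + 1" for t c j y
        using that(1) by (induction j arbitrary: y) (use that(2,3) ge in auto)
      show "iden K (f_base P (l \<^bold>+ \<^bold>1) b \<^bold>\<and> \<^bold>1 \<^bold>\<le> j \<^bold>\<and> j \<^bold>\<le> i \<^bold>\<and>
          f_rec (\<lambda>y. y \<^bold>= c) (\<lambda>_ y z. f_bracket (f_upgrade P Q) b y (l \<^bold>+ \<^bold>1) z) j x)
        (\<lambda>t. bb t = base (B t) (ll t + 1) \<and> 1 \<le> jj t \<and> jj t \<le> ii t \<and>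
         iter (\<lambda>y. y = cc t) (?r t) (jj t) (xx t))"
      proof (intro iden_lazy(1) iden_le mterm_ops h(4) tmK)
        show "iden K (f_base P (l \<^bold>+ \<^bold>1) b) (\<lambda>t. bb t = base (B t) (ll t + 1))"
          by (intro iden_base mpred_mono[OF BH HK] B(1) lK b)
        assume bb: "\<forall>\<^sub>F t. bb t = base (B t) (ll t + 1)"
        define A where "A = (\<lambda>t. opint B0 O_iter (top_bound t) (map (\<lambda>A. A t) [B, Z]) (map (\<lambda>f. f t) [\<lambda>t. ll t + 1, cc]))"
        have AS: "A \<in> S" unfolding A_def
          using BZ mterm_I[OF lH] mterm_I[OF H(2)] by (intro S_opint) auto
        show "iden K (f_rec (\<lambda>y. y \<^bold>= c) (\<lambda>_ y z. f_bracket (f_upgrade P Q) b y (l \<^bold>+ \<^bold>1) z) j x)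
          (\<lambda>t. iter (\<lambda>y. y = cc t) (?r t) (jj t) (xx t))"
        proof (rule iden_rec[OF h(4) tmK(3) _ _ _ AS])
          show "iden L (a \<^bold>= c) (\<lambda>t. y t = cc t)" if "K \<preceq> L" "mterm L a y" for L a y
            by (intro iden_atoms that mterm_mono[OF cK that(1)])
          show "pair j x \<in> A t \<longleftrightarrow> iter (\<lambda>y. y = cc t) (?r t) j x" for t j x
            unfolding iter_enat by (auto simp: A_def d_step_def[abs_def])
          show "\<forall>\<^sub>F t. \<forall>j y x. iter (\<lambda>y. y = cc t) (?r t) j y \<and> ?r t j y x \<longrightarrow> y \<le> x + 1"
            using c2 le1
          proof eventually_elim
            case (elim t)
            show ?case
            proof (intro allI impI)
              fix j y x assume *: "iter (\<lambda>y. y = cc t) (?r t) j y \<and> ?r t j y x"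
              then have "2 \<le> y" using it2[OF _ elim] by blast
              then show "y \<le> x + 1" using ge[OF _ _ elim(2)] * by fastforce
            qed
          qed
          fix L k kk y yy z zz d jj'
          assume L: "K \<preceq> L" "mterm L y yy" "mterm L z zz" "\<forall>\<^sub>F t. iter (\<lambda>y. y = cc t) (?r t) (jj' t) (yy t)"
          have y2: "\<forall>\<^sub>F t. 2 \<le> yy t" using L(4) c2 le1 by eventually_elim (use it2 in blast)
          have "iden L (f_bracket (f_upgrade P Q) b y (l \<^bold>+ \<^bold>1) z) (\<lambda>t. ?br t (bb t) (yy t) (ll t + 1) (zz t))"
            by (rule br[OF mle_trans[OF HK L(1)] mterm_mono[OF b L(1)] L(2) mterm_mono[OF lK L(1)] L(3) bb y2])
          then show "iden L (f_bracket (f_upgrade P Q) b y (l \<^bold>+ \<^bold>1) z) (\<lambda>t. ?r t (jj' t) (yy t) (zz t))"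
            by (rule iden_cong) (use bb in eventually_elim, simp)
        qed
      qed
    next
      show "mterm H (l \<^bold>+ \<^bold>1) (\<lambda>t. ll t + 1)" by (rule lH)
      show "mterm K i ii" if "H \<preceq> K" for K by (rule mterm_mono[OF tmH(1) that])
      show "\<forall>\<^sub>F t. \<forall>j. bb t = base (B t) (ll t + 1) \<and> 1 \<le> j \<and> j \<le> ii t \<and>
         iter (\<lambda>y. y = cc t) (\<lambda>_ y z. ?br t (base (B t) (ll t + 1)) y (ll t + 1) z) j (xx t) \<longrightarrow> j \<le> ii t" for bb
        by (intro ev_always) blast
      show "\<forall>\<^sub>F t. \<forall>b. (\<exists>j. b = base (B t) (ll t + 1) \<and> 1 \<le> j \<and> j \<le> ii t \<and>
         iter (\<lambda>y. y = cc t) (\<lambda>_ y z. ?br t (base (B t) (ll t + 1)) y (ll t + 1) z) j (xx t)) \<longrightarrow> b \<le> ll t + 1"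
        using le1 by eventually_elim (use hierS_base(2)[OF B(1)] in blast)
    qed
  qed
qed (auto intro: ev_always)

lemma hierS_stage:
  assumes "hierS B" "i \<in> I" "n \<in> I"
  shows "setS (\<lambda>t. plus_stage (B t) (i t) (n t))" "(\<lambda>t. Max (plus_stage (B t) (i t) (n t))) \<in> I"
    "finite (plus_stage (B t) (i t) (n t))" "plus_stage (B t) (i t) (n t) \<noteq> {}"
proof -
  have B: "B \<in> S" "base_hierarchy (B t)" for t using assms(1) by (auto simp: hierS_def)
  have p: "finite (plus_stage (B t) j k) \<and> plus_stage (B t) j k \<noteq> {} \<and> (\<forall>z\<in>plus_stage (B t) j k. 2 \<le> z)" for t j k
    using hierarchy_props[OF B(2)] by (intro plus_stage_props)
  then show "finite (plus_stage (B t) (i t) (n t))" "plus_stage (B t) (i t) (n t) \<noteq> {}" by blast+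
  have "(\<lambda>t. opint B0 O_stage_row (top_bound t) (map (\<lambda>A. A t) [B]) (map (\<lambda>f. f t) [i, n])) \<in> S"
    using B(1) assms by (intro S_opint) auto
  then show "setS (\<lambda>t. plus_stage (B t) (i t) (n t))" using p unfolding setS_def by simp
  show "(\<lambda>t. Max (plus_stage (B t) (i t) (n t))) \<in> I"
    using I_maxb[OF assms] successor.maxb_def[OF successorI[OF B(2)]] by simp
qed

lemma mpred_row:
  assumes X: "mset G X T" "mterm G k j" and row: "\<And>y. y \<in> I \<Longrightarrow> (\<forall>\<^sub>F t. pair (j t) (y t) \<in> T t) \<longleftrightarrow> (\<forall>\<^sub>F t. y t \<in> Z t)"
  shows "mpred G (\<lambda>y. \<^bold>\<langle>k, y\<^bold>\<rangle> \<^bold>\<in> X) Z"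
  unfolding mpred_def
proof (intro allI impI)
  fix H a y assume H: "G \<preceq> H" "mterm H a y"
  have "iden H (\<^bold>\<langle>k, a\<^bold>\<rangle> \<^bold>\<in> X) (\<lambda>t. pair (j t) (y t) \<in> T t)"
    by (intro iden_atoms mterm_pair mset_mono[OF X(1) H(1)] mterm_mono[OF X(2) H(1)] H(2))
  then show "iden H (\<^bold>\<langle>k, a\<^bold>\<rangle> \<^bold>\<in> X) (\<lambda>t. y t \<in> Z t)" unfolding row[OF mterm_I[OF H(2)]] .
qed

lemma hold_all:
  assumes "hold G (l_all Q)" "G \<preceq> G" "x \<in> I"
  obtains H b where "G \<preceq> H" "H \<preceq> H" "mterm H b x" "hold H (Q b)"
  using assms mle_push(1)[OF assms(2,3)] mle_refl mterm_newN[OF assms(3)] unfolding hold_quantifiers(1) by metis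

text \<open>This variant of the uniqueness argument serves recursions in which row
  \<open>j + 1\<close> depends on the whole row \<open>j\<close>; hence agreement on row
  \<open>j\<close> is available for all \<open>y\<close> in the cut.\<close>

lemma agree_rows:
  assumes A: "A \<in> S" and X: "mset G X T" and G: "G \<preceq> G"
    and zero: "hold G (\<^bold>\<forall>x. \<^bold>\<langle>\<^bold>0, x\<^bold>\<rangle> \<^bold>\<in> X \<^bold>\<longleftrightarrow> P x)"
      "\<And>H b x. G \<preceq> H \<Longrightarrow> mterm H b x \<Longrightarrow> iden H (P b) (\<lambda>t. pair 0 (x t) \<in> A t)"
    and step: "hold G (\<^bold>\<forall>k. \<^bold>\<forall>x. \<Psi> k x)"
      "\<And>H a j b x. G \<preceq> H \<Longrightarrow> mterm H a j \<Longrightarrow> mterm H b x \<Longrightarrow> \<forall>\<^sub>F t. j t < n t \<Longrightarrow>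
        (\<And>y. y \<in> I \<Longrightarrow> (\<forall>\<^sub>F t. pair (j t) (y t) \<in> T t) \<longleftrightarrow> (\<forall>\<^sub>F t. pair (j t) (y t) \<in> A t)) \<Longrightarrow>
        den H (\<Psi> a b) ((\<forall>\<^sub>F t. pair (j t + 1) (x t) \<in> T t) \<longleftrightarrow> (\<forall>\<^sub>F t. pair (j t + 1) (x t) \<in> A t))"
    and n: "n \<in> I" "v \<in> I"
  shows "(\<forall>\<^sub>F t. pair (n t) (v t) \<in> T t) \<longleftrightarrow> (\<forall>\<^sub>F t. pair (n t) (v t) \<in> A t)"
proof (rule agree_induct[OF mset_S[OF X] A n])
  fix j x assume j: "j \<in> I" "x \<in> I" "\<forall>\<^sub>F t. j t \<le> n t" and
    below: "\<And>j' x'. j' \<in> I \<Longrightarrow> x' \<in> I \<Longrightarrow> \<forall>\<^sub>F t. j' t < j t \<Longrightarrow>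
      (\<forall>\<^sub>F t. pair (j' t) (x' t) \<in> T t) \<longleftrightarrow> (\<forall>\<^sub>F t. pair (j' t) (x' t) \<in> A t)"
  show "(\<forall>\<^sub>F t. pair (j t) (x t) \<in> T t) \<longleftrightarrow> (\<forall>\<^sub>F t. pair (j t) (x t) \<in> A t)"
  proof (cases "\<forall>\<^sub>F t. j t = 0")
    case True
    obtain H b where H: "G \<preceq> H" "H \<preceq> H" "mterm H b x" "hold H (\<^bold>\<langle>\<^bold>0, b\<^bold>\<rangle> \<^bold>\<in> X \<^bold>\<longleftrightarrow> P b)"
      using hold_all[OF zero(1) G j(2)] .
    have "iden H (\<^bold>\<langle>\<^bold>0, b\<^bold>\<rangle> \<^bold>\<in> X \<^bold>\<longleftrightarrow> P b) (\<lambda>t. pair 0 (x t) \<in> T t \<longleftrightarrow> pair 0 (x t) \<in> A t)"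
      by (intro iden_conn(3) zero(2) iden_atoms mterm_pair mterm_ops mset_mono[OF X] H)
    then have "\<forall>\<^sub>F t. pair 0 (x t) \<in> T t \<longleftrightarrow> pair 0 (x t) \<in> A t" using H(2,4) unfolding den_def by blast
    then have "\<forall>\<^sub>F t. pair (j t) (x t) \<in> T t \<longleftrightarrow> pair (j t) (x t) \<in> A t" using True by eventually_elim simp
    then show ?thesis unfolding ev_iff .
  next
    case False
    then have pos: "\<forall>\<^sub>F t. 0 < j t" unfolding ev_not[symmetric] by simp
    define k where "k t = j t - 1" for t
    have kj: "\<forall>\<^sub>F t. j t = k t + 1" using pos by eventually_elim (simp add: k_def)
    have k: "k \<in> I" by (rule I_mono[OF j(1)]) (simp add: k_def)
    have kl: "\<forall>\<^sub>F t. k t < j t" "\<forall>\<^sub>F t. k t < n t" using kj j(3) by (eventually_elim, simp)+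
    obtain H a b where H: "G \<preceq> H" "H \<preceq> H" "mterm H a k" "mterm H b x" "hold H (\<Psi> a b)"
      using hold_all2[OF step(1) G k j(2)] .
    have "den H (\<Psi> a b) ((\<forall>\<^sub>F t. pair (k t + 1) (x t) \<in> T t) \<longleftrightarrow> (\<forall>\<^sub>F t. pair (k t + 1) (x t) \<in> A t))"
      by (rule step(2)[OF H(1,3,4) kl(2) below[OF k _ kl(1)]])
    then have "\<forall>\<^sub>F t. pair (k t + 1) (x t) \<in> T t \<longleftrightarrow> pair (k t + 1) (x t) \<in> A t"
      using H(2,5) unfolding den_def ev_iff by blast
    then have "\<forall>\<^sub>F t. pair (j t) (x t) \<in> T t \<longleftrightarrow> pair (j t) (x t) \<in> A t" using kj by eventually_elim simp
    then show ?thesis unfolding ev_iff .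
  qed
qed

lemma den_exS_assoc:
  assumes "den G (\<^bold>\<exists>\<^sub>s X. (P X \<^bold>\<and> Q X) \<^bold>\<and> R X) b" shows "den G (\<^bold>\<exists>\<^sub>s X. P X \<^bold>\<and> Q X \<^bold>\<and> R X) b"
  using assms unfolding den_def hold_quantifiers(3) hold_simps(2) conj_assoc .

lemma iden_stage:
  assumes B: "hierS B" "mpred G P B" and tm: "mterm G i ii" "mterm G n nn" "mterm G x xx"
  shows "iden G (f_stage P i n x) (\<lambda>t. xx t \<in> plus_stage (B t) (ii t) (nn t))"
proof -
  define A where "A = (\<lambda>t. opint B0 O_stage (top_bound t) (map (\<lambda>A. A t) [B]) (map (\<lambda>f. f t) [ii]))"
  have AS: "A \<in> S" unfolding A_def using B mterm_I[OF tm(1)] by (intro S_opint) (auto simp: hierS_def)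
  have A: "pair k x \<in> A t \<longleftrightarrow> x \<in> plus_stage (B t) (ii t) k" for t k x by (auto simp: A_def)
  have Suc: "pair (k + 1) x \<in> A t \<longleftrightarrow> (k + 1 \<le> Inf (B t) \<and> x = Inf (B t) + 1) \<or>
       (Inf (B t) < k + 1 \<and> (pair k x \<in> A t \<or> x \<in> new_bases (B t) (ii t) (plus_stage (B t) (ii t) k) (k + 1)))" for t k x
    unfolding A by auto
  let ?zero = "\<lambda>X m. \<^bold>\<forall>x. \<^bold>\<langle>\<^bold>0, x\<^bold>\<rangle> \<^bold>\<in> X \<^bold>\<longleftrightarrow> x \<^bold>= m \<^bold>+ \<^bold>1"
  let ?\<Psi> = "\<lambda>X m k x. k \<^bold>< n \<^bold>\<longrightarrow> (\<^bold>\<langle>k \<^bold>+ \<^bold>1, x\<^bold>\<rangle> \<^bold>\<in> X \<^bold>\<longleftrightarrow>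
       (k \<^bold>+ \<^bold>1 \<^bold>\<le> m \<^bold>\<and> x \<^bold>= m \<^bold>+ \<^bold>1) \<^bold>\<or>
       (m \<^bold>< k \<^bold>+ \<^bold>1 \<^bold>\<and> (\<^bold>\<langle>k, x\<^bold>\<rangle> \<^bold>\<in> X \<^bold>\<or> f_new P i (\<lambda>y. \<^bold>\<langle>k, y\<^bold>\<rangle> \<^bold>\<in> X) k x)))"
  have step: "den K (?\<Psi> X m k x) ((\<forall>\<^sub>F t. j t < nn t) \<longrightarrow>
      ((\<forall>\<^sub>F t. pair (j t + 1) (y t) \<in> T t) \<longleftrightarrow> (\<forall>\<^sub>F t. pair (j t + 1) (y t) \<in> A t)))"
    if K: "G \<preceq> K" "mterm K m mm" "\<forall>\<^sub>F t. mm t = Inf (B t)" "mset K X T" "mterm K k j" "mterm K x y"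
      and row: "\<And>y. \<forall>\<^sub>F t. j t < nn t \<Longrightarrow> y \<in> I \<Longrightarrow> (\<forall>\<^sub>F t. pair (j t) (y t) \<in> T t) \<longleftrightarrow> (\<forall>\<^sub>F t. pair (j t) (y t) \<in> A t)"
    for K m mm X T k j x y
  proof (rule den_conn(2))
    show "iden K (k \<^bold>< n) (\<lambda>t. j t < nn t)" by (intro iden_atoms K mterm_mono[OF tm(2) K(1)])
    assume lt: "\<forall>\<^sub>F t. j t < nn t"
    have Z: "mpred K (\<lambda>y. \<^bold>\<langle>k, y\<^bold>\<rangle> \<^bold>\<in> X) (\<lambda>t. plus_stage (B t) (ii t) (j t))"
      by (rule mpred_row[OF K(4,5)]) (use row[OF lt] A in simp)
    note ij = mterm_I[OF tm(1)] mterm_I[OF K(5)]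
    have "iden K ((k \<^bold>+ \<^bold>1 \<^bold>\<le> m \<^bold>\<and> x \<^bold>= m \<^bold>+ \<^bold>1) \<^bold>\<or>
       (m \<^bold>< k \<^bold>+ \<^bold>1 \<^bold>\<and> (\<^bold>\<langle>k, x\<^bold>\<rangle> \<^bold>\<in> X \<^bold>\<or> f_new P i (\<lambda>y. \<^bold>\<langle>k, y\<^bold>\<rangle> \<^bold>\<in> X) k x)))
      (\<lambda>t. (j t + 1 \<le> mm t \<and> y t = mm t + 1) \<or> (mm t < j t + 1 \<and>
         (pair (j t) (y t) \<in> A t \<or> y t \<in> new_bases (B t) (ii t) (plus_stage (B t) (ii t) (j t)) (j t + 1))))"
    proof (intro iden_conn(2) iden_lazy(1))
      show "iden K (k \<^bold>+ \<^bold>1 \<^bold>\<le> m) (\<lambda>t. j t + 1 \<le> mm t)" "iden K (x \<^bold>= m \<^bold>+ \<^bold>1) (\<lambda>t. y t = mm t + 1)"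
        "iden K (m \<^bold>< k \<^bold>+ \<^bold>1) (\<lambda>t. mm t < j t + 1)"
        by (intro iden_atoms iden_le mterm_ops K)+
      show "iden K (\<^bold>\<langle>k, x\<^bold>\<rangle> \<^bold>\<in> X) (\<lambda>t. pair (j t) (y t) \<in> A t)"
        using mpred_here[OF Z K(6)] unfolding A .
      assume "\<forall>\<^sub>F t. mm t < j t + 1"
      then have less: "\<forall>\<^sub>F t. Inf (B t) < j t + 1" using K(3) by eventually_elim simp
      show "iden K (f_new P i (\<lambda>y. \<^bold>\<langle>k, y\<^bold>\<rangle> \<^bold>\<in> X) k x)
        (\<lambda>t. y t \<in> new_bases (B t) (ii t) (plus_stage (B t) (ii t) (j t)) (j t + 1))"
        by (rule iden_new[OF B(1) mpred_mono[OF B(2) K(1)] hierS_stage(1)[OF B(1) ij] Z hierS_stage(2-4)[OF B(1) ij]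
            mterm_mono[OF tm(1) K(1)] K(5,6) less])
    qed
    then have "iden K ((k \<^bold>+ \<^bold>1 \<^bold>\<le> m \<^bold>\<and> x \<^bold>= m \<^bold>+ \<^bold>1) \<^bold>\<or>
       (m \<^bold>< k \<^bold>+ \<^bold>1 \<^bold>\<and> (\<^bold>\<langle>k, x\<^bold>\<rangle> \<^bold>\<in> X \<^bold>\<or> f_new P i (\<lambda>y. \<^bold>\<langle>k, y\<^bold>\<rangle> \<^bold>\<in> X) k x)))
      (\<lambda>t. pair (j t + 1) (y t) \<in> A t)"
      by (rule iden_cong) (use K(3) in eventually_elim, simp only: Suc)
    then show "den K (\<^bold>\<langle>k \<^bold>+ \<^bold>1, x\<^bold>\<rangle> \<^bold>\<in> X \<^bold>\<longleftrightarrow>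
       (k \<^bold>+ \<^bold>1 \<^bold>\<le> m \<^bold>\<and> x \<^bold>= m \<^bold>+ \<^bold>1) \<^bold>\<or>
       (m \<^bold>< k \<^bold>+ \<^bold>1 \<^bold>\<and> (\<^bold>\<langle>k, x\<^bold>\<rangle> \<^bold>\<in> X \<^bold>\<or> f_new P i (\<lambda>y. \<^bold>\<langle>k, y\<^bold>\<rangle> \<^bold>\<in> X) k x)))
      ((\<forall>\<^sub>F t. pair (j t + 1) (y t) \<in> T t) \<longleftrightarrow> (\<forall>\<^sub>F t. pair (j t + 1) (y t) \<in> A t))"
      by (intro den_conn(1) iden_atoms mterm_pair mterm_ops K)
  qed
  have zero: "iden K (x \<^bold>= m \<^bold>+ \<^bold>1) (\<lambda>t. pair 0 (y t) \<in> A t)"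
    if K: "mterm K m mm" "\<forall>\<^sub>F t. mm t = Inf (B t)" "mterm K x y" for K m mm x y
  proof (rule iden_cong)
    show "iden K (x \<^bold>= m \<^bold>+ \<^bold>1) (\<lambda>t. y t = mm t + 1)" by (intro iden_atoms mterm_ops K)
    show "\<forall>\<^sub>F t. y t = mm t + 1 \<longleftrightarrow> pair 0 (y t) \<in> A t" using K(2) by eventually_elim (simp add: A)
  qed
  have body: "iden H (\<^bold>\<exists>\<^sub>s X. ?zero X m \<^bold>\<and> (\<^bold>\<forall>k. \<^bold>\<forall>x. ?\<Psi> X m k x) \<^bold>\<and> \<^bold>\<langle>n, x\<^bold>\<rangle> \<^bold>\<in> X)
      (\<lambda>t. pair (nn t) (xx t) \<in> A t)"
    if H: "G \<preceq> H" "mterm H m mm" and mm: "\<forall>\<^sub>F t. mm t = Inf (B t)" for H m mm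
  proof (rule den_exS_assoc, rule iden_set_recursion[OF AS mterm_mono[OF tm(2) H(1)] mterm_mono[OF tm(3) H(1)]])
    fix K X assume K: "H \<preceq> K" "mset K X A"
    have "den K (?zero X m) (\<forall>x\<in>I. True)"
    proof (rule den_all)
      fix L a x assume L: "K \<preceq> L" "mterm L a x"
      have "iden L (\<^bold>\<langle>\<^bold>0, a\<^bold>\<rangle> \<^bold>\<in> X \<^bold>\<longleftrightarrow> a \<^bold>= m \<^bold>+ \<^bold>1) (\<lambda>t. pair 0 (x t) \<in> A t \<longleftrightarrow> pair 0 (x t) \<in> A t)"
        by (intro iden_conn(3) iden_atoms(3) mterm_pair mterm_ops L(2) mset_mono[OF K(2) L(1)]
            zero[OF mterm_mono[OF H(2) mle_trans[OF K(1) L(1)]] mm])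
      then show "den L (\<^bold>\<langle>\<^bold>0, a\<^bold>\<rangle> \<^bold>\<in> X \<^bold>\<longleftrightarrow> a \<^bold>= m \<^bold>+ \<^bold>1) True" by simp
    qed
    moreover have "den K (\<^bold>\<forall>k. \<^bold>\<forall>x. ?\<Psi> X m k x) (\<forall>j\<in>I. \<forall>x\<in>I. True)"
    proof (intro den_all)
      fix M a j L b y assume *: "K \<preceq> M" "mterm M a j" "M \<preceq> L" "mterm L b y"
      have KL: "K \<preceq> L" by (rule mle_trans[OF *(1,3)])
      show "den L (?\<Psi> X m a b) True"
        using step[OF mle_trans[OF H(1) mle_trans[OF K(1) KL]] mterm_mono[OF H(2) mle_trans[OF K(1) KL]] mm
          mset_mono[OF K(2) KL] mterm_mono[OF *(2,3)] *(4)] by simp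
    qed
    ultimately have "den K (?zero X m \<^bold>\<and> (\<^bold>\<forall>k. \<^bold>\<forall>x. ?\<Psi> X m k x)) ((\<forall>x\<in>I. True) \<and> (\<forall>j\<in>I. \<forall>x\<in>I. True))"
      by (rule den_conn(3))
    then show "den K (?zero X m \<^bold>\<and> (\<^bold>\<forall>k. \<^bold>\<forall>x. ?\<Psi> X m k x)) True" by simp
  next
    fix K X T assume K: "H \<preceq> K" "K \<preceq> K" "mset K X T" "hold K (?zero X m \<^bold>\<and> (\<^bold>\<forall>k. \<^bold>\<forall>x. ?\<Psi> X m k x))"
    then have hold: "hold K (?zero X m)" "hold K (\<^bold>\<forall>k. \<^bold>\<forall>x. ?\<Psi> X m k x)" by (auto simp: hold_simps)
    have GK: "G \<preceq> K" and m: "mterm K m mm" using mle_trans[OF H(1) K(1)] mterm_mono[OF H(2) K(1)] .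
    show "(\<forall>\<^sub>F t. pair (nn t) (xx t) \<in> T t) \<longleftrightarrow> (\<forall>\<^sub>F t. pair (nn t) (xx t) \<in> A t)"
    proof (rule agree_rows[OF AS K(3,2) hold(1) zero[OF mterm_mono[OF m] mm] hold(2) _ mterm_I[OF tm(2)] mterm_I[OF tm(3)]])
      fix L a j b y assume L: "K \<preceq> L" "mterm L a j" "mterm L b y" "\<forall>\<^sub>F t. j t < nn t"
        and row: "\<And>y. y \<in> I \<Longrightarrow> (\<forall>\<^sub>F t. pair (j t) (y t) \<in> T t) \<longleftrightarrow> (\<forall>\<^sub>F t. pair (j t) (y t) \<in> A t)"
      show "den L (?\<Psi> X m a b) ((\<forall>\<^sub>F t. pair (j t + 1) (y t) \<in> T t) \<longleftrightarrow> (\<forall>\<^sub>F t. pair (j t + 1) (y t) \<in> A t))"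
        using step[OF mle_trans[OF GK L(1)] mterm_mono[OF m L(1)] mm mset_mono[OF K(3) L(1)] L(2,3) row] L(4) by simp
    qed
  qed
  have InfI: "(\<lambda>t. Inf (B t)) \<in> I" using B(1) by (simp add: hierS_def)
  have "iden G (f_stage P i n x) (\<lambda>t. \<exists>m. m = Inf (B t) \<and> pair (nn t) (xx t) \<in> A t)"
    unfolding f_stage_def
  proof (rule iden_ex[OF _ InfI])
    fix H m mm assume H: "G \<preceq> H" "mterm H m mm"
    show "iden H (f_min P m \<^bold>\<and> (\<^bold>\<exists>\<^sub>s X. ?zero X m \<^bold>\<and> (\<^bold>\<forall>k. \<^bold>\<forall>x. ?\<Psi> X m k x) \<^bold>\<and> \<^bold>\<langle>n, x\<^bold>\<rangle> \<^bold>\<in> X))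
      (\<lambda>t. mm t = Inf (B t) \<and> pair (nn t) (xx t) \<in> A t)"
      by (intro iden_lazy(1) iden_min mpred_mono[OF B(2) H(1)] B(1) H(2) body[OF H])
  qed (auto intro: ev_always)
  then show ?thesis unfolding A by simp
qed

text \<open>The formula does not bound the stage, but by \<open>in_own_stage\<close> the stage
  \<open>x\<close> itself can be taken, and \<open>x\<close> is in the cut.\<close>

lemma iden_plus:
  assumes B: "hierS B" "mpred G P B" and tm: "mterm G i ii" "mterm G x xx"
  shows "iden G (f_plus P i x) (\<lambda>t. xx t \<in> ouroboros_plus (B t) (ii t))"
proof -
  have "den G (f_plus P i x) (\<exists>n\<in>I. \<forall>\<^sub>F t. xx t \<in> plus_stage (B t) (ii t) (n t))"
    unfolding f_plus_def
    by (rule den_ex) (intro iden_stage B(1) mpred_mono[OF B(2)] mterm_mono[OF tm(1)] mterm_mono[OF tm(2)])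
  moreover have "(\<exists>n\<in>I. \<forall>\<^sub>F t. xx t \<in> plus_stage (B t) (ii t) (n t)) \<longleftrightarrow> (\<forall>\<^sub>F t. xx t \<in> ouroboros_plus (B t) (ii t))"
  proof
    assume "\<exists>n\<in>I. \<forall>\<^sub>F t. xx t \<in> plus_stage (B t) (ii t) (n t)"
    then show "\<forall>\<^sub>F t. xx t \<in> ouroboros_plus (B t) (ii t)"
      by (auto simp: ouroboros_plus_def elim: eventually_mono)
  next
    assume "\<forall>\<^sub>F t. xx t \<in> ouroboros_plus (B t) (ii t)"
    moreover have "base_hierarchy (B t)" for t using B(1) by (simp add: hierS_def)
    note successor.in_own_stage[OF successorI[OF this]]
    ultimately have "\<forall>\<^sub>F t. xx t \<in> plus_stage (B t) (ii t) (xx t)" by (rule eventually_mono)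
    then show "\<exists>n\<in>I. \<forall>\<^sub>F t. xx t \<in> plus_stage (B t) (ii t) (n t)" using mterm_I[OF tm(2)] by blast
  qed
  ultimately show ?thesis by simp
qed

end

section \<open>The Goodstein sequence in the model\<close>

lemma (in goodstein_process) iter_goodstein:
  "iter (\<lambda>x. x = n) (\<lambda>j y x. (0 < y \<and> upgrade (Bs j) (Bs (j + 1)) y = enat (x + 1)) \<or> (y = 0 \<and> x = 0)) i v
    \<longleftrightarrow> goodstein Bs n i = enat v"
proof (induction i arbitrary: v)
  case (Suc i)
  have "(0 < y \<and> upgrade (Bs i) (Bs (i + 1)) y = enat (x + 1)) \<or> (y = 0 \<and> x = 0) \<longleftrightarrow> x = up i y - 1" for x y
    using up_ge[of y i] upgrade_eq_up[of i y] by (cases "y = 0") (auto simp: up_0)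
  then show ?case unfolding iter.simps Suc.IH goodstein_run by auto
qed (auto simp: zero_enat_def)

lemma (in goodstein_process) Inf_hierarchy: "Inf (Bs j) = Inf B0 + j"
proof (induction j)
  case (Suc j)
  then show ?case using successor.Inf_successor[OF successor, of j "j + 1"] by simp
qed simp

context rca0_model
begin

lemma hierS_seq:
  assumes "base_hierarchy B0" "j \<in> I"
  shows "hierS (\<lambda>t. ouroboros_seq B0 (j t))" "setS (\<lambda>t. ouroboros_seq B0 (j t))"
proof -
  interpret goodstein_process B0 using assms(1) by unfold_locales
  have S: "(\<lambda>t. Bs (j t)) \<in> S"
  proof -
    have "(\<lambda>t. opint B0 O_seq_row (top_bound t) (map (\<lambda>A. A t) []) (map (\<lambda>f. f t) [j])) \<in> S"
      using assms(2) by (intro S_opint) auto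
    then show ?thesis by simp
  qed
  show "hierS (\<lambda>t. Bs (j t))"
    unfolding hierS_def Inf_hierarchy using S hierarchy I_add[OF I_const assms(2)] by blast
  show "setS (\<lambda>t. Bs (j t))"
    unfolding setS_def using S hierarchy hierarchy_props by blast
qed

text \<open>The code \<open>H\<close> is arbitrary because the termination statement merely provides
  some \<open>H\<close>. Agreement is proved row by row, with absoluteness of the successor as the
  step.\<close>

lemma hierarchies_rows:
  assumes B0: "base_hierarchy B0" and G: "G \<preceq> G" and X: "mset G X (\<lambda>_. B0)" "mset G H T"
    and hold: "hold G (f_hierarchies X H)" and n: "n \<in> I" "v \<in> I"
  shows "(\<forall>\<^sub>F t. pair (n t) (v t) \<in> T t) \<longleftrightarrow> (\<forall>\<^sub>F t. v t \<in> ouroboros_seq B0 (n t))"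
proof -
  define A where "A = (\<lambda>t. opint B0 O_seq (top_bound t) (map (\<lambda>A. A t) []) (map (\<lambda>f. f t) []))"
  have AS: "A \<in> S" unfolding A_def by (intro S_opint) auto
  have A: "pair k x \<in> A t \<longleftrightarrow> x \<in> ouroboros_seq B0 k" for t k x by (auto simp: A_def)
  have h: "hold G (\<^bold>\<forall>x. \<^bold>\<langle>\<^bold>0, x\<^bold>\<rangle> \<^bold>\<in> H \<^bold>\<longleftrightarrow> x \<^bold>\<in> X)"
    "hold G (\<^bold>\<forall>i. \<^bold>\<forall>x. \<^bold>\<langle>i \<^bold>+ \<^bold>1, x\<^bold>\<rangle> \<^bold>\<in> H \<^bold>\<longleftrightarrow> f_plus (\<lambda>y. \<^bold>\<langle>i, y\<^bold>\<rangle> \<^bold>\<in> H) (i \<^bold>+ \<^bold>1) x)"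
    using hold unfolding f_hierarchies_def hold_simps(2) by blast+
  have "(\<forall>\<^sub>F t. pair (n t) (v t) \<in> T t) \<longleftrightarrow> (\<forall>\<^sub>F t. pair (n t) (v t) \<in> A t)"
  proof (rule agree_rows[OF AS X(2) G h(1) _ h(2) _ n])
    fix K b x assume K: "G \<preceq> K" "mterm K b x"
    have "iden K (b \<^bold>\<in> X) (\<lambda>t. x t \<in> B0)" by (intro iden_atoms K mset_mono[OF X(1)])
    then show "iden K (b \<^bold>\<in> X) (\<lambda>t. pair 0 (x t) \<in> A t)" by (simp add: A)
  next
    fix K a j b x assume K: "G \<preceq> K" "mterm K a j" "mterm K b x"
      and row: "\<And>y. y \<in> I \<Longrightarrow> (\<forall>\<^sub>F t. pair (j t) (y t) \<in> T t) \<longleftrightarrow> (\<forall>\<^sub>F t. pair (j t) (y t) \<in> A t)"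
    have P: "mpred K (\<lambda>y. \<^bold>\<langle>a, y\<^bold>\<rangle> \<^bold>\<in> H) (\<lambda>t. ouroboros_seq B0 (j t))"
      by (rule mpred_row[OF mset_mono[OF X(2) K(1)] K(2)]) (use row A in simp)
    have "iden K (f_plus (\<lambda>y. \<^bold>\<langle>a, y\<^bold>\<rangle> \<^bold>\<in> H) (a \<^bold>+ \<^bold>1) b) (\<lambda>t. x t \<in> ouroboros_plus (ouroboros_seq B0 (j t)) (j t + 1))"
      by (intro iden_plus hierS_seq B0 mterm_I[OF K(2)] P mterm_ops K)
    then have "iden K (f_plus (\<lambda>y. \<^bold>\<langle>a, y\<^bold>\<rangle> \<^bold>\<in> H) (a \<^bold>+ \<^bold>1) b) (\<lambda>t. pair (j t + 1) (x t) \<in> A t)"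
      by (simp add: A)
    then show "den K (\<^bold>\<langle>a \<^bold>+ \<^bold>1, b\<^bold>\<rangle> \<^bold>\<in> H \<^bold>\<longleftrightarrow> f_plus (\<lambda>y. \<^bold>\<langle>a, y\<^bold>\<rangle> \<^bold>\<in> H) (a \<^bold>+ \<^bold>1) b)
      ((\<forall>\<^sub>F t. pair (j t + 1) (x t) \<in> T t) \<longleftrightarrow> (\<forall>\<^sub>F t. pair (j t + 1) (x t) \<in> A t))"
      by (intro den_conn(1) iden_atoms mterm_pair mterm_ops K mset_mono[OF X(2)])
  qed
  then show ?thesis unfolding A .
qed

text \<open>An upgrade is at least its argument, so one step lowers the value by at most
  \<open>1\<close>; this is the bound that \<open>iden_rec\<close> requires. The unknown code
  \<open>H\<close> is handled by \<open>hierarchies_rows\<close>.\<close>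

lemma goodstein_hold:
  assumes B0: "base_hierarchy B0" and G: "G \<preceq> G" and X: "mset G X (\<lambda>_. B0)"
    and tm: "mterm G n nn" "mterm G i ii" "mterm G v vv" and hold: "hold G (f_goodstein X n i v)"
  shows "\<forall>\<^sub>F t. goodstein (ouroboros_seq B0) (nn t) (ii t) = enat (vv t)"
proof -
  interpret gp: goodstein_process B0 using B0 by unfold_locales
  let ?S = "ouroboros_seq B0"
  obtain T where T: "T \<in> S" and h: "hold (pushS T G) (f_hierarchies X (newS G))"
    "hold (pushS T G) (f_rec (\<lambda>x. x \<^bold>= n)
       (\<lambda>j y x. (\<^bold>0 \<^bold>< y \<^bold>\<and> f_upgrade (\<lambda>z. \<^bold>\<langle>j, z\<^bold>\<rangle> \<^bold>\<in> newS G) (\<lambda>z. \<^bold>\<langle>j \<^bold>+ \<^bold>1, z\<^bold>\<rangle> \<^bold>\<in> newS G) y (x \<^bold>+ \<^bold>1)) \<^bold>\<or>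
          (y \<^bold>= \<^bold>0 \<^bold>\<and> x \<^bold>= \<^bold>0)) i v)"
    using hold unfolding f_goodstein_def hold_quantifiers(3) hold_simps(2) by blast
  let ?G = "pushS T G" and ?H = "newS G"
  have GG: "G \<preceq> ?G" "?G \<preceq> ?G" using mle_push(2)[OF G T] mle_refl by blast+
  note H = mset_newS[OF T, of G]
  have row: "(\<forall>\<^sub>F t. pair (j t) (y t) \<in> T t) \<longleftrightarrow> (\<forall>\<^sub>F t. y t \<in> ?S (j t))" if "j \<in> I" "y \<in> I" for j y
    by (rule hierarchies_rows[OF B0 GG(2) mset_mono[OF X GG(1)] H h(1) that])
  let ?r = "\<lambda>(t::nat) j y x. (0 < y \<and> upgrade (?S j) (?S (j + 1)) y = enat (x + 1)) \<or> (y = 0 \<and> x = 0)"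
  define A where "A = (\<lambda>t. opint B0 O_goodstein (top_bound t) (map (\<lambda>A. A t) []) (map (\<lambda>f. f t) [nn]))"
  have AS: "A \<in> S" unfolding A_def using mterm_I[OF tm(1)] by (intro S_opint) auto
  have "iden ?G (f_rec (\<lambda>x. x \<^bold>= n)
       (\<lambda>j y x. (\<^bold>0 \<^bold>< y \<^bold>\<and> f_upgrade (\<lambda>z. \<^bold>\<langle>j, z\<^bold>\<rangle> \<^bold>\<in> ?H) (\<lambda>z. \<^bold>\<langle>j \<^bold>+ \<^bold>1, z\<^bold>\<rangle> \<^bold>\<in> ?H) y (x \<^bold>+ \<^bold>1)) \<^bold>\<or>
          (y \<^bold>= \<^bold>0 \<^bold>\<and> x \<^bold>= \<^bold>0)) i v)
     (\<lambda>t. iter (\<lambda>x. x = nn t) (?r t) (ii t) (vv t))"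
  proof (rule iden_rec[OF mterm_mono[OF tm(2) GG(1)] mterm_mono[OF tm(3) GG(1)] _ _ _ AS])
    show "iden K (a \<^bold>= n) (\<lambda>t. x t = nn t)" if "?G \<preceq> K" "mterm K a x" for K a x
      by (intro iden_atoms that mterm_mono[OF tm(1) mle_trans[OF GG(1) that(1)]])
    show "pair j x \<in> A t \<longleftrightarrow> iter (\<lambda>x. x = nn t) (?r t) j x" for t j x
      unfolding gp.iter_goodstein by (auto simp: A_def)
    have "y \<le> x + 1" if "?r t j y x" for t j y x
      using that gp.up_ge[of y j] gp.upgrade_eq_up[of j y] by auto
    then show "\<forall>\<^sub>F t. \<forall>j y x. iter (\<lambda>x. x = nn t) (?r t) j y \<and> ?r t j y x \<longrightarrow> y \<le> x + 1"
      by (intro ev_always) blast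
    fix K a j b y c x
    assume K: "?G \<preceq> K" "mterm K a j" "mterm K b y" "mterm K c x"
    have j1: "mterm K (a \<^bold>+ \<^bold>1) (\<lambda>t. j t + 1)" by (intro mterm_ops K)
    have P: "mpred K (\<lambda>z. \<^bold>\<langle>a, z\<^bold>\<rangle> \<^bold>\<in> ?H) (\<lambda>t. ?S (j t))" "mpred K (\<lambda>z. \<^bold>\<langle>a \<^bold>+ \<^bold>1, z\<^bold>\<rangle> \<^bold>\<in> ?H) (\<lambda>t. ?S (j t + 1))"
      by (rule mpred_row[OF mset_mono[OF H K(1)] K(2)], rule row[OF mterm_I[OF K(2)]], assumption)
        (rule mpred_row[OF mset_mono[OF H K(1)] j1], rule row[OF mterm_I[OF j1]], assumption)
    show "iden K ((\<^bold>0 \<^bold>< b \<^bold>\<and> f_upgrade (\<lambda>z. \<^bold>\<langle>a, z\<^bold>\<rangle> \<^bold>\<in> ?H) (\<lambda>z. \<^bold>\<langle>a \<^bold>+ \<^bold>1, z\<^bold>\<rangle> \<^bold>\<in> ?H) b (c \<^bold>+ \<^bold>1)) \<^bold>\<or>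
        (b \<^bold>= \<^bold>0 \<^bold>\<and> c \<^bold>= \<^bold>0)) (\<lambda>t. ?r t (j t) (y t) (x t))"
      by (intro iden_conn(2) iden_lazy(1) iden_atoms mterm_ops K
          iden_upgrade[OF hierS_seq(1)[OF B0 mterm_I[OF K(2)]] P(1) hierS_seq(2)[OF B0 mterm_I[OF j1]] P(2)])
  qed
  then show ?thesis using h(2) GG(2) unfolding den_def gp.iter_goodstein by blast
qed

text \<open>If the sentence held in the model, the sequence started at \<open>n\<close> would reach
  \<open>0\<close> at an index in the cut. Such an index is below \<open>top_bound\<close> almost
  everywhere, where the true sequence is still positive.\<close>

lemma not_provable:
  assumes B0: "base_hierarchy B0" and n: "n \<in> I"
    and slow: "\<And>t j. j < top_bound t \<Longrightarrow> goodstein (ouroboros_seq B0) (n t) j \<noteq> 0"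
  shows "\<not> RCA0_proves_about B0 goodstein_terminates"
proof
  assume "RCA0_proves_about B0 goodstein_terminates"
  then obtain q where q: "bounded q" "\<And>\<rho> \<sigma>. \<sigma> 0 = B0 \<Longrightarrow> sat \<rho> \<sigma> (AllN q)"
    and p: "RCA\<^sub>0 \<turnstile> AllS (Imp (AllN q) goodstein_terminates)"
    unfolding RCA0_proves_about_def Pi01_def by blast
  define \<rho> :: "nat \<Rightarrow> nat \<Rightarrow> nat" where "\<rho> = (\<lambda>_ _. 0)"
  define \<sigma> :: "nat \<Rightarrow> nat \<Rightarrow> nat set" where "\<sigma> = (\<lambda>_ _. B0)"
  have B0S: "(\<lambda>_. B0) \<in> S"
  proof -
    have "(\<lambda>t. opint B0 O_base (top_bound t) (map (\<lambda>A. A t) []) (map (\<lambda>f. f t) [])) \<in> S" by (intro S_opint) auto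
    then show ?thesis by simp
  qed
  have r: "range \<rho> \<subseteq> I" "range \<sigma> \<subseteq> S" using I_const[of 0] B0S by (auto simp: \<rho>_def \<sigma>_def)
  \<comment> \<open>The description is true of \<open>B0\<close>, so its bounded matrix holds in
    every coordinate for all numbers, and \<open>msat_bounded\<close> transfers this to the
    cut.\<close>
  have "msat (case_nat f \<rho>) \<sigma> q" if "f \<in> I" for f
  proof -
    have "sat (\<lambda>k. \<rho> k t) (\<lambda>X. \<sigma> X t) (AllN q)" for t by (rule q(2)) (simp add: \<sigma>_def)
    then have "sat (case_nat (f t) (\<lambda>k. \<rho> k t)) (\<lambda>X. \<sigma> X t) q" for t by simp
    then show ?thesis
      unfolding msat_bounded[OF q(1) case_nat_range[OF that r(1)]] case_nat_apply by (intro ev_always)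
  qed
  moreover have "case_nat (\<lambda>_. B0) \<sigma> = \<sigma>" by (rule ext) (simp add: \<sigma>_def split: nat.split)
  moreover have "msat \<rho> (case_nat (\<lambda>_. B0) \<sigma>) (Imp (AllN q) goodstein_terminates)"
    using RCA0_sound_model[OF p r] B0S by simp
  ultimately have "msat \<rho> \<sigma> goodstein_terminates" by simp
  moreover define G where "G = (0::nat, Suc 0, \<rho>, \<sigma>)"
  moreover define X :: lset where "X = (\<lambda>s. s - Suc 0)"
  ultimately have hold: "hold G (\<^bold>\<forall>n. \<^bold>\<exists>i. f_goodstein X n i \<^bold>0)"
    by (simp add: goodstein_terminates_def hold_def)
  have G: "G \<preceq> G" using r by (simp add: G_def mle_def)
  have X: "mset G X (\<lambda>_. B0)"
    unfolding mset_def
  proof (intro conjI B0S allI impI)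
    fix d s \<rho>' \<sigma>' assume "G \<preceq> (d, s, \<rho>', \<sigma>')"
    then have "\<sigma>' (0 + (s - Suc 0)) = \<sigma> 0" unfolding G_def mle_def by (simp only: prod.case)
    then show "\<sigma>' (X s) = (\<lambda>_. B0)" by (simp add: X_def \<sigma>_def)
  qed
  obtain H b where H: "G \<preceq> H" "H \<preceq> H" "mterm H b n" "hold H (\<^bold>\<exists>i. f_goodstein X b i \<^bold>0)"
    using hold_all[OF hold G n] .
  then obtain f where f: "f \<in> I" "hold (pushN f H) (f_goodstein X b (newN H) \<^bold>0)"
    unfolding hold_quantifiers(2) by blast
  have HK: "H \<preceq> pushN f H" by (rule mle_push(1)[OF H(2) f(1)])
  have "\<forall>\<^sub>F t. goodstein (ouroboros_seq B0) (n t) (f t) = enat 0"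
    by (rule goodstein_hold[OF B0 mle_refl[OF HK] mset_mono[OF X mle_trans[OF H(1) HK]] mterm_mono[OF H(3) HK]
        mterm_newN[OF f(1)] mterm_ops(1) f(2)])
  then have "\<forall>\<^sub>F t. False"
    using I_top_bound[OF f(1)] by eventually_elim (use slow in \<open>auto simp: zero_enat_def\<close>)
  then show False by (simp add: ev_const)
qed

end

theorem theorem8p4:
  fixes B0 :: "nat set"
  assumes "base_hierarchy B0"
    and "\<not> (\<exists>k::nat.
            (\<forall>b\<in>B0. next_base B0 b \<le> enat (min (3 * b) (b * Inf B0))) \<and>
            finite {b \<in> B0. next_base B0 b = enat (3 * b)} \<and>
            card {b \<in> B0. next_base B0 b = enat (3 * b)} = k)"
  shows "\<not> RCA0_proves_about B0 goodstein_terminates"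
proof -
  interpret goodstein_process B0 using assms(1) by unfold_locales
  have "\<exists>s. \<forall>t\<ge>s. \<forall>j<ack k t. goodstein Bs (s + t) j \<noteq> 0" for k
    using assms(2) by (intro goodstein_lower_bound) blast
  \<comment> \<open>The threshold for level \<open>k\<close> is chosen for each \<open>k\<close>
    separately. Taken along the diagonal, at \<open>k = t\<close> with argument
    \<open>\<tau> t\<close>, it gives survival for \<open>ack t (\<tau> t)\<close> steps, which is
    \<open>top_bound t\<close>.\<close>
  then obtain \<tau> where \<tau>: "\<And>k. \<forall>t\<ge>\<tau> k. \<forall>j<ack k t. goodstein Bs (\<tau> k + t) j \<noteq> 0" by metis
  obtain F :: "nat filter" where F: "F \<noteq> bot" "F \<le> sequentially"
    "\<And>P. eventually P F \<or> eventually (\<lambda>x. \<not> P x) F" by (rule free_ultrafilter_exists) blast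
  then interpret rca0_model F B0 \<tau> by unfold_locales
  show ?thesis
  proof (rule not_provable[OF assms(1)])
    show "(\<lambda>t. \<tau> t + \<tau> t) \<in> I" by (intro I_add I_tau)
    show "goodstein Bs (\<tau> t + \<tau> t) j \<noteq> 0" if "j < top_bound t" for t j
      using \<tau>[of t] that by (simp add: top_bound_def)
  qed
qed

end
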